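(* Let $\epsilon>0$. (i) If $\gamma$ is any curve driven (under the downwards Loewner flow) by $\lambda\in C^{3/2+\epsilon}([0,T))$ with $\lambda(0)=0$, $\dot\lambda(0)\ne0$, then $$\lim_{\delta\to0^+}\frac{I(\gamma[0,\delta])}{I(\text{EMP curve from }0\text{ to }\gamma(\delta))}=\frac98.$$ (ii) Let $\eta\in C^{3/2+\epsilon}([0,T))$ be a driver with $\eta(0)=0$, $\dot\eta(0)\ne0$, and let $\tilde\gamma[0,\delta]$ be the curve generated by $\eta$ by means of the upwards Loewner flow on $[0,\delta]$. Let $u(\delta)<0<v(\delta)$ be the points welded to the base of $\tilde\gamma[0,\delta]$ at time $\delta$. Then $$\lim_{\delta\to0^+}\frac{I(\eta[0,\delta])}{I(\text{EMW minimizer for }u(\delta),v(\delta))}=\frac98.$$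
   Context: Loewner conventions. $\mathbb{H}$ is the upper half-plane. For a simple curve $\gamma$ with $\gamma(0)=0$ and $\gamma(t)\in\mathbb{H}$ for $t>0$, $g_t:\mathbb{H}\setminus\gamma(0,t]\to\mathbb{H}$ is the conformal map with $g_t(z)=z+\mathrm{hcap}(\gamma[0,t])/z+O(1/z^2)$ at $\infty$; curves are parametrized by capacity, $\mathrm{hcap}(\gamma[0,t])=2t$. The (downwards) driving function is $\lambda(t)=g_t(\gamma(t))$, with $\dot g_t=\frac{2}{g_t-\lambda(t)}$; it determines $\gamma$. The Loewner energy of a driver (or of the curve it generates) on $[0,\delta]$ is $\frac12\int_0^\delta\dot\lambda(t)^2dt$ if the driver is absolutely continuous, $+\infty$ otherwise. Upwards flow: a driver $\eta$ with $\eta(0)=0$ gives $\dot h_t(z)=\frac{-2}{h_t(z)-\eta(t)}$, $h_0(z)=z$; the curve generated on $[0,\delta]$ is $\mathbb{H}\setminus h_\delta(\mathbb{H})$, with base $\eta(\delta)$. Points $u<0<v$ are welded to the base at time $\delta$ if $h_t(u)<\eta(t)<h_t(v)$ for $t<\delta$ and both $h_t(u)-\eta(t)$ and $h_t(v)-\eta(t)$ tend to $0$ as $t\to\delta^-$. The EMP curve from $0$ to $z\in\mathbb{H}$ is the unique minimizer of the Loewner energy among simple curves in $\mathbb{H}$ from $0$ to $z$. The EMW minimizer for $x<0<y$ is the unique minimizer of the Loewner energy among drivers $\xi$ with $\xi(0)=0$ whose upwards flow welds $x$ and $y$ to its base. $C^{3/2+\epsilon}$ (for small $\epsilon$) means $C^1$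 with $(1/2+\epsilon)$-Hölder derivative. *)

theory Defs
  imports "HOL-Analysis.Analysis" "HOL-Library.Landau_Symbols"
begin

definition upper_half_plane :: "complex set" where
  "upper_half_plane = {z. Im z > 0}"

definition C1_holder :: "real \<Rightarrow> real set \<Rightarrow> (real \<Rightarrow> real) \<Rightarrow> (real \<Rightarrow> real) \<Rightarrow> bool" where
  "C1_holder \<beta> J f f' \<longleftrightarrow>
     (\<forall>t\<in>J. (f has_real_derivative f' t) (at t within J)) \<and> continuous_on J f' \<and>
     (\<exists>C. \<forall>s\<in>J. \<forall>t\<in>J. \<bar>f' s - f' t\<bar> \<le> C * \<bar>s - t\<bar> powr \<beta>)"

text \<open>The usual epsilon-delta definition: the members of \<open>D\<close> are finitely many
  closed intervals \<open>[Inf k, Sup k]\<close> with disjoint interiors.\<close>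

definition abs_continuous_on :: "real set \<Rightarrow> (real \<Rightarrow> real) \<Rightarrow> bool" where
  "abs_continuous_on S f \<longleftrightarrow>
     (\<forall>e>0. \<exists>d>0. \<forall>D. D division_of \<Union>D \<and> \<Union>D \<subseteq> S \<and> (\<Sum>k\<in>D. Sup k - Inf k) < d
        \<longrightarrow> (\<Sum>k\<in>D. \<bar>f (Sup k) - f (Inf k)\<bar>) < e)"

text \<open>An absolutely continuous function is differentiable only almost everywhere; the arbitrary
  value of \<^const>\<open>deriv\<close> at the remaining points is harmless because \<^const>\<open>lebesgue\<close>
  is complete.\<close>

definition driver_energy :: "real \<Rightarrow> (real \<Rightarrow> real) \<Rightarrow> ennreal" where
  "driver_energy \<delta> \<xi> =
     (if abs_continuous_on {0..\<delta>} \<xi>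
      then (\<integral>\<^sup>+ t\<in>{0..\<delta>}. ennreal ((deriv \<xi> t)\<^sup>2) \<partial>lebesgue) / 2
      else \<infinity>)"

subsection \<open>Downwards flow\<close>

text \<open>The conformal map \<open>g\<close> of the complement of \<open>K\<close> onto the half-plane, normalised by
  \<open>g(z) = z + c/z + O(1/z^2)\<close> at infinity; \<open>c\<close> is then the half-plane capacity of \<open>K\<close>.\<close>

definition mapping_out :: "complex set \<Rightarrow> real \<Rightarrow> (complex \<Rightarrow> complex) \<Rightarrow> bool" where
  "mapping_out K c g \<longleftrightarrow>
     g holomorphic_on (upper_half_plane - K) \<and>
     bij_betw g (upper_half_plane - K) upper_half_plane \<and>
     (\<lambda>z. g z - z - of_real c / z)
       \<in> O[inf at_infinity (principal (upper_half_plane - K))](\<lambda>z. 1 / z\<^sup>2)"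

definition capacity_curve :: "real set \<Rightarrow> (real \<Rightarrow> complex) \<Rightarrow> bool" where
  "capacity_curve J \<gamma> \<longleftrightarrow>
     continuous_on J \<gamma> \<and> inj_on \<gamma> J \<and> \<gamma> 0 = 0 \<and> (\<forall>t\<in>J. t > 0 \<longrightarrow> \<gamma> t \<in> upper_half_plane) \<and>
     (\<forall>t\<in>J. \<exists>g. mapping_out (\<gamma> ` {0<..t}) (2 * t) g)"

text \<open>Since \<open>\<gamma> t\<close> is a boundary point of the domain of \<open>g t\<close>, the value \<open>g t (\<gamma> t)\<close>
  is understood as a limit from inside the domain.\<close>

definition driven_by :: "real set \<Rightarrow> (real \<Rightarrow> complex) \<Rightarrow> (real \<Rightarrow> real) \<Rightarrow> bool" where
  "driven_by J \<gamma> lam \<longleftrightarrow>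
     capacity_curve J \<gamma> \<and>
     (\<exists>g. \<forall>t\<in>J. mapping_out (\<gamma> ` {0<..t}) (2 * t) (g t) \<and>
        (g t \<longlongrightarrow> of_real (lam t)) (at (\<gamma> t) within upper_half_plane - \<gamma> ` {0<..t}) \<and>
        (\<forall>z\<in>upper_half_plane - \<gamma> ` {0<..t}.
           ((\<lambda>s. g s z) has_vector_derivative 2 / (g t z - of_real (lam t))) (at t within J)))"

text \<open>The driver is determined by the curve on \<open>{0..\<delta>}\<close>, so the infimum below
  merely selects its energy.\<close>

definition curve_energy :: "real \<Rightarrow> (real \<Rightarrow> complex) \<Rightarrow> ennreal" where
  "curve_energy \<delta> \<gamma> = (INF lam\<in>{lam. driven_by {0..\<delta>} \<gamma> lam}. driver_energy \<delta> lam)"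

text \<open>Curves and drivers of variable duration are pairs of a duration and a function; the
  function is \<^const>\<open>extensional\<close>, since otherwise no minimizer could be unique.\<close>

definition simple_curve_to :: "complex \<Rightarrow> real \<times> (real \<Rightarrow> complex) \<Rightarrow> bool" where
  "simple_curve_to z = (\<lambda>(\<tau>, \<gamma>). \<tau> > 0 \<and> \<gamma> \<in> extensional {0..\<tau>} \<and>
     capacity_curve {0..\<tau>} \<gamma> \<and> \<gamma> \<tau> = z)"

definition EMP_curve :: "complex \<Rightarrow> real \<times> (real \<Rightarrow> complex)" where
  "EMP_curve z =
     (THE p. is_arg_min (\<lambda>(\<tau>, \<gamma>). curve_energy \<tau> \<gamma>) (simple_curve_to z) p)"

subsection \<open>Upwards flow\<close>

definition upward_trajectory :: "(real \<Rightarrow> real) \<Rightarrow> real set \<Rightarrow> real \<Rightarrow> (real \<Rightarrow> real) \<Rightarrow> bool" where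
  "upward_trajectory \<eta> J x h \<longleftrightarrow>
     h 0 = x \<and> (\<forall>t\<in>J. (h has_real_derivative - 2 / (h t - \<eta> t)) (at t within J))"

definition welded_at :: "(real \<Rightarrow> real) \<Rightarrow> real \<Rightarrow> real \<Rightarrow> real \<Rightarrow> bool" where
  "welded_at \<eta> \<delta> u v \<longleftrightarrow> u < 0 \<and> 0 < v \<and>
     (\<exists>hu hv. upward_trajectory \<eta> {0..<\<delta>} u hu \<and> upward_trajectory \<eta> {0..<\<delta>} v hv \<and>
        (\<forall>t\<in>{0..<\<delta>}. hu t < \<eta> t \<and> \<eta> t < hv t) \<and>
        ((\<lambda>t. hu t - \<eta> t) \<longlongrightarrow> 0) (at_left \<delta>) \<and> ((\<lambda>t. hv t - \<eta> t) \<longlongrightarrow> 0) (at_left \<delta>))"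

definition welding_driver :: "real \<Rightarrow> real \<Rightarrow> real \<times> (real \<Rightarrow> real) \<Rightarrow> bool" where
  "welding_driver x y = (\<lambda>(\<tau>, \<xi>). \<tau> > 0 \<and> \<xi> \<in> extensional {0..\<tau>} \<and>
     continuous_on {0..\<tau>} \<xi> \<and> \<xi> 0 = 0 \<and> welded_at \<xi> \<tau> x y)"

definition EMW_minimizer :: "real \<Rightarrow> real \<Rightarrow> real \<times> (real \<Rightarrow> real)" where
  "EMW_minimizer x y =
     (THE p. is_arg_min (\<lambda>(\<tau>, \<xi>). driver_energy \<tau> \<xi>) (welding_driver x y) p)"

end

(* Both energies are controlled by one explicit function of the starting point of a dying trajectory.
   Let w be the distance of a trajectory of the Loewner flow from the driver, dying at time tau, with
   tilt q = Re w / Im w. The function 4 ln (1 + q^2) of w decreases along the flow at rate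
   f^2/2 - (f - k)^2/2, where f is the slope of the driver and k = 8 Re w / |w|^2; hence it is the least
   energy of a curve from 0 to the initial value of w, attained only by following the feedback law
   f = k. That law integrates to Re w = c (Im w)^3 with a polynomial time change, which gives both
   uniqueness and an explicit C1 driver; the curve driven by it is constructed by solving the Loewner
   equation. Welding works the same way for the two real trajectories, i.e. with w rotated by a
   quarter turn. For a C1 driver with slope m at 0, w^2 + 4 delta is asymptotically
   (8 i / 3) m delta^(3/2), so q^2 is asymptotically m^2 delta / 9 and the minimal energy is
   4 m^2 delta / 9, while the energy of the given driver is m^2 delta / 2. *)

theory Submission
  imports Defs "HOL-Complex_Analysis.Complex_Analysis"
begin

subsection \<open>Absolutely continuous functions\<close>

text \<open>Competitors are merely absolutely continuous, so almost everywhere differentiability and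
  the fundamental theorem of calculus are first derived for the epsilon-delta notion
  \<open>abs_continuous_on\<close>. The cost functions must also vanish at the tip of every
  finite-energy competitor: they see only the direction of \<open>w\<close>, and it is the vanishing
  remaining energy that forces \<open>w^2 / (\<tau> - t)\<close> to tend to -4. Since
  \<open>EMP_curve\<close> and \<open>EMW_minimizer\<close> are definite descriptions, existence and
  uniqueness both have to be shown. For curves existence is the harder half: a simple trace with all
  its conformal maps is required, not just a driver. Backward trajectories that end in a narrow cone
  about the vertical contract distances, which produces the trace as a limit; the cone argument
  needs slope squared times duration at most 1/2. This smallness is available because the point
  \<open>\<gamma> \<delta>\<close> becomes vertical as \<delta> tends to 0, so only targets with
  \<open>\<bar>Re z\<bar> \<le> Im z / 8\<close> have to be reached.\<close>

lemma abs_continuous_onE: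
 assumes "abs_continuous_on S F" "e > 0"
 obtains d where "d > 0"
  "\<And>D. D division_of \<Union>D \<Longrightarrow> \<Union>D \<subseteq> S \<Longrightarrow> (\<Sum>k\<in>D. Sup k - Inf k) < d
    \<Longrightarrow> (\<Sum>k\<in>D. \<bar>F (Sup k) - F (Inf k)\<bar>) < e"
 using assms unfolding abs_continuous_on_def by meson

lemma division_member_real:
 fixes D :: "real set set"
 assumes "D division_of U" "k \<in> D"
 obtains u v where "k = {u..v}" "u \<le> v" "Inf k = u" "Sup k = v"
proof -
 obtain u v where k: "k = cbox u v" "k \<noteq> {}"
  using assms by blast
 then have "u \<le> v" by auto
 then show thesis using that k by (auto simp: cbox_interval)
qed

lemma division_sum_diff:
 fixes F :: "real \<Rightarrow> real"
 assumes q: "q division_of {a..b}" and "a \<le> b"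
 shows "(\<Sum>k\<in>q. F (Sup k) - F (Inf k)) = F b - F a"
proof -
 \<comment> \<open>Left endpoints serve as tags, so that the telescoping identity for tagged
   divisions applies.\<close>
 define p where "p = (\<lambda>k. (Inf k, k)) ` q"
 have inj: "inj_on (\<lambda>k. (Inf k, k)) q" by (auto simp: inj_on_def)
 have "p tagged_division_of {a..b}"
 proof (rule tagged_division_ofI)
  show "finite p" using q unfolding p_def by auto
  have "{K. \<exists>x. (x, K) \<in> p} = q" by (auto simp: p_def image_iff)
  then show "\<Union>{K. \<exists>x. (x, K) \<in> p} = {a..b}" using division_ofD(6)[OF q] by simp
 next
  fix x K assume "(x, K) \<in> p"
  then have K: "K \<in> q" "x = Inf K" by (auto simp: p_def)
  obtain u v where "K = {u..v}" "u \<le> v" "Inf K = u" using division_member_real[OF q K(1)] by metis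
  then show "x \<in> K" "\<exists>a b. K = cbox a b" using K by (auto simp: cbox_interval)
  show "K \<subseteq> {a..b}" using division_ofD(2)[OF q K(1)] .
 next
  fix x1 K1 x2 K2 assume "(x1, K1) \<in> p" "(x2, K2) \<in> p" "(x1, K1) \<noteq> (x2, K2)"
  then show "interior K1 \<inter> interior K2 = {}" using division_ofD(5)[OF q] by (auto simp: p_def)
 qed
 from additive_tagged_division_1[OF \<open>a \<le> b\<close> this, of F]
 show ?thesis unfolding p_def by (simp add: sum.reindex[OF inj])
qed

lemma abs_continuous_on_imp_continuous:
 assumes "abs_continuous_on {a..b} F"
 shows "continuous_on {a..b} F"
proof (rule continuous_onI)
 fix x e :: real assume x: "x \<in> {a..b}" and "e > 0"
 obtain d where d: "d > 0"
  and D: "\<And>D. D division_of \<Union>D \<Longrightarrow> \<Union>D \<subseteq> {a..b} \<Longrightarrow> (\<Sum>k\<in>D. Sup k - Inf k) < d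
    \<Longrightarrow> (\<Sum>k\<in>D. \<bar>F (Sup k) - F (Inf k)\<bar>) < e" by (rule abs_continuous_onE[OF assms \<open>e > 0\<close>]) blast
 have *: "\<bar>F v - F u\<bar> < e" if "u \<in> {a..b}" "v \<in> {a..b}" "u \<le> v" "v - u < d" for u v
 proof -
  have "cbox u v \<noteq> {}" using that by simp
  then have "{{u..v}} division_of \<Union>{{u..v}}" using division_of_self[of u v] by simp
  moreover have "{u..v} \<subseteq> {a..b}" using that by auto
  ultimately show ?thesis using D[of "{{u..v}}"] that by simp
 qed
 show "\<exists>d>0. \<forall>x'\<in>{a..b}. dist x' x < d \<longrightarrow> dist (F x') (F x) \<le> e"
 proof (intro exI[of _ d] conjI ballI impI d)
  fix y assume "y \<in> {a..b}" "dist y x < d"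
  then show "dist (F y) (F x) \<le> e" using *[of x y] *[of y x] x
   by (cases "x \<le> y") (auto simp: dist_real_def)
 qed
qed

text \<open>One domination principle behind the closure properties below: sums, differences,
  products and Lipschitz images all have increments bounded by those of two absolutely continuous
  functions, and a common division serves both.\<close>

lemma abs_continuous_on_bound2:
 assumes F: "abs_continuous_on S F" and G: "abs_continuous_on S G"
  and le: "\<And>x y. x \<in> S \<Longrightarrow> y \<in> S \<Longrightarrow> \<bar>H x - H y\<bar> \<le> L * (\<bar>F x - F y\<bar> + \<bar>G x - G y\<bar>)"
 shows "abs_continuous_on S H"
 unfolding abs_continuous_on_def
proof (intro allI impI)
 fix e :: real assume "e > 0"
 \<comment> \<open>\<open>L\<close> may be zero or negative; a positive bound keeps the budget
   \<open>e / (2 * M)\<close> meaningful.\<close>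
 define M where "M = \<bar>L\<bar> + 1"
 have M: "M > 0" "L \<le> M" by (auto simp: M_def)
 have e2: "e / (2 * M) > 0" using M \<open>e > 0\<close> by auto
 obtain d1 where d1: "d1 > 0" "\<And>D. D division_of \<Union>D \<Longrightarrow> \<Union>D \<subseteq> S \<Longrightarrow> (\<Sum>k\<in>D. Sup k - Inf k) < d1
    \<Longrightarrow> (\<Sum>k\<in>D. \<bar>F (Sup k) - F (Inf k)\<bar>) < e / (2*M)" by (rule abs_continuous_onE[OF F e2]) blast
 obtain d2 where d2: "d2 > 0" "\<And>D. D division_of \<Union>D \<Longrightarrow> \<Union>D \<subseteq> S \<Longrightarrow> (\<Sum>k\<in>D. Sup k - Inf k) < d2
    \<Longrightarrow> (\<Sum>k\<in>D. \<bar>G (Sup k) - G (Inf k)\<bar>) < e / (2*M)" by (rule abs_continuous_onE[OF G e2]) blast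
 show "\<exists>d>0. \<forall>D. D division_of \<Union> D \<and> \<Union> D \<subseteq> S \<and> (\<Sum>k\<in>D. Sup k - Inf k) < d \<longrightarrow>
        (\<Sum>k\<in>D. \<bar>H (Sup k) - H (Inf k)\<bar>) < e"
 proof (intro exI[of _ "min d1 d2"] conjI allI impI)
  show "min d1 d2 > 0" using d1 d2 by auto
  fix D assume D: "D division_of \<Union> D \<and> \<Union> D \<subseteq> S \<and> (\<Sum>k\<in>D. Sup k - Inf k) < min d1 d2"
  have "(\<Sum>k\<in>D. \<bar>H (Sup k) - H (Inf k)\<bar>)
    \<le> (\<Sum>k\<in>D. M * (\<bar>F (Sup k) - F (Inf k)\<bar> + \<bar>G (Sup k) - G (Inf k)\<bar>))"
  proof (rule sum_mono)
   fix k assume k: "k \<in> D"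
   obtain u v where uv: "k = {u..v}" "u \<le> v" "Inf k = u" "Sup k = v"
    using division_member_real[OF _ k] D by metis
   have "k \<subseteq> S" using k D by blast
   then have "u \<in> S" "v \<in> S" using uv by auto
   then have "\<bar>H (Sup k) - H (Inf k)\<bar> \<le> L * (\<bar>F (Sup k) - F (Inf k)\<bar> + \<bar>G (Sup k) - G (Inf k)\<bar>)"
    using le uv by auto
   also have "\<dots> \<le> M * (\<bar>F (Sup k) - F (Inf k)\<bar> + \<bar>G (Sup k) - G (Inf k)\<bar>)"
    using M by (intro mult_right_mono) auto
   finally show "\<bar>H (Sup k) - H (Inf k)\<bar> \<le> M * (\<bar>F (Sup k) - F (Inf k)\<bar> + \<bar>G (Sup k) - G (Inf k)\<bar>)" .
  qed
  also have "\<dots> = M * ((\<Sum>k\<in>D. \<bar>F (Sup k) - F (Inf k)\<bar>) + (\<Sum>k\<in>D. \<bar>G (Sup k) - G (Inf k)\<bar>))"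
   by (simp add: sum.distrib flip: sum_distrib_left)
  also have "\<dots> < M * (e / (2*M) + e / (2*M))"
   using d1(2)[of D] d2(2)[of D] D M by (intro mult_strict_left_mono add_strict_mono) auto
  also have "\<dots> = e" using M by (simp add: field_simps)
  finally show "(\<Sum>k\<in>D. \<bar>H (Sup k) - H (Inf k)\<bar>) < e" .
 qed
qed

lemma abs_continuous_on_id: "abs_continuous_on S (\<lambda>x. x)"
 unfolding abs_continuous_on_def
proof (intro allI impI)
 fix e :: real assume "e > 0"
 show "\<exists>d>0. \<forall>D. D division_of \<Union> D \<and> \<Union> D \<subseteq> S \<and> (\<Sum>k\<in>D. Sup k - Inf k) < d \<longrightarrow>
        (\<Sum>k\<in>D. \<bar>Sup k - Inf k\<bar>) < e"
 proof (intro exI[of _ e] conjI allI impI \<open>e > 0\<close>)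
  fix D assume D: "D division_of \<Union> D \<and> \<Union> D \<subseteq> S \<and> (\<Sum>k\<in>D. Sup k - Inf k) < e"
  have "(\<Sum>k\<in>D. \<bar>Sup k - Inf k\<bar>) = (\<Sum>k\<in>D. Sup k - Inf k)"
   using D by (intro sum.cong refl) (metis abs_of_nonneg diff_ge_0_iff_ge division_member_real)
  then show "(\<Sum>k\<in>D. \<bar>Sup k - Inf k\<bar>) < e" using D by auto
 qed
qed

lemma abs_continuous_on_lipschitz:
 assumes "\<And>x y. x \<in> S \<Longrightarrow> y \<in> S \<Longrightarrow> \<bar>H x - H y\<bar> \<le> L * \<bar>x - y\<bar>"
 shows "abs_continuous_on S H"
 by (rule abs_continuous_on_bound2[OF abs_continuous_on_id abs_continuous_on_id, of S H "L/2"])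
   (use assms in fastforce)

lemma abs_continuous_on_add:
 assumes "abs_continuous_on S F" "abs_continuous_on S G"
 shows "abs_continuous_on S (\<lambda>x. F x + G x)"
 by (rule abs_continuous_on_bound2[OF assms, of _ 1]) auto

lemma abs_continuous_on_diff:
 assumes "abs_continuous_on S F" "abs_continuous_on S G"
 shows "abs_continuous_on S (\<lambda>x. F x - G x)"
 by (rule abs_continuous_on_bound2[OF assms, of _ 1]) auto

lemma abs_continuous_on_compose:
 assumes "abs_continuous_on S F"
  and "\<And>x y. x \<in> F ` S \<Longrightarrow> y \<in> F ` S \<Longrightarrow> \<bar>H x - H y\<bar> \<le> L * \<bar>x - y\<bar>"
 shows "abs_continuous_on S (\<lambda>x. H (F x))"
 by (rule abs_continuous_on_bound2[OF assms(1) assms(1), of _ "L/2"])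
   (use assms(2) in fastforce)

lemma abs_continuous_on_cmult:
 "abs_continuous_on S F \<Longrightarrow> abs_continuous_on S (\<lambda>x. c * F x)" for c :: real
 by (rule abs_continuous_on_compose[where L = "\<bar>c\<bar>"]) (auto simp: abs_mult simp flip: right_diff_distrib)

lemma abs_continuous_on_mult:
 assumes F: "abs_continuous_on {a..b} F" and G: "abs_continuous_on {a..b} G"
 shows "abs_continuous_on {a..b} (\<lambda>x. F x * G x)"
proof -
 obtain B where B: "\<And>x. x \<in> {a..b} \<Longrightarrow> \<bar>F x\<bar> \<le> B"
  using compact_imp_bounded[OF compact_continuous_image[OF abs_continuous_on_imp_continuous[OF F] compact_Icc]]
  unfolding bounded_iff by force
 obtain C where C: "\<And>x. x \<in> {a..b} \<Longrightarrow> \<bar>G x\<bar> \<le> C"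
  using compact_imp_bounded[OF compact_continuous_image[OF abs_continuous_on_imp_continuous[OF G] compact_Icc]]
  unfolding bounded_iff by force
 show ?thesis
 proof (rule abs_continuous_on_bound2[OF F G, of _ "\<bar>B\<bar> + \<bar>C\<bar>"])
  fix x y assume xy: "x \<in> {a..b}" "y \<in> {a..b}"
  have "F x * G x - F y * G y = F x * (G x - G y) + G y * (F x - F y)" by (simp add: algebra_simps)
  then have "\<bar>F x * G x - F y * G y\<bar> \<le> \<bar>F x\<bar> * \<bar>G x - G y\<bar> + \<bar>G y\<bar> * \<bar>F x - F y\<bar>"
   by (metis abs_mult abs_triangle_ineq)
  also have "\<dots> \<le> (\<bar>B\<bar> + \<bar>C\<bar>) * \<bar>G x - G y\<bar> + (\<bar>B\<bar> + \<bar>C\<bar>) * \<bar>F x - F y\<bar>"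
   using B[OF xy(1)] C[OF xy(2)] by (intro add_mono mult_right_mono) auto
  finally show "\<bar>F x * G x - F y * G y\<bar> \<le> (\<bar>B\<bar> + \<bar>C\<bar>) * (\<bar>F x - F y\<bar> + \<bar>G x - G y\<bar>)"
   by (simp add: algebra_simps)
 qed
qed

text \<open>The minimum \<open>c\<close> of \<open>F\<close> on the compact interval is positive,
  and \<open>ln\<close> is Lipschitz with constant \<open>1 / c\<close> above it.\<close>

lemma abs_continuous_on_ln:
 assumes F: "abs_continuous_on {a..b} F" and pos: "\<And>x. x \<in> {a..b} \<Longrightarrow> F x > 0"
 shows "abs_continuous_on {a..b} (\<lambda>x. ln (F x))"
proof (cases "a \<le> b")
 case True
 obtain x0 where x0: "x0 \<in> {a..b}" "\<And>x. x \<in> {a..b} \<Longrightarrow> F x0 \<le> F x"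
  using continuous_attains_inf[OF compact_Icc _ abs_continuous_on_imp_continuous[OF F]] True by auto
 define c where "c = F x0"
 have c: "c > 0" using pos x0 by (auto simp: c_def)
 have *: "ln x - ln y \<le> 1/c * \<bar>x - y\<bar>" if "x \<ge> c" "y \<ge> c" for x y
 proof (cases "x \<ge> y")
  case True
  have "ln x - ln y = ln (x / y)" using that c by (simp add: ln_div)
  also have "\<dots> \<le> x / y - 1" using that c by (intro ln_le_minus_one) auto
  also have "\<dots> = (x - y) / y" using that c by (simp add: field_simps)
  also have "\<dots> \<le> (x - y) / c" using True that c by (intro divide_left_mono) auto
  finally show ?thesis using True by simp
 next
  case False
  then have "ln x \<le> ln y" using that c by auto
  then show ?thesis using c by (smt (verit) zero_le_divide_1_iff mult_nonneg_nonneg)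
 qed
 show ?thesis
  proof (rule abs_continuous_on_compose[OF F, of ln "1/c"])
  fix x y assume "x \<in> F ` {a..b}" "y \<in> F ` {a..b}"
  then have "x \<ge> c" "y \<ge> c" using x0 by (auto simp: c_def)
  then show "\<bar>ln x - ln y\<bar> \<le> 1/c * \<bar>x - y\<bar>"
   using *[of x y] *[of y x] by (simp add: abs_le_iff abs_minus_commute)
 qed
next
 case False
 then show ?thesis by (intro abs_continuous_on_lipschitz[of _ _ 0]) auto
qed

lemma abs_continuous_on_subset:
 "abs_continuous_on S F \<Longrightarrow> T \<subseteq> S \<Longrightarrow> abs_continuous_on T F"
 unfolding abs_continuous_on_def by (meson subset_trans)

lemma abs_continuous_on_cong:
 assumes "\<And>x. x \<in> S \<Longrightarrow> F x = G x"
 shows "abs_continuous_on S F \<longleftrightarrow> abs_continuous_on S G"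
proof
 assume "abs_continuous_on S F"
 from abs_continuous_on_bound2[OF this this, of _ 1] show "abs_continuous_on S G"
  by (auto simp: assms)
next
 assume "abs_continuous_on S G"
 from abs_continuous_on_bound2[OF this this, of _ 1] show "abs_continuous_on S F"
  by (auto simp: assms)
qed

lemma abs_continuous_on_deriv_bounded:
 assumes "continuous_on {a..b} F"
  and "\<And>x. x \<in> {a<..<b} \<Longrightarrow> (F has_real_derivative f x) (at x)"
  and "\<And>x. x \<in> {a<..<b} \<Longrightarrow> \<bar>f x\<bar> \<le> L"
 shows "abs_continuous_on {a..b} F"
proof -
 have *: "\<bar>F y - F x\<bar> \<le> L * \<bar>y - x\<bar>" if "x < y" "x \<in> {a..b}" "y \<in> {a..b}" for x y
 proof -
  have "continuous_on {x..y} F" using assms(1) that by (auto intro: continuous_on_subset)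
  moreover have "F differentiable (at t)" if "x < t" "t < y" for t
   using assms(2)[of t] that \<open>x \<in> {a..b}\<close> \<open>y \<in> {a..b}\<close> by (auto simp: real_differentiable_def)
  ultimately obtain l z where z: "x < z" "z < y" "(F has_real_derivative l) (at z)" "F y - F x = (y - x) * l"
   using MVT[OF \<open>x < y\<close>] by metis
  then have "l = f z" using assms(2)[of z] that by (auto intro: DERIV_unique)
  then have "\<bar>F y - F x\<bar> = \<bar>f z\<bar> * \<bar>y - x\<bar>" using z by (simp add: abs_mult)
  also have "\<dots> \<le> L * \<bar>y - x\<bar>" using assms(3)[of z] z that by (intro mult_right_mono) auto
  finally show ?thesis .
 qed
 show ?thesis
 proof (rule abs_continuous_on_lipschitz[of _ _ L])
  fix x y assume "x \<in> {a..b}" "y \<in> {a..b}"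
  then show "\<bar>F x - F y\<bar> \<le> L * \<bar>x - y\<bar>" using *[of x y] *[of y x]
   by (cases x y rule: linorder_cases) (auto simp: abs_minus_commute)
 qed
qed


section \<open>Vitali coverings and the fundamental theorem of calculus\<close>

lemma sum_length_division_le:
 fixes D :: "real set set"
 assumes D: "D division_of \<Union>D" and "\<Union>D \<subseteq> T" "T \<in> lmeasurable"
 shows "(\<Sum>k\<in>D. Sup k - Inf k) \<le> measure lebesgue T"
proof -
 have "(\<Sum>k\<in>D. Sup k - Inf k) = (\<Sum>k\<in>D. measure lebesgue k)"
 proof (rule sum.cong[OF refl])
  fix k assume "k \<in> D"
  then obtain u v where "k = {u..v}" "u \<le> v" "Inf k = u" "Sup k = v"
   using division_member_real[OF D] by metis
  then show "Sup k - Inf k = measure lebesgue k" by simp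
 qed
 also have "\<dots> = measure lebesgue (\<Union>D)"
 proof (rule measure_negligible_finite_Union[symmetric])
  show "finite D" using D by blast
  show "k \<in> lmeasurable" if k: "k \<in> D" for k
   using division_member_real[OF D k] by (metis lmeasurable_interval(1) cbox_interval)
  show "pairwise (\<lambda>S T. negligible (S \<inter> T)) D"
  proof (rule pairwiseI)
   fix k l assume kl: "k \<in> D" "l \<in> D" "k \<noteq> l"
   obtain u v where k: "k = {u..v}" using division_member_real[OF D kl(1)] by metis
   obtain u' v' where l: "l = {u'..v'}" using division_member_real[OF D kl(2)] by metis
   have "interior (k \<inter> l) = {}" using division_ofD(5)[OF D kl] by simp
   moreover have "convex (k \<inter> l)" using k l by (simp add: convex_Int)
   ultimately show "negligible (k \<inter> l)" using negligible_convex_interior by blast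
  qed
 qed
 also have "\<dots> \<le> measure lebesgue T"
 proof (rule measure_mono_fmeasurable)
  have "k \<in> lmeasurable" if k: "k \<in> D" for k
   using division_member_real[OF D k] by (metis lmeasurable_interval(1) cbox_interval)
  then show "\<Union>D \<in> sets lebesgue" using D by (intro sets.finite_Union) (auto dest: fmeasurableD)
 qed (use assms in auto)
 finally show ?thesis .
qed

text \<open>Vitali's theorem extracts countably many disjoint intervals covering \<open>S\<close> up
  to a null set. Their finite unions all lie in \<open>T\<close>, so the measures stay bounded and a
  finite subfamily already captures \<open>measure lebesgue S\<close> up to \<open>e\<close>;
  disjointness makes it a division.\<close>

lemma Vitali_division:
 fixes S T :: "real set"
 assumes S: "S \<in> lmeasurable" and T: "T \<in> lmeasurable" and "e > 0"
  and J: "\<And>k. k \<in> J \<Longrightarrow> k \<subseteq> T \<and> (\<exists>u v. u < v \<and> k = {u..v})"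
  and cov: "\<And>x d. x \<in> S \<Longrightarrow> d > 0 \<Longrightarrow> \<exists>k\<in>J. x \<in> k \<and> Sup k - Inf k < d"
 obtains D where "D \<subseteq> J" "D division_of \<Union>D" "measure lebesgue S - e < (\<Sum>k\<in>D. Sup k - Inf k)"
proof -
 \<comment> \<open>Intervals are read as closed balls, through midpoint and half length, to match
   the covering theorem.\<close>
 let ?a = "\<lambda>k::real set. (Inf k + Sup k) / 2" and ?r = "\<lambda>k::real set. (Sup k - Inf k) / 2"
 have cb: "cball (?a k) (?r k) = k \<and> Inf k < Sup k" if "k \<in> J" for k
 proof -
  obtain u v where "u < v" "k = {u..v}" using J[OF \<open>k \<in> J\<close>] by blast
  then show ?thesis by (simp add: cball_eq_atLeastAtMost field_simps)
 qed
 have *: "\<exists>k. k \<in> J \<and> x \<in> cball (?a k) (?r k) \<and> ?r k < d" if x: "x \<in> S" and "d > 0" for x d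
 proof -
  have "2 * d > 0" using \<open>d > 0\<close> by simp
  from cov[OF x this] obtain k where "k \<in> J" "x \<in> k" "Sup k - Inf k < 2 * d" by blast
  moreover have "x \<in> cball (?a k) (?r k)" using cb[OF \<open>k \<in> J\<close>] \<open>x \<in> k\<close> by (simp del: mem_cball)
  ultimately show ?thesis by (intro exI[of _ k]) (simp del: mem_cball)
 qed
 obtain C where C: "countable C" "C \<subseteq> J"
   "pairwise (\<lambda>i j. disjnt (cball (?a i) (?r i)) (cball (?a j) (?r j))) C"
   "negligible (S - (\<Union>i \<in> C. cball (?a i) (?r i)))"
 proof (rule Vitali_covering_theorem_cballs[of J ?r S ?a])
  show "0 < ?r i" if "i \<in> J" for i using cb[OF that] by simp
 qed (use * in blast)+
 have "(\<Union>i \<in> C. cball (?a i) (?r i)) = (\<Union>i\<in>C. i)"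
  by (rule SUP_cong[OF refl]) (use cb C(2) in blast)
 then have eq: "(\<Union>i \<in> C. cball (?a i) (?r i)) = \<Union>C" by simp
 have meas: "k \<in> lmeasurable" if kC: "k \<in> C" for k
 proof -
  obtain u v where "k = {u..v}" using J C(2) kC by blast
  then show ?thesis by (metis lmeasurable_interval(1) cbox_interval)
 qed
 have bd: "measure lebesgue (\<Union>D') \<le> measure lebesgue T" if "D' \<subseteq> C" "finite D'" for D'
 proof (rule measure_mono_fmeasurable[OF _ _ T])
  show "\<Union>D' \<subseteq> T" using that C(2) J by blast
  show "\<Union>D' \<in> sets lebesgue" using that meas by (intro sets.finite_Union) (auto dest: fmeasurableD)
 qed
 obtain D where D: "D \<subseteq> C" "finite D" "measure lebesgue (\<Union>C) - e < measure lebesgue (\<Union>D)"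
  using measure_countable_Union_approachable[OF C(1) \<open>e > 0\<close> meas bd] by metis
 have disj: "k \<inter> l = {}" if "k \<in> C" "l \<in> C" "k \<noteq> l" for k l
  using C(3) that cb C(2) unfolding pairwise_def disjnt_def by (metis subsetD)
 have Ddiv: "D division_of \<Union>D"
 proof (rule division_ofI[OF D(2)])
  show "K \<noteq> {}" "\<exists>a b. K = cbox a b" if K: "K \<in> D" for K
  proof -
   obtain u v where "u < v" "K = {u..v}" using J C(2) D(1) K by blast
   then show "K \<noteq> {}" "\<exists>a b. K = cbox a b" by (auto simp: cbox_interval)
  qed
  show "interior K1 \<inter> interior K2 = {}" if "K1 \<in> D" "K2 \<in> D" "K1 \<noteq> K2" for K1 K2
   using disj[of K1 K2] that D(1) interior_subset[of K1] interior_subset[of K2] by blast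
 qed auto
 have mC: "\<Union>C \<in> lmeasurable"
 proof -
  have "(\<Union>k\<in>C. k) \<in> lmeasurable"
   by (rule fmeasurable_UN_bound[OF C(1) meas, of "\<lambda>k. k" "measure lebesgue T"]) (use bd in auto)
  then show ?thesis by simp
 qed
 have "measure lebesgue S \<le> measure lebesgue (\<Union>C)"
 proof -
  have "measure lebesgue S \<le> measure lebesgue (\<Union>C \<union> (S - \<Union>C))"
   using C(4) S mC unfolding eq by (intro measure_mono_fmeasurable) (auto simp: fmeasurableD negligible_imp_measurable fmeasurable.Un)
  also have "\<dots> \<le> measure lebesgue (\<Union>C) + measure lebesgue (S - \<Union>C)"
   using C(4) mC unfolding eq by (intro measure_Un_le) (auto simp: fmeasurableD negligible_imp_sets)
  also have "\<dots> = measure lebesgue (\<Union>C)" using C(4) unfolding eq by (simp add: negligible_imp_measure0)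
  finally show ?thesis .
 qed
 moreover have "measure lebesgue (\<Union>D) \<le> (\<Sum>k\<in>D. Sup k - Inf k)"
 proof -
  have "measure lebesgue (\<Union>k\<in>D. k) \<le> (\<Sum>k\<in>D. measure lebesgue k)"
   using meas D(1) by (intro measure_UNION_le[OF D(2)]) (auto dest: fmeasurableD)
  also have "\<dots> = (\<Sum>k\<in>D. Sup k - Inf k)"
  proof (rule sum.cong[OF refl])
   fix k assume "k \<in> D"
   then obtain u v where "k = {u..v}" "u \<le> v" "Inf k = u" "Sup k = v"
    using division_member_real[OF Ddiv] by metis
   then show "measure lebesgue k = Sup k - Inf k" by simp
  qed
  finally show ?thesis by simp
 qed
 ultimately have "measure lebesgue S - e < (\<Sum>k\<in>D. Sup k - Inf k)" using D(3) by linarith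
 then show thesis using that D(1) C(2) Ddiv by blast
qed

text \<open>The integrand is set to 0 on \<open>N\<close>, so intervals tagged in \<open>N\<close>
  contribute only increments of \<open>F\<close>. A gauge that forces them into an open set of small
  measure lets absolute continuity bound these increments; all other tags use
  differentiability.\<close>

theorem has_integral_abs_continuous:
 assumes F: "abs_continuous_on {a..b} F" and "a \<le> b" and N: "negligible N"
  and der: "\<And>x. x \<in> {a..b} - N \<Longrightarrow> (F has_real_derivative f x) (at x within {a..b})"
 shows "(f has_integral F b - F a) {a..b}"
proof -
 define g where "g x = (if x \<in> N then 0 else f x)" for x
 have "(g has_integral F b - F a) {a..b}"
  unfolding has_integral_real
 proof (intro allI impI)
  fix e :: real assume "e > 0"
  \<comment> \<open>Spread over the length \<open>b - a\<close> this costs at most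
    \<open>e / 2\<close>; the added 1 keeps the denominator positive when
    \<open>a = b\<close>.\<close>
  define e' where "e' = e / (2 * (b - a + 1))"
  have e': "e' > 0" using \<open>e > 0\<close> \<open>a \<le> b\<close> by (auto simp: e'_def)
  have "e/2 > 0" using \<open>e > 0\<close> by auto
  obtain d where d: "d > 0"
   and D: "\<And>D. D division_of \<Union>D \<Longrightarrow> \<Union>D \<subseteq> {a..b} \<Longrightarrow> (\<Sum>k\<in>D. Sup k - Inf k) < d
    \<Longrightarrow> (\<Sum>k\<in>D. \<bar>F (Sup k) - F (Inf k)\<bar>) < e/2" by (rule abs_continuous_onE[OF F \<open>e/2 > 0\<close>]) blast
  obtain U where U: "open U" "N \<subseteq> U" "U \<in> lmeasurable" "measure lebesgue U < d"
  proof -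
   obtain U where U: "open U" "N \<subseteq> U" "U - N \<in> lmeasurable" "emeasure lebesgue (U - N) < ennreal d"
    using sets_lebesgue_outer_open[OF negligible_imp_sets[OF N] d] by metis
   have 1: "U \<in> lmeasurable" 
    using fmeasurable.Un[OF U(3) negligible_imp_measurable[OF N]] U(2) by (simp add: Un_absorb2)
   have "measure lebesgue U = measure lebesgue (U - N)"
    by (rule measure_negligible_symdiff) (use U(3) N in \<open>auto intro: negligible_subset\<close>)
   also have "\<dots> < d" using U(3,4) d by (simp add: emeasure_eq_measure2 ennreal_less_iff)
   finally show thesis using that U 1 by blast
  qed
  have "\<exists>r>0. \<forall>y\<in>{a..b}. \<bar>y - x\<bar> < r \<longrightarrow> \<bar>F y - F x - f x * (y - x)\<bar> \<le> e' * \<bar>y - x\<bar>"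
   if "x \<in> {a..b} - N" for x
   using der[OF that] e' unfolding has_field_derivative_def has_derivative_within_alt
   by (fastforce simp: mult.commute)
  then obtain r where r: "\<And>x. x \<in> {a..b} - N \<Longrightarrow> r x > 0"
   "\<And>x y. x \<in> {a..b} - N \<Longrightarrow> y \<in> {a..b} \<Longrightarrow> \<bar>y - x\<bar> < r x \<Longrightarrow> \<bar>F y - F x - f x * (y - x)\<bar> \<le> e' * \<bar>y - x\<bar>"
   by metis
  define \<gamma> where "\<gamma> x = (if x \<in> N then U else if x \<in> {a..b} then ball x (r x) else ball x 1)" for x
  have g1: "gauge \<gamma>" using U r by (auto simp: gauge_def \<gamma>_def)
  have g2: "norm ((\<Sum>(x, k)\<in>p. measure lborel k *\<^sub>R g x) - (F b - F a)) < e"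
   if p: "p tagged_division_of {a..b}" and fine: "\<gamma> fine p" for p
  proof -
   note pD = tagged_division_ofD[OF p]
   have mem: "\<exists>u v. k = {u..v} \<and> u \<le> v \<and> Inf k = u \<and> Sup k = v \<and> x \<in> {u..v} \<and> {u..v} \<subseteq> {a..b} \<and> measure lborel k = v - u"
    if xk: "(x, k) \<in> p" for x k
   proof -
    obtain u v where "k = cbox u v" using pD(4)[OF xk] by blast
    moreover have "x \<in> k" "k \<subseteq> {a..b}" using pD(2,3)[OF xk] by auto
    ultimately show ?thesis by (intro exI[of _ u] exI[of _ v]) (auto simp: cbox_interval)
   qed
   define h where "h = (\<lambda>(x::real, k). measure lborel k *\<^sub>R g x - (F (Sup k) - F (Inf k)))"
   define p1 where "p1 = {(x,k) \<in> p. x \<in> N}"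
   define p2 where "p2 = {(x,k) \<in> p. x \<notin> N}"
   have fin: "finite p" using pD(1) .
   have split: "p = p1 \<union> p2" "p1 \<inter> p2 = {}" "finite p1" "finite p2"
    using fin by (auto simp: p1_def p2_def intro: finite_subset)
   have "(\<Sum>(x, k)\<in>p. measure lborel k *\<^sub>R g x) - (F b - F a) = sum h p"
    unfolding additive_tagged_division_1[OF \<open>a \<le> b\<close> p, of F, symmetric] h_def
    by (simp add: sum_subtractf case_prod_unfold)
   also have "\<dots> = sum h p1 + sum h p2"
    by (subst split(1)) (rule sum.union_disjoint[OF split(3,4,2)])
   finally have eq: "(\<Sum>(x, k)\<in>p. measure lborel k *\<^sub>R g x) - (F b - F a) = sum h p1 + sum h p2" .
   have "\<bar>sum h p1\<bar> < e/2"
   proof -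
    have pp: "p1 tagged_partial_division_of {a..b}"
     using tagged_partial_division_subset[of p _ p1] p split(1) by (auto simp: tagged_division_of_def)
    have "\<bar>sum h p1\<bar> \<le> (\<Sum>xk\<in>p1. \<bar>h xk\<bar>)" by (rule sum_abs)
    also have "\<dots> = (\<Sum>(x,k)\<in>p1. \<bar>F (Sup k) - F (Inf k)\<bar>)"
     by (rule sum.cong) (auto simp: h_def g_def p1_def)
    \<comment> \<open>The case distinction changes nothing on \<open>p1\<close>. It is there because
      the transfer to the set of intervals asks for a function that vanishes on every box without
      interior, including the empty one, where \<open>Sup\<close> and \<open>Inf\<close> carry no
      information.\<close>
    also have "\<dots> = (\<Sum>(x,k)\<in>p1. if k = {} then 0 else \<bar>F (Sup k) - F (Inf k)\<bar>)"
     by (rule sum.cong) (use mem split(1) in fastforce)+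
    also have "\<dots> = (\<Sum>k\<in>snd ` p1. if k = {} then 0 else \<bar>F (Sup k) - F (Inf k)\<bar>)"
    proof (rule sum.over_tagged_division_lemma)
     show "p1 tagged_division_of \<Union>(snd ` p1)"
      using tagged_partial_division_of_Union_self[OF pp] .
     show "(if cbox u v = {} then 0 else \<bar>F (Sup (cbox u v)) - F (Inf (cbox u v))\<bar>) = 0"
      if "box u v = {}" for u v
      using that by (cases "u = v") (auto simp: cbox_interval box_real)
    qed
    also have "\<dots> = (\<Sum>k\<in>snd ` p1. \<bar>F (Sup k) - F (Inf k)\<bar>)"
     by (rule sum.cong) (use mem split(1) in fastforce)+
    also have "\<dots> < e/2"
    proof (rule D)
     show dv: "snd ` p1 division_of \<Union>(snd ` p1)" using partial_division_of_tagged_division[OF pp] .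
     show "\<Union>(snd ` p1) \<subseteq> {a..b}" using pD(3) split(1) by fastforce
     have "k \<subseteq> U" if "(x, k) \<in> p1" for x k
      using fineD[OF fine, of x k] that by (auto simp: p1_def \<gamma>_def)
     then have "\<Union>(snd ` p1) \<subseteq> U" by fastforce
     from sum_length_division_le[OF dv this U(3)] U(4)
     show "(\<Sum>k\<in>snd ` p1. Sup k - Inf k) < d" by simp
    qed
    finally show ?thesis .
   qed
   moreover have "\<bar>sum h p2\<bar> \<le> e' * (b - a)"
   proof -
    have "\<bar>sum h p2\<bar> \<le> (\<Sum>xk\<in>p2. \<bar>h xk\<bar>)" by (rule sum_abs)
    also have "\<dots> \<le> (\<Sum>(x,k)\<in>p2. e' * (Sup k - Inf k))"
    proof (rule sum_mono, clarify)
     fix x k assume xk: "(x, k) \<in> p2"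
     then have xkp: "(x,k) \<in> p" and xN: "x \<notin> N" by (auto simp: p2_def)
     obtain u v where uv: "k = {u..v}" "u \<le> v" "Inf k = u" "Sup k = v" "x \<in> {u..v}" "{u..v} \<subseteq> {a..b}"
      "measure lborel k = v - u" using mem[OF xkp] by blast
     have x: "x \<in> {a..b} - N" using uv xN by auto
     have "{u..v} \<subseteq> ball x (r x)" using fineD[OF fine xkp] uv x by (auto simp: \<gamma>_def)
     then have "\<bar>u - x\<bar> < r x" "\<bar>v - x\<bar> < r x" using uv(2) by (auto simp: subset_iff dist_real_def abs_minus_commute)
     then have "\<bar>F u - F x - f x * (u - x)\<bar> \<le> e' * \<bar>u - x\<bar>" "\<bar>F v - F x - f x * (v - x)\<bar> \<le> e' * \<bar>v - x\<bar>"
      using r(2)[OF x, of u] r(2)[OF x, of v] uv by auto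
     \<comment> \<open>Straddle estimate: the tag lies between \<open>u\<close> and
       \<open>v\<close>, so the two one-sided errors add up to a multiple of
       \<open>v - u\<close>.\<close>
     then have "\<bar>(v - u) * f x - (F v - F u)\<bar> \<le> e' * \<bar>u - x\<bar> + e' * \<bar>v - x\<bar>"
      by (simp add: algebra_simps abs_le_iff)
     also have "\<dots> = e' * (v - u)" using uv(5) by (auto simp: algebra_simps)
     finally show "\<bar>h (x, k)\<bar> \<le> e' * (Sup k - Inf k)" using uv xN by (simp add: h_def g_def)
    qed
    also have "\<dots> \<le> (\<Sum>(x,k)\<in>p. e' * (Sup k - Inf k))"
     using split mem e' by (intro sum_mono2[OF fin]) fastforce+
    also have "\<dots> = e' * (\<Sum>(x,k)\<in>p. Sup k - Inf k)" by (simp add: sum_distrib_left case_prod_unfold)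
    also have "(\<Sum>(x,k)\<in>p. Sup k - Inf k) = b - a"
     using additive_tagged_division_1[OF \<open>a \<le> b\<close> p, of "\<lambda>x. x"] by simp
    finally show ?thesis .
   qed
   moreover have "e' * (b - a) \<le> e/2"
   proof -
    have "e' * (b - a) \<le> e' * (b - a + 1)" using e' by simp
    also have "\<dots> = e/2" using \<open>a \<le> b\<close> by (simp add: e'_def field_simps)
    finally show ?thesis .
   qed
   ultimately show ?thesis unfolding eq real_norm_def by linarith
  qed
  show "\<exists>\<gamma>. gauge \<gamma> \<and> (\<forall>\<D>. \<D> tagged_division_of {a..b} \<and> \<gamma> fine \<D> \<longrightarrow>
    norm ((\<Sum>(x, k)\<in>\<D>. measure lborel k *\<^sub>R g x) - (F b - F a)) < e)"
   by (intro exI[of _ \<gamma>] conjI allI impI g1 g2) auto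
 qed
 then show ?thesis
  by (rule has_integral_spike[OF N, rotated]) (auto simp: g_def)
qed

section \<open>Differentiability almost everywhere\<close>

lemma borel_nested_interval_cover:
 "{x::real. \<forall>n::nat. \<exists>u v. P n u v \<and> u < x \<and> x < v} \<in> sets borel"
proof -
 \<comment> \<open>Because the point lies strictly inside the witnessing interval, each level is a
   union of open intervals; the set is therefore a countable intersection of open sets, whatever
   \<open>P\<close> is.\<close>
 define W where "W n = (\<Union>(u, v)\<in>{(u, v). P n u v}. {u<..<v})" for n
 have W: "open (W n)" for n unfolding W_def by (intro open_UN) auto
 have "{x::real. \<forall>n::nat. \<exists>u v. P n u v \<and> u < x \<and> x < v} = (\<Inter>n. W n)"
  unfolding W_def by (rule set_eqI) simp
 moreover have "(\<Inter>n. W n) \<in> sets borel"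
  using W by (intro sets.countable_INT) (auto intro: borel_open)
 ultimately show ?thesis by simp
qed

lemma measurable_subset_Icc:
 assumes "A \<in> sets borel" "A \<subseteq> {a..b::real}"
 shows "A \<in> lmeasurable"
 using assms bounded_set_imp_lmeasurable[OF bounded_subset[OF bounded_closed_interval assms(2)]] by simp

lemma measurable_subset_Ioo:
 assumes "A \<in> sets borel" "A \<subseteq> {a<..<b::real}"
 shows "A \<in> lmeasurable"
 using measurable_subset_Icc[OF assms(1), of a b] assms(2) greaterThanLessThan_subseteq_atLeastAtMost_iff[of a b a b] by blast

text \<open>\<open>A\<close> collects points with slopes below \<open>- r\<close> and above
  \<open>r\<close> at all small scales. If \<open>A\<close> had measure \<open>m > 0\<close>, most
  of it could be covered by intervals of slope below \<open>- r\<close> (\<open>D1\<close>), and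
  then again, inside those, by intervals of slope above \<open>r\<close> (\<open>D2\<close>).
  Exchanging \<open>D1\<close> for \<open>D2\<close> in a division changes the sum of increments by
  at least \<open>r * m\<close>, while the leftover intervals are so short that absolute continuity
  allows only \<open>r * m / 4\<close>.\<close>

lemma negligible_oscillation:
 assumes F: "abs_continuous_on {a..b} F" and r: "r > 0"
  and A_def: "A = {x. \<forall>n::nat. \<exists>u v. (a \<le> u \<and> v \<le> b \<and> v - u < 1 / (real n + 1) \<and> F v - F u < - r * (v - u)) \<and> u < x \<and> x < v}
   \<inter> {x. \<forall>n::nat. \<exists>u v. (a \<le> u \<and> v \<le> b \<and> v - u < 1 / (real n + 1) \<and> F v - F u > r * (v - u)) \<and> u < x \<and> x < v}"
 shows "negligible A"
proof -
 have Ab: "A \<in> sets borel" unfolding A_def by (intro sets.Int borel_nested_interval_cover)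
 have Asub: "A \<subseteq> {a<..<b}" unfolding A_def by fastforce
 have Am: "A \<in> lmeasurable" using measurable_subset_Ioo[OF Ab Asub] .
 have neg: "\<exists>u v. a \<le> u \<and> v \<le> b \<and> v - u < d \<and> F v - F u < - r * (v - u) \<and> u < x \<and> x < v"
  and pos: "\<exists>u v. a \<le> u \<and> v \<le> b \<and> v - u < d \<and> F v - F u > r * (v - u) \<and> u < x \<and> x < v"
  if "x \<in> A" "d > 0" for x d
 proof -
  obtain n :: nat where "1 / (real n + 1) < d" using reals_Archimedean[OF \<open>d > 0\<close>] by (auto simp: field_simps)
  then show "\<exists>u v. a \<le> u \<and> v \<le> b \<and> v - u < d \<and> F v - F u < - r * (v - u) \<and> u < x \<and> x < v"
   "\<exists>u v. a \<le> u \<and> v \<le> b \<and> v - u < d \<and> F v - F u > r * (v - u) \<and> u < x \<and> x < v"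
   using that(1) unfolding A_def Int_iff mem_Collect_eq
   by (metis (no_types, lifting) less_trans)+
 qed
 define m where "m = measure lebesgue A"
 have "m = 0"
 proof (rule ccontr)
  assume "m \<noteq> 0"
  then have m: "m > 0" by (simp add: m_def order_less_le)
  then have "r * m / 4 > 0" using r by simp
  obtain d0 where d0: "d0 > 0"
   and D0: "\<And>D. D division_of \<Union>D \<Longrightarrow> \<Union>D \<subseteq> {a..b} \<Longrightarrow> (\<Sum>k\<in>D. Sup k - Inf k) < d0
    \<Longrightarrow> (\<Sum>k\<in>D. \<bar>F (Sup k) - F (Inf k)\<bar>) < r * m / 4"
   by (rule abs_continuous_onE[OF F \<open>r * m / 4 > 0\<close>]) blast
  \<comment> \<open>Each loss of measure below is at most \<open>d / 4\<close>; four such losses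
    stay within \<open>d0\<close>, and \<open>d \<le> m\<close> keeps the main term
    dominant.\<close>
  define d where "d = min d0 m"
  have d: "d > 0" "d \<le> d0" "d \<le> m" using d0 m by (auto simp: d_def)
  define S where "S f X = (\<Sum>k\<in>X. f (Sup k) - f (Inf k))" for f :: "real \<Rightarrow> real" and X :: "real set set"
  obtain G where G: "open G" "A \<subseteq> G" "G - A \<in> lmeasurable" "emeasure lebesgue (G - A) < ennreal (d/4)"
   using sets_lebesgue_outer_open[OF fmeasurableD[OF Am], of "d/4"] d by auto
  define T where "T = G \<inter> {a<..<b}"
  have T: "open T" "A \<subseteq> T" "T \<subseteq> {a<..<b}" using G Asub by (auto simp: T_def)
  have Tm: "T \<in> lmeasurable" using T by (intro measurable_subset_Ioo[of T a b]) auto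
  have mT: "measure lebesgue T \<le> m + d/4"
  proof -
   have "measure lebesgue T \<le> measure lebesgue (A \<union> (G - A))"
    by (rule measure_mono_fmeasurable[OF _ fmeasurableD[OF Tm] fmeasurable.Un[OF Am G(3)]]) (auto simp: T_def)
   also have "\<dots> \<le> m + measure lebesgue (G - A)"
    unfolding m_def using Am G by (intro measure_Un_le) (auto simp: fmeasurableD)
   also have "measure lebesgue (G - A) < d/4"
    using G(3,4) d by (simp add: emeasure_eq_measure2 ennreal_less_iff)
   finally show ?thesis by simp
  qed
  define J1 where "J1 = {{u..v} |u v. u < v \<and> {u..v} \<subseteq> T \<and> F v - F u < - r * (v - u)}"
  have "d/4 > 0" using d by simp
  have cov1: "\<exists>k\<in>J1. x \<in> k \<and> Sup k - Inf k < c" if x: "x \<in> A" "c > 0" for x c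
  proof -
   obtain \<rho> where \<rho>: "\<rho> > 0" "ball x \<rho> \<subseteq> T" using T x openE by blast
   have "min c \<rho> > 0" using \<rho> x by simp
   from neg[OF x(1) this] obtain u v where uv: "v - u < c" "v - u < \<rho>" "F v - F u < - r * (v - u)" "u < x" "x < v"
    by auto
   have "{u..v} \<subseteq> ball x \<rho>" using uv by (auto simp: dist_real_def)
   then have "{u..v} \<in> J1" using uv \<rho> unfolding J1_def by auto
   then show ?thesis using uv by (intro bexI[of _ "{u..v}"]) auto
  qed
  obtain D1 where D1: "D1 \<subseteq> J1" "D1 division_of \<Union>D1" "m - d/4 < (\<Sum>k\<in>D1. Sup k - Inf k)"
   unfolding m_def
  proof (rule Vitali_division[OF Am Tm \<open>d/4 > 0\<close>, of J1])
   show "k \<subseteq> T \<and> (\<exists>u v. u < v \<and> k = {u..v})" if "k \<in> J1" for k using that unfolding J1_def by auto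
  qed (use cov1 in blast)+
  have D1T: "\<Union>D1 \<subseteq> T" using D1(1) unfolding J1_def by auto
  have fin1: "finite D1" using D1(2) by blast
  have clo: "closed (\<Union>D1)" using fin1 D1(1) by (intro closed_Union) (auto simp: J1_def)
  have D1m: "\<Union>D1 \<in> lmeasurable"
   using clo subset_trans[OF D1T T(3)] by (intro measurable_subset_Ioo[of _ a b]) auto
  \<comment> \<open>The second cover must nest strictly inside members of \<open>D1\<close>. Passing
    to interiors loses only finitely many endpoints.\<close>
  define U where "U = (\<Union>k\<in>D1. interior k)"
  have U: "open U" unfolding U_def by (intro open_UN) simp
  have UT: "U \<subseteq> T"
  proof
   fix x assume "x \<in> U"
   then obtain k where k: "k \<in> D1" "x \<in> interior k" unfolding U_def by blast
   then have "x \<in> \<Union>D1" using interior_subset[of k] by blast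
   then show "x \<in> T" using D1T by blast
  qed
  have UI: "U \<subseteq> {a<..<b}" using UT T(3) by (rule subset_trans)
  have Um: "U \<in> lmeasurable" using U UI by (intro measurable_subset_Ioo[of _ a b]) simp_all
  have AUm: "A \<inter> U \<in> lmeasurable" using Am Um by (rule fmeasurable.Int)
  have mAU: "m \<le> measure lebesgue (A \<inter> U) + d/2"
  proof -
   have fin: "finite (\<Union>k\<in>D1. {Inf k, Sup k})" using fin1 by simp
   have Zm: "(\<Union>k\<in>D1. {Inf k, Sup k}) \<in> lmeasurable"
    using negligible_imp_measurable[OF negligible_finite[OF fin]] .
   have TDm: "T - \<Union>D1 \<in> lmeasurable" by (rule fmeasurable_Diff[OF Tm fmeasurableD[OF D1m]])
   have sub: "A \<subseteq> (A \<inter> U) \<union> (T - \<Union>D1) \<union> (\<Union>k\<in>D1. {Inf k, Sup k})"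
   proof
    fix x assume x: "x \<in> A"
    show "x \<in> (A \<inter> U) \<union> (T - \<Union>D1) \<union> (\<Union>k\<in>D1. {Inf k, Sup k})"
    proof (cases "x \<in> \<Union>D1")
     case True
     then obtain k where k: "k \<in> D1" "x \<in> k" by blast
     obtain u v where uv: "k = {u..v}" "Inf k = u" "Sup k = v" using division_member_real[OF D1(2) k(1)] by metis
     then have "x \<in> interior k \<or> x = u \<or> x = v" using k(2) by auto
     then show ?thesis
     proof (elim disjE)
      assume "x \<in> interior k"
      then have "x \<in> A \<inter> U" using k(1) x unfolding U_def by (intro IntI UN_I)
      then show ?thesis by simp
     next
      assume "x = u"
      then have "x \<in> (\<Union>k\<in>D1. {Inf k, Sup k})" using k(1) uv(2) by (intro UN_I[of k]) simp_all
      then show ?thesis by simp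
     next
      assume "x = v"
      then have "x \<in> (\<Union>k\<in>D1. {Inf k, Sup k})" using k(1) uv(3) by (intro UN_I[of k]) simp_all
      then show ?thesis by simp
     qed
    qed (use x T in auto)
   qed
   have "m \<le> measure lebesgue ((A \<inter> U) \<union> (T - \<Union>D1) \<union> (\<Union>k\<in>D1. {Inf k, Sup k}))"
    unfolding m_def
    by (rule measure_mono_fmeasurable[OF sub fmeasurableD[OF Am] fmeasurable.Un[OF fmeasurable.Un[OF AUm TDm] Zm]])
   also have "\<dots> \<le> measure lebesgue ((A \<inter> U) \<union> (T - \<Union>D1)) + measure lebesgue (\<Union>k\<in>D1. {Inf k, Sup k})"
    by (rule measure_Un_le[OF fmeasurableD[OF fmeasurable.Un[OF AUm TDm]] fmeasurableD[OF Zm]])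
   also have "measure lebesgue (\<Union>k\<in>D1. {Inf k, Sup k}) = 0"
    using fin by (intro negligible_imp_measure0 negligible_finite)
   also have "measure lebesgue ((A \<inter> U) \<union> (T - \<Union>D1)) \<le> measure lebesgue (A \<inter> U) + measure lebesgue (T - \<Union>D1)"
    by (rule measure_Un_le[OF fmeasurableD[OF AUm] fmeasurableD[OF TDm]])
   also have "measure lebesgue (T - \<Union>D1) = measure lebesgue T - measure lebesgue (\<Union>D1)"
    by (rule measurable_measure_Diff[OF Tm fmeasurableD[OF D1m] D1T])
   finally have "m \<le> measure lebesgue (A \<inter> U) + (measure lebesgue T - measure lebesgue (\<Union>D1))" by simp
   moreover have "measure lebesgue (\<Union>D1) \<ge> m - d/4"
    using sum_length_division_le[OF D1(2) order_refl D1m] D1(3) by linarith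
   ultimately show ?thesis using mT by simp
  qed
  define J2 where "J2 = {{u..v} |u v. u < v \<and> (\<exists>k\<in>D1. {u..v} \<subseteq> interior k) \<and> F v - F u > r * (v - u)}"
  have cov2: "\<exists>k\<in>J2. x \<in> k \<and> Sup k - Inf k < c" if x: "x \<in> A \<inter> U" "c > 0" for x c
  proof -
   obtain k where k: "k \<in> D1" "x \<in> interior k" using x U_def by auto
   then obtain \<rho> where \<rho>: "\<rho> > 0" "ball x \<rho> \<subseteq> interior k" using openE[OF open_interior] by metis
   have "min c \<rho> > 0" "x \<in> A" using \<rho> x by auto
   from pos[OF this(2,1)] obtain u v where uv: "v - u < c" "v - u < \<rho>" "F v - F u > r * (v - u)" "u < x" "x < v"
    by auto
   have "{u..v} \<subseteq> ball x \<rho>" using uv by (auto simp: dist_real_def)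
   then have "{u..v} \<subseteq> interior k" using \<rho> by blast
   then have "{u..v} \<in> J2" using uv k(1) unfolding J2_def by fastforce
   then show ?thesis using uv by (intro bexI[of _ "{u..v}"]) auto
  qed
  obtain D2 where D2: "D2 \<subseteq> J2" "D2 division_of \<Union>D2" "measure lebesgue (A \<inter> U) - d/4 < (\<Sum>k\<in>D2. Sup k - Inf k)"
  proof (rule Vitali_division[OF AUm Um \<open>d/4 > 0\<close>, of J2])
   show "k \<subseteq> U \<and> (\<exists>u v. u < v \<and> k = {u..v})" if "k \<in> J2" for k using that unfolding J2_def U_def by blast
  qed (use cov2 in blast)+
  have "a \<le> b" using T m Asub m_def by (metis (no_types, opaque_lifting) bot.extremum_uniqueI greaterThanLessThan_empty less_irrefl linear measure_empty)
  have ab: "\<Union>D1 \<subseteq> {a..b}" using D1T T(3) greaterThanLessThan_subseteq_atLeastAtMost_iff[of a b a b] by blast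
  \<comment> \<open>\<open>E\<close> completes \<open>D1\<close> to a division of the whole
    interval, and \<open>R\<close> completes \<open>D2\<close> together with \<open>E\<close>. Both
    divisions telescope to the same total, so \<open>R\<close> carries exactly the difference
    between \<open>D1\<close> and \<open>D2\<close>.\<close>
  obtain q1 where q1: "D1 \<subseteq> q1" "q1 division_of {a..b}"
   using partial_division_extend_interval[OF D1(2), of a b] ab by (auto simp: cbox_interval)
  define E where "E = q1 - D1"
  have finq1: "finite q1" using q1 by blast
  have sep: "interior k \<inter> interior l = {}" if kl: "k \<in> D2" "l \<in> E" for k l
  proof -
   have "k \<in> J2" using kl(1) D2(1) by blast
   then obtain k1 where k1: "k1 \<in> D1" "k \<subseteq> interior k1" unfolding J2_def by blast
   have "k1 \<noteq> l" using k1 kl(2) by (auto simp: E_def)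
   then have "interior k1 \<inter> interior l = {}" using division_ofD(5)[OF q1(2)] k1(1) q1(1) kl(2) by (auto simp: E_def)
   then show ?thesis using k1(2) interior_subset[of k] by blast
  qed
  have disj: "D2 \<inter> E = {}"
  proof (rule ccontr)
   assume "D2 \<inter> E \<noteq> {}"
   then obtain k where k: "k \<in> D2" "k \<in> E" by blast
   from sep[OF k] have "interior k = {}" by simp
   moreover have "k \<in> J2" using k(1) D2(1) by blast
   then obtain u v where "u < v" "k = {u..v}" unfolding J2_def by blast
   ultimately show False by (simp add: interior_atLeastAtMost_real)
  qed
  have Ediv: "E division_of \<Union>E"
   by (rule division_of_subset[of q1]) (use q1 division_of_union_self in \<open>auto simp: E_def\<close>)
  have P: "(D2 \<union> E) division_of \<Union>(D2 \<union> E)"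
  proof (rule division_ofI)
   show "finite (D2 \<union> E)" using D2(2) Ediv by blast
   show "K \<noteq> {}" "\<exists>a b. K = cbox a b" if "K \<in> D2 \<union> E" for K
    using that division_ofD(3,4)[OF D2(2)] division_ofD(3,4)[OF Ediv] by auto
   show "interior K1 \<inter> interior K2 = {}" if KK: "K1 \<in> D2 \<union> E" "K2 \<in> D2 \<union> E" "K1 \<noteq> K2" for K1 K2
   proof -
    consider "K1 \<in> D2 \<and> K2 \<in> D2" | "K1 \<in> D2 \<and> K2 \<in> E" | "K1 \<in> E \<and> K2 \<in> D2" | "K1 \<in> E \<and> K2 \<in> E"
     using KK by blast
    then show ?thesis
    proof cases
     case 1 then show ?thesis using division_ofD(5)[OF D2(2)] KK(3) by metis
    next
     case 2 then show ?thesis using sep by metis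
    next
     case 3 then show ?thesis using sep[of K2 K1] by (simp only: Int_commute)
    next
     case 4 then show ?thesis using division_ofD(5)[OF Ediv] KK(3) by metis
    qed
   qed
  qed auto
  have "\<Union>D2 \<subseteq> {a..b}"
  proof -
   have "k \<subseteq> U" if "k \<in> D2" for k
   proof -
    have "k \<in> J2" using that D2(1) by blast
    then show ?thesis unfolding J2_def U_def by blast
   qed
   then have "\<Union>D2 \<subseteq> U" by blast
   then show ?thesis using UI greaterThanLessThan_subseteq_atLeastAtMost_iff[of a b a b] by blast
  qed
  then have "\<Union>(D2 \<union> E) \<subseteq> {a..b}" using q1(2) unfolding E_def by blast
  then obtain q where q: "D2 \<union> E \<subseteq> q" "q division_of {a..b}"
   using partial_division_extend_interval[OF P, of a b] by (auto simp: cbox_interval)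
  define R where "R = q - (D2 \<union> E)"
  have finq: "finite q" using q by blast
  have Sq1: "S f D1 + S f E = f b - f a" for f
  proof -
   have "S f q1 = S f D1 + S f E" unfolding S_def E_def
    using sum.subset_diff[OF q1(1) finq1] by (simp add: add.commute)
   then show ?thesis using division_sum_diff[OF q1(2) \<open>a \<le> b\<close>, of f] by (simp add: S_def)
  qed
  have Sq: "S f D2 + S f E + S f R = f b - f a" for f
  proof -
   have "S f q = S f R + S f (D2 \<union> E)" unfolding S_def R_def
    using sum.subset_diff[OF q(1) finq] by simp
   also have "S f (D2 \<union> E) = S f D2 + S f E" unfolding S_def
    using disj D2(2) finq1 by (intro sum.union_disjoint) (auto simp: E_def)
   finally show ?thesis using division_sum_diff[OF q(2) \<open>a \<le> b\<close>, of f] by (simp add: S_def)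
  qed
  have Rdiv: "R division_of \<Union>R"
   by (rule division_of_subset[of q]) (use q division_of_union_self in \<open>auto simp: R_def\<close>)
  have Rsub: "\<Union>R \<subseteq> {a..b}" using q(2) unfolding R_def by blast
  have SD1: "S (\<lambda>x. x) D1 \<le> m + d/4"
   using sum_length_division_le[OF D1(2) D1T Tm] mT by (simp add: S_def)
  have SD2: "S (\<lambda>x. x) D2 > m - 3 * d/4" using D2(3) mAU by (simp add: S_def)
  \<comment> \<open>The length of \<open>R\<close> is the length of \<open>D1\<close> minus that of
    \<open>D2\<close>, which is less than \<open>(m + d/4) - (m - 3 * d/4) = d\<close>.\<close>
  have "(\<Sum>k\<in>R. Sup k - Inf k) < d0"
   using Sq[of "\<lambda>x. x"] Sq1[of "\<lambda>x. x"] SD1 SD2 d by (simp add: S_def)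
  from D0[OF Rdiv Rsub this] have a1: "\<bar>S F R\<bar> < r * m / 4"
   unfolding S_def by (rule order_le_less_trans[OF sum_abs])
  have a2: "S F R = S F D1 - S F D2" using Sq[of F] Sq1[of F] by simp
  have a3: "S F D1 \<le> - r * S (\<lambda>x. x) D1"
   unfolding S_def sum_distrib_left
  proof (rule sum_mono)
   fix k assume "k \<in> D1"
   then have "k \<in> J1" using D1(1) by blast
   then obtain u v where "k = {u..v}" "u < v" "F v - F u < - r * (v - u)" unfolding J1_def by blast
   then show "F (Sup k) - F (Inf k) \<le> - r * (Sup k - Inf k)" by simp
  qed
  have a4: "S F D2 \<ge> r * S (\<lambda>x. x) D2"
   unfolding S_def sum_distrib_left
  proof (rule sum_mono)
   fix k assume "k \<in> D2"
   then have "k \<in> J2" using D2(1) by blast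
   then obtain u v where "k = {u..v}" "u < v" "F v - F u > r * (v - u)" unfolding J2_def by blast
   then show "F (Sup k) - F (Inf k) \<ge> r * (Sup k - Inf k)" by simp
  qed
  have a5: "r * m - (r * d)/4 \<le> r * S (\<lambda>x. x) D1"
  proof -
   have "r * (m - d/4) \<le> r * S (\<lambda>x. x) D1" using D1(3) r by (intro mult_left_mono) (auto simp: S_def)
   moreover have "r * (m - d/4) = r * m - (r * d)/4" by (simp add: right_diff_distrib)
   ultimately show ?thesis by simp
  qed
  have a6: "r * m - 3 * (r * d)/4 \<le> r * S (\<lambda>x. x) D2"
  proof -
   have "r * (m - 3 * d/4) \<le> r * S (\<lambda>x. x) D2" using SD2 r by (intro mult_left_mono) auto
   moreover have "r * (m - 3 * d/4) = r * m - 3 * (r * d)/4" by (simp add: right_diff_distrib)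
   ultimately show ?thesis by simp
  qed
  have a7: "r * d \<le> r * m" using d(3) r by simp
  have a8: "r * m > 0" using r m by simp
  \<comment> \<open>The arithmetic in isolation:
    \<open>Z \<le> - (P + Q) \<le> - 2 * X + Y \<le> - X\<close>, against
    \<open>\<bar>Z\<bar> < X / 4\<close>.\<close>
  have lin: False if "\<bar>Z\<bar> < X/4" "Z = A - B" "A \<le> - P" "Q \<le> B" "X - Y/4 \<le> P" "X - 3 * Y/4 \<le> Q" "Y \<le> X" "X > 0"
   for Z A B P Q X Y :: real using that by linarith
  show False
   by (rule lin[OF a1 a2 a3[unfolded mult_minus_left] a4 a5 a6 a7 a8])
 qed
 then show ?thesis using Am negligible_iff_measure[of A] by (simp add: m_def)
qed

text \<open>Within a window shorter than the \<open>d\<close> that belongs to \<open>e = 1\<close>,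
  the increments over any division sum to less than 1. A part of \<open>B\<close> of positive
  measure \<open>m\<close> would admit a division of length above \<open>m / 2\<close> with all
  slopes above \<open>N\<close>, and \<open>N\<close> can be taken larger than
  \<open>2 / m\<close>.\<close>

lemma negligible_unbounded_slopes:
 assumes F: "abs_continuous_on {a..b} F"
  and B_def: "B = {x. \<forall>n::nat. \<exists>u v. (a \<le> u \<and> v \<le> b \<and> v - u < 1 / (real n + 1)
    \<and> \<bar>F v - F u\<bar> > (real n + 1) * (v - u)) \<and> u < x \<and> x < v}"
 shows "negligible B"
proof -
 have Bb: "B \<in> sets borel" unfolding B_def by (rule borel_nested_interval_cover)
 have Bsub: "B \<subseteq> {a<..<b}"
 proof
  fix x assume "x \<in> B"
  then obtain u v where "a \<le> u" "v \<le> b" "u < x" "x < v" unfolding B_def by blast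
  then show "x \<in> {a<..<b}" by simp
 qed
 obtain d where d: "d > 0"
   and D: "\<And>D. D division_of \<Union>D \<Longrightarrow> \<Union>D \<subseteq> {a..b} \<Longrightarrow> (\<Sum>k\<in>D. Sup k - Inf k) < d
    \<Longrightarrow> (\<Sum>k\<in>D. \<bar>F (Sup k) - F (Inf k)\<bar>) < 1"
  by (rule abs_continuous_onE[OF F zero_less_one]) blast
 show ?thesis
 proof (rule locally_negligible_alt[THEN iffD2], rule ballI)
  fix x assume "x \<in> B"
  \<comment> \<open>The window has length at most \<open>2 * d / 3\<close>, hence below
    \<open>d\<close>. Negligibility is a local property, so windows suffice.\<close>
  define T where "T = {a<..<b} \<inter> ball x (d/3)"
  have T: "open T" by (auto simp: T_def)
  have Tm: "T \<in> lmeasurable" using T by (intro measurable_subset_Ioo[of _ a b]) (auto simp: T_def)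
  have mT: "measure lebesgue T < d"
  proof -
   have "measure lebesgue T \<le> measure lebesgue {x - d/3..x + d/3}"
   proof (rule measure_mono_fmeasurable[OF _ fmeasurableD[OF Tm]])
    show "T \<subseteq> {x - d/3..x + d/3}"
    proof
     fix y assume "y \<in> T"
     then have "\<bar>x - y\<bar> < d/3" by (simp add: T_def dist_real_def)
     then have "x - d/3 \<le> y" "y \<le> x + d/3" by linarith+
     then show "y \<in> {x - d/3..x + d/3}" by simp
    qed
    show "{x - d/3..x + d/3} \<in> lmeasurable" by (metis lmeasurable_interval(1) cbox_interval)
   qed
   also have "\<dots> < d" using d by simp
   finally show ?thesis .
  qed
  have Sm: "B \<inter> T \<in> lmeasurable" using Bb T Bsub by (intro measurable_subset_Ioo[of _ a b]) auto
  define m where "m = measure lebesgue (B \<inter> T)"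
  have "m = 0"
  proof (rule ccontr)
   assume "m \<noteq> 0"
   then have m: "m > 0" by (simp add: m_def order_less_le)
   obtain N :: nat where N: "real N * (m/2) > 1" using reals_Archimedean3[of "m/2"] m by (meson half_gt_zero)
   define J where "J = {{u..v} |u v. u < v \<and> {u..v} \<subseteq> T \<and> \<bar>F v - F u\<bar> > real N * (v - u)}"
   have cov: "\<exists>k\<in>J. y \<in> k \<and> Sup k - Inf k < c" if y: "y \<in> B \<inter> T" "c > 0" for y c
   proof -
    obtain \<rho> where \<rho>: "\<rho> > 0" "ball y \<rho> \<subseteq> T" using T y openE by blast
    then obtain n :: nat where n: "1 / (real n + 1) < min c \<rho>"
     using reals_Archimedean[of "min c \<rho>"] y(2) by (auto simp: field_simps)
    \<comment> \<open>One index has to deliver both a small scale (through \<open>n\<close>) and a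
      steep slope (through \<open>N\<close>).\<close>
    define n' where "n' = max n N"
    have n': "1 / (real n' + 1) \<le> 1 / (real n + 1)" by (rule divide_left_mono) (auto simp: n'_def)
    obtain u v where uv: "v - u < 1 / (real n' + 1)" "\<bar>F v - F u\<bar> > (real n' + 1) * (v - u)" "u < y" "y < v"
     using y(1) unfolding B_def by blast
    have uv': "v - u < c" "v - u < \<rho>" using uv(1) n n' by auto
    have "{u..v} \<subseteq> ball y \<rho>" using uv uv' by (auto simp: dist_real_def)
    then have "{u..v} \<subseteq> T" using \<rho>(2) by blast
    moreover have "real N * (v - u) \<le> (real n' + 1) * (v - u)" using uv(3,4) by (intro mult_right_mono) (auto simp: n'_def)
    then have "\<bar>F v - F u\<bar> > real N * (v - u)" using uv(2) by linarith
    ultimately have "{u..v} \<in> J" using uv(3,4) unfolding J_def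
     by (intro CollectI exI[of _ u] exI[of _ v]) simp
    then show ?thesis using uv uv' by (intro bexI[of _ "{u..v}"]) auto
   qed
   have "m/2 > 0" using m by simp
   obtain D1 where D1: "D1 \<subseteq> J" "D1 division_of \<Union>D1" "m - m/2 < (\<Sum>k\<in>D1. Sup k - Inf k)"
    unfolding m_def
   proof (rule Vitali_division[OF Sm Tm \<open>m/2 > 0\<close>[unfolded m_def], of J])
    show "k \<subseteq> T \<and> (\<exists>u v. u < v \<and> k = {u..v})" if "k \<in> J" for k using that unfolding J_def by auto
   qed (use cov in blast)+
   have D1T: "\<Union>D1 \<subseteq> T" using D1(1) unfolding J_def by auto
   then have "\<Union>D1 \<subseteq> {a..b}" unfolding T_def
    using greaterThanLessThan_subseteq_atLeastAtMost_iff[of a b a b] by blast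
   moreover have "(\<Sum>k\<in>D1. Sup k - Inf k) < d" using sum_length_division_le[OF D1(2) D1T Tm] mT by simp
   ultimately have "(\<Sum>k\<in>D1. \<bar>F (Sup k) - F (Inf k)\<bar>) < 1" using D D1(2) by blast
   moreover have "(\<Sum>k\<in>D1. \<bar>F (Sup k) - F (Inf k)\<bar>) \<ge> (\<Sum>k\<in>D1. real N * (Sup k - Inf k))"
   proof (rule sum_mono)
    fix k assume "k \<in> D1"
    then obtain u v where "k = {u..v}" "u < v" "\<bar>F v - F u\<bar> > real N * (v - u)" using D1(1) unfolding J_def by blast
    then show "\<bar>F (Sup k) - F (Inf k)\<bar> \<ge> real N * (Sup k - Inf k)" by simp
   qed
   moreover have "(\<Sum>k\<in>D1. real N * (Sup k - Inf k)) \<ge> real N * (m/2)"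
    unfolding sum_distrib_left[symmetric] using D1(3) by (intro mult_left_mono) auto
   ultimately show False using N by simp
  qed
  then have "negligible (B \<inter> T)" using Sm negligible_iff_measure[of "B \<inter> T"] by (simp add: m_def)
  moreover have "x \<in> B \<inter> T" using \<open>x \<in> B\<close> Bsub d by (auto simp: T_def)
  ultimately show "\<exists>U. openin (top_of_set B) U \<and> x \<in> U \<and> negligible U"
   using T by (intro exI[of _ "B \<inter> T"]) (auto simp: openin_open)
 qed
qed

text \<open>Slopes are taken over intervals that contain the point in their interior. Outside
  countably many null sets the slopes are bounded and every pair of rationals \<open>p < q\<close>
  is decided: near the point the slopes are all at least \<open>p\<close> or all at most
  \<open>q\<close>. They therefore squeeze to a single number, and continuity passes from these
  intervals to those having the point as an endpoint.\<close>

theorem abs_continuous_on_differentiable_ae: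
 assumes F: "abs_continuous_on {a..b} F"
 obtains N where "negligible N" "\<And>x. x \<in> {a<..<b} - N \<Longrightarrow> F differentiable (at x)"
proof -
 define P where "P n u v \<longleftrightarrow> a \<le> u \<and> v \<le> b \<and> v - u < 1 / (real n + 1)" for n :: nat and u v
 define A where "A p q = {x. \<forall>n::nat. \<exists>u v. (P n u v \<and> F v - F u < p * (v - u)) \<and> u < x \<and> x < v}
   \<inter> {x. \<forall>n::nat. \<exists>u v. (P n u v \<and> F v - F u > q * (v - u)) \<and> u < x \<and> x < v}" for p q
 define B where "B = {x. \<forall>n::nat. \<exists>u v. (P n u v \<and> \<bar>F v - F u\<bar> > (real n + 1) * (v - u)) \<and> u < x \<and> x < v}"
 have nB: "negligible B"
  by (rule negligible_unbounded_slopes[OF F]) (simp add: B_def P_def conj_assoc)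
 have nA: "negligible (A p q)" if "p < q" for p q
 proof -
  \<comment> \<open>Tilting by the mean slope turns the thresholds \<open>p\<close> and
    \<open>q\<close> into the symmetric pair \<open>- (q-p)/2\<close> and
    \<open>(q-p)/2\<close>.\<close>
  have "abs_continuous_on {a..b} (\<lambda>x. F x - (p+q)/2 * x)"
   by (intro abs_continuous_on_diff F abs_continuous_on_cmult abs_continuous_on_id)
  then show ?thesis
  proof (rule negligible_oscillation)
   show "(q - p) / 2 > 0" using that by simp
   have pq: "(p+q)/2 - (q-p)/2 = p" "(p+q)/2 + (q-p)/2 = q" by (simp_all add: field_simps)
   have gen: "F v - c * v - (F u - c * u) < - r * (v - u) \<longleftrightarrow> F v - F u < (c - r) * (v - u)"
    "F v - c * v - (F u - c * u) > r * (v - u) \<longleftrightarrow> F v - F u > (c + r) * (v - u)" for c r u v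
    by (auto simp: algebra_simps)
   note e = gen[where c = "(p+q)/2" and r = "(q-p)/2", unfolded pq]
   show "A p q = {x. \<forall>n::nat. \<exists>u v. (a \<le> u \<and> v \<le> b \<and> v - u < 1 / (real n + 1) \<and>
      F v - (p+q)/2 * v - (F u - (p+q)/2 * u) < - ((q-p)/2) * (v - u)) \<and> u < x \<and> x < v}
     \<inter> {x. \<forall>n::nat. \<exists>u v. (a \<le> u \<and> v \<le> b \<and> v - u < 1 / (real n + 1) \<and>
      F v - (p+q)/2 * v - (F u - (p+q)/2 * u) > ((q-p)/2) * (v - u)) \<and> u < x \<and> x < v}"
    unfolding e A_def P_def conj_assoc ..
  qed
 qed
 define N where "N = B \<union> (\<Union>p\<in>\<rat>. \<Union>q\<in>{q\<in>\<rat>. p < q}. A p q)"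
 have "negligible N"
  unfolding N_def
 proof (intro negligible_Un nB)
  have "countable {(p, q). p \<in> \<rat> \<and> q \<in> \<rat> \<and> p < (q::real)}"
   by (rule countable_subset[of _ "\<rat> \<times> \<rat>"]) (auto intro: countable_rat)
  then have "negligible (\<Union>((\<lambda>(p, q). A p q) ` {(p, q). p \<in> \<rat> \<and> q \<in> \<rat> \<and> p < q}))"
   using nA by (intro negligible_countable_Union) auto
  then show "negligible (\<Union>p\<in>\<rat>. \<Union>q\<in>{q\<in>\<rat>. p < q}. A p q)"
   by (rule negligible_subset) auto
 qed
 moreover have "F differentiable (at x)" if x: "x \<in> {a<..<b} - N" for x
 proof -
  define W where "W d = {(u, v). a \<le> u \<and> u < x \<and> x < v \<and> v \<le> b \<and> v - u < d}" for d
  define low where "low p \<longleftrightarrow> (\<exists>d>0. \<forall>(u, v)\<in>W d. F v - F u \<ge> p * (v - u))" for p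
  define up where "up q \<longleftrightarrow> (\<exists>d>0. \<forall>(u, v)\<in>W d. F v - F u \<le> q * (v - u))" for q
  have WP: "P n u v \<and> u < x \<and> x < v \<longleftrightarrow> (u, v) \<in> W (1 / (real n + 1))" for n u v
   by (auto simp: W_def P_def)
  have "x \<notin> B" using x by (auto simp: N_def)
  then obtain n :: nat where n0: "\<not> (\<exists>u v. (P n u v \<and> \<bar>F v - F u\<bar> > (real n + 1) * (v - u)) \<and> u < x \<and> x < v)"
   unfolding B_def by blast
  have n: "\<bar>F v - F u\<bar> \<le> (real n + 1) * (v - u)" if "(u, v) \<in> W (1 / (real n + 1))" for u v
  proof (rule ccontr)
   assume "\<not> ?thesis"
   moreover have "P n u v" "u < x" "x < v" using that WP by blast+
   ultimately show False using n0 by fastforce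
  qed
  have lown: "low (- (real n + 1))" unfolding low_def
  proof (intro exI[of _ "1 / (real n + 1)"] conjI ballI, simp, clarify)
   fix u v assume "(u, v) \<in> W (1 / (real n + 1))"
   from n[OF this] show "- (real n + 1) * (v - u) \<le> F v - F u" by (simp add: abs_le_iff algebra_simps)
  qed
  have upn: "up (real n + 1)" unfolding up_def
  proof (intro exI[of _ "1 / (real n + 1)"] conjI ballI, simp, clarify)
   fix u v assume "(u, v) \<in> W (1 / (real n + 1))"
   from n[OF this] show "F v - F u \<le> (real n + 1) * (v - u)" by (simp add: abs_le_iff)
  qed
  have le: "p \<le> q" if "low p" "up q" for p q
  proof -
   obtain d1 where d1: "d1 > 0" "\<And>u v. (u, v) \<in> W d1 \<Longrightarrow> F v - F u \<ge> p * (v - u)" using \<open>low p\<close> unfolding low_def by blast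
   obtain d2 where d2: "d2 > 0" "\<And>u v. (u, v) \<in> W d2 \<Longrightarrow> F v - F u \<le> q * (v - u)" using \<open>up q\<close> unfolding up_def by blast
   define h where "h = min (min d1 d2 / 3) (min (x - a) (b - x))"
   have h: "h > 0" "2 * h < d1" "2 * h < d2" "h \<le> x - a" "h \<le> b - x"
    using d1(1) d2(1) x by (auto simp: h_def min_def)
   then have "(x - h, x + h) \<in> W d1" "(x - h, x + h) \<in> W d2" by (auto simp: W_def)
   then have "p * (2 * h) \<le> q * (2 * h)" using d1(2) d2(2) by fastforce
   then show ?thesis using h by simp
  qed
  have dich: "low p \<or> up q" if "p \<in> \<rat>" "q \<in> \<rat>" "p < q" for p q
  proof -
   have "x \<notin> A p q" using x that by (auto simp: N_def)
   then obtain n where "\<not> (\<exists>u v. (P n u v \<and> F v - F u < p * (v - u)) \<and> u < x \<and> x < v) \<or>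
     \<not> (\<exists>u v. (P n u v \<and> F v - F u > q * (v - u)) \<and> u < x \<and> x < v)"
    unfolding A_def by blast
   then consider "\<And>u v. (u, v) \<in> W (1 / (real n + 1)) \<Longrightarrow> F v - F u \<ge> p * (v - u)"
    | "\<And>u v. (u, v) \<in> W (1 / (real n + 1)) \<Longrightarrow> F v - F u \<le> q * (v - u)"
    using WP[of n] not_less by metis
   then show ?thesis
   proof cases
    case 1
    then have "low p" unfolding low_def by (intro exI[of _ "1 / (real n + 1)"]) auto
    then show ?thesis ..
   next
    case 2
    then have "up q" unfolding up_def by (intro exI[of _ "1 / (real n + 1)"]) auto
    then show ?thesis ..
   qed
  qed
  \<comment> \<open>The lower derivate at the point: the largest asymptotic lower bound of the
    slopes. It is finite because slopes are bounded near \<open>x\<close>.\<close>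
  define L where "L = Sup {p. low p}"
  have bdd: "bdd_above {p. low p}" using le[OF _ upn] by (auto simp: bdd_above_def)
  have slope: "\<exists>d>0. \<forall>(u, v)\<in>W d. \<bar>F v - F u - L * (v - u)\<bar> \<le> e * (v - u)" if "e > 0" for e
  proof -
   obtain p where p: "low p" "L - e < p"
    using less_cSup_iff[OF _ bdd, of "L - e"] lown \<open>e > 0\<close> unfolding L_def by auto
   \<comment> \<open>Since \<open>p1\<close> exceeds the supremum, \<open>low p1\<close> fails, and
     the dichotomy for \<open>p1 < q1\<close> then yields an upper bound within \<open>e\<close> of
     \<open>L\<close>.\<close>
   obtain p1 where p1: "p1 \<in> \<rat>" "L < p1" "p1 < L + e" using Rats_dense_in_real[of L "L + e"] \<open>e > 0\<close> by auto
   obtain q1 where q1: "q1 \<in> \<rat>" "p1 < q1" "q1 < L + e" using Rats_dense_in_real[of p1 "L + e"] p1 by auto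
   have "\<not> low p1" using cSup_upper[OF _ bdd, of p1] p1(2) by (auto simp: L_def)
   then have "up q1" using dich p1 q1 by blast
   obtain d1 where d1: "d1 > 0" "\<And>u v. (u, v) \<in> W d1 \<Longrightarrow> F v - F u \<ge> p * (v - u)" using p(1) unfolding low_def by blast
   obtain d2 where d2: "d2 > 0" "\<And>u v. (u, v) \<in> W d2 \<Longrightarrow> F v - F u \<le> q1 * (v - u)" using \<open>up q1\<close> unfolding up_def by blast
   show ?thesis
   proof (intro exI[of _ "min d1 d2"] conjI ballI, simp add: d1 d2, clarify)
    fix u v assume uv: "(u, v) \<in> W (min d1 d2)"
    then have "u < v" "(u, v) \<in> W d1" "(u, v) \<in> W d2" by (auto simp: W_def)
    then have "p * (v - u) \<le> F v - F u" "F v - F u \<le> q1 * (v - u)" using d1(2) d2(2) by blast+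
    moreover have "(L - e) * (v - u) \<le> p * (v - u)" "q1 * (v - u) \<le> (L + e) * (v - u)"
     using p q1 \<open>u < v\<close> by (auto intro!: mult_right_mono)
    ultimately show "\<bar>F v - F u - L * (v - u)\<bar> \<le> e * (v - u)" by (simp add: abs_le_iff algebra_simps)
   qed
  qed
  have cont: "isCont F x"
   using abs_continuous_on_imp_continuous[OF F] x by (simp add: continuous_on_interior interior_atLeastAtMost_real continuous_on_eq_continuous_within at_within_Icc_at)
  \<comment> \<open>For \<open>y\<close> on one side of \<open>x\<close> the other endpoint tends to
    \<open>x\<close> from the opposite side; the slope bound is preserved because \<open>F\<close>
    is continuous at \<open>x\<close>.\<close>
  have "(F has_derivative (\<lambda>h. L * h)) (at x)"
   unfolding has_derivative_at_alt
  proof (intro conjI bounded_linear_mult_right allI impI)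
   fix e :: real assume "e > 0"
   from slope[OF this] obtain d where d: "d > 0" "\<And>u v. (u, v) \<in> W d \<Longrightarrow> \<bar>F v - F u - L * (v - u)\<bar> \<le> e * (v - u)" by blast
   define r where "r = min d (min (x - a) (b - x))"
   have r: "r > 0" "r \<le> d" "r \<le> x - a" "r \<le> b - x" using d x by (auto simp: r_def)
   have "\<bar>F y - F x - L * (y - x)\<bar> \<le> e * \<bar>y - x\<bar>" if y: "\<bar>y - x\<bar> < r" for y
   proof (cases y x rule: linorder_cases)
    case equal then show ?thesis by simp
   next
    case greater
    have l1: "((\<lambda>u. \<bar>F y - F u - L * (y - u)\<bar>) \<longlongrightarrow> \<bar>F y - F x - L * (y - x)\<bar>) (at_left x)"
     by (intro tendsto_intros filterlim_at_split[THEN iffD1, THEN conjunct1] cont[unfolded isCont_def])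
    have l2: "((\<lambda>u. e * (y - u)) \<longlongrightarrow> e * (y - x)) (at_left x)" by (intro tendsto_intros)
    have l3: "\<forall>\<^sub>F u in at_left x. \<bar>F y - F u - L * (y - u)\<bar> \<le> e * (y - u)"
     unfolding eventually_at_left_field
    proof (intro exI[of _ "max a (y - d)"] conjI allI impI)
     show "max a (y - d) < x" using y r greater x by auto
     fix u assume "max a (y - d) < u" "u < x"
     then show "\<bar>F y - F u - L * (y - u)\<bar> \<le> e * (y - u)" using y r greater by (intro d(2)) (auto simp: W_def)
    qed
    have "\<bar>F y - F x - L * (y - x)\<bar> \<le> e * (y - x)"
     by (rule tendsto_le[OF trivial_limit_at_left_real l2 l1 l3])
    then show ?thesis using greater by simp
   next
    case less
    have l1: "((\<lambda>u. \<bar>F u - F y - L * (u - y)\<bar>) \<longlongrightarrow> \<bar>F x - F y - L * (x - y)\<bar>) (at_right x)"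
     by (intro tendsto_intros filterlim_at_split[THEN iffD1, THEN conjunct2] cont[unfolded isCont_def])
    have l2: "((\<lambda>u. e * (u - y)) \<longlongrightarrow> e * (x - y)) (at_right x)" by (intro tendsto_intros)
    have l3: "\<forall>\<^sub>F u in at_right x. \<bar>F u - F y - L * (u - y)\<bar> \<le> e * (u - y)"
     unfolding eventually_at_right_field
    proof (intro exI[of _ "min b (y + d)"] conjI allI impI)
     show "x < min b (y + d)" using y r less x by auto
     fix u assume "x < u" "u < min b (y + d)"
     then show "\<bar>F u - F y - L * (u - y)\<bar> \<le> e * (u - y)" using y r less by (intro d(2)) (auto simp: W_def)
    qed
    have "\<bar>F x - F y - L * (x - y)\<bar> \<le> e * (x - y)"
     by (rule tendsto_le[OF trivial_limit_at_right_real l2 l1 l3])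
    then show ?thesis using less by (simp add: abs_minus_commute algebra_simps) 
   qed
   then show "\<exists>d>0. \<forall>y. norm (y - x) < d \<longrightarrow> norm (F y - F x - L * (y - x)) \<le> e * norm (y - x)"
    using r(1) by auto
  qed
  then show ?thesis unfolding differentiable_def by blast
 qed
 ultimately show thesis using that by blast
qed

subsection \<open>Drivers of finite energy\<close>

lemma has_integral_ac:
 fixes F f :: "real \<Rightarrow> real"
 assumes F: "abs_continuous_on {a..b} F" and "a \<le> b" and N: "negligible N"
  and der: "\<And>x. x \<in> {a<..<b} - N \<Longrightarrow> (F has_real_derivative f x) (at x)"
 shows "(f has_integral F b - F a) {a..b}"
proof (rule has_integral_abs_continuous[OF F \<open>a \<le> b\<close>, of "N \<union> {a, b}"])
 show "negligible (N \<union> {a, b})" using N by (simp add: negligible_Un)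
 fix x assume "x \<in> {a..b} - (N \<union> {a, b})"
 then have "x \<in> {a<..<b} - N" by auto
 then show "(F has_real_derivative f x) (at x within {a..b})"
  using der has_field_derivative_at_within by blast
qed

lemma has_integral_Complex:
 assumes "(u has_integral a) S" "(v has_integral b) S"
 shows "((\<lambda>x. Complex (u x) (v x)) has_integral Complex a b) S"
proof -
 have "((\<lambda>x. of_real (u x) + \<i> * of_real (v x)) has_integral (of_real a + \<i> * of_real b)) S"
  by (intro has_integral_add has_integral_mult_right has_integral_of_real assms)
 then show ?thesis by (simp add: Complex_eq)
qed

lemma has_integral_ac_complex:
 fixes F f :: "real \<Rightarrow> complex"
 assumes "abs_continuous_on {a..b} (\<lambda>x. Re (F x))" "abs_continuous_on {a..b} (\<lambda>x. Im (F x))"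
  and "a \<le> b" and N: "negligible N"
  and der: "\<And>x. x \<in> {a<..<b} - N \<Longrightarrow> (F has_vector_derivative f x) (at x)"
 shows "(f has_integral F b - F a) {a..b}"
proof -
 have 1: "((\<lambda>x. Re (f x)) has_integral Re (F b) - Re (F a)) {a..b}"
 proof (rule has_integral_ac[OF assms(1) assms(3) N])
  fix x assume "x \<in> {a<..<b} - N"
  from der[OF this] show "((\<lambda>x. Re (F x)) has_real_derivative Re (f x)) (at x)"
   by (simp add: has_real_derivative_iff_has_vector_derivative has_vector_derivative_complex_iff)
 qed
 have 2: "((\<lambda>x. Im (f x)) has_integral Im (F b) - Im (F a)) {a..b}"
 proof (rule has_integral_ac[OF assms(2) assms(3) N])
  fix x assume "x \<in> {a<..<b} - N"
  from der[OF this] show "((\<lambda>x. Im (F x)) has_real_derivative Im (f x)) (at x)"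
   by (simp add: has_real_derivative_iff_has_vector_derivative has_vector_derivative_complex_iff)
 qed
 have "((\<lambda>x. Complex (Re (f x)) (Im (f x))) has_integral
     Complex (Re (F b) - Re (F a)) (Im (F b) - Im (F a))) {a..b}"
  by (rule has_integral_Complex[OF 1 2])
 moreover have "Complex (Re (F b) - Re (F a)) (Im (F b) - Im (F a)) = F b - F a" by (simp add: complex_eq_iff)
 ultimately show ?thesis by simp
qed

text \<open>The slope \<open>f\<close> is a parameter, so that it can be \<open>deriv \<xi>\<close>
  for an arbitrary competitor and an explicit formula for an extremal or a C1 driver.\<close>

definition finite_energy :: "real \<Rightarrow> (real \<Rightarrow> real) \<Rightarrow> (real \<Rightarrow> real) \<Rightarrow> bool" where
 "finite_energy \<tau> \<xi> f \<longleftrightarrow> abs_continuous_on {0..\<tau>} \<xi> \<and>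
   (\<exists>N. negligible N \<and> (\<forall>x\<in>{0<..<\<tau>} - N. (\<xi> has_real_derivative f x) (at x))) \<and>
   f absolutely_integrable_on {0..\<tau>} \<and> (\<lambda>t. (f t)^2) integrable_on {0..\<tau>}"

lemma driver_energy_eq:
 assumes "finite_energy \<tau> \<xi> f"
 shows "driver_energy \<tau> \<xi> = ennreal (integral {0..\<tau>} (\<lambda>t. (f t)^2) / 2)"
proof -
 obtain N where N: "negligible N" "\<And>x. x \<in> {0<..<\<tau>} - N \<Longrightarrow> (\<xi> has_real_derivative f x) (at x)"
  and ac: "abs_continuous_on {0..\<tau>} \<xi>" and i2: "(\<lambda>t. (f t)^2) integrable_on {0..\<tau>}"
  using assms unfolding finite_energy_def by blast
 define I where "I = integral {0..\<tau>} (\<lambda>t. (f t)^2)"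
 define h where "h t = (if t \<in> {0..\<tau>} then (f t)^2 else 0)" for t
 have "((\<lambda>t. (f t)^2) has_integral I) {0..\<tau>}" using i2 by (simp add: I_def has_integral_integral)
 then have "(h has_integral I) UNIV" unfolding h_def by (simp only: has_integral_restrict_UNIV)
 then have h: "integral\<^sup>N lebesgue h = ennreal I" "0 \<le> I"
  using has_integral_iff_nn_integral_lebesgue[of h I] by (auto simp: h_def)
 have "negligible (N \<union> {0, \<tau>})" using N by (simp add: negligible_Un)
 then have null: "N \<union> {0, \<tau>} \<in> null_sets lebesgue" by (simp add: negligible_iff_null_sets)
 have "(\<integral>\<^sup>+ t\<in>{0..\<tau>}. ennreal ((deriv \<xi> t)^2) \<partial>lebesgue) = integral\<^sup>N lebesgue h"
 proof (rule nn_integral_cong_AE)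
  have "AE t in lebesgue. t \<notin> N \<union> {0, \<tau>}" using null by (rule AE_not_in)
  then show "AE t in lebesgue. ennreal ((deriv \<xi> t)^2) * indicator {0..\<tau>} t = ennreal (h t)"
  proof (eventually_elim)
   case (elim t)
   show ?case
   proof (cases "t \<in> {0..\<tau>}")
    case True
    then have "t \<in> {0<..<\<tau>} - N" using elim by auto
    then have "deriv \<xi> t = f t" using N(2) DERIV_imp_deriv by blast
    then show ?thesis using True by (simp add: h_def)
   next
    case False
    then show ?thesis by (simp add: h_def indicator_def del: atLeastAtMost_iff)
   qed
  qed
 qed
 then show ?thesis using ac h unfolding driver_energy_def
  by (simp add: I_def[symmetric] divide_ennreal[symmetric])
qed

lemma finite_energyI:
 assumes ac: "abs_continuous_on {0..\<tau>} \<xi>" and "\<tau> > 0" and N: "negligible N"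
  and der: "\<And>x. x \<in> {0<..<\<tau>} - N \<Longrightarrow> (\<xi> has_real_derivative f x) (at x)"
  and fin: "(\<lambda>t. (f t)^2) integrable_on {0..\<tau>}"
 shows "finite_energy \<tau> \<xi> f"
proof -
 have "(f has_integral \<xi> \<tau> - \<xi> 0) {0..\<tau>}" using has_integral_ac[OF ac _ N der] \<open>\<tau> > 0\<close> by simp
 then have "f integrable_on {0..\<tau>}" by blast
 then have m: "f \<in> borel_measurable (lebesgue_on {0..\<tau>})" by (rule integrable_imp_measurable)
 have "f absolutely_integrable_on {0..\<tau>}"
 proof (rule measurable_bounded_by_integrable_imp_absolutely_integrable[OF m])
  \<comment> \<open>Square integrability dominates integrability on a bounded interval, by
    \<open>2 * \<bar>f\<bar> \<le> 1 + f^2\<close>.\<close>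
  show "(\<lambda>t. (1 + (f t)^2) / 2) integrable_on {0..\<tau>}"
   by (intro integrable_on_divide integrable_add fin integrable_const_ivl)
  show "norm (f t) \<le> (1 + (f t)^2) / 2" for t
   using sum_squares_bound[of 1 "\<bar>f t\<bar>"] by (simp add: power2_eq_square)
 qed simp
 then show ?thesis using assms unfolding finite_energy_def by blast
qed

text \<open>Finite energy rules out the infinite branch of the definition, so the driver is
  absolutely continuous and \<open>deriv \<xi>\<close> is its true derivative almost
  everywhere.\<close>

lemma driver_energy_finite:
 assumes "\<tau> > 0" and fin: "driver_energy \<tau> \<xi> < \<infinity>"
 shows "finite_energy \<tau> \<xi> (deriv \<xi>)"
proof -
 have ac: "abs_continuous_on {0..\<tau>} \<xi>" using fin unfolding driver_energy_def by (auto split: if_splits)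
 obtain N where N: "negligible N" "\<And>x. x \<in> {0<..<\<tau>} - N \<Longrightarrow> \<xi> differentiable (at x)"
  using abs_continuous_on_differentiable_ae[OF ac] by blast
 have der: "(\<xi> has_real_derivative deriv \<xi> x) (at x)" if "x \<in> {0<..<\<tau>} - N" for x
  using N(2)[OF that] by (simp add: DERIV_deriv_iff_real_differentiable)
 show ?thesis
 proof (rule finite_energyI[OF ac \<open>\<tau> > 0\<close> N(1) der])
  \<comment> \<open>Possessing an integral is what makes \<open>deriv \<xi>\<close> measurable, so
    that the nonnegative Lebesgue integral of its square can be turned into a gauge
    integral.\<close>
  have "(deriv \<xi> has_integral \<xi> \<tau> - \<xi> 0) {0..\<tau>}" using has_integral_ac[OF ac _ N(1) der] \<open>\<tau> > 0\<close> by simp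
  from has_integral_implies_lebesgue_measurable_real[OF this]
  have m: "(\<lambda>x. deriv \<xi> x * indicator {0..\<tau>} x) \<in> lebesgue \<rightarrow>\<^sub>M borel" .
  define h where "h t = (deriv \<xi> t * indicator {0..\<tau>} t)^2" for t
  have hm: "h \<in> lebesgue \<rightarrow>\<^sub>M borel" unfolding h_def using m by (intro borel_measurable_power)
  have "integral\<^sup>N lebesgue h = (\<integral>\<^sup>+ t\<in>{0..\<tau>}. ennreal ((deriv \<xi> t)^2) \<partial>lebesgue)"
   by (rule nn_integral_cong) (simp add: h_def indicator_def)
  also have "\<dots> < \<infinity>"
   using fin ac unfolding driver_energy_def by (auto simp: ennreal_divide_eq_top_iff simp flip: top.not_eq_extremum)
  finally obtain r where "integral\<^sup>N lebesgue h = ennreal r" "0 \<le> r"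
   by (cases "integral\<^sup>N lebesgue h") auto
  then have "(h has_integral r) UNIV" using has_integral_iff_nn_integral_lebesgue[of h r] hm by (simp add: h_def)
  moreover have "h = (\<lambda>t. if t \<in> {0..\<tau>} then (deriv \<xi> t)^2 else 0)" by (auto simp: h_def)
  ultimately have "((\<lambda>t. (deriv \<xi> t)^2) has_integral r) {0..\<tau>}" by (simp only: has_integral_restrict_UNIV)
  then show "(\<lambda>t. (deriv \<xi> t)^2) integrable_on {0..\<tau>}" by blast
 qed
qed

text \<open>Cauchy-Schwarz against the constant 1, read off from the nonnegative integral of
  \<open>(\<bar>f\<bar> - x)^2\<close> where \<open>x\<close> is the mean of
  \<open>\<bar>f\<bar>\<close>.\<close>

lemma integral_abs_square_le:
 fixes f :: "real \<Rightarrow> real"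
 assumes f: "f absolutely_integrable_on {a..b}" and f2: "(\<lambda>t. (f t)^2) integrable_on {a..b}" and "a \<le> b"
 shows "(integral {a..b} (\<lambda>t. \<bar>f t\<bar>))^2 \<le> (b - a) * integral {a..b} (\<lambda>t. (f t)^2)"
proof (cases "a = b")
 case False
 then have "a < b" using \<open>a \<le> b\<close> by simp
 define A where "A = integral {a..b} (\<lambda>t. \<bar>f t\<bar>)"
 define E where "E = integral {a..b} (\<lambda>t. (f t)^2)"
 define x where "x = A / (b - a)"
 have fa: "((\<lambda>t. \<bar>f t\<bar>) has_integral A) {a..b}" unfolding A_def
  by (intro integrable_integral set_lebesgue_integral_eq_integral(1) set_integrable_abs f)
 have fe: "((\<lambda>t. (f t)^2) has_integral E) {a..b}" using f2 by (simp add: E_def has_integral_integral)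
 have "((\<lambda>t. x^2) has_integral (b - a) * x^2) {a..b}"
  using has_integral_const_real[of "x^2" a b] \<open>a < b\<close> by simp
 from has_integral_add[OF has_integral_diff[OF fe has_integral_mult_right[OF fa, of "2 * x"]] this]
 have "((\<lambda>t. (\<bar>f t\<bar> - x)^2) has_integral E - 2 * x * A + (b - a) * x^2) {a..b}"
  by (simp add: power2_diff algebra_simps)
 then have "0 \<le> E - 2 * x * A + (b - a) * x^2" by (rule has_integral_nonneg) simp
 also have "(b - a) * x^2 = x * A" using \<open>a < b\<close> by (simp add: x_def power2_eq_square)
 finally have "A * A / (b - a) \<le> E" by (simp add: x_def)
 then show ?thesis using \<open>a < b\<close> by (simp add: A_def E_def power2_eq_square pos_divide_le_eq mult.commute)
qed simp

lemma finite_energy_subinterval: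
 assumes "finite_energy \<tau> \<xi> f" "{a..b} \<subseteq> {0..\<tau>}"
 shows "f absolutely_integrable_on {a..b}" "(\<lambda>t. (f t)^2) integrable_on {a..b}" "abs_continuous_on {a..b} \<xi>"
proof -
 have f: "f absolutely_integrable_on {0..\<tau>}" "(\<lambda>t. (f t)^2) integrable_on {0..\<tau>}" "abs_continuous_on {0..\<tau>} \<xi>"
  using assms(1) unfolding finite_energy_def by simp_all
 show "f absolutely_integrable_on {a..b}" by (rule absolutely_integrable_on_subinterval[OF f(1) assms(2)])
 show "(\<lambda>t. (f t)^2) integrable_on {a..b}" by (rule integrable_on_subinterval[OF f(2) assms(2)])
 show "abs_continuous_on {a..b} \<xi>" by (rule abs_continuous_on_subset[OF f(3) assms(2)])
qed

text \<open>Twice the energy left after time \<open>t\<close>: the factor 1/2 is left out, which is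
  why halves of it appear in the energy bounds.\<close>

definition remaining_energy :: "real \<Rightarrow> (real \<Rightarrow> real) \<Rightarrow> real \<Rightarrow> real" where
 "remaining_energy \<tau> f t = integral {t..\<tau>} (\<lambda>s. (f s)^2)"

lemma remaining_energy_nonneg: "remaining_energy \<tau> f t \<ge> 0"
 unfolding remaining_energy_def
 by (cases "(\<lambda>s. (f s)^2) integrable_on {t..\<tau>}") (auto intro: integral_nonneg simp: not_integrable_integral)

lemma remaining_energy_split:
 assumes "finite_energy \<tau> \<xi> f" "0 \<le> t" "t \<le> \<tau>"
 shows "integral {0..t} (\<lambda>s. (f s)^2) + remaining_energy \<tau> f t = remaining_energy \<tau> f 0"
 using assms Henstock_Kurzweil_Integration.integral_combine[of 0 t \<tau> "\<lambda>s. (f s)^2"]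
 unfolding remaining_energy_def finite_energy_def by auto

lemma remaining_energy_tendsto_0:
 assumes fe: "finite_energy \<tau> \<xi> f" and "\<tau> > 0"
 shows "(remaining_energy \<tau> f \<longlongrightarrow> 0) (at_left \<tau>)"
proof -
 have "continuous_on {0..\<tau>} (\<lambda>t. integral {0..t} (\<lambda>s. (f s)^2))"
  using fe unfolding finite_energy_def by (intro indefinite_integral_continuous_1) auto
 then have "((\<lambda>t. integral {0..t} (\<lambda>s. (f s)^2)) \<longlongrightarrow> remaining_energy \<tau> f 0) (at \<tau> within {0..\<tau>})"
  using \<open>\<tau> > 0\<close> unfolding continuous_on_def remaining_energy_def by simp
 then have "((\<lambda>t. integral {0..t} (\<lambda>s. (f s)^2)) \<longlongrightarrow> remaining_energy \<tau> f 0) (at_left \<tau>)"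
  using \<open>\<tau> > 0\<close> by (simp add: at_within_Icc_at_left)
 then have "((\<lambda>t. remaining_energy \<tau> f 0 - integral {0..t} (\<lambda>s. (f s)^2))
   \<longlongrightarrow> remaining_energy \<tau> f 0 - remaining_energy \<tau> f 0) (at_left \<tau>)"
  by (intro tendsto_diff tendsto_const)
 then have "((\<lambda>t. remaining_energy \<tau> f 0 - integral {0..t} (\<lambda>s. (f s)^2)) \<longlongrightarrow> 0) (at_left \<tau>)" by simp
 moreover have "\<forall>\<^sub>F t in at_left \<tau>. remaining_energy \<tau> f 0 - integral {0..t} (\<lambda>s. (f s)^2) = remaining_energy \<tau> f t"
  using eventually_at_left_real[OF \<open>\<tau> > 0\<close>]
  by eventually_elim (use remaining_energy_split[OF fe] in \<open>auto simp: algebra_simps\<close>)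
 ultimately show ?thesis by (rule Lim_transform_eventually)
qed

text \<open>Cauchy-Schwarz on the whole remaining interval makes the bound uniform in
  \<open>t'\<close>, so it survives letting \<open>t'\<close> tend to \<tau>.\<close>

lemma integral_abs_le_remaining:
 assumes fe: "finite_energy \<tau> \<xi> f" and "0 \<le> t" "t \<le> t'" "t' \<le> \<tau>"
 shows "integral {t..t'} (\<lambda>s. \<bar>f s\<bar>) \<le> sqrt (\<tau> - t) * sqrt (remaining_energy \<tau> f t)"
proof -
 have sub: "{t..\<tau>} \<subseteq> {0..\<tau>}" "{t..t'} \<subseteq> {t..\<tau>}" using assms by auto
 note f = finite_energy_subinterval[OF fe sub(1)]
 have fa: "(\<lambda>s. \<bar>f s\<bar>) integrable_on {t..\<tau>}" by (rule set_lebesgue_integral_eq_integral(1)[OF set_integrable_abs[OF f(1)]])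
 have "integral {t..t'} (\<lambda>s. \<bar>f s\<bar>) \<le> integral {t..\<tau>} (\<lambda>s. \<bar>f s\<bar>)"
  using fa sub(2) integrable_on_subinterval[OF fa sub(2)] by (intro integral_subset_le) auto
 also have "\<dots> \<le> sqrt ((\<tau> - t) * remaining_energy \<tau> f t)"
  using integral_abs_square_le[OF f(1,2)] assms unfolding remaining_energy_def by (intro real_le_rsqrt) auto
 finally show ?thesis by (simp add: real_sqrt_mult)
qed

text \<open>Completing the square in the energy density: \<open>\<phi>\<close> is the energy still to be spent, and
 spending it optimally means following the feedback law \<open>f = k\<close>.\<close>

lemma
 assumes fe: "finite_energy \<tau> \<xi> f" and \<tau>: "\<tau> > 0"
  and ac: "\<And>t. t \<in> {0..<\<tau>} \<Longrightarrow> abs_continuous_on {0..t} \<phi>"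
  and N: "negligible N"
  and der: "\<And>t. t \<in> {0<..<\<tau>} - N \<Longrightarrow> (\<phi> has_real_derivative (f t - k t)^2 / 2 - (f t)^2 / 2) (at t)"
  and lim: "(\<phi> \<longlongrightarrow> 0) (at_left \<tau>)"
  and k: "continuous_on {0..<\<tau>} k"
 shows completing_square_le: "\<phi> 0 \<le> remaining_energy \<tau> f 0 / 2"
  and completing_square_eqD: "\<phi> 0 = remaining_energy \<tau> f 0 / 2 \<Longrightarrow> t \<in> {0..<\<tau>} \<Longrightarrow> \<xi> t - \<xi> 0 = integral {0..t} k"
  and completing_square_eqI: "(\<And>t. t \<in> {0<..<\<tau>} - N \<Longrightarrow> f t = k t) \<Longrightarrow> \<phi> 0 = remaining_energy \<tau> f 0 / 2"
proof -
 \<comment> \<open>The squared distance of the slope from the feedback law. Integrating the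
   derivative of \<phi> evaluates it as twice the increase of \<phi> plus the energy spent so
   far.\<close>
 define G where "G t = integral {0..t} (\<lambda>s. (f s - k s)^2)" for t
 have G: "((\<lambda>s. (f s - k s)^2) has_integral G t) {0..t}" "G t = 2 * (\<phi> t - \<phi> 0) + (remaining_energy \<tau> f 0 - remaining_energy \<tau> f t)"
  if t: "t \<in> {0..<\<tau>}" for t
 proof -
  have "((\<lambda>s. (f s - k s)^2 / 2 - (f s)^2 / 2) has_integral \<phi> t - \<phi> 0) {0..t}"
   using t der by (intro has_integral_ac[OF ac[OF t] _ N]) auto
  moreover have "((\<lambda>s. (f s)^2) has_integral (remaining_energy \<tau> f 0 - remaining_energy \<tau> f t)) {0..t}"
   using remaining_energy_split[OF fe, of t] finite_energy_subinterval(2)[OF fe, of 0 t] t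
   by (auto simp: has_integral_iff)
  ultimately have "((\<lambda>s. 2 * ((f s - k s)^2 / 2 - (f s)^2 / 2) + (f s)^2) has_integral
    2 * (\<phi> t - \<phi> 0) + (remaining_energy \<tau> f 0 - remaining_energy \<tau> f t)) {0..t}"
   by (intro has_integral_add has_integral_mult_right)
  then have *: "((\<lambda>s. (f s - k s)^2) has_integral 2 * (\<phi> t - \<phi> 0) + (remaining_energy \<tau> f 0 - remaining_energy \<tau> f t)) {0..t}"
   by simp
  then show "G t = 2 * (\<phi> t - \<phi> 0) + (remaining_energy \<tau> f 0 - remaining_energy \<tau> f t)"
   unfolding G_def by (rule integral_unique)
  with * show "((\<lambda>s. (f s - k s)^2) has_integral G t) {0..t}" by simp
 qed
 have Gnn: "G t \<ge> 0" if "t \<in> {0..<\<tau>}" for t using has_integral_nonneg[OF G(1)[OF that]] by simp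
 have ev: "\<forall>\<^sub>F t in at_left \<tau>. t \<in> {0<..<\<tau>}" using \<tau> by (rule eventually_at_left_real)
 have "((\<lambda>t. 2 * (\<phi> t - \<phi> 0) + (remaining_energy \<tau> f 0 - remaining_energy \<tau> f t))
   \<longlongrightarrow> 2 * (0 - \<phi> 0) + (remaining_energy \<tau> f 0 - 0)) (at_left \<tau>)"
  by (intro tendsto_intros lim remaining_energy_tendsto_0[OF fe \<tau>])
 moreover have "\<forall>\<^sub>F t in at_left \<tau>. 2 * (\<phi> t - \<phi> 0) + (remaining_energy \<tau> f 0 - remaining_energy \<tau> f t) = G t"
  using ev by eventually_elim (use G(2) in auto)
 ultimately have "(G \<longlongrightarrow> 2 * (0 - \<phi> 0) + (remaining_energy \<tau> f 0 - 0)) (at_left \<tau>)"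
  by (rule Lim_transform_eventually)
 then have Glim: "(G \<longlongrightarrow> remaining_energy \<tau> f 0 - 2 * \<phi> 0) (at_left \<tau>)" by simp
 have "0 \<le> remaining_energy \<tau> f 0 - 2 * \<phi> 0"
  by (rule tendsto_lowerbound[OF Glim _ trivial_limit_at_left_real]) (use ev Gnn in \<open>auto elim: eventually_mono\<close>)
 then show "\<phi> 0 \<le> remaining_energy \<tau> f 0 / 2" by simp
 show "\<xi> t - \<xi> 0 = integral {0..t} k" if eq: "\<phi> 0 = remaining_energy \<tau> f 0 / 2" and t: "t \<in> {0..<\<tau>}"
 proof -
  \<comment> \<open>\<open>G\<close> is nondecreasing, so its limit bounds it; in the case of
    equality that limit is 0 and \<open>G\<close> vanishes.\<close>
  have "G t \<le> remaining_energy \<tau> f 0 - 2 * \<phi> 0"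
  proof (rule tendsto_lowerbound[OF Glim _ trivial_limit_at_left_real])
   have "\<forall>\<^sub>F s in at_left \<tau>. s \<in> {t<..<\<tau>}" using t by (intro eventually_at_left_real) simp
   then show "\<forall>\<^sub>F s in at_left \<tau>. G t \<le> G s"
   proof eventually_elim
    case (elim s)
    then have "s \<in> {0..<\<tau>}" using t by auto
    then show ?case using G(1)[OF t] G(1)[of s] elim t
     by (intro has_integral_subset_le[of "{0..t}" "{0..s}"]) auto
   qed
  qed
  then have G0: "G t = 0" using eq Gnn[OF t] by simp
  have sub: "{0..t} \<subseteq> {0..\<tau>}" using t by auto
  have ki: "k absolutely_integrable_on {0..t}"
   using t by (intro absolutely_integrable_continuous_real continuous_on_subset[OF k]) auto
  have fi: "f absolutely_integrable_on {0..t}" by (rule finite_energy_subinterval(1)[OF fe sub])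
  \<comment> \<open>Vanishing square distance gives vanishing distance in the mean, so
    \<open>f\<close> and \<open>k\<close> have the same integrals although equality is only known
    almost everywhere.\<close>
  have "(integral {0..t} (\<lambda>s. \<bar>f s - k s\<bar>))^2 \<le> (t - 0) * integral {0..t} (\<lambda>s. (f s - k s)^2)"
   using G(1)[OF t] t by (intro integral_abs_square_le set_integral_diff fi ki) auto
  then have "integral {0..t} (\<lambda>s. \<bar>f s - k s\<bar>) = 0" using G0 by (simp add: G_def)
  moreover have "norm (integral {0..t} (\<lambda>s. f s - k s)) \<le> integral {0..t} (\<lambda>s. norm (f s - k s))"
  proof (rule Henstock_Kurzweil_Integration.integral_norm_bound_integral)
   have fk: "(\<lambda>s. f s - k s) absolutely_integrable_on {0..t}" by (rule set_integral_diff(1)[OF fi ki])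
   then show "(\<lambda>s. f s - k s) integrable_on {0..t}" by (rule set_lebesgue_integral_eq_integral(1))
   show "(\<lambda>s. norm (f s - k s)) integrable_on {0..t}"
    by (rule set_lebesgue_integral_eq_integral(1)[OF absolutely_integrable_norm[OF fk, unfolded o_def]])
  qed simp
  ultimately have "integral {0..t} (\<lambda>s. f s - k s) = 0" by simp
  then have "integral {0..t} f = integral {0..t} k"
   using fi ki by (simp add: Henstock_Kurzweil_Integration.integral_diff set_lebesgue_integral_eq_integral(1))
  moreover have "(f has_integral \<xi> t - \<xi> 0) {0..t}"
  proof -
   obtain N' where N': "negligible N'" "\<And>x. x \<in> {0<..<\<tau>} - N' \<Longrightarrow> (\<xi> has_real_derivative f x) (at x)"
    using fe unfolding finite_energy_def by blast
   show ?thesis using t N' by (intro has_integral_ac[OF finite_energy_subinterval(3)[OF fe sub] _ N'(1)]) auto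
  qed
  ultimately show ?thesis by (simp add: integral_unique)
 qed
 show "\<phi> 0 = remaining_energy \<tau> f 0 / 2" if fk: "\<And>t. t \<in> {0<..<\<tau>} - N \<Longrightarrow> f t = k t"
 proof -
  have "G t = 0" if t: "t \<in> {0<..<\<tau>}" for t
  proof -
   have "((\<lambda>s. (f s - k s)^2) has_integral 0) {0..t}"
   proof (rule has_integral_spike[of "N \<union> {0}"])
    show "negligible (N \<union> {0})" using N by (simp add: negligible_Un)
    show "((\<lambda>s. 0::real) has_integral 0) {0..t}" by simp
    fix s assume "s \<in> {0..t} - (N \<union> {0})"
    then have "s \<in> {0<..<\<tau>} - N" using t by auto
    then show "(f s - k s)^2 = 0" using fk by simp
   qed
   then show ?thesis unfolding G_def by (rule integral_unique)
  qed
  then have "\<forall>\<^sub>F t in at_left \<tau>. 0 = G t" using ev by (auto elim: eventually_mono)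
  then have "(G \<longlongrightarrow> 0) (at_left \<tau>)" by (rule Lim_transform_eventually[OF tendsto_const])
  with Glim have "remaining_energy \<tau> f 0 - 2 * \<phi> 0 = 0" by (rule tendsto_unique[OF trivial_limit_at_left_real])
  then show ?thesis by simp
 qed
qed

text \<open>\<open>P\<close> is the square of the distance process, with modulus \<open>W\<^sup>2\<close>; the estimate says that \<open>W\<close>
 behaves like \<open>2 * sqrt (\<tau> - t)\<close> close to the absorption time.\<close>

lemma
 fixes P :: "real \<Rightarrow> complex"
 assumes fe: "finite_energy \<tau> \<xi> f" and t: "0 \<le> t" "t < \<tau>"
  and W: "\<And>s. s \<in> {t..<\<tau>} \<Longrightarrow> W s \<ge> 0" "continuous_on {t..<\<tau>} W" "(W \<longlongrightarrow> 0) (at_left \<tau>)"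
  and P: "\<And>s. s \<in> {t..<\<tau>} \<Longrightarrow> cmod (P s) = (W s)^2"
  and est: "\<And>s s' M. s \<in> {t..<\<tau>} \<Longrightarrow> s' \<in> {s..<\<tau>} \<Longrightarrow> (\<And>r. r \<in> {s..s'} \<Longrightarrow> W r \<le> M) \<Longrightarrow>
    cmod (P s - P s' + 4 * of_real (s' - s)) \<le> 2 * M * integral {s..s'} (\<lambda>r. \<bar>f r\<bar>)"
 shows tip_modulus_le: "W t \<le> (2 + 2 * sqrt (remaining_energy \<tau> f t)) * sqrt (\<tau> - t)"
  and tip_square_le: "cmod (P t + 4 * of_real (\<tau> - t)) \<le>
    2 * (2 + 2 * sqrt (remaining_energy \<tau> f t)) * sqrt (remaining_energy \<tau> f t) * (\<tau> - t)"
proof -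
 define E where "E = sqrt (remaining_energy \<tau> f t)"
 define \<sigma> where "\<sigma> = sqrt (\<tau> - t)"
 have E: "E \<ge> 0" and \<sigma>: "\<sigma> > 0" "\<sigma>^2 = \<tau> - t" using t by (auto simp: E_def \<sigma>_def remaining_energy_nonneg)
 \<comment> \<open>Extending \<open>W\<close> by its limit 0 at \<tau> makes the interval compact,
   so that a maximum is attained.\<close>
 define V where "V s = (if s = \<tau> then 0 else W s)" for s
 have "continuous_on {t..\<tau>} V"
  unfolding continuous_on_def
 proof
  fix s assume s: "s \<in> {t..\<tau>}"
  show "(V \<longlongrightarrow> V s) (at s within {t..\<tau>})"
  proof (cases "s = \<tau>")
   case True
   have "(V \<longlongrightarrow> 0) (at_left \<tau>)"
    using W(3) by (rule Lim_transform_eventually) (auto simp: V_def eventually_at_filter)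
   then show ?thesis using True t by (simp add: V_def at_within_Icc_at_left)
  next
   case False
   then have s': "s \<in> {t..<\<tau>}" using s by auto
   then have "(W \<longlongrightarrow> W s) (at s within {t..<\<tau>})" using W(2) by (auto simp: continuous_on_def)
   moreover have "at s within {t..\<tau>} = at s within {t..<\<tau>}"
    using s' by (intro at_within_nhd[of s "{..<\<tau>}"]) auto
   ultimately have "(W \<longlongrightarrow> W s) (at s within {t..\<tau>})" by simp
   moreover have "\<forall>\<^sub>F r in at s within {t..\<tau>}. W r = V r"
    using s' eventually_at_topological[of "\<lambda>r. W r = V r" s "{t..\<tau>}"] by (auto simp: V_def intro!: exI[of _ "{..<\<tau>}"])
   ultimately have "(V \<longlongrightarrow> W s) (at s within {t..\<tau>})" by (rule Lim_transform_eventually)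
   then show ?thesis using False by (simp add: V_def)
  qed
 qed
 then obtain s0 where s0: "s0 \<in> {t..\<tau>}" "\<And>s. s \<in> {t..\<tau>} \<Longrightarrow> V s \<le> V s0"
  using continuous_attains_sup[of "{t..\<tau>}" V] t by fastforce
 define M where "M = V s0"
 have WM: "W s \<le> M" if "s \<in> {t..<\<tau>}" for s using s0(2)[of s] that by (auto simp: V_def M_def)
 have M: "M \<ge> 0" using WM[of t] W(1)[of t] t by auto
 \<comment> \<open>The increment estimate with \<open>s'\<close> sent to \<tau>, where
   \<open>P\<close> disappears; the remaining factors are frozen at their values at
   \<open>t\<close>.\<close>
 have key: "cmod (P s + 4 * of_real (\<tau> - s)) \<le> 2 * M * (\<sigma> * E)" if s: "s \<in> {t..<\<tau>}" for s
 proof -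
  have "((\<lambda>s'. cmod (P s')) \<longlongrightarrow> 0^2) (at_left \<tau>)"
  proof (rule Lim_transform_eventually)
   show "((\<lambda>s'. (W s')^2) \<longlongrightarrow> 0^2) (at_left \<tau>)" by (intro tendsto_intros W(3))
   show "\<forall>\<^sub>F s' in at_left \<tau>. (W s')^2 = cmod (P s')"
    using eventually_at_left_real[OF t(2)] by eventually_elim (use P in auto)
  qed
  then have "(P \<longlongrightarrow> 0) (at_left \<tau>)" by (simp add: tendsto_norm_zero_iff)
  then have "((\<lambda>s'. cmod (P s - P s' + 4 * of_real (s' - s))) \<longlongrightarrow> cmod (P s - 0 + 4 * of_real (\<tau> - s))) (at_left \<tau>)"
   by (intro tendsto_intros)
  moreover have "\<forall>\<^sub>F s' in at_left \<tau>. cmod (P s - P s' + 4 * of_real (s' - s)) \<le> 2 * M * (\<sigma> * E)"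
  proof -
   have "\<forall>\<^sub>F s' in at_left \<tau>. s' \<in> {s<..<\<tau>}" using s by (intro eventually_at_left_real) simp
   then show ?thesis
   proof eventually_elim
    case (elim s')
    have "cmod (P s - P s' + 4 * of_real (s' - s)) \<le> 2 * M * integral {s..s'} (\<lambda>r. \<bar>f r\<bar>)"
     using s elim WM by (intro est) auto
    also have "\<dots> \<le> 2 * M * (sqrt (\<tau> - s) * sqrt (remaining_energy \<tau> f s))"
     using M s elim t by (intro mult_left_mono integral_abs_le_remaining[OF fe]) auto
    also have "\<dots> \<le> 2 * M * (\<sigma> * E)"
    proof -
     have "remaining_energy \<tau> f s \<le> remaining_energy \<tau> f t" unfolding remaining_energy_def
      using s t by (intro integral_subset_le finite_energy_subinterval(2)[OF fe]) auto
     then show ?thesis using M s t unfolding \<sigma>_def E_def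
      by (intro mult_left_mono mult_mono) (auto simp: remaining_energy_nonneg)
    qed
    finally show ?case .
   qed
  qed
  ultimately have "cmod (P s - 0 + 4 * of_real (\<tau> - s)) \<le> 2 * M * (\<sigma> * E)"
   by (rule tendsto_upperbound[OF _ _ trivial_limit_at_left_real])
  then show ?thesis by simp
 qed
 \<comment> \<open>At a maximum point the key estimate is a quadratic inequality,
   \<open>M^2 \<le> 2 * M * (\<sigma> * E) + 4 * \<sigma>^2\<close>, which confines \<open>M\<close>
   to the order of \<sigma>.\<close>
 have M2: "M \<le> (2 + 2 * E) * \<sigma>"
 proof (cases "s0 = \<tau>")
  case True
  then have "M = 0" by (simp add: M_def V_def)
  then show ?thesis using E \<sigma> by simp
 next
  case False
  then have s: "s0 \<in> {t..<\<tau>}" "M = W s0" using s0 by (auto simp: M_def V_def)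
  have "M^2 = cmod (P s0)" using P s by simp
  also have "\<dots> \<le> cmod (P s0 + 4 * of_real (\<tau> - s0)) + cmod (4 * of_real (\<tau> - s0))"
   using norm_triangle_ineq4[of "P s0 + 4 * of_real (\<tau> - s0)" "4 * of_real (\<tau> - s0)"] by simp
  also have "cmod (4 * of_real (\<tau> - s0)) \<le> 4 * \<sigma>^2" using s(1) \<sigma> by (simp add: norm_mult del: of_real_diff)
  finally have le: "M^2 \<le> 2 * M * (\<sigma> * E) + 4 * \<sigma>^2" using key[OF s(1)] by simp
  show ?thesis
  proof (rule ccontr)
   assume "\<not> ?thesis"
   then have gt: "M > (2 + 2 * E) * \<sigma>" by simp
   have pos: "(2 + 2 * E) * \<sigma> > 0" using E \<sigma> by simp
   have "M * ((2 + 2 * E) * \<sigma>) < M * M" using gt pos by (intro mult_strict_left_mono) auto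
   moreover have "2 * \<sigma> * (2 * \<sigma>) \<le> M * (2 * \<sigma>)"
   proof (rule mult_right_mono)
    have "2 * \<sigma> \<le> (2 + 2 * E) * \<sigma>" using E \<sigma> by simp
    then show "2 * \<sigma> \<le> M" using gt by simp
   qed (use \<sigma> in simp)
   ultimately show False using le by (simp add: power2_eq_square algebra_simps)
  qed
 qed
 show "W t \<le> (2 + 2 * sqrt (remaining_energy \<tau> f t)) * sqrt (\<tau> - t)"
  using WM[of t] t M2 by (simp add: E_def \<sigma>_def)
 have "cmod (P t + 4 * of_real (\<tau> - t)) \<le> 2 * M * (\<sigma> * E)" using key[of t] t by simp
 also have "\<dots> \<le> 2 * ((2 + 2 * E) * \<sigma>) * (\<sigma> * E)"
  using M2 E \<sigma> by (intro mult_right_mono mult_left_mono) auto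
 also have "\<dots> = 2 * (2 + 2 * E) * E * \<sigma>^2" by (simp add: power2_eq_square)
 finally show "cmod (P t + 4 * of_real (\<tau> - t)) \<le>
    2 * (2 + 2 * sqrt (remaining_energy \<tau> f t)) * sqrt (remaining_energy \<tau> f t) * (\<tau> - t)"
  using \<sigma>(2) by (simp add: E_def)
qed

subsection \<open>Trajectories and their tips\<close>

text \<open>One equation covers both flows: \<open>\<kappa> = 1\<close> is the downwards flow, and multiplying the real
 upwards flow by \<open>\<i>\<close> gives the cases \<open>\<kappa> = \<plusminus>\<i>\<close>.\<close>

definition driven_path :: "complex \<Rightarrow> real \<Rightarrow> (real \<Rightarrow> real) \<Rightarrow> (real \<Rightarrow> complex) \<Rightarrow> bool" where
 "driven_path \<kappa> \<tau> \<xi> G \<longleftrightarrow> (\<forall>t\<in>{0..<\<tau>}. G t - \<kappa> * of_real (\<xi> t) \<noteq> 0 \<and>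
   (G has_vector_derivative 2 / (G t - \<kappa> * of_real (\<xi> t))) (at t within {0..<\<tau>}))"

lemma driven_path_derivative:
 assumes "driven_path \<kappa> \<tau> \<xi> G" "t \<in> {0<..<\<tau>}"
 shows "(G has_vector_derivative 2 / (G t - \<kappa> * of_real (\<xi> t))) (at t)"
proof -
 have "(G has_vector_derivative 2 / (G t - \<kappa> * of_real (\<xi> t))) (at t within {0..<\<tau>})"
  using assms unfolding driven_path_def by auto
 moreover have "at t within {0..<\<tau>} = at t"
  using assms(2) by (intro at_within_interior) simp
 ultimately show ?thesis by simp
qed

lemma driven_path_continuous:
 assumes "driven_path \<kappa> \<tau> \<xi> G"
 shows "continuous_on {0..<\<tau>} G"
 unfolding continuous_on_eq_continuous_within
 using assms unfolding driven_path_def by (blast intro: has_vector_derivative_continuous)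

lemma finite_energy_continuous: "finite_energy \<tau> \<xi> f \<Longrightarrow> continuous_on {0..\<tau>} \<xi>"
 unfolding finite_energy_def by (intro abs_continuous_on_imp_continuous) simp

text \<open>Only the driver is rough: on a compact interval before \<tau> the vector field is
  bounded, so \<open>G\<close> is Lipschitz there and the difference inherits absolute continuity
  from \<xi>.\<close>

lemma driven_path_ac:
 assumes G: "driven_path \<kappa> \<tau> \<xi> G" and fe: "finite_energy \<tau> \<xi> f" and t: "t \<in> {0..<\<tau>}"
 shows "abs_continuous_on {0..t} (\<lambda>s. Re (G s - \<kappa> * of_real (\<xi> s)))"
  and "abs_continuous_on {0..t} (\<lambda>s. Im (G s - \<kappa> * of_real (\<xi> s)))"
proof -
 have sub: "{0..t} \<subseteq> {0..\<tau>}" "{0..t} \<subseteq> {0..<\<tau>}" using t by auto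
 have cG: "continuous_on {0..t} G" by (rule continuous_on_subset[OF driven_path_continuous[OF G] sub(2)])
 have c\<xi>: "continuous_on {0..t} \<xi>" by (rule continuous_on_subset[OF finite_energy_continuous[OF fe] sub(1)])
 have "continuous_on {0..t} (\<lambda>s. 2 / (G s - \<kappa> * of_real (\<xi> s)))"
  using G sub(2) unfolding driven_path_def by (intro continuous_intros cG c\<xi>) blast
 then have "bounded ((\<lambda>s. 2 / (G s - \<kappa> * of_real (\<xi> s))) ` {0..t})"
  by (intro compact_imp_bounded compact_continuous_image) auto
 then obtain L where L: "\<And>s. s \<in> {0..t} \<Longrightarrow> cmod (2 / (G s - \<kappa> * of_real (\<xi> s))) \<le> L"
  unfolding bounded_iff by blast
 have der: "((\<lambda>s. Re (G s)) has_real_derivative Re (2 / (G s - \<kappa> * of_real (\<xi> s)))) (at s)"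
  "((\<lambda>s. Im (G s)) has_real_derivative Im (2 / (G s - \<kappa> * of_real (\<xi> s)))) (at s)" if "s \<in> {0<..<t}" for s
  using driven_path_derivative[OF G, of s] that t
  by (simp_all add: has_real_derivative_iff_has_vector_derivative has_vector_derivative_complex_iff)
 have ac: "abs_continuous_on {0..t} (\<lambda>s. Re (G s))" "abs_continuous_on {0..t} (\<lambda>s. Im (G s))"
 proof -
  have le: "\<bar>Re (2 / (G s - \<kappa> * of_real (\<xi> s)))\<bar> \<le> L" "\<bar>Im (2 / (G s - \<kappa> * of_real (\<xi> s)))\<bar> \<le> L"
   if "s \<in> {0<..<t}" for s
  proof -
   have "s \<in> {0..t}" using that by auto
   from L[OF this] show "\<bar>Re (2 / (G s - \<kappa> * of_real (\<xi> s)))\<bar> \<le> L" "\<bar>Im (2 / (G s - \<kappa> * of_real (\<xi> s)))\<bar> \<le> L"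
    using abs_Re_le_cmod abs_Im_le_cmod order_trans by blast+
  qed
  show "abs_continuous_on {0..t} (\<lambda>s. Re (G s))"
   by (rule abs_continuous_on_deriv_bounded[OF _ der(1) le(1)]) (intro continuous_intros cG)
  show "abs_continuous_on {0..t} (\<lambda>s. Im (G s))"
   by (rule abs_continuous_on_deriv_bounded[OF _ der(2) le(2)]) (intro continuous_intros cG)
 qed
 have "abs_continuous_on {0..t} (\<lambda>s. Re (G s) - Re \<kappa> * \<xi> s)" "abs_continuous_on {0..t} (\<lambda>s. Im (G s) - Im \<kappa> * \<xi> s)"
  using finite_energy_subinterval(3)[OF fe sub(1)] ac
  by (intro abs_continuous_on_diff abs_continuous_on_cmult; simp)+
 then show "abs_continuous_on {0..t} (\<lambda>s. Re (G s - \<kappa> * of_real (\<xi> s)))"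
  "abs_continuous_on {0..t} (\<lambda>s. Im (G s - \<kappa> * of_real (\<xi> s)))" by simp_all
qed

lemma finite_energy_derivative:
 assumes "finite_energy \<tau> \<xi> f"
 obtains N where "negligible N" "\<And>x. x \<in> {0<..<\<tau>} - N \<Longrightarrow> (\<xi> has_real_derivative f x) (at x)"
 using assms unfolding finite_energy_def by (elim conjE exE) blast

lemma driven_path_w_derivative:
 assumes G: "driven_path \<kappa> \<tau> \<xi> G" and t: "t \<in> {0<..<\<tau>}" and \<xi>: "(\<xi> has_real_derivative d) (at t)"
 shows "((\<lambda>s. G s - \<kappa> * of_real (\<xi> s)) has_vector_derivative 2 / (G t - \<kappa> * of_real (\<xi> t)) - \<kappa> * of_real d) (at t)"
 by (intro has_vector_derivative_diff driven_path_derivative[OF G t] has_vector_derivative_mult_right has_vector_derivative_of_real \<xi>)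

text \<open>Squaring cancels the singularity of the vector field, since
  \<open>w * (2 / w) = 2\<close>; hence \<open>(w^2)' = 4 - 2 * \<kappa> * w * f\<close> almost
  everywhere.\<close>

lemma driven_path_square_integral:
 assumes G: "driven_path \<kappa> \<tau> \<xi> G" and fe: "finite_energy \<tau> \<xi> f" and st: "0 \<le> s" "s \<le> t" "t < \<tau>"
 defines "w \<equiv> \<lambda>s. G s - \<kappa> * of_real (\<xi> s)"
 shows "((\<lambda>r. 4 - 2 * \<kappa> * w r * of_real (f r)) has_integral (w t)^2 - (w s)^2) {s..t}"
proof -
 obtain N where N: "negligible N" "\<And>x. x \<in> {0<..<\<tau>} - N \<Longrightarrow> (\<xi> has_real_derivative f x) (at x)"
  using finite_energy_derivative[OF fe] by blast
 have sub: "{s..t} \<subseteq> {0..t}" using st by auto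
 have ac: "abs_continuous_on {s..t} (\<lambda>s. Re (w s))" "abs_continuous_on {s..t} (\<lambda>s. Im (w s))"
  unfolding w_def using driven_path_ac[OF G fe, of t] st abs_continuous_on_subset[OF _ sub] by auto
 show ?thesis
 proof (rule has_integral_ac_complex[OF _ _ st(2) N(1)])
  have "abs_continuous_on {s..t} (\<lambda>x. Re (w x) * Re (w x) - Im (w x) * Im (w x))"
   "abs_continuous_on {s..t} (\<lambda>x. Re (w x) * Im (w x) + Re (w x) * Im (w x))"
   by (intro abs_continuous_on_diff abs_continuous_on_add abs_continuous_on_mult ac)+
  then show "abs_continuous_on {s..t} (\<lambda>x. Re ((w x)^2))" "abs_continuous_on {s..t} (\<lambda>x. Im ((w x)^2))"
   by (simp_all add: power2_eq_square mult.commute)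
  fix x assume x: "x \<in> {s<..<t} - N"
  then have x': "x \<in> {0<..<\<tau>}" "x \<in> {0<..<\<tau>} - N" using st by auto
  have wn: "w x \<noteq> 0" using G x'(1) unfolding driven_path_def w_def by auto
  have "(w has_vector_derivative 2 / w x - \<kappa> * of_real (f x)) (at x)"
   unfolding w_def using driven_path_w_derivative[OF G x'(1) N(2)[OF x'(2)]] .
  from has_vector_derivative_mult[OF this this]
  have "((\<lambda>x. w x * w x) has_vector_derivative
   w x * (2 / w x - \<kappa> * of_real (f x)) + (2 / w x - \<kappa> * of_real (f x)) * w x) (at x)" .
  moreover have "w x * (2 / w x - \<kappa> * of_real (f x)) + (2 / w x - \<kappa> * of_real (f x)) * w x = 4 - 2 * \<kappa> * w x * of_real (f x)"
   using wn by (simp add: field_simps)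
  ultimately show "((\<lambda>x. (w x)^2) has_vector_derivative 4 - 2 * \<kappa> * w x * of_real (f x)) (at x)"
   by (simp add: power2_eq_square)
 qed
qed

lemma driven_path_square_bound:
 assumes G: "driven_path \<kappa> \<tau> \<xi> G" and fe: "finite_energy \<tau> \<xi> f" and \<kappa>: "cmod \<kappa> = 1"
  and st: "0 \<le> s" "s \<le> t" "t < \<tau>"
 defines "w \<equiv> \<lambda>s. G s - \<kappa> * of_real (\<xi> s)"
 assumes M: "\<And>r. r \<in> {s..t} \<Longrightarrow> cmod (w r) \<le> M"
 shows "cmod ((w s)^2 - (w t)^2 + 4 * of_real (t - s)) \<le> 2 * M * integral {s..t} (\<lambda>r. \<bar>f r\<bar>)"
proof -
 have sub: "{s..t} \<subseteq> {0..\<tau>}" using st by auto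
 have "((\<lambda>r. 4::complex) has_integral of_real (t - s) * 4) {s..t}"
  using has_integral_const_real[of "4::complex" s t] st by (simp add: scaleR_conv_of_real)
 from has_integral_diff[OF this driven_path_square_integral[OF G fe st]]
 have i: "((\<lambda>r. 2 * \<kappa> * w r * of_real (f r)) has_integral (w s)^2 - (w t)^2 + 4 * of_real (t - s)) {s..t}"
  by (simp add: w_def algebra_simps)
 have fa: "(\<lambda>r. \<bar>f r\<bar>) integrable_on {s..t}"
  by (rule set_lebesgue_integral_eq_integral(1)[OF set_integrable_abs[OF finite_energy_subinterval(1)[OF fe sub]]])
 have "cmod (integral {s..t} (\<lambda>r. 2 * \<kappa> * w r * of_real (f r))) \<le> integral {s..t} (\<lambda>r. (2 * M) * \<bar>f r\<bar>)"
 proof (rule Henstock_Kurzweil_Integration.integral_norm_bound_integral)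
  show "(\<lambda>r. 2 * \<kappa> * w r * of_real (f r)) integrable_on {s..t}" using i by blast
  show "(\<lambda>r. (2 * M) * \<bar>f r\<bar>) integrable_on {s..t}" using fa by (intro integrable_on_mult_right)
  show "cmod (2 * \<kappa> * w r * of_real (f r)) \<le> (2 * M) * \<bar>f r\<bar>" if "r \<in> {s..t}" for r
   using M[OF that] \<kappa> by (simp add: norm_mult mult_right_mono)
 qed
 also have "\<dots> = 2 * M * integral {s..t} (\<lambda>r. \<bar>f r\<bar>)" by simp
 finally show ?thesis using integral_unique[OF i] by simp
qed

lemma
 assumes G: "driven_path \<kappa> \<tau> \<xi> G" and fe: "finite_energy \<tau> \<xi> f" and \<kappa>: "cmod \<kappa> = 1"
  and t: "0 \<le> t" "t < \<tau>" and lim: "((\<lambda>t. G t - \<kappa> * of_real (\<xi> t)) \<longlongrightarrow> 0) (at_left \<tau>)"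
 shows driven_path_square_le: "cmod ((G t - \<kappa> * of_real (\<xi> t))^2 + 4 * of_real (\<tau> - t)) \<le>
    2 * (2 + 2 * sqrt (remaining_energy \<tau> f t)) * sqrt (remaining_energy \<tau> f t) * (\<tau> - t)"
proof -
 define w where "w = (\<lambda>s. G s - \<kappa> * of_real (\<xi> s))"
 have sub: "{t..<\<tau>} \<subseteq> {0..<\<tau>}" "{t..<\<tau>} \<subseteq> {0..\<tau>}" using t by auto
 have c: "continuous_on {t..<\<tau>} (\<lambda>s. cmod (w s))"
  unfolding w_def
  by (intro continuous_intros continuous_on_subset[OF driven_path_continuous[OF G] sub(1)]
    continuous_on_subset[OF finite_energy_continuous[OF fe] sub(2)])
 have l: "((\<lambda>s. cmod (w s)) \<longlongrightarrow> 0) (at_left \<tau>)" using lim unfolding w_def by (rule tendsto_norm_zero)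
 have p: "cmod ((w s)^2) = (cmod (w s))^2" for s by (rule norm_power)
 have e: "cmod ((w s)^2 - (w s')^2 + 4 * of_real (s' - s)) \<le> 2 * M * integral {s..s'} (\<lambda>r. \<bar>f r\<bar>)"
  if "s \<in> {t..<\<tau>}" "s' \<in> {s..<\<tau>}" "\<And>r. r \<in> {s..s'} \<Longrightarrow> cmod (w r) \<le> M" for s s' M
  using driven_path_square_bound[OF G fe \<kappa>, of s s' M] that t unfolding w_def by auto
 show "cmod ((G t - \<kappa> * of_real (\<xi> t))^2 + 4 * of_real (\<tau> - t)) \<le>
    2 * (2 + 2 * sqrt (remaining_energy \<tau> f t)) * sqrt (remaining_energy \<tau> f t) * (\<tau> - t)"
  using tip_square_le[OF fe t _ c l p e] by (simp add: w_def)
qed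

text \<open>The relative error in \<open>w^2 = - 4 * (\<tau> - t)\<close> is bounded by a function
  of the remaining energy alone, and that energy tends to 0. Every finite-energy trajectory
  therefore dies in the direction of the imaginary axis, which makes the cost functions vanish at
  the tip.\<close>

lemma driven_path_square_asymp:
 assumes G: "driven_path \<kappa> \<tau> \<xi> G" and fe: "finite_energy \<tau> \<xi> f" and \<kappa>: "cmod \<kappa> = 1" and "\<tau> > 0"
  and lim: "((\<lambda>t. G t - \<kappa> * of_real (\<xi> t)) \<longlongrightarrow> 0) (at_left \<tau>)"
 shows "((\<lambda>t. (G t - \<kappa> * of_real (\<xi> t))^2 / of_real (\<tau> - t)) \<longlongrightarrow> -4) (at_left \<tau>)"
proof -
 define e where "e t = sqrt (remaining_energy \<tau> f t)" for t
 have "(e \<longlongrightarrow> sqrt 0) (at_left \<tau>)"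
  unfolding e_def by (intro tendsto_real_sqrt remaining_energy_tendsto_0[OF fe \<open>\<tau> > 0\<close>])
 then have e0: "(e \<longlongrightarrow> 0) (at_left \<tau>)" by simp
 have "((\<lambda>t. 2 * (2 + 2 * e t) * e t) \<longlongrightarrow> 2 * (2 + 2 * 0) * 0) (at_left \<tau>)"
  by (intro tendsto_intros e0)
 then have b: "((\<lambda>t. 2 * (2 + 2 * e t) * e t) \<longlongrightarrow> 0) (at_left \<tau>)" by simp
 have "((\<lambda>t. (G t - \<kappa> * of_real (\<xi> t))^2 / of_real (\<tau> - t) - (-4)) \<longlongrightarrow> 0) (at_left \<tau>)"
 proof (rule Lim_null_comparison[OF _ b])
  show "\<forall>\<^sub>F t in at_left \<tau>. cmod ((G t - \<kappa> * of_real (\<xi> t))^2 / of_real (\<tau> - t) - (-4)) \<le> 2 * (2 + 2 * e t) * e t"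
   using eventually_at_left_real[OF \<open>\<tau> > 0\<close>]
  proof eventually_elim
   case (elim t)
   then have t: "0 \<le> t" "t < \<tau>" by auto
   have nz: "complex_of_real (\<tau> - t) \<noteq> 0" using t by (simp del: of_real_diff)
   have "(G t - \<kappa> * of_real (\<xi> t))^2 / of_real (\<tau> - t) - (-4) = ((G t - \<kappa> * of_real (\<xi> t))^2 + 4 * of_real (\<tau> - t)) / of_real (\<tau> - t)"
    using nz by (simp add: add_divide_distrib del: of_real_diff)
   then have "cmod ((G t - \<kappa> * of_real (\<xi> t))^2 / of_real (\<tau> - t) - (-4)) =
     cmod ((G t - \<kappa> * of_real (\<xi> t))^2 + 4 * of_real (\<tau> - t)) / (\<tau> - t)"
    using t by (simp add: norm_divide del: of_real_diff)
   also have "\<dots> \<le> 2 * (2 + 2 * e t) * e t"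
    using driven_path_square_le[OF G fe \<kappa> t lim] t by (simp add: e_def pos_divide_le_eq del: of_real_diff)
   finally show ?case .
  qed
 qed
 then show ?thesis by (rule LIM_zero_cancel)
qed

section \<open>Tip asymptotics for C1 drivers\<close>

lemma finite_energy_C1:
 assumes der: "\<And>t. t \<in> {0..<T} \<Longrightarrow> (\<xi> has_real_derivative f t) (at t within {0..<T})"
  and f: "continuous_on {0..<T} f" and \<delta>: "\<delta> \<in> {0<..<T}"
 shows "finite_energy \<delta> \<xi> f"
proof -
 have sub: "{0..\<delta>} \<subseteq> {0..<T}" using \<delta> by auto
 have fc: "continuous_on {0..\<delta>} f" by (rule continuous_on_subset[OF f sub])
 have der': "(\<xi> has_real_derivative f t) (at t)" if "t \<in> {0<..<\<delta>}" for t
 proof -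
  have "at t within {0..<T} = at t" using that \<delta> by (intro at_within_interior) auto
  then show ?thesis using der[of t] that \<delta> by auto
 qed
 obtain L where L: "\<And>t. t \<in> {0..\<delta>} \<Longrightarrow> norm (f t) \<le> L"
  using compact_imp_bounded[OF compact_continuous_image[OF fc compact_Icc]] unfolding bounded_iff by blast
 have "continuous_on {0..<T} \<xi>" unfolding continuous_on_eq_continuous_within
  using der DERIV_continuous by blast
 then have "abs_continuous_on {0..\<delta>} \<xi>"
  using L by (intro abs_continuous_on_deriv_bounded[of 0 \<delta> \<xi> f L] der' continuous_on_subset[OF _ sub]) auto
 then show ?thesis
  using \<delta> der' by (intro finite_energyI[of \<delta> \<xi> "{}" f] integrable_continuous_real continuous_intros fc) auto
qed

lemma vector_derivative_bound:
 fixes F :: "real \<Rightarrow> complex"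
 assumes "convex S" "\<And>x. x \<in> S \<Longrightarrow> (F has_vector_derivative F' x) (at x within S)"
  "\<And>x. x \<in> S \<Longrightarrow> cmod (F' x) \<le> B" "x \<in> S" "y \<in> S"
 shows "cmod (F x - F y) \<le> B * \<bar>x - y\<bar>"
proof -
 have "norm (F x - F y) \<le> B * norm (x - y)"
 proof (rule differentiable_bound[OF assms(1) _ _ assms(4,5)])
  show "(F has_derivative (\<lambda>h. h *\<^sub>R F' x)) (at x within S)" if "x \<in> S" for x
   using assms(2)[OF that] by (simp add: has_vector_derivative_def)
  show "onorm (\<lambda>h. h *\<^sub>R F' x) \<le> B" if "x \<in> S" for x
  proof (rule onorm_le)
   show "norm (h *\<^sub>R F' x) \<le> B * norm h" for h
    using mult_right_mono[OF assms(3)[OF that] norm_ge_zero[of h]] by (simp add: mult.commute)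
  qed
 qed
 then show ?thesis by simp
qed

text \<open>In \<open>(w^2)' = 4 - 2 * \<kappa> * w * f\<close> the trajectory is to leading order
  \<open>2 * \<i> * sqrt (\<delta> - t)\<close> and the slope is close to \<open>f 0\<close>.
  Integrating \<open>4 * \<i> * \<kappa> * f 0 * sqrt (\<delta> - t)\<close> over
  \<open>{0..\<delta>}\<close> gives the coefficient 8/3. Positivity of the imaginary part selects
  the square root.\<close>

lemma driven_path_tip_asymp:
 assumes "T > 0"
  and der: "\<And>t. t \<in> {0..<T} \<Longrightarrow> (\<xi> has_real_derivative f t) (at t within {0..<T})"
  and f: "continuous_on {0..<T} f" and \<kappa>: "cmod \<kappa> = 1"
  and G: "\<And>\<delta>. \<delta> \<in> {0<..<T} \<Longrightarrow> driven_path \<kappa> \<delta> \<xi> (G \<delta>)"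
  and pos: "\<And>\<delta> t. \<delta> \<in> {0<..<T} \<Longrightarrow> t \<in> {0..<\<delta>} \<Longrightarrow> Im (G \<delta> t - \<kappa> * of_real (\<xi> t)) > 0"
  and lim: "\<And>\<delta>. \<delta> \<in> {0<..<T} \<Longrightarrow> ((\<lambda>t. G \<delta> t - \<kappa> * of_real (\<xi> t)) \<longlongrightarrow> 0) (at_left \<delta>)"
 shows "((\<lambda>\<delta>. ((G \<delta> 0 - \<kappa> * of_real (\<xi> 0))^2 + 4 * of_real \<delta>) / of_real (\<delta> * sqrt \<delta>))
   \<longlongrightarrow> (8 * \<i> / 3) * \<kappa> * of_real (f 0)) (at_right 0)"
proof (rule tendstoI)
 fix e :: real assume "e > 0"
 define M where "M = \<bar>f 0\<bar> + 1"
 \<comment> \<open>The final error is \<open>8 * M * \<rho> + 4 * \<omega>\<close>; both summands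
   are kept at most \<open>e / 4\<close>, the second by this choice and the first by that of
   \<open>s0\<close> below.\<close>
 define \<omega> where "\<omega> = min 1 (e / 16)"
 have M: "M \<ge> 1" and \<omega>: "\<omega> > 0" "\<omega> \<le> 1" "\<omega> \<le> e / 16" using \<open>e > 0\<close> by (auto simp: M_def \<omega>_def)
 have "(f \<longlongrightarrow> f 0) (at 0 within {0..<T})" using f \<open>T > 0\<close> unfolding continuous_on_def by auto
 from tendstoD[OF this \<omega>(1)] obtain d where d: "d > 0" "\<And>t. t \<in> {0..<T} \<Longrightarrow> t \<noteq> 0 \<Longrightarrow> dist t 0 < d \<Longrightarrow> dist (f t) (f 0) < \<omega>"
  unfolding eventually_at by blast
 define s0 where "s0 = min (1 / M) (e / (32 * M^2))"
 have s0: "s0 > 0" using M \<open>e > 0\<close> by (auto simp: s0_def)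
 define \<delta>0 where "\<delta>0 = min (min T d) (s0^2)"
 have "\<delta>0 > 0" using \<open>T > 0\<close> d s0 by (auto simp: \<delta>0_def)
 have main: "dist (((G \<delta> 0 - \<kappa> * of_real (\<xi> 0))^2 + 4 * of_real \<delta>) / of_real (\<delta> * sqrt \<delta>)) ((8 * \<i> / 3) * \<kappa> * of_real (f 0)) < e"
  if \<delta>: "0 < \<delta>" "\<delta> < \<delta>0" for \<delta>
 proof -
  have \<delta>T: "\<delta> \<in> {0<..<T}" using \<delta> by (auto simp: \<delta>0_def)
  have sd: "sqrt \<delta> < s0"
  proof -
   have "\<delta> < s0^2" using \<delta> by (simp add: \<delta>0_def)
   then have "sqrt \<delta> < sqrt (s0^2)" by (rule real_sqrt_less_mono)
   then show ?thesis using s0 by simp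
  qed
  have sdp: "sqrt \<delta> > 0" using \<delta> by simp
  \<comment> \<open>A bound for the root of the remaining energy, as slopes on
    \<open>{0..\<delta>}\<close> are at most \<open>M\<close>.\<close>
  define \<rho> where "\<rho> = M * sqrt \<delta>"
  have \<rho>: "\<rho> \<ge> 0" "\<rho> \<le> 1" "8 * M * \<rho> \<le> e / 4"
  proof -
   show "\<rho> \<ge> 0" using M sdp by (simp add: \<rho>_def)
   have "\<rho> \<le> M * s0" unfolding \<rho>_def using sd M by (intro mult_left_mono) auto
   also have "M * s0 \<le> M * (1 / M)" using M by (intro mult_left_mono) (auto simp: s0_def)
   finally show "\<rho> \<le> 1" using M by simp
   have "8 * M * \<rho> = 8 * M^2 * sqrt \<delta>" by (simp add: \<rho>_def power2_eq_square)
   also have "\<dots> \<le> 8 * M^2 * (e / (32 * M^2))" using sd by (intro mult_left_mono) (auto simp: s0_def)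
   also have "\<dots> = e / 4" using M by simp
   finally show "8 * M * \<rho> \<le> e / 4" .
  qed
  have fw: "\<bar>f t - f 0\<bar> \<le> \<omega>" if "t \<in> {0..\<delta>}" for t
   using d(2)[of t] that \<delta> \<delta>T \<omega> by (cases "t = 0") (auto simp: dist_real_def \<delta>0_def)
  have fM: "\<bar>f t\<bar> \<le> M" if "t \<in> {0..\<delta>}" for t using fw[OF that] \<omega> by (auto simp: M_def)
  note fe = finite_energy_C1[OF der f \<delta>T]
  define w where "w t = G \<delta> t - \<kappa> * of_real (\<xi> t)" for t
  have E: "sqrt (remaining_energy \<delta> f t) \<le> \<rho>" if t: "t \<in> {0..<\<delta>}" for t
  proof -
   have "remaining_energy \<delta> f t \<le> integral {t..\<delta>} (\<lambda>s. M^2)"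
    unfolding remaining_energy_def
   proof (rule integral_le)
    show "(\<lambda>s. (f s)^2) integrable_on {t..\<delta>}" using t by (intro finite_energy_subinterval(2)[OF fe]) auto
    show "(f s)^2 \<le> M^2" if "s \<in> {t..\<delta>}" for s
     using fM[of s] that t M by (intro abs_le_square_iff[THEN iffD1]) auto
    show "(\<lambda>s. M^2) integrable_on {t..\<delta>}" by (rule integrable_const_ivl)
   qed
   also have "\<dots> = M^2 * (\<delta> - t)" using t by simp
   also have "\<dots> \<le> M^2 * \<delta>" using t by (intro mult_left_mono) auto
   finally have "sqrt (remaining_energy \<delta> f t) \<le> sqrt (M^2 * \<delta>)" by simp
   also have "\<dots> = \<rho>" using M by (simp add: \<rho>_def real_sqrt_mult)
   finally show ?thesis .
  qed
  have close: "cmod (w t - 2 * \<i> * of_real (sqrt (\<delta> - t))) \<le> 4 * \<rho> * sqrt (\<delta> - t)" if t: "t \<in> {0..<\<delta>}" for t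
  proof -
   define \<sigma> where "\<sigma> = sqrt (\<delta> - t)"
   have \<sigma>: "\<sigma> > 0" "\<sigma>^2 = \<delta> - t" using t by (auto simp: \<sigma>_def)
   have "cmod ((w t)^2 + 4 * of_real (\<delta> - t)) \<le> 2 * (2 + 2 * sqrt (remaining_energy \<delta> f t)) * sqrt (remaining_energy \<delta> f t) * (\<delta> - t)"
    unfolding w_def using t by (intro driven_path_square_le[OF G[OF \<delta>T] fe \<kappa> _ _ lim[OF \<delta>T]]) auto
   also have "\<dots> \<le> 2 * (2 + 2 * 1) * \<rho> * (\<delta> - t)"
   proof -
    define q where "q = sqrt (remaining_energy \<delta> f t)"
    have "0 \<le> q" "q \<le> \<rho>" using E[OF t] by (simp_all add: q_def remaining_energy_nonneg)
    with \<rho>(2) have q: "0 \<le> q" "q \<le> \<rho>" "q \<le> 1" by linarith+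
    have "2 * (2 + 2 * q) * q \<le> 2 * (2 + 2 * 1) * \<rho>" using q by (intro mult_mono) auto
    then show ?thesis unfolding q_def[symmetric] using t by (intro mult_right_mono) auto
   qed
   finally have "cmod ((w t)^2 + 4 * of_real (\<delta> - t)) \<le> 8 * \<rho> * \<sigma>^2" using \<sigma> by simp
   \<comment> \<open>The other factor has modulus at least \<open>2 * \<sigma>\<close> because
     \<open>Im (w t) > 0\<close>, so closeness of the squares becomes closeness of the
     roots.\<close>
   moreover have "(w t)^2 + 4 * of_real (\<delta> - t) = (w t - 2 * \<i> * of_real \<sigma>) * (w t + 2 * \<i> * of_real \<sigma>)"
    unfolding \<sigma>(2)[symmetric] by (simp add: power2_eq_square algebra_simps)
   ultimately have le: "cmod (w t - 2 * \<i> * of_real \<sigma>) * cmod (w t + 2 * \<i> * of_real \<sigma>) \<le> 8 * \<rho> * \<sigma>^2"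
    by (simp add: norm_mult)
   have "2 * \<sigma> \<le> Im (w t + 2 * \<i> * of_real \<sigma>)" using pos[OF \<delta>T t] by (simp add: w_def)
   also have "\<dots> \<le> cmod (w t + 2 * \<i> * of_real \<sigma>)" by (rule order_trans[OF abs_ge_self abs_Im_le_cmod])
   finally have le2: "cmod (w t - 2 * \<i> * of_real \<sigma>) * (2 * \<sigma>) \<le> cmod (w t - 2 * \<i> * of_real \<sigma>) * cmod (w t + 2 * \<i> * of_real \<sigma>)"
    by (intro mult_left_mono) auto
   have "8 * \<rho> * \<sigma>^2 = (4 * \<rho> * \<sigma>) * (2 * \<sigma>)" by (simp add: power2_eq_square)
   with order_trans[OF le2 le] have "cmod (w t - 2 * \<i> * of_real \<sigma>) * (2 * \<sigma>) \<le> (4 * \<rho> * \<sigma>) * (2 * \<sigma>)" by simp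
   moreover have "2 * \<sigma> > 0" using \<sigma>(1) by simp
   ultimately have "cmod (w t - 2 * \<i> * of_real \<sigma>) \<le> 4 * \<rho> * \<sigma>" by (simp only: mult_le_cancel_right_pos)
   then show ?thesis unfolding \<sigma>_def .
  qed
  define c where "c = (8 * \<i> / 3) * \<kappa> * of_real (f 0)"
  \<comment> \<open>\<open>w^2\<close> minus its predicted course, arranged so that the prediction
    for \<open>Q\<close> is a constant. Its derivative consists of the two error terms only.\<close>
  define Q where "Q t = (w t)^2 - 4 * of_real t - c * of_real ((\<delta> - t) * sqrt (\<delta> - t))" for t
  define B where "B = 2 * (4 * \<rho> * M + 2 * \<omega>) * sqrt \<delta>"
  have Qder: "(Q has_vector_derivative - 2 * \<kappa> * ((w t - 2 * \<i> * of_real (sqrt (\<delta> - t))) * of_real (f t)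
    + 2 * \<i> * of_real (sqrt (\<delta> - t)) * of_real (f t - f 0))) (at t within {0..<\<delta>})" (is "(Q has_vector_derivative ?q) _")
   if t: "t \<in> {0..<\<delta>}" for t
  proof -
   have wn: "w t \<noteq> 0" using G[OF \<delta>T] t unfolding driven_path_def w_def by auto
   have "(\<xi> has_real_derivative f t) (at t within {0..<\<delta>})"
    using t \<delta>T by (intro has_field_derivative_subset[OF der]) auto
   then have wd: "(w has_vector_derivative 2 / w t - \<kappa> * of_real (f t)) (at t within {0..<\<delta>})"
    unfolding w_def using G[OF \<delta>T] t unfolding driven_path_def
    by (intro has_vector_derivative_diff has_vector_derivative_mult_right has_vector_derivative_of_real) auto
   have "((\<lambda>t. (\<delta> - t) * sqrt (\<delta> - t)) has_real_derivative - (3/2) * sqrt (\<delta> - t)) (at t within {0..<\<delta>})"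
   proof -
    have "(\<delta> - t) * (inverse (sqrt (\<delta> - t)) / 2 * -1) + (-1) * sqrt (\<delta> - t) = - (3/2) * sqrt (\<delta> - t)"
    proof -
     have "(\<delta> - t) * inverse (sqrt (\<delta> - t)) = sqrt (\<delta> - t)"
      using t real_div_sqrt[of "\<delta> - t"] by (simp add: divide_inverse)
     then show ?thesis by simp
    qed
    moreover have "((\<lambda>t. (\<delta> - t) * sqrt (\<delta> - t)) has_real_derivative (\<delta> - t) * (inverse (sqrt (\<delta> - t)) / 2 * -1) + (-1) * sqrt (\<delta> - t)) (at t within {0..<\<delta>})"
     using t by (auto intro!: derivative_eq_intros)
    ultimately show ?thesis by simp
   qed
   then have sd: "((\<lambda>t. c * of_real ((\<delta> - t) * sqrt (\<delta> - t))) has_vector_derivative c * of_real (- (3/2) * sqrt (\<delta> - t))) (at t within {0..<\<delta>})"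
    by (intro has_vector_derivative_mult_right has_vector_derivative_of_real)
   have ld: "((\<lambda>t. 4 * complex_of_real t) has_vector_derivative 4 * of_real 1) (at t within {0..<\<delta>})"
    by (intro has_vector_derivative_mult_right has_vector_derivative_of_real) (rule DERIV_ident)
   have "(Q has_vector_derivative (w t * (2 / w t - \<kappa> * of_real (f t)) + (2 / w t - \<kappa> * of_real (f t)) * w t) - 4 * of_real 1
     - c * of_real (- (3/2) * sqrt (\<delta> - t))) (at t within {0..<\<delta>})"
    unfolding Q_def power2_eq_square
    by (intro has_vector_derivative_diff has_vector_derivative_mult wd sd ld)
   moreover have "(w t * (2 / w t - \<kappa> * of_real (f t)) + (2 / w t - \<kappa> * of_real (f t)) * w t) - 4 * of_real 1
     - c * of_real (- (3/2) * sqrt (\<delta> - t)) = ?q"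
    using wn by (simp add: c_def field_simps)
   ultimately show ?thesis by simp
  qed
  have Qb: "cmod (- 2 * \<kappa> * ((w t - 2 * \<i> * of_real (sqrt (\<delta> - t))) * of_real (f t)
    + 2 * \<i> * of_real (sqrt (\<delta> - t)) * of_real (f t - f 0))) \<le> B" if t: "t \<in> {0..<\<delta>}" for t
  proof -
   have ss: "sqrt (\<delta> - t) \<le> sqrt \<delta>" "0 \<le> sqrt (\<delta> - t)" using t by auto
   have "cmod ((w t - 2 * \<i> * of_real (sqrt (\<delta> - t))) * of_real (f t)) \<le> (4 * \<rho> * sqrt \<delta>) * M"
    unfolding norm_mult
   proof (rule mult_mono)
    show "cmod (w t - 2 * \<i> * complex_of_real (sqrt (\<delta> - t))) \<le> 4 * \<rho> * sqrt \<delta>"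
     using order_trans[OF close[OF t] mult_left_mono[OF ss(1), of "4 * \<rho>"]] \<rho> by simp
   qed (use fM[of t] t \<rho> sdp in auto)
   moreover have "cmod (2 * \<i> * of_real (sqrt (\<delta> - t)) * of_real (f t - f 0)) \<le> (2 * sqrt \<delta>) * \<omega>"
    unfolding norm_mult
    using fw[of t] t ss \<omega> by (intro mult_mono) (auto simp del: of_real_diff)
   ultimately have "cmod ((w t - 2 * \<i> * of_real (sqrt (\<delta> - t))) * of_real (f t)
    + 2 * \<i> * of_real (sqrt (\<delta> - t)) * of_real (f t - f 0)) \<le> (4 * \<rho> * sqrt \<delta>) * M + (2 * sqrt \<delta>) * \<omega>"
    by (rule norm_triangle_le[OF add_mono])
   moreover have "cmod (- 2 * \<kappa> * z) = 2 * cmod z" for z using \<kappa> by (simp add: norm_mult)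
   moreover have "B = 2 * ((4 * \<rho> * sqrt \<delta>) * M + (2 * sqrt \<delta>) * \<omega>)" by (simp add: B_def algebra_simps)
   ultimately show ?thesis by simp
  qed
  have "cmod (Q t - Q 0) \<le> B * \<delta>" if t: "t \<in> {0..<\<delta>}" for t
  proof -
   have "cmod (Q t - Q 0) \<le> B * \<bar>t - 0\<bar>"
    by (rule vector_derivative_bound[of "{0..<\<delta>}" Q, OF _ Qder Qb t]) (use \<delta> in auto)
   also have "\<dots> \<le> B * \<delta>" using t \<rho> M \<omega> sdp by (intro mult_left_mono) (auto simp: B_def)
   finally show ?thesis .
  qed
  then have ev: "\<forall>\<^sub>F t in at_left \<delta>. cmod (Q t - Q 0) \<le> B * \<delta>"
   using eventually_at_left_real[OF \<delta>(1)] by (auto elim: eventually_mono)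
  \<comment> \<open>At the tip \<open>w\<close> vanishes, so \<open>Q\<close> tends to
    \<open>- 4 * \<delta>\<close>; comparing with \<open>Q 0\<close> yields the expansion of
    \<open>w 0\<close>.\<close>
  have "((\<lambda>t. cmod (Q t - Q 0)) \<longlongrightarrow> cmod ((0^2 - 4 * of_real \<delta> - c * of_real ((\<delta> - \<delta>) * sqrt (\<delta> - \<delta>))) - Q 0)) (at_left \<delta>)"
   unfolding Q_def w_def by (intro tendsto_intros lim[OF \<delta>T])
  from tendsto_upperbound[OF this ev trivial_limit_at_left_real]
  have "cmod (- 4 * of_real \<delta> - Q 0) \<le> B * \<delta>" by simp
  moreover have "- 4 * of_real \<delta> - Q 0 = - ((w 0)^2 + 4 * of_real \<delta> - c * of_real (\<delta> * sqrt \<delta>))" by (simp add: Q_def)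
  ultimately have fin: "cmod ((w 0)^2 + 4 * of_real \<delta> - c * of_real (\<delta> * sqrt \<delta>)) \<le> B * \<delta>" by (simp only: norm_minus_cancel)
  define D where "D = \<delta> * sqrt \<delta>"
  have D: "D > 0" using \<delta> by (simp add: D_def)
  have "dist (((w 0)^2 + 4 * of_real \<delta>) / of_real D) c = cmod (((w 0)^2 + 4 * of_real \<delta> - c * of_real D) / of_real D)"
   using D by (simp add: dist_norm diff_divide_distrib)
  also have "\<dots> = cmod ((w 0)^2 + 4 * of_real \<delta> - c * of_real D) / D" using D by (simp add: norm_divide)
  also have "\<dots> \<le> B * \<delta> / D" using fin[folded D_def] D by (intro divide_right_mono) auto
  also have "B * \<delta> = (2 * (4 * \<rho> * M + 2 * \<omega>)) * D" by (simp add: B_def D_def)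
  also have "(2 * (4 * \<rho> * M + 2 * \<omega>)) * D / D = 8 * M * \<rho> + 4 * \<omega>" using D by simp
  also have "\<dots> < e" using \<rho>(3) \<omega>(3) \<open>e > 0\<close> by simp
  finally show ?thesis by (simp add: w_def c_def D_def)
 qed
 show "\<forall>\<^sub>F \<delta> in at_right 0. dist (((G \<delta> 0 - \<kappa> * of_real (\<xi> 0))^2 + 4 * of_real \<delta>) / of_real (\<delta> * sqrt \<delta>)) ((8 * \<i> / 3) * \<kappa> * of_real (f 0)) < e"
  unfolding eventually_at_right_field using main \<open>\<delta>0 > 0\<close> by blast
qed

lemma continuous_on_left_end:
 fixes h :: "real \<Rightarrow> real"
 assumes "continuous_on {0..\<tau>} h" "\<tau> > 0"
 shows "(h \<longlongrightarrow> h \<tau>) (at_left \<tau>)"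
proof -
 have "(h \<longlongrightarrow> h \<tau>) (at \<tau> within {0..\<tau>})" using assms unfolding continuous_on_def by auto
 then show ?thesis using assms(2) by (simp add: at_within_Icc_at_left)
qed

lemma zero_derivative_constant:
 fixes F :: "real \<Rightarrow> real"
 assumes "\<And>t. t \<in> {0..<\<tau>} \<Longrightarrow> (F has_real_derivative 0) (at t within {0..<\<tau>})" "t \<in> {0..<\<tau>}"
 shows "F t = F 0"
proof -
 obtain c where c: "\<And>t. t \<in> {0..<\<tau>} \<Longrightarrow> F t = c"
  using has_field_derivative_zero_constant[of "{0..<\<tau>}" F] assms(1) by auto
 have "0 \<in> {0..<\<tau>}" using assms(2) by simp
 then show ?thesis using c[of 0] c[OF assms(2)] by simp
qed

text \<open>The profile function inverts the polynomial below; its sign is \<open>\<kappa> > 0\<close> for the downwards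
 and \<open>\<kappa> < 0\<close> for the upwards problem.\<close>

definition profile_poly :: "real \<Rightarrow> real \<Rightarrow> real" where
 "profile_poly \<kappa> s = s^2 / 2 + \<kappa> * s ^ 6 / 6"

lemma profile_poly_derivative:
 "(profile_poly \<kappa> has_real_derivative s * (1 + \<kappa> * s ^ 4)) (at s within A)"
 unfolding profile_poly_def
 by (auto intro!: derivative_eq_intros simp: algebra_simps power_numeral_reduce)

lemma profile_factor_pos:
 assumes "1 + \<kappa> * S ^ 4 > 0" "0 \<le> s" "s \<le> S"
 shows "1 + \<kappa> * s ^ 4 > (0::real)"
proof (cases "\<kappa> \<ge> 0")
 case True then show ?thesis by (simp add: add_pos_nonneg)
next
 case False
 have "s ^ 4 \<le> S ^ 4" using assms by (intro power_mono)
 then have "\<kappa> * S ^ 4 \<le> \<kappa> * s ^ 4" using False by (intro mult_left_mono_neg) auto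
 then show ?thesis using assms by simp
qed

lemma profile_poly_strict_mono:
 assumes "1 + \<kappa> * S ^ 4 > 0" "0 \<le> a" "a < b" "b \<le> S"
 shows "profile_poly \<kappa> a < profile_poly \<kappa> b"
proof (rule DERIV_pos_imp_increasing_open[OF assms(3)])
 fix s assume s: "a < s" "s < b"
 then have "s * (1 + \<kappa> * s ^ 4) > 0" using profile_factor_pos[OF assms(1), of s] assms by simp
 then show "\<exists>y. (profile_poly \<kappa> has_real_derivative y) (at s) \<and> 0 < y" using profile_poly_derivative by blast
qed (auto simp: profile_poly_def intro!: continuous_intros)

text \<open>The equation for \<open>S\<close> is separable:
  \<open>profile_poly \<kappa> (S t)\<close> falls linearly at rate \<open>p\<close>. Inverting the
  increasing polynomial solves it up to the final time, where the right-hand side is singular and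
  \<open>S\<close> is merely continuous.\<close>

lemma profile_exists:
 assumes S0: "S0 > 0" and pos: "1 + \<kappa> * S0 ^ 4 > 0" and p: "p > 0"
 defines "\<tau> \<equiv> profile_poly \<kappa> S0 / p"
 obtains S where "S 0 = S0" "S \<tau> = 0" "continuous_on {0..\<tau>} S"
  "\<And>t. t \<in> {0..<\<tau>} \<Longrightarrow> 0 < S t \<and> S t \<le> S0"
  "\<And>t. t \<in> {0..<\<tau>} \<Longrightarrow> (S has_real_derivative - p / (S t * (1 + \<kappa> * S t ^ 4))) (at t)"
  "\<And>t. t \<in> {0..\<tau>} \<Longrightarrow> profile_poly \<kappa> (S t) = p * (\<tau> - t)"
proof -
 let ?N = "profile_poly \<kappa>"
 \<comment> \<open>A slightly larger interval puts \<open>S0\<close> in the interior, so the inverse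
   function is differentiable on both sides at time 0.\<close>
 obtain S1 where S1: "S1 > S0" "1 + \<kappa> * S1 ^ 4 > 0"
 proof -
  have "isCont (\<lambda>s. 1 + \<kappa> * s ^ 4) S0" by (intro continuous_intros)
  then have "((\<lambda>s. 1 + \<kappa> * s ^ 4) \<longlongrightarrow> 1 + \<kappa> * S0 ^ 4) (at_right S0)"
   by (simp add: isCont_def filterlim_at_split)
  then have "\<forall>\<^sub>F s in at_right S0. 1 + \<kappa> * s ^ 4 > 0" using pos by (rule order_tendstoD)
  then obtain b where b: "b > S0" "\<And>s. S0 < s \<Longrightarrow> s < b \<Longrightarrow> 1 + \<kappa> * s ^ 4 > 0"
   unfolding eventually_at_right_field by blast
  have "S0 < (S0 + b) / 2" "(S0 + b) / 2 < b" using b(1) by (auto simp: field_simps)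
  then show thesis using that b(2) by blast
 qed
 have mono: "?N a < ?N b" if "0 \<le> a" "a < b" "b \<le> S1" for a b
  using profile_poly_strict_mono[OF S1(2) that] .
 have inj: "inj_on ?N {0..S1}"
 proof (rule inj_onI)
  fix a b assume ab: "a \<in> {0..S1}" "b \<in> {0..S1}" "?N a = ?N b"
  show "a = b" using mono[of a b] mono[of b a] ab by (cases a b rule: linorder_cases) auto
 qed
 have cont: "continuous_on A ?N" for A unfolding profile_poly_def by (intro continuous_intros) auto
 have N0: "?N 0 = 0" by (simp add: profile_poly_def)
 define g where "g = the_inv_into {0..S1} ?N"
 have gN: "g (?N s) = s" if "s \<in> {0..S1}" for s unfolding g_def using the_inv_into_f_f[OF inj that] .
 have surj: "\<exists>s\<in>{0..S1}. ?N s = y" if y: "y \<in> {0..?N S1}" for y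
  using IVT'[of ?N 0 y S1] y N0 S1 S0 cont by auto
 have Ng: "?N (g y) = y" "g y \<in> {0..S1}" if y: "y \<in> {0..?N S1}" for y
 proof -
  obtain s where s: "s \<in> {0..S1}" "?N s = y" using surj[OF y] by blast
  then show "?N (g y) = y" "g y \<in> {0..S1}" using gN[OF s(1)] by auto
 qed
 have gc: "continuous_on {0..?N S1} g"
 proof -
  have "continuous_on (?N ` {0..S1}) g" by (rule continuous_on_inv[OF cont compact_Icc]) (use gN in auto)
  then show ?thesis by (rule continuous_on_subset) (use surj in force)
 qed
 define S where "S t = g (?N S0 - p * t)" for t
 have NS1: "?N S0 < ?N S1" using mono[of S0 S1] S0 S1 by simp
 have NS0: "?N S0 > 0" using mono[of 0 S0] S0 S1 N0 by simp
 have arg: "?N S0 - p * t \<in> {0..?N S1}" "?N S0 - p * t = p * (\<tau> - t)" if t: "t \<in> {0..\<tau>}" for t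
 proof -
  show eq: "?N S0 - p * t = p * (\<tau> - t)" using p by (simp add: \<tau>_def algebra_simps)
  have "0 \<le> p * (\<tau> - t)" "0 \<le> p * t" using p t by auto
  then show "?N S0 - p * t \<in> {0..?N S1}" using NS1 eq by simp
 qed
 have \<tau>: "\<tau> > 0" using NS0 p by (simp add: \<tau>_def)
 have NS: "?N (S t) = p * (\<tau> - t)" if t: "t \<in> {0..\<tau>}" for t
  unfolding S_def using Ng(1)[OF arg(1)[OF t]] arg(2)[OF t] by simp
 have rng: "0 < S t \<and> S t \<le> S0" if t: "t \<in> {0..<\<tau>}" for t
 proof -
  have t': "t \<in> {0..\<tau>}" using t by auto
  have S: "S t \<in> {0..S1}" unfolding S_def by (rule Ng(2)[OF arg(1)[OF t']])
  have "?N (S t) > 0" using NS[OF t'] p t by simp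
  then have "S t \<noteq> 0" using N0 by auto
  moreover have "S t \<le> S0"
  proof (rule ccontr)
   assume "\<not> S t \<le> S0"
   then have "?N S0 < ?N (S t)" using mono[of S0 "S t"] S S0 by auto
   moreover have "?N (S t) \<le> ?N S0"
   proof -
    have "p * t \<ge> 0" using p t by simp
    then show ?thesis using NS[OF t'] arg(2)[OF t'] by linarith
   qed
   ultimately show False by simp
  qed
  ultimately show ?thesis using S by auto
 qed
 show thesis
 proof
  show "S 0 = S0" unfolding S_def using gN[of S0] S0 S1 by simp
  show "S \<tau> = 0" unfolding S_def using gN[of 0] N0 p S0 S1 by (simp add: \<tau>_def)
  show "continuous_on {0..\<tau>} S" unfolding S_def
   by (rule continuous_on_compose2[OF gc]) (use arg(1) in \<open>auto intro!: continuous_intros\<close>)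
  show "0 < S t \<and> S t \<le> S0" if "t \<in> {0..<\<tau>}" for t using rng[OF that] .
  show "profile_poly \<kappa> (S t) = p * (\<tau> - t)" if "t \<in> {0..\<tau>}" for t using NS[OF that] .
  show "(S has_real_derivative - p / (S t * (1 + \<kappa> * S t ^ 4))) (at t)" if t: "t \<in> {0..<\<tau>}" for t
  proof -
   have t': "t \<in> {0..\<tau>}" using t by auto
   define y where "y = ?N S0 - p * t"
   have "p * t \<ge> 0" "p * (\<tau> - t) > 0" using p t by simp_all
   then have y: "0 < y" "y < ?N S1" using arg(2)[OF t'] NS1 unfolding y_def by linarith+
   define D where "D = g y * (1 + \<kappa> * (g y) ^ 4)"
   have gy: "g y = S t" by (simp add: S_def y_def)
   have D: "D > 0" unfolding D_def gy using rng[OF t] profile_factor_pos[OF pos, of "S t"] by simp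
   have "(g has_real_derivative inverse D) (at y)"
   proof (rule DERIV_inverse_function[of ?N _ _ _ 0 "?N S1"])
    show "(?N has_real_derivative D) (at (g y))" unfolding D_def by (rule profile_poly_derivative)
    show "D \<noteq> 0" using D by simp
    show "isCont g y" using gc y by (simp add: continuous_on_interior)
   qed (use y Ng(1) in auto)
   moreover have "((\<lambda>t. ?N S0 - p * t) has_real_derivative - p) (at t)" by (auto intro!: derivative_eq_intros)
   ultimately have "((\<lambda>t. g (?N S0 - p * t)) has_real_derivative inverse D * (- p)) (at t)"
    unfolding y_def by (rule DERIV_chain2)
   then show ?thesis unfolding D_def gy by (simp add: S_def[abs_def] divide_inverse mult.commute)
  qed
 qed
qed

subsection \<open>The optimal welding\<close>

lemma integral_function_derivative:
 fixes k :: "real \<Rightarrow> real"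
 assumes k: "continuous_on {0..<\<tau>} k" and \<xi>: "\<And>t. t \<in> {0..<\<tau>} \<Longrightarrow> \<xi> t = c + integral {0..t} k" and t: "t \<in> {0..<\<tau>}"
 shows "(\<xi> has_real_derivative k t) (at t within {0..<\<tau>})"
proof -
 define b where "b = (t + \<tau>) / 2"
 have b: "t < b" "b < \<tau>" using t by (auto simp: b_def)
 have "continuous_on {0..b} k" by (rule continuous_on_subset[OF k]) (use b in auto)
 then have "((\<lambda>x. integral {0..x} k) has_real_derivative k t) (at t within {0..b})"
  by (rule integral_has_real_derivative) (use t b in auto)
 moreover have "at t within {0..b} = at t within {0..<\<tau>}"
  by (rule at_within_nhd[of t "{..<b}"]) (use b t in auto)
 ultimately have "((\<lambda>x. c + integral {0..x} k) has_real_derivative 0 + k t) (at t within {0..<\<tau>})"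
  by (intro DERIV_add DERIV_const) simp
 then have "((\<lambda>x. c + integral {0..x} k) has_real_derivative k t) (at t within {0..<\<tau>})" by simp
 then show ?thesis
  by (rule has_field_derivative_transform_within[OF _ zero_less_one t]) (use \<xi> in auto)
qed

section \<open>Limits of energy quotients\<close>

lemma energy_rate:
 assumes "T > 0" and f: "continuous_on {0..<T} f"
 shows "((\<lambda>\<delta>. remaining_energy \<delta> f 0 / \<delta>) \<longlongrightarrow> (f 0)^2) (at_right 0)"
proof -
 have "((\<lambda>\<delta>. remaining_energy \<delta> f 0) has_real_derivative (f 0)^2) (at 0 within {0..<T})"
  by (rule integral_function_derivative[where c = 0])
    (use \<open>T > 0\<close> in \<open>auto simp: remaining_energy_def intro!: continuous_intros f\<close>)
 then have "((\<lambda>\<delta>. (remaining_energy \<delta> f 0 - remaining_energy 0 f 0) / (\<delta> - 0)) \<longlongrightarrow> (f 0)^2) (at 0 within {0..<T})"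
  by (simp only: has_field_derivative_iff)
 moreover have "at 0 within {0..<T} = at_right 0"
 proof -
  have "at 0 within {0..<T} = at 0 within {0<..}"
   by (rule at_within_nhd[of 0 "{..<T}"]) (use \<open>T > 0\<close> in auto)
  then show ?thesis .
 qed
 ultimately show ?thesis by (simp add: remaining_energy_def)
qed

text \<open>Squeezed between \<open>z / (1 + z)\<close> and \<open>z\<close>, whose quotients by
  \<delta> share the limit because \<open>z\<close> tends to 0.\<close>

lemma ln_one_plus_rate:
 fixes z :: "real \<Rightarrow> real"
 assumes lim: "((\<lambda>\<delta>. z \<delta> / \<delta>) \<longlongrightarrow> L) (at_right 0)" and nn: "\<forall>\<^sub>F \<delta> in at_right 0. z \<delta> \<ge> 0"
 shows "((\<lambda>\<delta>. ln (1 + z \<delta>) / \<delta>) \<longlongrightarrow> L) (at_right 0)"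
proof -
 have pos: "\<forall>\<^sub>F \<delta> in at_right 0. (0::real) < \<delta>" by (simp add: eventually_at_filter)
 have id0: "((\<lambda>\<delta>::real. \<delta>) \<longlongrightarrow> 0) (at_right 0)" by (rule tendsto_ident_at)
 have "((\<lambda>\<delta>. z \<delta> / \<delta> * \<delta>) \<longlongrightarrow> L * 0) (at_right 0)" by (intro tendsto_mult lim id0)
 moreover have "\<forall>\<^sub>F \<delta> in at_right 0. z \<delta> / \<delta> * \<delta> = z \<delta>" using pos by eventually_elim simp
 ultimately have z0: "(z \<longlongrightarrow> 0) (at_right 0)" using Lim_transform_eventually by fastforce
 have "((\<lambda>\<delta>. z \<delta> / \<delta> / (1 + z \<delta>)) \<longlongrightarrow> L / (1 + 0)) (at_right 0)"
  by (intro tendsto_divide lim tendsto_add tendsto_const z0) simp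
 then have l: "((\<lambda>\<delta>. z \<delta> / \<delta> / (1 + z \<delta>)) \<longlongrightarrow> L) (at_right 0)" by simp
 show ?thesis
 proof (rule tendsto_sandwich[OF _ _ l lim])
  show "\<forall>\<^sub>F \<delta> in at_right 0. z \<delta> / \<delta> / (1 + z \<delta>) \<le> ln (1 + z \<delta>) / \<delta>"
   using pos nn
  proof eventually_elim
   case (elim \<delta>)
   have "ln (1 / (1 + z \<delta>)) \<le> 1 / (1 + z \<delta>) - 1" using elim by (intro ln_le_minus_one) auto
   moreover have "ln (1 / (1 + z \<delta>)) = - ln (1 + z \<delta>)" using elim by (simp add: ln_div)
   moreover have "1 / (1 + z \<delta>) - 1 = - (z \<delta> / (1 + z \<delta>))" using elim by (simp add: field_simps)
   ultimately have "z \<delta> / (1 + z \<delta>) \<le> ln (1 + z \<delta>)" by linarith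
   then have "z \<delta> / (1 + z \<delta>) / \<delta> \<le> ln (1 + z \<delta>) / \<delta>" using elim by (intro divide_right_mono) auto
   then show ?case by (simp add: mult.commute)
  qed
  show "\<forall>\<^sub>F \<delta> in at_right 0. ln (1 + z \<delta>) / \<delta> \<le> z \<delta> / \<delta>"
   using pos nn by eventually_elim (auto intro!: divide_right_mono ln_add_one_self_le_self)
 qed
qed

text \<open>Both energies are linear in \<delta> to leading order, with rates \<open>m^2 / 2\<close>
  and \<open>4 / 9 * m^2\<close>, whose quotient is 9/8. Since \<open>m\<close> is nonzero the
  denominator is eventually positive, so the quotient of extended reals is the real one.\<close>

lemma energy_ratio_limit:
 fixes num den :: "real \<Rightarrow> ennreal"
 assumes num: "\<forall>\<^sub>F \<delta> in at_right 0. num \<delta> = ennreal (R \<delta> / 2)"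
  and den: "\<forall>\<^sub>F \<delta> in at_right 0. den \<delta> = ennreal (\<Psi> \<delta>)"
  and R: "((\<lambda>\<delta>. R \<delta> / \<delta>) \<longlongrightarrow> m^2) (at_right 0)" and \<Psi>: "((\<lambda>\<delta>. \<Psi> \<delta> / \<delta>) \<longlongrightarrow> 4 / 9 * m^2) (at_right 0)"
  and Rnn: "\<And>\<delta>. R \<delta> \<ge> 0" and m: "m \<noteq> 0"
 shows "((\<lambda>\<delta>. num \<delta> / den \<delta>) \<longlongrightarrow> 9 / 8) (at_right 0)"
proof -
 have m2: "m^2 > 0" using m by simp
 have pos: "\<forall>\<^sub>F \<delta> in at_right 0. (0::real) < \<delta>" by (simp add: eventually_at_filter)
 have \<Psi>pos: "\<forall>\<^sub>F \<delta> in at_right 0. \<Psi> \<delta> / \<delta> > 0" by (rule order_tendstoD(1)[OF \<Psi>]) (use m2 in simp)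
 have "((\<lambda>\<delta>. (R \<delta> / \<delta>) / 2 / (\<Psi> \<delta> / \<delta>)) \<longlongrightarrow> m^2 / 2 / (4 / 9 * m^2)) (at_right 0)"
  by (intro tendsto_divide R \<Psi> tendsto_const) (use m in auto)
 moreover have e: "m^2 / 2 / (4 / 9 * m^2) = 9 / 8" using m2 by (simp add: field_simps)
 ultimately have "((\<lambda>\<delta>. (R \<delta> / \<delta>) / 2 / (\<Psi> \<delta> / \<delta>)) \<longlongrightarrow> 9 / 8) (at_right 0)" by (simp only: e)
 then have "((\<lambda>\<delta>. ennreal ((R \<delta> / \<delta>) / 2 / (\<Psi> \<delta> / \<delta>))) \<longlongrightarrow> ennreal (9 / 8)) (at_right 0)"
  by (rule tendsto_ennrealI)
 moreover have "\<forall>\<^sub>F \<delta> in at_right 0. ennreal ((R \<delta> / \<delta>) / 2 / (\<Psi> \<delta> / \<delta>)) = num \<delta> / den \<delta>"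
  using num den pos \<Psi>pos
 proof eventually_elim
  case (elim \<delta>)
  then have P: "\<Psi> \<delta> > 0" by (simp add: zero_less_divide_iff)
  have "(R \<delta> / \<delta>) / 2 / (\<Psi> \<delta> / \<delta>) = (R \<delta> / 2) / \<Psi> \<delta>" using elim(3) P by (simp add: field_simps)
  then show ?case using elim(1,2) P Rnn[of \<delta>] by (simp add: divide_ennreal)
 qed
 ultimately have "((\<lambda>\<delta>. num \<delta> / den \<delta>) \<longlongrightarrow> ennreal (9 / 8)) (at_right 0)" by (rule Lim_transform_eventually)
 moreover have "ennreal (9 / 8) = 9 / 8" using divide_ennreal[of 9 8] by simp
 ultimately show ?thesis by simp
qed

text \<open>The value \<open>4 * ln ((a + b)^2 / (4 * a * b))\<close>, split into logarithms for
  differentiation. It vanishes for \<open>a = b\<close> and depends only on the ratio of the two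
  distances.\<close>

definition emw_energy :: "real \<Rightarrow> real \<Rightarrow> real" where
 "emw_energy a b = 8 * ln (a + b) - 4 * ln a - 4 * ln b - 8 * ln 2"

lemma emw_energy_eq:
 assumes "a > 0" "b > 0"
 shows "emw_energy a b = 4 * ln (1 + (a - b)^2 / (4 * a * b))"
proof -
 have "1 + (a - b)^2 / (4 * a * b) = (a + b)^2 / (2^2 * (a * b))"
  using assms by (simp add: field_simps power2_eq_square)
 also have "ln \<dots> = ln ((a + b)^2) - ln (2^2 * (a * b))" using assms by (intro ln_divide_pos) auto
 also have "\<dots> = 2 * ln (a + b) - (2 * ln 2 + (ln a + ln b))"
 proof -
  have "ln ((a + b)^2) = 2 * ln (a + b)" using assms by (simp add: ln_realpow)
  moreover have "ln (2^2 * (a * b)) = ln (2^2) + ln (a * b)" using assms by (intro ln_mult_pos) auto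
  moreover have "ln (a * b) = ln a + ln b" using assms by (intro ln_mult_pos) auto
  moreover have "ln ((2::real)^2) = 2 * ln 2" using ln_realpow[of "2::real" 2] by simp
  ultimately show ?thesis by simp
 qed
 finally show ?thesis by (simp add: emw_energy_def)
qed

lemma emw_energy_nonneg:
 assumes "a > 0" "b > 0"
 shows "emw_energy a b \<ge> 0"
proof -
 have "(a - b)^2 / (4 * a * b) \<ge> 0" using assms by simp
 then show ?thesis unfolding emw_energy_eq[OF assms] using ln_ge_zero[of "1 + (a - b)^2 / (4 * a * b)"] by linarith
qed

lemma emw_energy_scale:
 assumes "a > 0" "b > 0" "c > 0"
 shows "emw_energy (a / c) (b / c) = emw_energy a b"
proof -
 have "emw_energy (a / c) (b / c) = 8 * ln ((a + b) / c) - 4 * ln (a / c) - 4 * ln (b / c) - 8 * ln 2"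
  by (simp add: emw_energy_def add_divide_distrib)
 also have "\<dots> = 8 * (ln (a + b) - ln c) - 4 * (ln a - ln c) - 4 * (ln b - ln c) - 8 * ln 2"
  using assms by (simp add: ln_divide_pos)
 finally show ?thesis by (simp add: emw_energy_def)
qed

text \<open>Scale invariance allows division of both distances by \<open>sqrt (\<tau> - t)\<close>;
  they then converge to 2, where the energy is 0.\<close>

lemma emw_energy_tendsto_0:
 assumes a: "((\<lambda>t. (a t)^2 / (\<tau> - t)) \<longlongrightarrow> 4) (at_left \<tau>)" and b: "((\<lambda>t. (b t)^2 / (\<tau> - t)) \<longlongrightarrow> 4) (at_left \<tau>)"
  and pos: "\<forall>\<^sub>F t in at_left \<tau>. t < \<tau> \<and> 0 < a t \<and> 0 < b t"
 shows "((\<lambda>t. emw_energy (a t) (b t)) \<longlongrightarrow> 0) (at_left \<tau>)"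
proof -
 have root: "((\<lambda>t. c t / sqrt (\<tau> - t)) \<longlongrightarrow> 2) (at_left \<tau>)"
  if c: "((\<lambda>t. (c t)^2 / (\<tau> - t)) \<longlongrightarrow> 4) (at_left \<tau>)" and cp: "\<forall>\<^sub>F t in at_left \<tau>. t < \<tau> \<and> 0 < c t" for c
 proof -
  have "((\<lambda>t. sqrt ((c t)^2 / (\<tau> - t))) \<longlongrightarrow> sqrt 4) (at_left \<tau>)" by (intro tendsto_real_sqrt c)
  moreover have "\<forall>\<^sub>F t in at_left \<tau>. sqrt ((c t)^2 / (\<tau> - t)) = c t / sqrt (\<tau> - t)"
   using cp by eventually_elim (simp add: real_sqrt_divide)
  ultimately show ?thesis using Lim_transform_eventually by fastforce
 qed
 have a2: "((\<lambda>t. a t / sqrt (\<tau> - t)) \<longlongrightarrow> 2) (at_left \<tau>)" by (rule root[OF a]) (use pos in \<open>auto elim: eventually_mono\<close>)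
 have b2: "((\<lambda>t. b t / sqrt (\<tau> - t)) \<longlongrightarrow> 2) (at_left \<tau>)" by (rule root[OF b]) (use pos in \<open>auto elim: eventually_mono\<close>)
 have "((\<lambda>t. emw_energy (a t / sqrt (\<tau> - t)) (b t / sqrt (\<tau> - t))) \<longlongrightarrow> emw_energy 2 2) (at_left \<tau>)"
  unfolding emw_energy_def by (intro tendsto_intros a2 b2) auto
 moreover have "emw_energy 2 2 = 0" by (simp add: emw_energy_eq)
 moreover have "\<forall>\<^sub>F t in at_left \<tau>. emw_energy (a t / sqrt (\<tau> - t)) (b t / sqrt (\<tau> - t)) = emw_energy (a t) (b t)"
  using pos by eventually_elim (intro emw_energy_scale, auto)
 ultimately show ?thesis using Lim_transform_eventually by fastforce
qed

section \<open>Welding trajectories, feedback law and extremal driver\<close>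

definition welding_paths :: "(real \<Rightarrow> real) \<Rightarrow> real \<Rightarrow> (real \<Rightarrow> real) \<Rightarrow> (real \<Rightarrow> real) \<Rightarrow> bool" where
 "welding_paths \<xi> \<tau> hu hv \<longleftrightarrow>
   upward_trajectory \<xi> {0..<\<tau>} (hu 0) hu \<and> upward_trajectory \<xi> {0..<\<tau>} (hv 0) hv \<and>
   (\<forall>t\<in>{0..<\<tau>}. hu t < \<xi> t \<and> \<xi> t < hv t) \<and>
   ((\<lambda>t. hu t - \<xi> t) \<longlongrightarrow> 0) (at_left \<tau>) \<and> ((\<lambda>t. hv t - \<xi> t) \<longlongrightarrow> 0) (at_left \<tau>)"

lemma welding_paths_exist:
 assumes "welded_at \<xi> \<tau> x y"
 obtains hu hv where "welding_paths \<xi> \<tau> hu hv" "hu 0 = x" "hv 0 = y"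
proof -
 obtain hu hv where h: "upward_trajectory \<xi> {0..<\<tau>} x hu" "upward_trajectory \<xi> {0..<\<tau>} y hv"
  "\<forall>t\<in>{0..<\<tau>}. hu t < \<xi> t \<and> \<xi> t < hv t"
  "((\<lambda>t. hu t - \<xi> t) \<longlongrightarrow> 0) (at_left \<tau>)" "((\<lambda>t. hv t - \<xi> t) \<longlongrightarrow> 0) (at_left \<tau>)"
  using assms unfolding welded_at_def by blast
 moreover have "hu 0 = x" "hv 0 = y" using h(1,2) unfolding upward_trajectory_def by auto
 ultimately show thesis using that unfolding welding_paths_def by simp
qed

lemma welding_pathsD:
 assumes "welding_paths \<xi> \<tau> hu hv" "t \<in> {0..<\<tau>}"
 shows "hu t < \<xi> t" "\<xi> t < hv t"
  "(hu has_real_derivative - 2 / (hu t - \<xi> t)) (at t within {0..<\<tau>})"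
  "(hv has_real_derivative - 2 / (hv t - \<xi> t)) (at t within {0..<\<tau>})"
 using assms unfolding welding_paths_def upward_trajectory_def by auto

text \<open>The rotations are chosen so that \<open>w\<close> becomes \<open>\<i>\<close> times the
  positive distance to the driver in both cases; the upward equation turns into the downward form
  because \<open>\<i> * (- 2 / a) = 2 / (\<i> * a)\<close>.\<close>

lemma welding_paths_driven:
 assumes h: "welding_paths \<xi> \<tau> hu hv"
 shows "driven_path (- \<i>) \<tau> \<xi> (\<lambda>t. - \<i> * of_real (hu t))" "driven_path \<i> \<tau> \<xi> (\<lambda>t. \<i> * of_real (hv t))"
  "((\<lambda>t. - \<i> * of_real (hu t) - (- \<i>) * of_real (\<xi> t)) \<longlongrightarrow> 0) (at_left \<tau>)"
  "((\<lambda>t. \<i> * of_real (hv t) - \<i> * of_real (\<xi> t)) \<longlongrightarrow> 0) (at_left \<tau>)"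
proof -
 show "driven_path (- \<i>) \<tau> \<xi> (\<lambda>t. - \<i> * of_real (hu t))"
  unfolding driven_path_def
 proof
  fix t assume t: "t \<in> {0..<\<tau>}"
  define a where "a = \<xi> t - hu t"
  have a: "a > 0" "hu t - \<xi> t = - a" using welding_pathsD(1)[OF h t] by (auto simp: a_def)
  have e: "- \<i> * of_real (hu t) - - \<i> * of_real (\<xi> t) = \<i> * of_real a" by (simp add: a_def algebra_simps)
  have "((\<lambda>t. - \<i> * of_real (hu t)) has_vector_derivative - \<i> * of_real (- 2 / (hu t - \<xi> t))) (at t within {0..<\<tau>})"
   by (intro has_vector_derivative_mult_right has_vector_derivative_of_real welding_pathsD(3)[OF h t])
  moreover have "- \<i> * of_real (- 2 / (hu t - \<xi> t)) = 2 / (\<i> * of_real a)"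
   using a(1) unfolding a(2) by (simp add: field_simps)
  ultimately show "- \<i> * of_real (hu t) - - \<i> * of_real (\<xi> t) \<noteq> 0 \<and>
   ((\<lambda>t. - \<i> * of_real (hu t)) has_vector_derivative 2 / (- \<i> * of_real (hu t) - - \<i> * of_real (\<xi> t))) (at t within {0..<\<tau>})"
   unfolding e using a(1) by simp
 qed
 show "driven_path \<i> \<tau> \<xi> (\<lambda>t. \<i> * of_real (hv t))"
  unfolding driven_path_def
 proof
  fix t assume t: "t \<in> {0..<\<tau>}"
  define a where "a = hv t - \<xi> t"
  have a: "a > 0" using welding_pathsD(2)[OF h t] by (auto simp: a_def)
  have e: "\<i> * of_real (hv t) - \<i> * of_real (\<xi> t) = \<i> * of_real a" by (simp add: a_def algebra_simps)
  have "((\<lambda>t. \<i> * of_real (hv t)) has_vector_derivative \<i> * of_real (- 2 / a)) (at t within {0..<\<tau>})"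
   unfolding a_def
   by (intro has_vector_derivative_mult_right has_vector_derivative_of_real welding_pathsD(4)[OF h t])
  moreover have "\<i> * of_real (- 2 / a) = 2 / (\<i> * of_real a)"
   using a(1) by (simp add: field_simps)
  ultimately show "\<i> * of_real (hv t) - \<i> * of_real (\<xi> t) \<noteq> 0 \<and>
   ((\<lambda>t. \<i> * of_real (hv t)) has_vector_derivative 2 / (\<i> * of_real (hv t) - \<i> * of_real (\<xi> t))) (at t within {0..<\<tau>})"
   unfolding e using a(1) by simp
 qed
 have "((\<lambda>t. - \<i> * of_real (hu t - \<xi> t)) \<longlongrightarrow> - \<i> * of_real 0) (at_left \<tau>)"
  "((\<lambda>t. \<i> * of_real (hv t - \<xi> t)) \<longlongrightarrow> \<i> * of_real 0) (at_left \<tau>)"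
  using h unfolding welding_paths_def by (intro tendsto_intros; simp)+
 then show "((\<lambda>t. - \<i> * of_real (hu t) - (- \<i>) * of_real (\<xi> t)) \<longlongrightarrow> 0) (at_left \<tau>)"
  "((\<lambda>t. \<i> * of_real (hv t) - \<i> * of_real (\<xi> t)) \<longlongrightarrow> 0) (at_left \<tau>)"
  by (simp_all add: algebra_simps)
qed

text \<open>The feedback law of the optimal welding: \<open>k = 4 (1/a - 1/b)\<close>, with \<open>a\<close> and \<open>b\<close> the distances
 of the two trajectories from the driver.\<close>

lemma
 assumes fe: "finite_energy \<tau> \<xi> f" and \<tau>: "\<tau> > 0" and h: "welding_paths \<xi> \<tau> hu hv"
 defines "a \<equiv> \<lambda>t. \<xi> t - hu t" and "b \<equiv> \<lambda>t. hv t - \<xi> t"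
 defines "k \<equiv> \<lambda>t. 4 * (b t - a t) / (a t * b t)"
 shows emw_lower: "emw_energy (a 0) (b 0) \<le> remaining_energy \<tau> f 0 / 2"
  and emw_eqD: "emw_energy (a 0) (b 0) = remaining_energy \<tau> f 0 / 2 \<Longrightarrow> t \<in> {0..<\<tau>} \<Longrightarrow> \<xi> t - \<xi> 0 = integral {0..t} k"
  and emw_eqI: "(\<And>t. t \<in> {0<..<\<tau>} \<Longrightarrow> f t = k t) \<Longrightarrow> emw_energy (a 0) (b 0) = remaining_energy \<tau> f 0 / 2"
  and emw_law_continuous: "continuous_on {0..<\<tau>} k"
proof -
 note dp = welding_paths_driven[OF h]
 have pos: "a t > 0" "b t > 0" if "t \<in> {0..<\<tau>}" for t
  using welding_pathsD(1,2)[OF h that] by (auto simp: a_def b_def)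
 have aac: "abs_continuous_on {0..t} a" and bac: "abs_continuous_on {0..t} b" if t: "t \<in> {0..<\<tau>}" for t
  using driven_path_ac(2)[OF dp(1) fe t] driven_path_ac(2)[OF dp(2) fe t] by (simp_all add: a_def b_def algebra_simps)
 obtain N where N: "negligible N" "\<And>x. x \<in> {0<..<\<tau>} - N \<Longrightarrow> (\<xi> has_real_derivative f x) (at x)"
  using finite_energy_derivative[OF fe] by blast
 define \<phi> where "\<phi> t = emw_energy (a t) (b t)" for t
 have ac: "abs_continuous_on {0..t} \<phi>" if t: "t \<in> {0..<\<tau>}" for t
 proof -
  have p: "a s > 0" "b s > 0" if "s \<in> {0..t}" for s using pos[of s] that t by auto
  have "abs_continuous_on {0..t} (\<lambda>s. 8 * ln (a s + b s) - 4 * ln (a s) - 4 * ln (b s) - 8 * ln 2)"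
   by (intro abs_continuous_on_diff abs_continuous_on_cmult abs_continuous_on_ln abs_continuous_on_add aac bac t)
     (use p in \<open>auto intro: add_pos_pos abs_continuous_on_lipschitz[of _ _ 0]\<close>)
  then show ?thesis by (simp add: \<phi>_def[abs_def] emw_energy_def)
 qed
 have der: "(\<phi> has_real_derivative (f t - k t)^2 / 2 - (f t)^2 / 2) (at t)" if t: "t \<in> {0<..<\<tau>} - N" for t
 proof -
  have t': "t \<in> {0..<\<tau>}" using t by auto
  have "at t within {0..<\<tau>} = at t" using t by (intro at_within_interior) auto
  note hd = welding_pathsD(3,4)[OF h t', unfolded this]
  note p = pos[OF t']
  have ad: "(a has_real_derivative f t - 2 / a t) (at t)"
  proof -
   have "(a has_real_derivative f t - (- 2 / (hu t - \<xi> t))) (at t)" unfolding a_def by (intro DERIV_diff N(2)[OF t] hd)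
   moreover have "- 2 / (hu t - \<xi> t) = 2 / a t" unfolding a_def by (metis minus_diff_eq minus_divide_divide minus_minus)
   ultimately show ?thesis by (simp only:)
  qed
  have bd: "(b has_real_derivative - 2 / b t - f t) (at t)" unfolding b_def by (intro DERIV_diff N(2)[OF t] hd)
  have l: "((\<lambda>x. ln (g x)) has_real_derivative d / g t) (at t)" if "(g has_real_derivative d) (at t)" "g t > 0" for g d
   by (rule DERIV_cong[OF DERIV_chain2[OF DERIV_ln[OF that(2)] that(1)]]) (simp add: divide_inverse mult.commute)
  have "a t + b t > 0" using p by simp
  then have "(\<phi> has_real_derivative 8 * (((f t - 2 / a t) + (- 2 / b t - f t)) / (a t + b t)) - 4 * ((f t - 2 / a t) / a t) - 4 * ((- 2 / b t - f t) / b t) - 0) (at t)"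
   unfolding \<phi>_def emw_energy_def
   by (intro DERIV_diff DERIV_cmult DERIV_const l[OF DERIV_add[OF ad bd]] l[OF ad] l[OF bd] p)
  moreover have "8 * (((f t - 2 / a t) + (- 2 / b t - f t)) / (a t + b t)) - 4 * ((f t - 2 / a t) / a t) - 4 * ((- 2 / b t - f t) / b t) - 0
    = (f t - k t)^2 / 2 - (f t)^2 / 2"
  proof -
   \<comment> \<open>In the reciprocals the identity is polynomial: the left side is
     \<open>8 * (p' - q')^2 - 4 * f t * (p' - q')\<close>, a completed square for
     \<open>k t = 4 * (p' - q')\<close>.\<close>
   define p' q' where "p' = 1 / a t" and "q' = 1 / b t"
   have e1: "((f t - 2 / a t) + (- 2 / b t - f t)) / (a t + b t) = - 2 * p' * q'" using p 
   proof -
    have "(f t - 2 / a t) + (- 2 / b t - f t) = (- 2 * p' * q') * (a t + b t)" using p by (simp add: p'_def q'_def field_simps)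
    then show ?thesis using p by simp
   qed
   have e2: "k t = 4 * (p' - q')" using p by (simp add: k_def p'_def q'_def field_simps)
   have e3: "(f t - 2 / a t) / a t = (f t - 2 * p') * p'" "(- 2 / b t - f t) / b t = (- 2 * q' - f t) * q'" by (simp_all add: p'_def q'_def)
   show ?thesis unfolding e1 e2 e3 by (simp add: power2_eq_square algebra_simps)
  qed
  ultimately show ?thesis by simp
 qed
 have lim: "(\<phi> \<longlongrightarrow> 0) (at_left \<tau>)"
  unfolding \<phi>_def
 proof (rule emw_energy_tendsto_0)
  \<comment> \<open>Here \<open>w^2 = - a^2\<close>, so the universal limit -4 reads as the limit 4
    for \<open>a^2 / (\<tau> - t)\<close>.\<close>
  have "((\<lambda>t. (- \<i> * of_real (hu t) - - \<i> * of_real (\<xi> t))^2 / of_real (\<tau> - t)) \<longlongrightarrow> - 4) (at_left \<tau>)"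
   by (rule driven_path_square_asymp[OF dp(1) fe _ \<tau> dp(3)]) simp
  from tendsto_minus[OF this] have "((\<lambda>t. complex_of_real ((a t)^2 / (\<tau> - t))) \<longlongrightarrow> of_real 4) (at_left \<tau>)"
   by (simp add: a_def power2_eq_square algebra_simps diff_divide_distrib add_divide_distrib)
  then show "((\<lambda>t. (a t)^2 / (\<tau> - t)) \<longlongrightarrow> 4) (at_left \<tau>)" by (simp only: tendsto_of_real_iff)
  have "((\<lambda>t. (\<i> * of_real (hv t) - \<i> * of_real (\<xi> t))^2 / of_real (\<tau> - t)) \<longlongrightarrow> - 4) (at_left \<tau>)"
   by (rule driven_path_square_asymp[OF dp(2) fe _ \<tau> dp(4)]) simp
  from tendsto_minus[OF this] have "((\<lambda>t. complex_of_real ((b t)^2 / (\<tau> - t))) \<longlongrightarrow> of_real 4) (at_left \<tau>)"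
   by (simp add: b_def power2_eq_square algebra_simps diff_divide_distrib add_divide_distrib)
  then show "((\<lambda>t. (b t)^2 / (\<tau> - t)) \<longlongrightarrow> 4) (at_left \<tau>)" by (simp only: tendsto_of_real_iff)
  show "\<forall>\<^sub>F t in at_left \<tau>. t < \<tau> \<and> 0 < a t \<and> 0 < b t"
   using eventually_at_left_real[OF \<tau>] by eventually_elim (use pos in auto)
 qed
 have hc: "continuous_on {0..<\<tau>} hu" "continuous_on {0..<\<tau>} hv"
  unfolding continuous_on_eq_continuous_within using welding_pathsD(3,4)[OF h] DERIV_continuous by blast+
 have \<xi>c: "continuous_on {0..<\<tau>} \<xi>" by (rule continuous_on_subset[OF finite_energy_continuous[OF fe]]) auto
 show kc: "continuous_on {0..<\<tau>} k" unfolding k_def a_def b_def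
  by (intro continuous_intros hc \<xi>c) (use pos in \<open>fastforce simp: a_def b_def\<close>)
 note cs = completing_square_le[OF fe \<tau> ac N(1) der lim kc] completing_square_eqD[OF fe \<tau> ac N(1) der lim kc]
  completing_square_eqI[OF fe \<tau> ac N(1) der lim kc]
 show "emw_energy (a 0) (b 0) \<le> remaining_energy \<tau> f 0 / 2" using cs(1) by (simp add: \<phi>_def)
 show "\<xi> t - \<xi> 0 = integral {0..t} k" if "emw_energy (a 0) (b 0) = remaining_energy \<tau> f 0 / 2" "t \<in> {0..<\<tau>}"
  using cs(2)[of t] that by (simp add: \<phi>_def)
 show "emw_energy (a 0) (b 0) = remaining_energy \<tau> f 0 / 2" if "\<And>t. t \<in> {0<..<\<tau>} \<Longrightarrow> f t = k t"
  using cs(3) that by (simp add: \<phi>_def)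
qed


text \<open>\<open>C * S0^2\<close> equals \<open>(- x - y) / (y - x)\<close>, which lies strictly
  between -1 and 1 because \<open>x < 0 < y\<close>. The profile factor with negative sign therefore
  stays positive up to \<open>S0\<close>.\<close>

lemma welding_constant_bounds:
 fixes x y :: real
 assumes "x < 0" "0 < y"
 defines "S0 \<equiv> y - x" and "C \<equiv> (- x - y) / (y - x) ^ 3"
 shows "S0 > 0" "1 + - (C^2) * S0 ^ 4 > 0" "C * S0 ^ 3 = - x - y"
proof -
 show S0: "S0 > 0" using assms by simp
 show C: "C * S0 ^ 3 = - x - y" using S0 by (simp add: C_def S0_def)
 have "\<bar>C\<bar> * S0 ^ 3 = \<bar>- x - y\<bar>" using C S0 by (metis abs_mult abs_of_pos zero_less_power)
 then have "\<bar>C\<bar> * S0 ^ 3 < S0" using assms by (simp add: abs_if S0_def)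
 then have "(\<bar>C\<bar> * S0^2) * S0 < 1 * S0" by (simp add: power2_eq_square power3_eq_cube mult.assoc)
 then have "\<bar>C\<bar> * S0^2 < 1" using S0 by (simp only: mult_less_cancel_right_pos)
 then have "(\<bar>C\<bar> * S0^2)^2 < 1" by (intro power_less_one_iff[THEN iffD2, of _ 2, simplified]) auto
 moreover have "(\<bar>C\<bar> * S0^2)^2 = C^2 * S0 ^ 4" by (simp add: power_mult_distrib flip: power_mult)
 ultimately show "1 + - (C^2) * S0 ^ 4 > 0" by simp
qed

text \<open>Under the feedback law the sum \<open>S\<close> and the difference \<open>D\<close> of
  the distances satisfy \<open>S' = - 2 * S / (a * b)\<close> and
  \<open>D' = - 6 * D / (a * b)\<close>, so \<open>D / S^3\<close> is constant. With
  \<open>4 * a * b = S^2 - D^2\<close> the equation for \<open>S\<close> closes. Naming some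
  \<open>S\<close> with the right profile value is enough for uniqueness, since the profile is
  injective on the relevant range.\<close>

lemma emw_rigidity:
 assumes fe: "finite_energy \<tau> \<xi> f" and \<tau>: "\<tau> > 0" and h: "welding_paths \<xi> \<tau> hu hv" and x: "hu 0 = x" and y: "hv 0 = y"
  and \<xi>0: "\<xi> 0 = 0" and eq: "emw_energy (- x) y = remaining_energy \<tau> f 0 / 2"
 defines "S0 \<equiv> y - x" and "C \<equiv> (- x - y) / (y - x) ^ 3"
 shows "\<tau> = profile_poly (- (C^2)) S0 / 8"
  and "t \<in> {0..<\<tau>} \<Longrightarrow> \<exists>S. 0 \<le> S \<and> S \<le> S0 \<and> profile_poly (- (C^2)) S = 8 * (\<tau> - t) \<and> \<xi> t = 2/3 * C * (S ^ 3 - S0 ^ 3)"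
proof -
 define a where "a t = \<xi> t - hu t" for t
 define b where "b t = hv t - \<xi> t" for t
 define k where "k t = 4 * (b t - a t) / (a t * b t)" for t
 define S where "S t = a t + b t" for t
 define D where "D t = a t - b t" for t
 have xy: "x < 0" "0 < y" using welding_pathsD(1,2)[OF h, of 0] \<tau> x y \<xi>0 by auto
 note cb = welding_constant_bounds[OF xy, folded S0_def C_def]
 have pos: "a t > 0" "b t > 0" if "t \<in> {0..<\<tau>}" for t
  using welding_pathsD(1,2)[OF h that] by (auto simp: a_def b_def)
 have kc: "continuous_on {0..<\<tau>} k" using emw_law_continuous[OF fe \<tau> h] unfolding k_def a_def b_def .
 have \<xi>k: "\<xi> t - \<xi> 0 = integral {0..t} k" if "t \<in> {0..<\<tau>}" for t
  using emw_eqD[OF fe \<tau> h _ that] eq x y \<xi>0 unfolding k_def[abs_def] a_def b_def by simp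
 have \<xi>d: "(\<xi> has_real_derivative k t) (at t within {0..<\<tau>})" if t: "t \<in> {0..<\<tau>}" for t
  by (rule integral_function_derivative[OF kc _ t, of \<xi> 0]) (use \<xi>k \<xi>0 in simp)
 have Sd: "(S has_real_derivative - 2 * S t / (a t * b t)) (at t within {0..<\<tau>})" if t: "t \<in> {0..<\<tau>}" for t
 proof -
  have "((\<lambda>t. hv t - hu t) has_real_derivative - 2 / (hv t - \<xi> t) - (- 2 / (hu t - \<xi> t))) (at t within {0..<\<tau>})"
   by (intro DERIV_diff welding_pathsD(3,4)[OF h t])
  moreover have "(\<lambda>t. hv t - hu t) = S" by (auto simp: S_def a_def b_def)
  moreover have "- 2 / (hv t - \<xi> t) - (- 2 / (hu t - \<xi> t)) = - 2 * S t / (a t * b t)"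
  proof -
   have e: "hv t - \<xi> t = b t" "hu t - \<xi> t = - a t" by (simp_all add: a_def b_def)
   show ?thesis unfolding e S_def using pos[OF t] by (simp add: field_simps)
  qed
  ultimately show ?thesis by simp
 qed
 have Dd: "(D has_real_derivative - 6 * D t / (a t * b t)) (at t within {0..<\<tau>})" if t: "t \<in> {0..<\<tau>}" for t
 proof -
  have "((\<lambda>t. 2 * \<xi> t - hu t - hv t) has_real_derivative 2 * k t - (- 2 / (hu t - \<xi> t)) - (- 2 / (hv t - \<xi> t))) (at t within {0..<\<tau>})"
   by (intro DERIV_diff DERIV_cmult welding_pathsD(3,4)[OF h t] \<xi>d t)
  moreover have "(\<lambda>t. 2 * \<xi> t - hu t - hv t) = D" by (auto simp: D_def a_def b_def)
  moreover have "2 * k t - (- 2 / (hu t - \<xi> t)) - (- 2 / (hv t - \<xi> t)) = - 6 * D t / (a t * b t)"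
  proof -
   have e: "hv t - \<xi> t = b t" "hu t - \<xi> t = - a t" by (simp_all add: a_def b_def)
   show ?thesis unfolding e D_def k_def using pos[OF t] by (simp add: field_simps)
  qed
  ultimately show ?thesis by simp
 qed
 have Spos: "S t > 0" if "t \<in> {0..<\<tau>}" for t using pos[OF that] by (simp add: S_def)
 have z0: "0 \<in> {0..<\<tau>}" using \<tau> by simp
 note const = zero_derivative_constant
 have S00: "S 0 = S0" and D00: "D 0 = - x - y" using x y \<xi>0 by (simp_all add: S_def D_def a_def b_def S0_def)
 have DS: "D t = C * S t ^ 3" if t: "t \<in> {0..<\<tau>}" for t
 proof -
  have "((\<lambda>t. D t / S t ^ 3) has_real_derivative 0) (at t within {0..<\<tau>})" if t: "t \<in> {0..<\<tau>}" for t
  proof -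
   have "((\<lambda>t. D t / S t ^ 3) has_real_derivative
    ((- 6 * D t / (a t * b t)) * S t ^ 3 - D t * (real 3 * ((- 2 * S t / (a t * b t)) * S t ^ (3 - Suc 0)))) / (S t ^ 3 * S t ^ 3)) (at t within {0..<\<tau>})"
    using Spos[OF t] by (intro DERIV_divide DERIV_power Dd[OF t] Sd[OF t]) auto
   moreover have e: "(- 6 * D t / (a t * b t)) * S t ^ 3 - D t * (real 3 * ((- 2 * S t / (a t * b t)) * S t ^ (3 - Suc 0))) = 0"
    by (simp add: power_numeral_reduce)
   ultimately show ?thesis by (simp only: e div_0)
  qed
  from const[OF this t] have "D t / S t ^ 3 = (- x - y) / S0 ^ 3" using S00 D00 by simp
  then show ?thesis using Spos[OF t] unfolding C_def S0_def by (simp add: field_simps)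
 qed
 let ?N = "profile_poly (- (C^2))"
 have N: "?N (S t) = ?N S0 - 8 * t" if t: "t \<in> {0..<\<tau>}" for t
 proof -
  have "((\<lambda>t. ?N (S t) + 8 * t) has_real_derivative 0) (at t within {0..<\<tau>})" if t: "t \<in> {0..<\<tau>}" for t
  proof -
   have "((\<lambda>t. ?N (S t) + 8 * t) has_real_derivative (S t * (1 + - (C^2) * S t ^ 4)) * (- 2 * S t / (a t * b t)) + 8 * 1) (at t within {0..<\<tau>})"
    by (intro DERIV_add DERIV_cmult DERIV_ident DERIV_chain2[OF profile_poly_derivative] Sd[OF t])
   moreover have "(S t * (1 + - (C^2) * S t ^ 4)) * (- 2 * S t / (a t * b t)) + 8 * 1 = 0"
   proof -
    \<comment> \<open>On the invariant cubic \<open>D = C * S^3\<close> the factor from the profile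
      derivative is exactly \<open>4 * a * b\<close>, which cancels the denominator and leaves the
      rate -8.\<close>
    have "S t * (1 + - (C^2) * S t ^ 4) * S t = (S t)^2 - (C * S t ^ 3)^2"
     by (simp add: power2_eq_square power_numeral_reduce algebra_simps)
    also have "\<dots> = (S t)^2 - (D t)^2" by (simp add: DS[OF t])
    also have "\<dots> = 4 * (a t * b t)" by (simp add: S_def D_def power2_eq_square algebra_simps)
    finally have "S t * (1 + - (C^2) * S t ^ 4) * S t = 4 * (a t * b t)" .
    then have "(S t * (1 + - (C^2) * S t ^ 4)) * (- 2 * S t / (a t * b t)) = - 2 * (4 * (a t * b t)) / (a t * b t)"
     by (metis (no_types, opaque_lifting) mult.assoc mult.left_commute times_divide_eq_right)
    also have "\<dots> = - 8" using pos[OF t] by simp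
    finally show ?thesis by simp
   qed
   ultimately show ?thesis by simp
  qed
  from const[OF this t] show ?thesis using S00 by simp
 qed
 have "((\<lambda>t. (hv t - \<xi> t) - (hu t - \<xi> t)) \<longlongrightarrow> 0 - 0) (at_left \<tau>)"
  using h unfolding welding_paths_def by (intro tendsto_diff) auto
 moreover have "(\<lambda>t. (hv t - \<xi> t) - (hu t - \<xi> t)) = S" by (auto simp: S_def a_def b_def)
 ultimately have Slim: "(S \<longlongrightarrow> 0) (at_left \<tau>)" by simp
 have "((\<lambda>t. ?N (S t)) \<longlongrightarrow> 0^2 / 2 + - (C^2) * 0 ^ 6 / 6) (at_left \<tau>)"
  unfolding profile_poly_def by (intro tendsto_intros Slim) auto
 then have l1: "((\<lambda>t. ?N (S t)) \<longlongrightarrow> 0) (at_left \<tau>)" by simp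
 have l2: "((\<lambda>t. ?N S0 - 8 * t) \<longlongrightarrow> ?N S0 - 8 * \<tau>) (at_left \<tau>)" by (intro tendsto_intros)
 have ev: "\<forall>\<^sub>F t in at_left \<tau>. ?N (S t) = ?N S0 - 8 * t"
  using eventually_at_left_real[OF \<tau>] by eventually_elim (use N in auto)
 have "0 = ?N S0 - 8 * \<tau>"
  by (rule tendsto_unique[OF trivial_limit_at_left_real Lim_transform_eventually[OF l1 ev] l2])
 then show \<tau>eq: "\<tau> = ?N S0 / 8" by simp
 show "\<exists>S. 0 \<le> S \<and> S \<le> S0 \<and> ?N S = 8 * (\<tau> - t) \<and> \<xi> t = 2/3 * C * (S ^ 3 - S0 ^ 3)" if t: "t \<in> {0..<\<tau>}"
 proof (intro exI[of _ "S t"] conjI)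
  show "0 \<le> S t" using Spos[OF t] by simp
  show "S t \<le> S0"
  proof -
   have "S t < S 0" if "0 < t"
   proof (rule DERIV_neg_imp_decreasing_open[OF that])
    fix s assume s: "0 < s" "s < t"
    then have s': "s \<in> {0..<\<tau>}" using t by auto
    have "at s within {0..<\<tau>} = at s" using s t by (intro at_within_interior) auto
    with Sd[OF s'] have "(S has_real_derivative - 2 * S s / (a s * b s)) (at s)" by simp
    moreover have "- 2 * S s / (a s * b s) < 0" using pos[OF s'] Spos[OF s'] by simp
    ultimately show "\<exists>y. (S has_real_derivative y) (at s) \<and> y < 0" by blast
   next
    have "continuous_on {0..<\<tau>} S" unfolding continuous_on_eq_continuous_within using Sd DERIV_continuous by blast
    then show "continuous_on {0..t} S" by (rule continuous_on_subset) (use t in auto)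
   qed
   then show ?thesis using S00 t by (cases "t = 0") auto
  qed
  show "?N (S t) = 8 * (\<tau> - t)" using N[OF t] \<tau>eq by simp
  \<comment> \<open>The law is \<open>k = - 4 * D / (a * b)\<close>, two thirds of
    \<open>D'\<close>, so the driver is recovered from \<open>D\<close> by a conserved
    quantity.\<close>
  have "((\<lambda>t. \<xi> t - 2/3 * D t) has_real_derivative 0) (at t within {0..<\<tau>})" if t: "t \<in> {0..<\<tau>}" for t
  proof -
   have "((\<lambda>t. \<xi> t - 2/3 * D t) has_real_derivative k t - 2/3 * (- 6 * D t / (a t * b t))) (at t within {0..<\<tau>})"
    by (intro DERIV_diff DERIV_cmult \<xi>d Dd t)
   moreover have "k t - 2/3 * (- 6 * D t / (a t * b t)) = 0" by (simp add: k_def D_def diff_divide_distrib right_diff_distrib)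
   ultimately show ?thesis by simp
  qed
  from const[OF this t] have "\<xi> t - 2/3 * D t = - 2/3 * D 0" using \<xi>0 by simp
  then show "\<xi> t = 2/3 * C * (S t ^ 3 - S0 ^ 3)"
   using DS[OF t] DS[OF z0] S00 by (simp add: algebra_simps)
 qed
qed


text \<open>The rigidity computation in reverse: start from the profile, read off the driver and
  both distances, and verify the flow equations. The slope then equals the feedback law, so the
  lower bound is attained.\<close>

lemma welding_extremal:
 fixes x y :: real
 assumes xy: "x < 0" "0 < y"
 defines "S0 \<equiv> y - x" and "C \<equiv> (- x - y) / (y - x) ^ 3"
 defines "\<tau> \<equiv> profile_poly (- (C^2)) S0 / 8"
 obtains \<xi> where "\<tau> > 0" "welding_driver x y (\<tau>, \<xi>)" "driver_energy \<tau> \<xi> = ennreal (emw_energy (- x) y)"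
  "\<And>t. t \<in> {0..<\<tau>} \<Longrightarrow> \<exists>S. 0 \<le> S \<and> S \<le> S0 \<and> profile_poly (- (C^2)) S = 8 * (\<tau> - t) \<and> \<xi> t = 2/3 * C * (S ^ 3 - S0 ^ 3)"
proof -
 note cb = welding_constant_bounds[OF xy, folded S0_def C_def]
 define \<kappa> where "\<kappa> = - (C^2)"
 have p: "1 + \<kappa> * S0 ^ 4 > 0" "(8::real) > 0" using cb(2) by (simp_all add: \<kappa>_def)
 have \<tau>\<kappa>: "\<tau> = profile_poly \<kappa> S0 / 8" by (simp add: \<tau>_def \<kappa>_def)
 obtain S where S: "S 0 = S0" "S \<tau> = 0" "continuous_on {0..\<tau>} S"
  "\<And>t. t \<in> {0..<\<tau>} \<Longrightarrow> 0 < S t \<and> S t \<le> S0"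
  "\<And>t. t \<in> {0..<\<tau>} \<Longrightarrow> (S has_real_derivative - 8 / (S t * (1 + \<kappa> * S t ^ 4))) (at t)"
  "\<And>t. t \<in> {0..\<tau>} \<Longrightarrow> profile_poly \<kappa> (S t) = 8 * (\<tau> - t)"
  by (rule profile_exists[OF cb(1) p, folded \<tau>\<kappa>]) (rule that)
 have \<tau>: "\<tau> > 0"
  using profile_poly_strict_mono[of \<kappa> S0 0 S0] cb(1,2) by (simp add: \<tau>_def \<kappa>_def profile_poly_def)
 have fac: "1 + \<kappa> * S t ^ 4 > 0" if "t \<in> {0..\<tau>}" for t
  using profile_factor_pos[of \<kappa> S0 "S t"] cb(1,2) S(2) S(4)[of t] that by (cases "t = \<tau>") (auto simp: \<kappa>_def)
 define \<xi>1 where "\<xi>1 t = 2/3 * C * (S t ^ 3 - S0 ^ 3)" for t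
 \<comment> \<open>The default value outside the interval makes the driver
   \<open>extensional\<close>, as membership in \<open>welding_driver\<close> demands.\<close>
 define \<xi> where "\<xi> t = (if t \<in> {0..\<tau>} then \<xi>1 t else undefined)" for t
 \<comment> \<open>The slope with the factor \<open>S\<close> cancelled; in this form it is
   continuous up to \<tau>, although \<open>S'\<close> blows up there.\<close>
 define F where "F t = - 16 * C * S t / (1 + \<kappa> * S t ^ 4)" for t
 have fs: "2 * C * (S t)^2 * (- 8 / (S t * (1 + \<kappa> * S t ^ 4))) = F t" if "t \<in> {0..<\<tau>}" for t
 proof -
  define Q where "Q = 1 + \<kappa> * S t ^ 4"
  have "Q > 0" "S t > 0" using S(4)[OF that] fac[of t] that by (auto simp: Q_def)
  then show ?thesis unfolding F_def Q_def[symmetric] by (simp add: power2_eq_square field_simps)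
 qed
 have \<xi>1d: "(\<xi>1 has_real_derivative F t) (at t)" if t: "t \<in> {0..<\<tau>}" for t
 proof -
  have "(\<xi>1 has_real_derivative 2/3 * C * (real 3 * ((- 8 / (S t * (1 + \<kappa> * S t ^ 4))) * S t ^ (3 - Suc 0)) - 0)) (at t)"
   unfolding \<xi>1_def by (intro DERIV_cmult DERIV_diff DERIV_const DERIV_power S(5) t)
  moreover have "2/3 * C * (real 3 * ((- 8 / (S t * (1 + \<kappa> * S t ^ 4))) * S t ^ (3 - Suc 0)) - 0) = F t"
   unfolding fs[OF t, symmetric] by simp
  ultimately show ?thesis by (simp only:)
 qed
 have \<xi>d: "(\<xi> has_real_derivative F t) (at t)" if t: "t \<in> {0<..<\<tau>}" for t
  by (rule has_field_derivative_transform_within_open[OF \<xi>1d, of t "{0<..<\<tau>}"]) (use t in \<open>auto simp: \<xi>_def\<close>)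
 have Fc: "continuous_on {0..\<tau>} F" unfolding F_def
  by (intro continuous_intros S(3)) (use fac in force)
 have \<xi>c: "continuous_on {0..\<tau>} \<xi>"
 proof -
  have "continuous_on {0..\<tau>} \<xi>1" unfolding \<xi>1_def by (intro continuous_intros S(3))
  then show ?thesis by (rule continuous_on_eq) (simp add: \<xi>_def)
 qed
 obtain L where L: "\<And>t. t \<in> {0..\<tau>} \<Longrightarrow> norm (F t) \<le> L"
  using compact_imp_bounded[OF compact_continuous_image[OF Fc compact_Icc]] unfolding bounded_iff by blast
 have ac: "abs_continuous_on {0..\<tau>} \<xi>"
  by (rule abs_continuous_on_deriv_bounded[OF \<xi>c \<xi>d, of L]) (use L in auto)
 have fe: "finite_energy \<tau> \<xi> F"
  by (rule finite_energyI[OF ac \<tau> negligible_empty]) (auto intro!: \<xi>d integrable_continuous_real continuous_intros Fc)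
 \<comment> \<open>The distances are determined by \<open>a + b = S\<close> and
   \<open>a - b = C * S^3\<close>.\<close>
 define a where "a t = S t * (1 + C * (S t)^2) / 2" for t
 define b where "b t = S t * (1 - C * (S t)^2) / 2" for t
 have fac2: "1 + \<kappa> * S t ^ 4 = (1 + C * (S t)^2) * (1 - C * (S t)^2)" for t
  by (simp add: \<kappa>_def power_numeral_reduce algebra_simps)
 have pm: "1 + C * (S t)^2 > 0" "1 - C * (S t)^2 > 0" if "t \<in> {0..\<tau>}" for t
 proof -
  have "(C * (S t)^2)^2 < 1" using fac[OF that] by (simp add: \<kappa>_def power_mult_distrib flip: power_mult)
  then have "\<bar>C * (S t)^2\<bar> < 1" by (simp add: abs_square_less_1)
  then show "1 + C * (S t)^2 > 0" "1 - C * (S t)^2 > 0" by linarith+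
 qed
 have ab: "a t > 0" "b t > 0" if "t \<in> {0..<\<tau>}" for t
  using pm[of t] S(4)[OF that] that by (simp_all add: a_def b_def)
 define hu where "hu t = \<xi> t - a t" for t
 define hv where "hv t = \<xi> t + b t" for t
 have hud: "(hu has_real_derivative - 2 / (hu t - \<xi> t)) (at t within {0..<\<tau>})"
  and hvd: "(hv has_real_derivative - 2 / (hv t - \<xi> t)) (at t within {0..<\<tau>})" if t: "t \<in> {0..<\<tau>}" for t
 proof -
  define s where "s = S t"
  define s' where "s' = - 8 / (s * (1 + \<kappa> * s ^ 4))"
  define A where "A = 1 + C * s^2"
  define B where "B = 1 - C * s^2"
  have t': "t \<in> {0..\<tau>}" using t by auto
  have s: "s > 0" using S(4)[OF t] by (simp add: s_def)
  have AB: "A > 0" "B > 0" using pm[OF t'] by (simp_all add: A_def B_def s_def)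
  have s'AB: "s' = - 8 / (s * (A * B))" by (simp add: s'_def A_def B_def s_def fac2)
  have Sd: "(S has_real_derivative s') (at t within {0..<\<tau>})"
   unfolding s'_def s_def by (rule has_field_derivative_at_within[OF S(5)[OF t]])
  have S3: "((\<lambda>t. C * S t ^ 3) has_real_derivative C * (real 3 * (s' * s ^ (3 - Suc 0)))) (at t within {0..<\<tau>})"
   unfolding s_def by (intro DERIV_cmult DERIV_power Sd)
  have x1: "(\<xi>1 has_real_derivative 2/3 * (C * (real 3 * (s' * s ^ (3 - Suc 0)))) - 0) (at t within {0..<\<tau>})"
  proof -
   have "\<xi>1 = (\<lambda>t. 2/3 * (C * S t ^ 3) - 2/3 * C * S0 ^ 3)" by (simp add: \<xi>1_def fun_eq_iff algebra_simps)
   then show ?thesis using DERIV_diff[OF DERIV_cmult[OF S3, of "2/3"] DERIV_const] by simp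
  qed
  have "((\<lambda>t. \<xi>1 t - (S t + C * S t ^ 3) / 2) has_real_derivative
    (2/3 * (C * (real 3 * (s' * s ^ (3 - Suc 0)))) - 0) - (s' + C * (real 3 * (s' * s ^ (3 - Suc 0)))) / 2) (at t within {0..<\<tau>})"
   by (intro DERIV_diff DERIV_cdivide DERIV_add x1 Sd S3)
  moreover have "(2/3 * (C * (real 3 * (s' * s ^ (3 - Suc 0)))) - 0) - (s' + C * (real 3 * (s' * s ^ (3 - Suc 0)))) / 2 = - (s' * B) / 2"
   by (simp add: B_def power2_eq_square algebra_simps)
  moreover have "- (s' * B) / 2 = - 2 / (- (s * A / 2))" unfolding s'AB using s AB by (simp add: field_simps)
  moreover have "hu t - \<xi> t = - (s * A / 2)" by (simp add: hu_def a_def A_def s_def)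
  ultimately have "((\<lambda>t. \<xi>1 t - (S t + C * S t ^ 3) / 2) has_real_derivative - 2 / (hu t - \<xi> t)) (at t within {0..<\<tau>})" by (simp only:)
  then show "(hu has_real_derivative - 2 / (hu t - \<xi> t)) (at t within {0..<\<tau>})"
   by (rule has_field_derivative_transform_within[OF _ zero_less_one t])
     (simp add: hu_def a_def \<xi>_def power_numeral_reduce power2_eq_square algebra_simps)
  have "((\<lambda>t. \<xi>1 t + (S t - C * S t ^ 3) / 2) has_real_derivative
    (2/3 * (C * (real 3 * (s' * s ^ (3 - Suc 0)))) - 0) + (s' - C * (real 3 * (s' * s ^ (3 - Suc 0)))) / 2) (at t within {0..<\<tau>})"
   by (intro DERIV_diff DERIV_cdivide DERIV_add x1 Sd S3)
  moreover have "(2/3 * (C * (real 3 * (s' * s ^ (3 - Suc 0)))) - 0) + (s' - C * (real 3 * (s' * s ^ (3 - Suc 0)))) / 2 = s' * A / 2"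
   by (simp add: A_def power2_eq_square algebra_simps diff_divide_distrib add_divide_distrib)
  moreover have "s' * A / 2 = - 2 / (s * B / 2)" unfolding s'AB using s AB by (simp add: field_simps)
  moreover have "hv t - \<xi> t = s * B / 2" by (simp add: hv_def b_def B_def s_def)
  ultimately have "((\<lambda>t. \<xi>1 t + (S t - C * S t ^ 3) / 2) has_real_derivative - 2 / (hv t - \<xi> t)) (at t within {0..<\<tau>})" by (simp only:)
  then show "(hv has_real_derivative - 2 / (hv t - \<xi> t)) (at t within {0..<\<tau>})"
   by (rule has_field_derivative_transform_within[OF _ zero_less_one t])
     (simp add: hv_def b_def \<xi>_def power_numeral_reduce power2_eq_square algebra_simps)
 qed
 have Slim: "(S \<longlongrightarrow> 0) (at_left \<tau>)" using continuous_on_left_end[OF S(3) \<tau>] S(2) by simp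
 have al: "(a \<longlongrightarrow> 0) (at_left \<tau>)" and bl: "(b \<longlongrightarrow> 0) (at_left \<tau>)"
 proof -
  have "(a \<longlongrightarrow> 0 * (1 + C * 0^2) / 2) (at_left \<tau>)" "(b \<longlongrightarrow> 0 * (1 - C * 0^2) / 2) (at_left \<tau>)"
   unfolding a_def b_def by (intro tendsto_intros Slim; simp)+
  then show "(a \<longlongrightarrow> 0) (at_left \<tau>)" "(b \<longlongrightarrow> 0) (at_left \<tau>)" by simp_all
 qed
 have z0: "0 \<in> {0..\<tau>}" using \<tau> by simp
 have CS: "C * S0 * S0^2 = - x - y" using cb(3) by (simp add: power_numeral_reduce power2_eq_square)
 have \<xi>0: "\<xi> 0 = 0" using z0 S(1) by (simp add: \<xi>_def \<xi>1_def)
 have a0: "a 0 = - x" and b0: "b 0 = y"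
  using CS S(1) by (simp_all add: a_def b_def algebra_simps) (simp_all add: S0_def)
 have hu0: "hu 0 = x" and hv0: "hv 0 = y" using a0 b0 \<xi>0 by (simp_all add: hu_def hv_def)
 have wp: "welding_paths \<xi> \<tau> hu hv"
  unfolding welding_paths_def upward_trajectory_def
 proof (intro conjI ballI refl)
  show "hu t < \<xi> t" "\<xi> t < hv t" if "t \<in> {0..<\<tau>}" for t using ab[OF that] by (simp_all add: hu_def hv_def)
  show "((\<lambda>t. hu t - \<xi> t) \<longlongrightarrow> 0) (at_left \<tau>)" using tendsto_minus[OF al] by (simp add: hu_def)
  show "((\<lambda>t. hv t - \<xi> t) \<longlongrightarrow> 0) (at_left \<tau>)" using bl by (simp add: hv_def)
 qed (use hud hvd in auto)
 have w: "welded_at \<xi> \<tau> x y"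
  unfolding welded_at_def using wp xy unfolding welding_paths_def hu0 hv0 by blast
 show thesis
 proof
  show "\<tau> > 0" by fact
  show "welding_driver x y (\<tau>, \<xi>)"
   unfolding welding_driver_def using \<tau> \<xi>c \<xi>0 w by (auto simp: extensional_def \<xi>_def)
  have "emw_energy (\<xi> 0 - hu 0) (hv 0 - \<xi> 0) = remaining_energy \<tau> F 0 / 2"
  proof (rule emw_eqI[OF fe \<tau> wp])
   fix t assume t: "t \<in> {0<..<\<tau>}"
   then have t': "t \<in> {0..<\<tau>}" by auto
   define s where "s = S t"
   define A where "A = 1 + C * s^2"
   define B where "B = 1 - C * s^2"
   have s: "s > 0" using S(4)[OF t'] by (simp add: s_def)
   have AB: "A > 0" "B > 0" using pm[of t] t by (simp_all add: A_def B_def s_def)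
   have e: "\<xi> t - hu t = s * A / 2" "hv t - \<xi> t = s * B / 2"
    by (simp_all add: hu_def hv_def a_def b_def A_def B_def s_def)
   have "F t = - 16 * C * s / (A * B)" by (simp add: F_def fac2 A_def B_def s_def)
   also have "\<dots> = 4 * (- (C * s ^ 3)) / (s * A / 2 * (s * B / 2))"
    using s AB by (simp add: field_simps power_numeral_reduce)
   also have "- (C * s ^ 3) = s * B / 2 - s * A / 2"
    by (simp add: A_def B_def power_numeral_reduce power2_eq_square field_simps)
   finally show "F t = 4 * (hv t - \<xi> t - (\<xi> t - hu t)) / ((\<xi> t - hu t) * (hv t - \<xi> t))" unfolding e .
  qed
  then have e: "emw_energy (- x) y = remaining_energy \<tau> F 0 / 2" by (simp only: hu0 hv0 \<xi>0 diff_0 diff_zero)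
  show "driver_energy \<tau> \<xi> = ennreal (emw_energy (- x) y)"
   unfolding e driver_energy_eq[OF fe] remaining_energy_def ..
  show "\<exists>S. 0 \<le> S \<and> S \<le> S0 \<and> profile_poly (- (C^2)) S = 8 * (\<tau> - t) \<and> \<xi> t = 2/3 * C * (S ^ 3 - S0 ^ 3)"
   if t: "t \<in> {0..<\<tau>}" for t
   using S(4)[OF t] S(6)[of t] t by (intro exI[of _ "S t"]) (auto simp: \<kappa>_def \<xi>_def \<xi>1_def)
 qed
qed

text \<open>Resolves the definite description. A competitor of equal energy has the same duration
  and, by injectivity of the profile, the same driver before \<tau>; continuity settles the endpoint
  and extensionality the rest. Competitors of infinite energy satisfy the bound trivially.\<close>

lemma EMW_minimizer_energy:
 assumes xy: "x < 0" "0 < y"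
 shows "(case EMW_minimizer x y of (\<tau>, \<xi>) \<Rightarrow> driver_energy \<tau> \<xi>) = ennreal (emw_energy (- x) y)"
proof -
 define S0 where "S0 = y - x"
 define C where "C = (- x - y) / (y - x) ^ 3"
 define \<tau> where "\<tau> = profile_poly (- (C^2)) S0 / 8"
 note cb = welding_constant_bounds[OF xy, folded S0_def C_def]
 obtain \<xi> where \<xi>: "\<tau> > 0" "welding_driver x y (\<tau>, \<xi>)" "driver_energy \<tau> \<xi> = ennreal (emw_energy (- x) y)"
  "\<And>t. t \<in> {0..<\<tau>} \<Longrightarrow> \<exists>S. 0 \<le> S \<and> S \<le> S0 \<and> profile_poly (- (C^2)) S = 8 * (\<tau> - t) \<and> \<xi> t = 2/3 * C * (S ^ 3 - S0 ^ 3)"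
  using welding_extremal[OF xy] unfolding S0_def C_def \<tau>_def by blast
 have lower: "ennreal (emw_energy (- x) y) \<le> driver_energy \<tau>' \<xi>'" 
  and unique: "driver_energy \<tau>' \<xi>' = ennreal (emw_energy (- x) y) \<Longrightarrow> (\<tau>', \<xi>') = (\<tau>, \<xi>)"
  if wd: "welding_driver x y (\<tau>', \<xi>')" for \<tau>' \<xi>'
 proof -
  have w: "\<tau>' > 0" "\<xi>' \<in> extensional {0..\<tau>'}" "continuous_on {0..\<tau>'} \<xi>'" "\<xi>' 0 = 0" "welded_at \<xi>' \<tau>' x y"
   using wd unfolding welding_driver_def by auto
  obtain hu hv where h: "welding_paths \<xi>' \<tau>' hu hv" "hu 0 = x" "hv 0 = y" using welding_paths_exist[OF w(5)] by blast
  have *: "finite_energy \<tau>' \<xi>' (deriv \<xi>')" "driver_energy \<tau>' \<xi>' = ennreal (remaining_energy \<tau>' (deriv \<xi>') 0 / 2)"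
   if "driver_energy \<tau>' \<xi>' < \<infinity>"
   using driver_energy_finite[OF w(1) that] driver_energy_eq[OF driver_energy_finite[OF w(1) that]]
   by (simp_all add: remaining_energy_def)
  show "ennreal (emw_energy (- x) y) \<le> driver_energy \<tau>' \<xi>'"
  proof (cases "driver_energy \<tau>' \<xi>' < \<infinity>")
   case True
   from emw_lower[OF *(1)[OF True] w(1) h(1)] show ?thesis
    unfolding *(2)[OF True] using h(2,3) w(4) by (intro ennreal_leI) simp
  next
   case False
   then have "driver_energy \<tau>' \<xi>' = top" by (simp add: less_top[symmetric])
   then show ?thesis by simp
  qed
  show "(\<tau>', \<xi>') = (\<tau>, \<xi>)" if eq: "driver_energy \<tau>' \<xi>' = ennreal (emw_energy (- x) y)"
  proof -
   have fin: "driver_energy \<tau>' \<xi>' < \<infinity>" unfolding eq by simp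
   have nn: "emw_energy (- x) y \<ge> 0" using emw_energy_nonneg[of "- x" y] xy by simp
   have "emw_energy (- x) y = remaining_energy \<tau>' (deriv \<xi>') 0 / 2"
    using eq unfolding *(2)[OF fin] using nn remaining_energy_nonneg[of \<tau>' "deriv \<xi>'" 0] by (simp add: ennreal_inj)
   note r = emw_rigidity[OF *(1)[OF fin] w(1) h(1,2,3) w(4) this, folded S0_def C_def]
   have \<tau>': "\<tau>' = \<tau>" using r(1) by (simp add: \<tau>_def)
   have agree: "\<xi>' t = \<xi> t" if t: "t \<in> {0..<\<tau>}" for t
   proof -
    obtain S where S: "0 \<le> S" "S \<le> S0" "profile_poly (- (C^2)) S = 8 * (\<tau> - t)" "\<xi>' t = 2/3 * C * (S ^ 3 - S0 ^ 3)"
     using r(2)[of t] t \<tau>' by auto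
    obtain R where R: "0 \<le> R" "R \<le> S0" "profile_poly (- (C^2)) R = 8 * (\<tau> - t)" "\<xi> t = 2/3 * C * (R ^ 3 - S0 ^ 3)"
     using \<xi>(4)[OF t] by auto
    have "R = S"
     using profile_poly_strict_mono[OF cb(2), of R S] profile_poly_strict_mono[OF cb(2), of S R] S R
     by (cases R S rule: linorder_cases) auto
    then show ?thesis using S(4) R(4) by simp
   qed
   note lim = continuous_on_left_end[OF _ \<xi>(1)]
   have c: "continuous_on {0..\<tau>} \<xi>" "\<xi> \<in> extensional {0..\<tau>}" using \<xi>(2) unfolding welding_driver_def by auto
   have "\<forall>\<^sub>F t in at_left \<tau>. \<xi>' t = \<xi> t"
    using eventually_at_left_real[OF \<xi>(1)] by eventually_elim (use agree in auto)
   from Lim_transform_eventually[OF lim[OF w(3)[unfolded \<tau>']] this] lim[OF c(1)]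
   have "\<xi>' \<tau> = \<xi> \<tau>" by (rule tendsto_unique[OF trivial_limit_at_left_real])
   then have "\<xi>' t = \<xi> t" if "t \<in> {0..\<tau>}" for t using agree[of t] that by (cases "t = \<tau>") auto
   then have "\<xi>' = \<xi>" using w(2) c(2) \<tau>' by (intro extensionalityI[of _ "{0..\<tau>}"]) auto
   then show ?thesis using \<tau>' by simp
  qed
 qed
 have "EMW_minimizer x y = (\<tau>, \<xi>)"
  unfolding EMW_minimizer_def
 proof (rule the_equality)
  show "is_arg_min (\<lambda>(\<tau>, \<xi>). driver_energy \<tau> \<xi>) (welding_driver x y) (\<tau>, \<xi>)"
   unfolding is_arg_min_def using \<xi>(2,3) lower by (auto simp: not_less)
  fix p assume p: "is_arg_min (\<lambda>(\<tau>, \<xi>). driver_energy \<tau> \<xi>) (welding_driver x y) p"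
  obtain \<tau>' \<xi>' where pe: "p = (\<tau>', \<xi>')" by (cases p)
  have wd: "welding_driver x y (\<tau>', \<xi>')" using p pe unfolding is_arg_min_def by simp
  have "\<not> driver_energy \<tau> \<xi> < driver_energy \<tau>' \<xi>'"
   using p pe \<xi>(2) unfolding is_arg_min_def by fastforce
  then have "driver_energy \<tau>' \<xi>' = ennreal (emw_energy (- x) y)" using lower[OF wd] \<xi>(3) by simp
  then show "p = (\<tau>, \<xi>)" using unique[OF wd] pe by simp
 qed
 then show ?thesis using \<xi>(3) by simp
qed


text \<open>Both distances are asymptotic to \<open>2 * sqrt \<delta>\<close>, while their squares
  differ by about \<open>- (16/3) * m * \<delta> * sqrt \<delta>\<close>. Hence \<open>A - B\<close>
  is about \<open>- (4/3) * m * \<delta>\<close> and \<open>(A - B)^2 / (4 * A * B)\<close> about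
  \<open>m^2 * \<delta> / 9\<close>.\<close>

lemma emw_energy_rate:
 fixes A B :: "real \<Rightarrow> real"
 assumes pos: "\<forall>\<^sub>F \<delta> in at_right 0. A \<delta> > 0 \<and> B \<delta> > 0"
  and A: "((\<lambda>\<delta>. ((A \<delta>)^2 - 4 * \<delta>) / (\<delta> * sqrt \<delta>)) \<longlongrightarrow> - (8/3) * m) (at_right 0)"
  and B: "((\<lambda>\<delta>. ((B \<delta>)^2 - 4 * \<delta>) / (\<delta> * sqrt \<delta>)) \<longlongrightarrow> 8/3 * m) (at_right 0)"
 shows "((\<lambda>\<delta>. emw_energy (A \<delta>) (B \<delta>) / \<delta>) \<longlongrightarrow> 4/9 * m^2) (at_right 0)"
proof -
 have dpos: "\<forall>\<^sub>F \<delta> in at_right 0. (0::real) < \<delta>" by (simp add: eventually_at_filter)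
 have "((\<lambda>\<delta>::real. sqrt \<delta>) \<longlongrightarrow> sqrt 0) (at_right 0)" by (intro tendsto_real_sqrt tendsto_ident_at)
 then have s0: "((\<lambda>\<delta>::real. sqrt \<delta>) \<longlongrightarrow> 0) (at_right 0)" by simp
 have two: "((\<lambda>\<delta>. X \<delta> / sqrt \<delta>) \<longlongrightarrow> 2) (at_right 0)"
  if X: "((\<lambda>\<delta>. ((X \<delta>)^2 - 4 * \<delta>) / (\<delta> * sqrt \<delta>)) \<longlongrightarrow> l) (at_right 0)" and Xp: "\<forall>\<^sub>F \<delta> in at_right 0. X \<delta> > 0" for X l
 proof -
  have "((\<lambda>\<delta>. sqrt (4 + sqrt \<delta> * (((X \<delta>)^2 - 4 * \<delta>) / (\<delta> * sqrt \<delta>)))) \<longlongrightarrow> sqrt (4 + 0 * l)) (at_right 0)"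
   by (intro tendsto_intros s0 X)
  moreover have "\<forall>\<^sub>F \<delta> in at_right 0. sqrt (4 + sqrt \<delta> * (((X \<delta>)^2 - 4 * \<delta>) / (\<delta> * sqrt \<delta>))) = X \<delta> / sqrt \<delta>"
   using dpos Xp
  proof eventually_elim
   case (elim \<delta>)
   have "sqrt \<delta> * (((X \<delta>)^2 - 4 * \<delta>) / (\<delta> * sqrt \<delta>)) = ((X \<delta>)^2 - 4 * \<delta>) / \<delta>" using elim by simp
   also have "\<dots> = (X \<delta>)^2 / \<delta> - 4" using elim by (simp add: diff_divide_distrib)
   finally have "4 + sqrt \<delta> * (((X \<delta>)^2 - 4 * \<delta>) / (\<delta> * sqrt \<delta>)) = (X \<delta>)^2 / \<delta>" by simp
   then show ?case using elim by (simp add: real_sqrt_divide)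
  qed
  ultimately show ?thesis using Lim_transform_eventually by fastforce
 qed
 have A2: "((\<lambda>\<delta>. A \<delta> / sqrt \<delta>) \<longlongrightarrow> 2) (at_right 0)" by (rule two[OF A]) (use pos in \<open>auto elim: eventually_mono\<close>)
 have B2: "((\<lambda>\<delta>. B \<delta> / sqrt \<delta>) \<longlongrightarrow> 2) (at_right 0)" by (rule two[OF B]) (use pos in \<open>auto elim: eventually_mono\<close>)
 define z where "z \<delta> = (A \<delta> - B \<delta>)^2 / (4 * A \<delta> * B \<delta>)" for \<delta>
 let ?q = "\<lambda>\<delta>. (((A \<delta>)^2 - 4 * \<delta>) / (\<delta> * sqrt \<delta>) - ((B \<delta>)^2 - 4 * \<delta>) / (\<delta> * sqrt \<delta>)) / (A \<delta> / sqrt \<delta> + B \<delta> / sqrt \<delta>)"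
 have q1: "((\<lambda>\<delta>. (?q \<delta>)^2 / (4 * (A \<delta> / sqrt \<delta>) * (B \<delta> / sqrt \<delta>))) \<longlongrightarrow> ((- (8/3) * m - 8/3 * m) / (2 + 2))^2 / (4 * 2 * 2)) (at_right 0)"
  by (intro tendsto_intros A B A2 B2) auto
 have q2: "((- (8/3) * m - 8/3 * m) / (2 + 2))^2 / (4 * 2 * 2) = m^2 / 9" by (simp add: power2_eq_square)
 have q3: "\<forall>\<^sub>F \<delta> in at_right 0. (?q \<delta>)^2 / (4 * (A \<delta> / sqrt \<delta>) * (B \<delta> / sqrt \<delta>)) = z \<delta> / \<delta>"
  using dpos pos
 proof eventually_elim
  case (elim \<delta>)
  define r where "r = sqrt \<delta>"
  have r: "r > 0" "\<delta> = r * r" using elim by (simp_all add: r_def)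
  define a where "a = A \<delta>"
  define b where "b = B \<delta>"
  have ab: "a > 0" "b > 0" using elim by (auto simp: a_def b_def)
  have "(a^2 - 4 * \<delta>) / (\<delta> * r) - (b^2 - 4 * \<delta>) / (\<delta> * r) = (a - b) * (a + b) / (\<delta> * r)"
   by (simp add: power2_eq_square algebra_simps flip: diff_divide_distrib)
  moreover have "a / r + b / r = (a + b) / r" by (simp add: add_divide_distrib)
  moreover have "(a - b) * c / (\<delta> * r) / (c / r) = (a - b) / \<delta>" if "c > 0" for c
   unfolding r(2) using that r(1) by (simp add: field_simps)
  ultimately have q: "((a^2 - 4 * \<delta>) / (\<delta> * r) - (b^2 - 4 * \<delta>) / (\<delta> * r)) / (a / r + b / r) = (a - b) / \<delta>"
   using ab by simp
  have "((a - b) / \<delta>)^2 / (4 * (a / r) * (b / r)) = ((a - b)^2 / (4 * a * b)) / \<delta>"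
   using ab r by (simp add: field_simps power2_eq_square)
  then show ?case using q unfolding z_def a_def b_def r_def by simp
 qed
 have zl: "((\<lambda>\<delta>. z \<delta> / \<delta>) \<longlongrightarrow> m^2 / 9) (at_right 0)"
  using Lim_transform_eventually[OF q1 q3] unfolding q2 .
 have znn: "\<forall>\<^sub>F \<delta> in at_right 0. z \<delta> \<ge> 0" using pos by eventually_elim (simp add: z_def)
 have "((\<lambda>\<delta>. 4 * (ln (1 + z \<delta>) / \<delta>)) \<longlongrightarrow> 4 * (m^2 / 9)) (at_right 0)"
  by (intro tendsto_intros ln_one_plus_rate zl znn)
 moreover have "\<forall>\<^sub>F \<delta> in at_right 0. 4 * (ln (1 + z \<delta>) / \<delta>) = emw_energy (A \<delta>) (B \<delta>) / \<delta>"
  using pos by eventually_elim (simp add: emw_energy_eq z_def)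
 ultimately show ?thesis using Lim_transform_eventually by fastforce
qed

lemma welding_energy_ratio:
 assumes T: "T > 0" and C1: "C1_holder \<beta> {0..<T} \<eta> \<eta>'" and \<eta>0: "\<eta> 0 = 0" and m: "\<eta>' 0 \<noteq> 0"
  and w: "\<And>\<delta>. \<delta> \<in> {0<..<T} \<Longrightarrow> welded_at \<eta> \<delta> (u \<delta>) (v \<delta>)"
 shows "((\<lambda>\<delta>. driver_energy \<delta> \<eta> / (case EMW_minimizer (u \<delta>) (v \<delta>) of (\<tau>, \<xi>) \<Rightarrow> driver_energy \<tau> \<xi>))
       \<longlongrightarrow> 9/8) (at_right 0)"
proof -
 have der: "(\<eta> has_real_derivative \<eta>' t) (at t within {0..<T})" if "t \<in> {0..<T}" for t
  using C1 that unfolding C1_holder_def by blast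
 have cont: "continuous_on {0..<T} \<eta>'" using C1 unfolding C1_holder_def by blast
 have "\<forall>\<delta>\<in>{0<..<T}. \<exists>h. welding_paths \<eta> \<delta> (fst h) (snd h) \<and> fst h 0 = u \<delta> \<and> snd h 0 = v \<delta>"
  using welding_paths_exist[OF w] by (metis fst_conv snd_conv)
 then obtain H where H: "\<And>\<delta>. \<delta> \<in> {0<..<T} \<Longrightarrow> welding_paths \<eta> \<delta> (fst (H \<delta>)) (snd (H \<delta>))"
  "\<And>\<delta>. \<delta> \<in> {0<..<T} \<Longrightarrow> fst (H \<delta>) 0 = u \<delta>" "\<And>\<delta>. \<delta> \<in> {0<..<T} \<Longrightarrow> snd (H \<delta>) 0 = v \<delta>" by metis
 have ev: "\<forall>\<^sub>F \<delta> in at_right 0. \<delta> \<in> {0<..<T}" using T by (rule eventually_at_right_real)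
 have uv: "u \<delta> < 0" "0 < v \<delta>" if "\<delta> \<in> {0<..<T}" for \<delta> using w[OF that] unfolding welded_at_def by auto
 note hd = welding_paths_driven[OF H(1)]
 have 1: "((\<lambda>\<delta>. ((- \<i> * of_real (fst (H \<delta>) 0) - - \<i> * of_real (\<eta> 0))^2 + 4 * of_real \<delta>) / of_real (\<delta> * sqrt \<delta>))
   \<longlongrightarrow> (8 * \<i> / 3) * (- \<i>) * of_real (\<eta>' 0)) (at_right 0)"
 proof (rule driven_path_tip_asymp[OF T der cont])
  show "0 < Im (- \<i> * of_real (fst (H \<delta>) t) - - \<i> * of_real (\<eta> t))" if "\<delta> \<in> {0<..<T}" "t \<in> {0..<\<delta>}" for \<delta> t
   using welding_pathsD(1)[OF H(1)[OF that(1)] that(2)] by simp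
 qed (use hd(1,3) in auto)
 have 2: "((\<lambda>\<delta>. ((\<i> * of_real (snd (H \<delta>) 0) - \<i> * of_real (\<eta> 0))^2 + 4 * of_real \<delta>) / of_real (\<delta> * sqrt \<delta>))
   \<longlongrightarrow> (8 * \<i> / 3) * \<i> * of_real (\<eta>' 0)) (at_right 0)"
 proof (rule driven_path_tip_asymp[OF T der cont])
  show "0 < Im (\<i> * of_real (snd (H \<delta>) t) - \<i> * of_real (\<eta> t))" if "\<delta> \<in> {0<..<T}" "t \<in> {0..<\<delta>}" for \<delta> t
   using welding_pathsD(2)[OF H(1)[OF that(1)] that(2)] by simp
 qed (use hd(2,4) in auto)
 \<comment> \<open>The rotated trajectory starts at \<open>\<i> * (- u \<delta>)\<close>, so its
   square is \<open>- (u \<delta>)^2\<close>; the tip asymptotics are negated to return to real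
   distances.\<close>
 have A: "((\<lambda>\<delta>. ((- u \<delta>)^2 - 4 * \<delta>) / (\<delta> * sqrt \<delta>)) \<longlongrightarrow> - (8/3) * \<eta>' 0) (at_right 0)"
 proof -
  have *: "\<forall>\<^sub>F \<delta> in at_right 0. - (((- \<i> * of_real (fst (H \<delta>) 0) - - \<i> * of_real (\<eta> 0))^2 + 4 * of_real \<delta>) / of_real (\<delta> * sqrt \<delta>))
    = complex_of_real (((- u \<delta>)^2 - 4 * \<delta>) / (\<delta> * sqrt \<delta>))"
   using ev
  proof eventually_elim
   case (elim \<delta>)
   have "- ((- \<i> * of_real (u \<delta>) - - \<i> * of_real (\<eta> 0))^2 + 4 * of_real \<delta>) = complex_of_real ((- u \<delta>)^2 - 4 * \<delta>)"
    by (simp add: \<eta>0 power_mult_distrib)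
   then show ?case unfolding H(2)[OF elim] minus_divide_left by simp
  qed
  have "((\<lambda>\<delta>. complex_of_real (((- u \<delta>)^2 - 4 * \<delta>) / (\<delta> * sqrt \<delta>))) \<longlongrightarrow> of_real (- (8/3) * \<eta>' 0)) (at_right 0)"
  proof -
   have e: "- ((8 * \<i> / 3) * (- \<i>) * of_real (\<eta>' 0)) = complex_of_real (- (8/3) * \<eta>' 0)" by (simp add: complex_eq_iff)
   from Lim_transform_eventually[OF tendsto_minus[OF 1] *] show ?thesis unfolding e .
  qed
  then show ?thesis by (simp only: tendsto_of_real_iff)
 qed
 have B: "((\<lambda>\<delta>. ((v \<delta>)^2 - 4 * \<delta>) / (\<delta> * sqrt \<delta>)) \<longlongrightarrow> 8/3 * \<eta>' 0) (at_right 0)"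
 proof -
  have *: "\<forall>\<^sub>F \<delta> in at_right 0. - (((\<i> * of_real (snd (H \<delta>) 0) - \<i> * of_real (\<eta> 0))^2 + 4 * of_real \<delta>) / of_real (\<delta> * sqrt \<delta>))
    = complex_of_real (((v \<delta>)^2 - 4 * \<delta>) / (\<delta> * sqrt \<delta>))"
   using ev
  proof eventually_elim
   case (elim \<delta>)
   have "- ((\<i> * of_real (v \<delta>) - \<i> * of_real (\<eta> 0))^2 + 4 * of_real \<delta>) = complex_of_real ((v \<delta>)^2 - 4 * \<delta>)"
    by (simp add: \<eta>0 power_mult_distrib)
   then show ?case unfolding H(3)[OF elim] minus_divide_left by simp
  qed
  have "((\<lambda>\<delta>. complex_of_real (((v \<delta>)^2 - 4 * \<delta>) / (\<delta> * sqrt \<delta>))) \<longlongrightarrow> of_real (8/3 * \<eta>' 0)) (at_right 0)"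
  proof -
   have e: "- ((8 * \<i> / 3) * \<i> * of_real (\<eta>' 0)) = complex_of_real (8/3 * \<eta>' 0)" by (simp add: complex_eq_iff)
   from Lim_transform_eventually[OF tendsto_minus[OF 2] *] show ?thesis unfolding e .
  qed
  then show ?thesis by (simp only: tendsto_of_real_iff)
 qed
 show ?thesis
 proof (rule energy_ratio_limit[where R = "\<lambda>\<delta>. remaining_energy \<delta> \<eta>' 0" and \<Psi> = "\<lambda>\<delta>. emw_energy (- u \<delta>) (v \<delta>)" and m = "\<eta>' 0"])
  show "\<forall>\<^sub>F \<delta> in at_right 0. driver_energy \<delta> \<eta> = ennreal (remaining_energy \<delta> \<eta>' 0 / 2)"
   using ev by eventually_elim (simp only: driver_energy_eq[OF finite_energy_C1[OF der cont]] remaining_energy_def)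
  show "\<forall>\<^sub>F \<delta> in at_right 0. (case EMW_minimizer (u \<delta>) (v \<delta>) of (\<tau>, \<xi>) \<Rightarrow> driver_energy \<tau> \<xi>) = ennreal (emw_energy (- u \<delta>) (v \<delta>))"
   using ev by eventually_elim (intro EMW_minimizer_energy uv)
  show "((\<lambda>\<delta>. remaining_energy \<delta> \<eta>' 0 / \<delta>) \<longlongrightarrow> (\<eta>' 0)^2) (at_right 0)" by (rule energy_rate[OF T cont])
  show "((\<lambda>\<delta>. emw_energy (- u \<delta>) (v \<delta>) / \<delta>) \<longlongrightarrow> 4/9 * (\<eta>' 0)^2) (at_right 0)"
  proof (rule emw_energy_rate[OF _ A B])
   show "\<forall>\<^sub>F \<delta> in at_right 0. 0 < - u \<delta> \<and> 0 < v \<delta>" using ev by eventually_elim (use uv in auto)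
  qed
 qed (use m remaining_energy_nonneg in auto)
qed

subsection \<open>Mapping-out functions\<close>

lemma upper_half_plane_open: "open upper_half_plane"
 unfolding upper_half_plane_def by (rule open_halfspace_Im_gt)

lemma upper_half_plane_connected: "connected upper_half_plane"
 unfolding upper_half_plane_def by (intro convex_connected convex_halfspace_Im_gt)

text \<open>An arc has no interior. Otherwise its inverse would map a disc injectively and
  continuously into the line: deleting the point with a middle value leaves the punctured disc
  connected, yet its image would miss an intermediate value.\<close>

lemma arc_image_not_superset_open:
 fixes \<gamma> :: "real \<Rightarrow> complex"
 assumes c: "continuous_on {a..b} \<gamma>" and inj: "inj_on \<gamma> {a..b}" and U: "open U" "U \<noteq> {}"
 shows "\<not> U \<subseteq> \<gamma> ` {a..b}"
proof
 assume sub: "U \<subseteq> \<gamma> ` {a..b}"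
 obtain p r where pr: "r > 0" "ball p r \<subseteq> U" using U openE by blast
 define h where "h = the_inv_into {a..b} \<gamma>"
 have hg: "h (\<gamma> t) = t" if "t \<in> {a..b}" for t unfolding h_def by (rule the_inv_into_f_f[OF inj that])
 have gh: "\<gamma> (h z) = z" if "z \<in> \<gamma> ` {a..b}" for z using that hg by auto
 have "continuous_on (\<gamma> ` {a..b}) h" by (rule continuous_on_inv[OF c compact_Icc]) (use hg in auto)
 then have hc: "continuous_on (ball p r) h" by (rule continuous_on_subset) (use pr sub in auto)
 have B: "gh_ok \<in> ball p r \<Longrightarrow> \<gamma> (h gh_ok) = gh_ok" for gh_ok using gh pr sub by blast
 have hinj: "inj_on h (ball p r)" by (rule inj_on_inverseI[of _ \<gamma>]) (use B in auto)
 \<comment> \<open>Three distinct points suffice, as one of their three values lies strictly between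
   the others.\<close>
 define q1 where "q1 = p + of_real (r/2)"
 define q2 where "q2 = p + \<i> * of_real (r/2)"
 have q: "p \<in> ball p r" "q1 \<in> ball p r" "q2 \<in> ball p r" "q1 \<noteq> p" "q2 \<noteq> p" "q1 \<noteq> q2"
  using pr(1) by (auto simp: q1_def q2_def dist_norm norm_mult complex_eq_iff)
 have hne: "h q1 \<noteq> h p" "h q2 \<noteq> h p" "h q1 \<noteq> h q2" using hinj q by (auto simp: inj_on_def)
 have no_between: False
  if xyz: "x \<in> ball p r" "y \<in> ball p r" "m \<in> ball p r" "h x < h m" "h m < h y" for x y m
 proof -
  have "connected (ball p r - {m})"
   using connected_open_delete[of "ball p r" m] by simp
  then have "connected (h ` (ball p r - {m}))"
   by (intro connected_continuous_image continuous_on_subset[OF hc]) auto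
  moreover have "h x \<in> h ` (ball p r - {m})" "h y \<in> h ` (ball p r - {m})" using xyz by auto
  ultimately have "h m \<in> h ` (ball p r - {m})" using xyz by (meson connectedD_interval less_imp_le)
  then show False using hinj xyz(3) by (auto simp: inj_on_def)
 qed
 consider "h q1 < h p" "h p < h q2" | "h q2 < h p" "h p < h q1" | "h p < h q1" "h q1 < h q2" | "h p < h q2" "h q2 < h q1"
  | "h q1 < h q2" "h q2 < h p" | "h q2 < h q1" "h q1 < h p"
  using hne by linarith
 then show False
  by cases (use no_between q in blast)+
qed

lemma cmod_diff_cnj: "(cmod (w - cnj z))^2 = (cmod (w - z))^2 + 4 * Im w * Im z"
 unfolding cmod_power2 by (simp add: power2_eq_square algebra_simps)

text \<open>The Schwarz lemma after Cayley maps centred at \<open>z\<close> and at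
  \<open>A z\<close>. The cross-multiplied form can be squared and compared without
  divisions.\<close>

lemma Schwarz_Pick_half_plane:
 assumes A: "A holomorphic_on upper_half_plane" "A ` upper_half_plane \<subseteq> upper_half_plane"
  and z: "z \<in> upper_half_plane" and w: "w \<in> upper_half_plane"
 shows "cmod (A w - A z) * cmod (w - cnj z) \<le> cmod (w - z) * cmod (A w - cnj (A z))"
proof -
 have ne: "w - cnj z \<noteq> 0" if "w \<in> upper_half_plane" "z \<in> upper_half_plane" for w z
  using that by (auto simp: upper_half_plane_def complex_eq_iff)
 have less: "cmod ((w - z) / (w - cnj z)) < 1" if wz: "w \<in> upper_half_plane" "z \<in> upper_half_plane" for w z
 proof -
  have "(cmod (w - z))^2 < (cmod (w - cnj z))^2"
   unfolding cmod_diff_cnj using wz by (simp add: upper_half_plane_def)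
  then have "cmod (w - z) < cmod (w - cnj z)" by (rule power2_less_imp_less) simp
  then show ?thesis by (simp add: norm_divide divide_less_eq)
 qed
 \<comment> \<open>The inverse Cayley map, from the disc to the half-plane, sending 0 to
   \<open>z\<close>.\<close>
 define D where "D \<zeta> = (z - cnj z * \<zeta>) / (1 - \<zeta>)" for \<zeta>
 have D: "D \<zeta> \<in> upper_half_plane" if "\<zeta> \<in> ball 0 1" for \<zeta>
 proof -
  have nz: "1 - \<zeta> \<noteq> 0" using that by auto
  have "D \<zeta> = ((z - cnj z * \<zeta>) * cnj (1 - \<zeta>)) / of_real ((cmod (1 - \<zeta>))^2)"
   unfolding D_def by (subst complex_div_cnj) (simp only: of_real_power)
  then have "Im (D \<zeta>) = Im ((z - cnj z * \<zeta>) * cnj (1 - \<zeta>)) / (cmod (1 - \<zeta>))^2"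
   by (simp only: Im_divide_of_real)
  also have "Im ((z - cnj z * \<zeta>) * cnj (1 - \<zeta>)) = Im z * (1 - (cmod \<zeta>)^2)"
   unfolding cmod_power2 by (simp add: power2_eq_square algebra_simps)
  finally show ?thesis using nz z that by (simp add: upper_half_plane_def abs_square_less_1)
 qed
 have DC: "D ((w - z) / (w - cnj z)) = w"
 proof -
  define q where "q = w - cnj z"
  have q: "q \<noteq> 0" "w = q + cnj z" using ne[OF w z] by (auto simp: q_def)
  have zz: "z - cnj z \<noteq> 0" using z by (auto simp: upper_half_plane_def complex_eq_iff)
  have "1 - (w - z) / q = (z - cnj z) / q" using q by (simp add: field_simps)
  moreover have "z - cnj z * ((w - z) / q) = w * (z - cnj z) / q" using q by (simp add: field_simps)
  ultimately show ?thesis unfolding D_def q_def[symmetric] using q zz by simp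
 qed
 define f where "f \<zeta> = (A (D \<zeta>) - A z) / (A (D \<zeta>) - cnj (A z))" for \<zeta>
 have Az: "A v \<in> upper_half_plane" if "v \<in> upper_half_plane" for v using A(2) that by auto
 have "D holomorphic_on ball 0 1" unfolding D_def by (intro holomorphic_intros) auto
 then have "A \<circ> D holomorphic_on ball 0 1"
  by (rule holomorphic_on_compose_gen[OF _ A(1)]) (use D in auto)
 then have AD: "(\<lambda>\<zeta>. A (D \<zeta>)) holomorphic_on ball 0 1" by (simp add: o_def)
 have f: "f holomorphic_on ball 0 1" unfolding f_def
  by (intro holomorphic_intros AD) (use ne Az D z in blast)
 have "D 0 = z" by (simp add: D_def)
 then have "f 0 = 0" by (simp add: f_def)
 moreover have "norm (f \<zeta>) < 1" if "norm \<zeta> < 1" for \<zeta>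
  unfolding f_def using that by (intro less Az D z) auto
 ultimately have "norm (f ((w - z) / (w - cnj z))) \<le> norm ((w - z) / (w - cnj z))"
  using less[OF w z] by (intro Schwarz_Lemma(1)[OF f])
 then have "cmod (A w - A z) / cmod (A w - cnj (A z)) \<le> cmod (w - z) / cmod (w - cnj z)"
  unfolding f_def DC by (simp add: norm_divide)
 moreover have "cmod (A w - cnj (A z)) > 0" "cmod (w - cnj z) > 0" using ne[OF w z] ne[OF Az[OF w] Az[OF z]] by auto
 ultimately show ?thesis by (simp add: field_simps)
qed

text \<open>Schwarz-Pick for \<open>A\<close> and for its left inverse gives equality, so
  \<open>A\<close> is an isometry. Comparing any point with points going to infinity along the
  imaginary axis, which \<open>A\<close> barely moves, forces \<open>Im (A w) = Im w\<close>. Then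
  \<open>A w - w\<close> has real values only, is constant by the open mapping theorem, and the
  constant is 0 by the behaviour at infinity.\<close>

lemma half_plane_automorphism_identity:
 assumes A: "A holomorphic_on upper_half_plane" "A ` upper_half_plane \<subseteq> upper_half_plane"
  and B: "B holomorphic_on upper_half_plane" "B ` upper_half_plane \<subseteq> upper_half_plane"
  and BA: "\<And>z. z \<in> upper_half_plane \<Longrightarrow> B (A z) = z"
  and z: "\<forall>\<^sub>F n in sequentially. z n \<in> upper_half_plane"
  and zl: "(\<lambda>n. z n - \<i> * of_nat n) \<longlonglongrightarrow> 0" and Azl: "(\<lambda>n. A (z n) - \<i> * of_nat n) \<longlonglongrightarrow> 0"
  and w: "w \<in> upper_half_plane"
 shows "A w = w"
proof -
 have Am: "A v \<in> upper_half_plane" if "v \<in> upper_half_plane" for v using A(2) that by auto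
 have id: "(cmod (A w - A z))^2 * (Im w * Im z) = (cmod (w - z))^2 * (Im (A w) * Im (A z))"
  if w: "w \<in> upper_half_plane" and z: "z \<in> upper_half_plane" for w z
 proof -
  have "cmod (A w - A z) * cmod (w - cnj z) \<le> cmod (w - z) * cmod (A w - cnj (A z))"
   by (rule Schwarz_Pick_half_plane[OF A z w])
  moreover have "cmod (w - z) * cmod (A w - cnj (A z)) \<le> cmod (A w - A z) * cmod (w - cnj z)"
   using Schwarz_Pick_half_plane[OF B Am[OF z] Am[OF w]] BA[OF w] BA[OF z] by simp
  ultimately have "(cmod (A w - A z) * cmod (w - cnj z))^2 = (cmod (w - z) * cmod (A w - cnj (A z)))^2" by simp
  then have "(cmod (A w - A z))^2 * ((cmod (w - z))^2 + 4 * Im w * Im z)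
    = (cmod (w - z))^2 * ((cmod (A w - A z))^2 + 4 * Im (A w) * Im (A z))"
   unfolding power_mult_distrib cmod_diff_cnj .
  then show ?thesis by (simp add: algebra_simps)
 qed
 have over_n: "(\<lambda>n. X n / of_nat n) \<longlonglongrightarrow> \<i>" if X: "(\<lambda>n. X n - \<i> * of_nat n) \<longlonglongrightarrow> 0" for X :: "nat \<Rightarrow> complex"
 proof -
  have "(\<lambda>n. (X n - \<i> * of_nat n) * (1 / of_nat n) + \<i>) \<longlonglongrightarrow> 0 * 0 + \<i>"
   by (intro tendsto_intros X lim_1_over_n)
  moreover have "\<forall>\<^sub>F n in sequentially. (X n - \<i> * of_nat n) * (1 / of_nat n) + \<i> = X n / of_nat n"
   using eventually_gt_at_top[of 0] by eventually_elim (simp add: field_simps)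
  ultimately show ?thesis using Lim_transform_eventually by fastforce
 qed
 have c0: "(\<lambda>n. c / of_nat n) \<longlonglongrightarrow> 0" for c :: complex
  using tendsto_mult[OF tendsto_const lim_1_over_n, of c] by simp
 have Im_eq: "Im (A w) = Im w" if w: "w \<in> upper_half_plane" for w
 proof -
  \<comment> \<open>The isometry identity divided by the cube of \<open>n\<close>: both sides
    converge, one to \<open>Im w\<close> and the other to \<open>Im (A w)\<close>.\<close>
  have l1: "(\<lambda>n. (cmod (A w / of_nat n - A (z n) / of_nat n))^2 * (Im w * Im (z n / of_nat n))) \<longlonglongrightarrow> (cmod (0 - \<i>))^2 * (Im w * Im \<i>)"
   by (intro tendsto_intros c0 over_n zl Azl)
  have l2: "(\<lambda>n. (cmod (w / of_nat n - z n / of_nat n))^2 * (Im (A w) * Im (A (z n) / of_nat n))) \<longlonglongrightarrow> (cmod (0 - \<i>))^2 * (Im (A w) * Im \<i>)"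
   by (intro tendsto_intros c0 over_n zl Azl)
  have "\<forall>\<^sub>F n in sequentially. (cmod (A w / of_nat n - A (z n) / of_nat n))^2 * (Im w * Im (z n / of_nat n))
    = (cmod (w / of_nat n - z n / of_nat n))^2 * (Im (A w) * Im (A (z n) / of_nat n))"
   using z eventually_gt_at_top[of 0]
  proof eventually_elim
   case (elim n)
   have e: "cmod (a / of_nat n - b / of_nat n) = cmod (a - b) / n" "Im (a / of_nat n) = Im a / n" for a b :: complex
    by (simp_all add: norm_divide flip: diff_divide_distrib)
   show ?case unfolding e power_divide using id[OF w elim(1)] elim(2) by (simp add: field_simps)
  qed
  from Lim_transform_eventually[OF l1 this] l2 show ?thesis
   using LIMSEQ_unique by fastforce
 qed
 define r where "r v = A v - v" for v
 have "r holomorphic_on upper_half_plane" unfolding r_def by (intro holomorphic_intros A)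
 have "r constant_on upper_half_plane"
 proof (rule ccontr)
  assume "\<not> ?thesis"
  then have op: "open (r ` upper_half_plane)"
   using open_mapping_thm[OF \<open>r holomorphic_on upper_half_plane\<close> upper_half_plane_open upper_half_plane_connected upper_half_plane_open] by blast
  have "r w \<in> r ` upper_half_plane" using w by auto
  then obtain e where e: "e > 0" "ball (r w) e \<subseteq> r ` upper_half_plane" using op openE by metis
  have "r w + \<i> * of_real (e/2) \<in> ball (r w) e" using e(1) by (simp add: dist_norm norm_mult)
  then obtain v where v: "v \<in> upper_half_plane" "r v = r w + \<i> * of_real (e/2)" using e(2) by (metis (no_types, lifting) imageE subsetD)
  then have "Im (r v) = Im (r w) + e/2" by simp
  then show False using Im_eq[OF v(1)] Im_eq[OF w] e(1) by (simp add: r_def)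
 qed
 then obtain c where c: "\<And>v. v \<in> upper_half_plane \<Longrightarrow> r v = c" unfolding constant_on_def by blast
 have "(\<lambda>n. (A (z n) - \<i> * of_nat n) - (z n - \<i> * of_nat n)) \<longlonglongrightarrow> 0 - 0" by (intro tendsto_diff zl Azl)
 moreover have "\<forall>\<^sub>F n in sequentially. (A (z n) - \<i> * of_nat n) - (z n - \<i> * of_nat n) = c"
  using z by eventually_elim (use c in \<open>auto simp: r_def\<close>)
 ultimately have "(\<lambda>n. c) \<longlonglongrightarrow> 0" using Lim_transform_eventually by fastforce
 then have "c = 0" using LIMSEQ_const_iff by blast
 then show ?thesis using c[OF w] by (simp add: r_def)
qed

text \<open>Sampling along the imaginary axis turns the normalisation at infinity into a sequence
  limit; a bounded hull leaves these points in the domain for large \<open>n\<close>.\<close>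

lemma mapping_out_asymptotics:
 assumes g: "mapping_out K c g" and K: "bounded K"
 shows "\<forall>\<^sub>F n in sequentially. \<i> * of_nat n \<in> upper_half_plane - K"
  and "(\<lambda>n. g (\<i> * of_nat n) - \<i> * of_nat n) \<longlonglongrightarrow> 0"
proof -
 obtain R where R: "\<And>z. z \<in> K \<Longrightarrow> cmod z \<le> R" using K unfolding bounded_iff by blast
 show ev: "\<forall>\<^sub>F n in sequentially. \<i> * of_nat n \<in> upper_half_plane - K"
  using eventually_gt_at_top[of "max 0 (nat \<lceil>R\<rceil>)"]
 proof eventually_elim
  case (elim n)
  have "\<i> * of_nat n \<notin> K"
  proof
   assume "\<i> * of_nat n \<in> K"
   from R[OF this] have "real n \<le> R" by (simp add: norm_mult)
   moreover have "R \<le> real (nat \<lceil>R\<rceil>)" by (rule real_nat_ceiling_ge)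
   moreover have "nat \<lceil>R\<rceil> < n" using elim by simp
   ultimately show False by linarith
  qed
  then show ?case using elim by (simp add: upper_half_plane_def)
 qed
 have "(\<lambda>z. g z - z - of_real c / z) \<in> O[inf at_infinity (principal (upper_half_plane - K))](\<lambda>z. 1 / z^2)"
  using g unfolding mapping_out_def by blast
 then obtain C where "C > 0" and C: "\<forall>\<^sub>F z in inf at_infinity (principal (upper_half_plane - K)). cmod (g z - z - of_real c / z) \<le> C * cmod (1 / z^2)"
  by (rule landau_o.bigE)
 have "\<exists>b. \<forall>z. b \<le> norm z \<longrightarrow> z \<in> upper_half_plane - K \<longrightarrow> cmod (g z - z - of_real c / z) \<le> C * cmod (1 / z^2)"
  using C unfolding eventually_inf_principal eventually_at_infinity .
 then obtain b where b0: "\<forall>z. b \<le> norm z \<longrightarrow> z \<in> upper_half_plane - K \<longrightarrow> cmod (g z - z - of_real c / z) \<le> C * cmod (1 / z^2)"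
  by (rule exE)
 have b: "cmod (g z - z - of_real c / z) \<le> C * cmod (1 / z^2)" if "cmod z \<ge> b" "z \<in> upper_half_plane - K" for z
  using b0[rule_format, OF that] .
 have l: "(\<lambda>n. C * cmod (1 / of_nat n)^2 + cmod (of_real c * (- \<i>) * (1 / of_nat n))) \<longlonglongrightarrow> C * cmod 0 ^ 2 + cmod (of_real c * (- \<i>) * 0)"
  by (intro tendsto_intros lim_1_over_n)
 then have l: "(\<lambda>n. C * cmod (1 / of_nat n)^2 + cmod (of_real c * (- \<i>) * (1 / of_nat n))) \<longlonglongrightarrow> 0" by simp
 show "(\<lambda>n. g (\<i> * of_nat n) - \<i> * of_nat n) \<longlonglongrightarrow> 0"
 proof (rule Lim_null_comparison[OF _ l])
  show "\<forall>\<^sub>F n in sequentially. cmod (g (\<i> * of_nat n) - \<i> * of_nat n) \<le> C * cmod (1 / of_nat n)^2 + cmod (of_real c * (- \<i>) * (1 / of_nat n))"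
   using ev eventually_gt_at_top[of "nat \<lceil>b\<rceil>"] eventually_gt_at_top[of 0]
  proof eventually_elim
   case (elim n)
   define z where "z = \<i> * complex_of_nat n"
   have "b \<le> real (nat \<lceil>b\<rceil>)" by (rule real_nat_ceiling_ge)
   then have "cmod z \<ge> b" using elim(2) by (simp add: z_def norm_mult)
   from b[OF this] elim(1) have 1: "cmod (g z - z - of_real c / z) \<le> C * cmod (1 / z^2)" by (simp add: z_def)
   have "1 / z^2 = - ((1 / of_nat n)^2)" by (simp add: z_def power_mult_distrib power_divide)
   then have 2: "cmod (1 / z^2) = cmod (1 / of_nat n) ^ 2" by (simp only: norm_minus_cancel norm_power)
   have 3: "of_real c / z = of_real c * (- \<i>) * (1 / of_nat n)" by (simp add: z_def divide_inverse)
   have "cmod (g z - z) \<le> cmod (g z - z - of_real c / z) + cmod (of_real c / z)"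
    using norm_triangle_ineq[of "g z - z - of_real c / z" "of_real c / z"] by simp
   then show ?case using 1 unfolding 2 3 z_def[symmetric] by linarith
  qed
 qed
qed

lemma holomorphic_inverse_ex:
 assumes "g holomorphic_on S" "open S" "inj_on g S"
 shows "\<exists>f. f holomorphic_on g ` S \<and> (\<forall>z\<in>S. f (g z) = z)"
 using holomorphic_has_inverse[OF assms] by metis

text \<open>\<open>g1\<close> after the inverse of \<open>g2\<close> is an automorphism of the
  half-plane. It is probed at \<open>g2 (\<i> * of_nat n)\<close>, where both the argument and the
  value are asymptotic to \<open>\<i> * of_nat n\<close>.\<close>

lemma mapping_out_unique:
 assumes g1: "mapping_out K c g1" and g2: "mapping_out K c g2" and K: "bounded K" "open (upper_half_plane - K)"
  and z: "z \<in> upper_half_plane - K"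
 shows "g1 z = g2 z"
proof -
 let ?D = "upper_half_plane - K"
 have h: "g1 holomorphic_on ?D" "g2 holomorphic_on ?D" "bij_betw g1 ?D upper_half_plane" "bij_betw g2 ?D upper_half_plane"
  using g1 g2 unfolding mapping_out_def by auto
 then have im: "g1 ` ?D = upper_half_plane" "g2 ` ?D = upper_half_plane" and inj: "inj_on g1 ?D" "inj_on g2 ?D"
  unfolding bij_betw_def by auto
 obtain f1 where "f1 holomorphic_on g1 ` ?D" "\<forall>z\<in>?D. f1 (g1 z) = z"
  using holomorphic_inverse_ex[OF h(1) K(2) inj(1)] by (elim exE conjE)
 then have f1: "f1 holomorphic_on upper_half_plane" "\<And>z. z \<in> ?D \<Longrightarrow> f1 (g1 z) = z"
  using im by simp_all
 obtain f2 where "f2 holomorphic_on g2 ` ?D" "\<forall>z\<in>?D. f2 (g2 z) = z"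
  using holomorphic_inverse_ex[OF h(2) K(2) inj(2)] by (elim exE conjE)
 then have f2: "f2 holomorphic_on upper_half_plane" "\<And>z. z \<in> ?D \<Longrightarrow> f2 (g2 z) = z"
  using im by simp_all
 have f1D: "f1 w \<in> ?D" "g1 (f1 w) = w" if wH: "w \<in> upper_half_plane" for w
 proof -
  have "w \<in> g1 ` ?D" using wH im(1) by simp
  then obtain v where "v \<in> ?D" "w = g1 v" by (elim imageE)
  then show "f1 w \<in> ?D" "g1 (f1 w) = w" using f1(2) by auto
 qed
 have f2D: "f2 w \<in> ?D" "g2 (f2 w) = w" if wH: "w \<in> upper_half_plane" for w
 proof -
  have "w \<in> g2 ` ?D" using wH im(2) by simp
  then obtain v where "v \<in> ?D" "w = g2 v" by (elim imageE)
  then show "f2 w \<in> ?D" "g2 (f2 w) = w" using f2(2) by auto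
 qed
 have g2z: "g2 z \<in> upper_half_plane" using im(2) z by auto
 have "(g1 \<circ> f2) (g2 z) = g2 z"
 proof (rule half_plane_automorphism_identity[where B = "g2 \<circ> f1" and z = "\<lambda>n. g2 (\<i> * of_nat n)"])
  show "g1 \<circ> f2 holomorphic_on upper_half_plane"
   by (rule holomorphic_on_compose_gen[OF f2(1) h(1)]) (use f2D in auto)
  show "g2 \<circ> f1 holomorphic_on upper_half_plane"
   by (rule holomorphic_on_compose_gen[OF f1(1) h(2)]) (use f1D in auto)
  show "(g1 \<circ> f2) ` upper_half_plane \<subseteq> upper_half_plane"
  proof
   fix x assume "x \<in> (g1 \<circ> f2) ` upper_half_plane"
   then obtain w where w: "w \<in> upper_half_plane" "x = g1 (f2 w)" by auto
   then show "x \<in> upper_half_plane" using f2D(1)[OF w(1)] im(1) by blast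
  qed
  show "(g2 \<circ> f1) ` upper_half_plane \<subseteq> upper_half_plane"
  proof
   fix x assume "x \<in> (g2 \<circ> f1) ` upper_half_plane"
   then obtain w where w: "w \<in> upper_half_plane" "x = g2 (f1 w)" by auto
   then show "x \<in> upper_half_plane" using f1D(1)[OF w(1)] im(2) by blast
  qed
  show "(g2 \<circ> f1) ((g1 \<circ> f2) w) = w" if "w \<in> upper_half_plane" for w
   using f1(2)[OF f2D(1)[OF that]] f2D(2)[OF that] by simp
  note ev = mapping_out_asymptotics(1)[OF g2 K(1)]
  show "\<forall>\<^sub>F n in sequentially. g2 (\<i> * of_nat n) \<in> upper_half_plane"
   using ev by eventually_elim (use im(2) in blast)
  show "(\<lambda>n. g2 (\<i> * of_nat n) - \<i> * of_nat n) \<longlonglongrightarrow> 0" by (rule mapping_out_asymptotics(2)[OF g2 K(1)])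
  show "(\<lambda>n. (g1 \<circ> f2) (g2 (\<i> * of_nat n)) - \<i> * of_nat n) \<longlonglongrightarrow> 0"
  proof (rule Lim_transform_eventually[OF mapping_out_asymptotics(2)[OF g1 K(1)]])
   show "\<forall>\<^sub>F n in sequentially. g1 (\<i> * of_nat n) - \<i> * of_nat n = (g1 \<circ> f2) (g2 (\<i> * of_nat n)) - \<i> * of_nat n"
    using ev by eventually_elim (simp add: f2(2))
  qed
  show "g2 z \<in> upper_half_plane" by (rule g2z)
 qed
 then show ?thesis using f2(2)[OF z] by simp
qed

lemma mapping_out_id: "mapping_out {} 0 (\<lambda>z. z)"
 unfolding mapping_out_def by (auto simp: bij_betw_def)

lemma mapping_out_trivial:
 assumes "mapping_out {} 0 g" "z \<in> upper_half_plane"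
 shows "g z = z"
 using mapping_out_unique[OF assms(1) mapping_out_id, of z] assms(2) upper_half_plane_open by simp

lemma capacity_curve_hull:
 assumes c: "capacity_curve J \<gamma>" and t: "{0..t} \<subseteq> J" "0 \<le> t"
 shows "bounded (\<gamma> ` {0<..t})" "open (upper_half_plane - \<gamma> ` {0<..t})"
  "U \<noteq> {} \<Longrightarrow> open U \<Longrightarrow> \<not> U \<subseteq> \<gamma> ` {0<..t}"
proof -
 have cont: "continuous_on {0..t} \<gamma>" and inj: "inj_on \<gamma> {0..t}" and g0: "\<gamma> 0 = 0"
  using c t(1) unfolding capacity_curve_def by (auto intro: continuous_on_subset inj_on_subset)
 have comp: "compact (\<gamma> ` {0..t})" by (rule compact_continuous_image[OF cont compact_Icc])
 have sub: "\<gamma> ` {0<..t} \<subseteq> \<gamma> ` {0..t}" by auto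
 show "bounded (\<gamma> ` {0<..t})" by (rule bounded_subset[OF compact_imp_bounded[OF comp] sub])
 have "\<gamma> ` {0..t} = insert 0 (\<gamma> ` {0<..t})"
 proof -
  have "{0..t} = insert 0 {0<..t}" using t(2) by auto
  then show ?thesis using g0 by (metis image_insert)
 qed
 \<comment> \<open>The half-open image differs from the compact one only in the real point
   \<open>\<gamma> 0\<close>, which is invisible inside the half-plane.\<close>
 then have "upper_half_plane - \<gamma> ` {0<..t} = upper_half_plane - \<gamma> ` {0..t}" by (auto simp: upper_half_plane_def)
 then show "open (upper_half_plane - \<gamma> ` {0<..t})"
  using upper_half_plane_open compact_imp_closed[OF comp] by (simp add: open_Diff)
 show "\<not> U \<subseteq> \<gamma> ` {0<..t}" if "U \<noteq> {}" "open U"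
  using arc_image_not_superset_open[OF cont inj that(2,1)] sub by blast
qed

section \<open>Curves, their drivers and their energy\<close>

lemma capacity_curve_subset:
 assumes "capacity_curve J \<gamma>" "{0..r} \<subseteq> J"
 shows "capacity_curve {0..r} \<gamma>"
 using assms unfolding capacity_curve_def by (auto intro: continuous_on_subset inj_on_subset)

lemma driven_byE:
 assumes "driven_by J \<gamma> lam"
 obtains g where "capacity_curve J \<gamma>"
  "\<And>t. t \<in> J \<Longrightarrow> mapping_out (\<gamma> ` {0<..t}) (2 * t) (g t)"
  "\<And>t. t \<in> J \<Longrightarrow> (g t \<longlongrightarrow> of_real (lam t)) (at (\<gamma> t) within upper_half_plane - \<gamma> ` {0<..t})"
  "\<And>t z. t \<in> J \<Longrightarrow> z \<in> upper_half_plane - \<gamma> ` {0<..t} \<Longrightarrow>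
      ((\<lambda>s. g s z) has_vector_derivative 2 / (g t z - of_real (lam t))) (at t within J)"
proof -
 obtain g where cc: "capacity_curve J \<gamma>" and *: "\<forall>t\<in>J. mapping_out (\<gamma> ` {0<..t}) (2 * t) (g t) \<and>
    (g t \<longlongrightarrow> of_real (lam t)) (at (\<gamma> t) within upper_half_plane - \<gamma> ` {0<..t}) \<and>
    (\<forall>z\<in>upper_half_plane - \<gamma> ` {0<..t}.
      ((\<lambda>s. g s z) has_vector_derivative 2 / (g t z - of_real (lam t))) (at t within J))"
  using assms unfolding driven_by_def by (elim conjE exE)
 note b = bspec[OF *]
 show thesis
  by (rule that[of g, OF cc conjunct1[OF b] conjunct1[OF conjunct2[OF b]] bspec[OF conjunct2[OF conjunct2[OF b]]]])
qed

lemma driven_by_subset: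
 assumes "driven_by J \<gamma> lam" "{0..r} \<subseteq> J"
 shows "driven_by {0..r} \<gamma> lam"
proof -
 obtain g where g: "capacity_curve J \<gamma>"
  "\<And>t. t \<in> J \<Longrightarrow> mapping_out (\<gamma> ` {0<..t}) (2 * t) (g t)"
  "\<And>t. t \<in> J \<Longrightarrow> (g t \<longlongrightarrow> of_real (lam t)) (at (\<gamma> t) within upper_half_plane - \<gamma> ` {0<..t})"
  "\<And>t z. t \<in> J \<Longrightarrow> z \<in> upper_half_plane - \<gamma> ` {0<..t} \<Longrightarrow>
      ((\<lambda>s. g s z) has_vector_derivative 2 / (g t z - of_real (lam t))) (at t within J)"
  by (rule driven_byE[OF assms(1)]) (rule that)
 show ?thesis
  unfolding driven_by_def
 proof (intro conjI exI[of _ g] ballI)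
  show "capacity_curve {0..r} \<gamma>" by (rule capacity_curve_subset[OF g(1) assms(2)])
  fix t assume "t \<in> {0..r}"
  then have t: "t \<in> J" using assms(2) by auto
  show "mapping_out (\<gamma> ` {0<..t}) (2 * t) (g t)" by (rule g(2)[OF t])
  show "(g t \<longlongrightarrow> of_real (lam t)) (at (\<gamma> t) within upper_half_plane - \<gamma> ` {0<..t})" by (rule g(3)[OF t])
  show "((\<lambda>s. g s z) has_vector_derivative 2 / (g t z - of_real (lam t))) (at t within {0..r})"
   if "z \<in> upper_half_plane - \<gamma> ` {0<..t}" for z
   by (rule has_vector_derivative_within_subset[OF g(4)[OF t that] assms(2)])
 qed
qed

text \<open>The hull at time 0 is empty, so \<open>g 0\<close> is the identity and its limit at
  \<open>\<gamma> 0 = 0\<close> is 0.\<close>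

lemma driven_by_start:
 assumes "driven_by {0..\<delta>} \<gamma> lam" "0 \<le> \<delta>"
 shows "lam 0 = 0"
proof -
 obtain g where g: "capacity_curve {0..\<delta>} \<gamma>"
  "\<And>t. t \<in> {0..\<delta>} \<Longrightarrow> mapping_out (\<gamma> ` {0<..t}) (2 * t) (g t)"
  "\<And>t. t \<in> {0..\<delta>} \<Longrightarrow> (g t \<longlongrightarrow> of_real (lam t)) (at (\<gamma> t) within upper_half_plane - \<gamma> ` {0<..t})"
  by (rule driven_byE[OF assms(1)]) (rule that)
 have \<gamma>0: "\<gamma> 0 = 0" using g(1) by (simp add: capacity_curve_def)
 have m: "mapping_out {} 0 (g 0)" using g(2)[of 0] assms(2) by simp
 have l: "(g 0 \<longlongrightarrow> of_real (lam 0)) (at 0 within upper_half_plane)" using g(3)[of 0] assms(2) \<gamma>0 by simp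
 have nt: "at (0::complex) within upper_half_plane \<noteq> bot"
 proof -
  have "0 islimpt upper_half_plane"
  proof (rule islimptI)
   fix T :: "complex set" assume "0 \<in> T" "open T"
   then obtain e where e: "e > 0" "ball 0 e \<subseteq> T" using openE by blast
   then have "\<i> * of_real (e/2) \<in> T" by (intro subsetD[OF e(2)]) (simp add: norm_mult)
   then show "\<exists>y\<in>upper_half_plane. y \<in> T \<and> y \<noteq> 0"
    using e(1) by (intro bexI[of _ "\<i> * of_real (e/2)"]) (auto simp: upper_half_plane_def)
  qed
  then show ?thesis using trivial_limit_within by blast
 qed
 have "(g 0 \<longlongrightarrow> 0) (at 0 within upper_half_plane)"
 proof (rule Lim_transform_eventually[OF tendsto_ident_at])
  show "\<forall>\<^sub>F z in at 0 within upper_half_plane. z = g 0 z"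
   unfolding eventually_at_filter by (rule always_eventually) (use mapping_out_trivial[OF m] in auto)
 qed
 from tendsto_unique[OF nt this l] show ?thesis by simp
qed

text \<open>The mapping-out functions of a hull are unique, so both flows coincide on their domains;
  the left derivative of one trajectory at \<open>t\<close> determines
  \<open>2 / (g t z - lam t)\<close> and with it the driver. Time 0 has no left derivative and is
  settled by the boundary limit.\<close>

lemma driven_by_driver_unique:
 assumes d1: "driven_by {0..\<delta>} \<gamma> lam1" and d2: "driven_by {0..\<delta>} \<gamma> lam2" and t: "t \<in> {0..\<delta>}"
 shows "lam1 t = lam2 t"
proof (cases "t = 0")
 case True
 then show ?thesis using driven_by_start[OF d1] driven_by_start[OF d2] t by simp
next
 case False
 obtain g1 where g1: "\<And>t. t \<in> {0..\<delta>} \<Longrightarrow> mapping_out (\<gamma> ` {0<..t}) (2 * t) (g1 t)"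
  "\<And>t z. t \<in> {0..\<delta>} \<Longrightarrow> z\<in>upper_half_plane - \<gamma> ` {0<..t} \<Longrightarrow>
      ((\<lambda>s. g1 s z) has_vector_derivative 2 / (g1 t z - of_real (lam1 t))) (at t within {0..\<delta>})"
  by (rule driven_byE[OF d1]) (rule that)
 obtain g2 where g2: "\<And>t. t \<in> {0..\<delta>} \<Longrightarrow> mapping_out (\<gamma> ` {0<..t}) (2 * t) (g2 t)"
  "\<And>t z. t \<in> {0..\<delta>} \<Longrightarrow> z\<in>upper_half_plane - \<gamma> ` {0<..t} \<Longrightarrow>
      ((\<lambda>s. g2 s z) has_vector_derivative 2 / (g2 t z - of_real (lam2 t))) (at t within {0..\<delta>})"
  by (rule driven_byE[OF d2]) (rule that)
 have cc: "capacity_curve {0..\<delta>} \<gamma>" using d1 unfolding driven_by_def by (rule conjunct1)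
 have hull: "bounded (\<gamma> ` {0<..s})" "open (upper_half_plane - \<gamma> ` {0<..s})" if "s \<in> {0..\<delta>}" for s
  using capacity_curve_hull[OF cc, of s] that by auto
 have eq: "g1 s z = g2 s z" if "s \<in> {0..\<delta>}" "z \<in> upper_half_plane - \<gamma> ` {0<..s}" for s z
  using mapping_out_unique[OF g1(1)[OF that(1)] g2(1)[OF that(1)] hull[OF that(1)] that(2)] .
 \<comment> \<open>Any point still outside the hull will serve; points high on the imaginary axis
   are available because the hull is bounded.\<close>
 obtain n where "\<i> * of_nat n \<in> upper_half_plane - \<gamma> ` {0<..t}"
  using eventually_happens[OF mapping_out_asymptotics(1)[OF g1(1)[OF t] hull(1)[OF t]]] by auto
 then obtain z where z: "z \<in> upper_half_plane - \<gamma> ` {0<..t}" by blast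
 have sub: "{0..t} \<subseteq> {0..\<delta>}" using t by auto
 have tt: "t \<in> {0..t}" "0 < t" using t False by auto
 have a: "((\<lambda>s. g1 s z) has_vector_derivative 2 / (g1 t z - of_real (lam1 t))) (at t within {0..t})"
  by (rule has_vector_derivative_within_subset[OF g1(2)[OF t z] sub])
 have b: "((\<lambda>s. g2 s z) has_vector_derivative 2 / (g2 t z - of_real (lam2 t))) (at t within {0..t})"
  by (rule has_vector_derivative_within_subset[OF g2(2)[OF t z] sub])
 have "((\<lambda>s. g1 s z) has_vector_derivative 2 / (g2 t z - of_real (lam2 t))) (at t within {0..t})"
 proof (rule has_vector_derivative_transform[OF tt(1) _ b])
  fix s assume "s \<in> {0..t}"
  then have "s \<in> {0..\<delta>}" "z \<in> upper_half_plane - \<gamma> ` {0<..s}" using sub z by auto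
  then show "g1 s z = g2 s z" by (rule eq)
 qed
 then have "2 / (g1 t z - of_real (lam1 t)) = 2 / (g2 t z - of_real (lam2 t))"
  using vector_derivative_unique_within[OF _ a] tt by (simp add: at_within_Icc_at_left)
 then have "g1 t z - of_real (lam1 t) = g2 t z - complex_of_real (lam2 t)"
  by (simp add: divide_cancel_left)
 then show ?thesis using eq[OF t z] by simp
qed

text \<open>\<open>deriv\<close> is two-sided and may see values beyond the interval, but only at
  the two endpoints, which form a null set.\<close>

lemma driver_energy_cong:
 assumes "\<And>t. t \<in> {0..\<delta>} \<Longrightarrow> f t = g t"
 shows "driver_energy \<delta> f = driver_energy \<delta> g"
proof -
 have "(\<integral>\<^sup>+ t\<in>{0..\<delta>}. ennreal ((deriv f t)^2) \<partial>lebesgue) = (\<integral>\<^sup>+ t\<in>{0..\<delta>}. ennreal ((deriv g t)^2) \<partial>lebesgue)"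
 proof (rule nn_integral_cong_AE)
  have "{0, \<delta>} \<in> null_sets lebesgue" by (simp add: negligible_iff_null_sets[symmetric])
  then have "AE t in lebesgue. t \<notin> {0, \<delta>}" by (rule AE_not_in)
  then show "AE t in lebesgue. ennreal ((deriv f t)^2) * indicator {0..\<delta>} t = ennreal ((deriv g t)^2) * indicator {0..\<delta>} t"
  proof eventually_elim
   case (elim t)
   show ?case
   proof (cases "t \<in> {0..\<delta>}")
    case True
    then have "t \<in> {0<..<\<delta>}" using elim by auto
    then have "\<forall>\<^sub>F s in nhds t. f s = g s"
     using assms by (auto simp: eventually_nhds intro!: exI[of _ "{0<..<\<delta>}"])
    then have "deriv f t = deriv g t" by (rule deriv_cong_ev) simp
    then show ?thesis by simp
   next
    case False then show ?thesis by (simp add: indicator_def del: atLeastAtMost_iff)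
   qed
  qed
 qed
 moreover have "abs_continuous_on {0..\<delta>} f \<longleftrightarrow> abs_continuous_on {0..\<delta>} g"
  using assms by (rule abs_continuous_on_cong)
 ultimately show ?thesis unfolding driver_energy_def by simp
qed

text \<open>All drivers of a curve agree on \<open>{0..\<delta>}\<close> and thus have one energy,
  so the infimum is taken over a single value.\<close>

lemma curve_energy_eq:
 assumes "driven_by {0..\<delta>} \<gamma> lam"
 shows "curve_energy \<delta> \<gamma> = driver_energy \<delta> lam"
proof -
 have eq: "driver_energy \<delta> lam' = driver_energy \<delta> lam" if "driven_by {0..\<delta>} \<gamma> lam'" for lam'
  by (rule driver_energy_cong) (rule driven_by_driver_unique[OF that assms])
 show ?thesis
  unfolding curve_energy_def
 proof (rule antisym)
  show "(INF lam\<in>{lam. driven_by {0..\<delta>} \<gamma> lam}. driver_energy \<delta> lam) \<le> driver_energy \<delta> lam"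
   by (rule INF_lower) (rule CollectI, rule assms)
  show "driver_energy \<delta> lam \<le> (INF lam\<in>{lam. driven_by {0..\<delta>} \<gamma> lam}. driver_energy \<delta> lam)"
  proof (rule INF_greatest)
   fix l assume "l \<in> {lam. driven_by {0..\<delta>} \<gamma> lam}"
   then have "driven_by {0..\<delta>} \<gamma> l" by (rule CollectD)
   then have "driver_energy \<delta> l = driver_energy \<delta> lam" by (rule eq)
   then show "driver_energy \<delta> lam \<le> driver_energy \<delta> l" by (rule eq_refl[OF sym])
  qed
 qed
qed

subsection \<open>Trajectories of the downward flow\<close>

text \<open>Over a closed interval the trajectory is alive at the final time; over a half-open one
  it may die there. Both uses occur below.\<close>

definition loewner_path :: "(real \<Rightarrow> real) \<Rightarrow> real set \<Rightarrow> (real \<Rightarrow> complex) \<Rightarrow> bool" where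
 "loewner_path lam S G \<longleftrightarrow> (\<forall>t\<in>S. Im (G t) > 0 \<and>
   (G has_vector_derivative 2 / (G t - of_real (lam t))) (at t within S))"

lemma loewner_path_subset:
 "loewner_path lam S G \<Longrightarrow> T \<subseteq> S \<Longrightarrow> loewner_path lam T G"
 unfolding loewner_path_def by (meson has_vector_derivative_within_subset subsetD)

lemma loewner_pathD:
 assumes "loewner_path lam S G" "t \<in> S"
 shows "Im (G t) > 0" "G t - of_real (lam t) \<noteq> 0"
  "(G has_vector_derivative 2 / (G t - of_real (lam t))) (at t within S)"
 using assms unfolding loewner_path_def by (auto simp: complex_eq_iff)

lemma loewner_path_continuous: "loewner_path lam S G \<Longrightarrow> continuous_on S G"
 unfolding loewner_path_def continuous_on_eq_continuous_within
 by (blast intro: has_vector_derivative_continuous)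

lemma loewner_path_driven: "loewner_path lam {0..<r} G \<Longrightarrow> driven_path 1 r lam G"
 unfolding driven_path_def using loewner_pathD(2,3) by simp

lemma loewner_path_Im_derivative:
 assumes "loewner_path lam S G" "t \<in> S"
 shows "((\<lambda>t. Im (G t)) has_real_derivative - 2 * Im (G t) / (cmod (G t - of_real (lam t)))^2) (at t within S)"
proof -
 have "((\<lambda>t. Im (G t)) has_real_derivative Im (2 / (G t - of_real (lam t)))) (at t within S)"
  using loewner_pathD(3)[OF assms] by (simp add: has_real_derivative_iff_has_vector_derivative has_vector_derivative_complex_iff)
 moreover have "Im (2 / (G t - of_real (lam t))) = - 2 * Im (G t) / (cmod (G t - of_real (lam t)))^2"
  by (simp add: Im_divide cmod_power2)
 ultimately show ?thesis by simp
qed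

lemma derivative_nonpos_decreasing_open:
 fixes F :: "real \<Rightarrow> real"
 assumes "a \<le> b" and der: "\<And>t. t \<in> {a..b} \<Longrightarrow> (F has_real_derivative F' t) (at t within {a..b})"
  and le: "\<And>t. t \<in> {a<..<b} \<Longrightarrow> F' t \<le> 0"
 shows "F b \<le> F a"
proof (cases "a = b")
 case False
 then have ab: "a < b" using assms(1) by simp
 have c: "continuous_on {a..b} F" unfolding continuous_on_eq_continuous_within using der DERIV_continuous by blast
 have d: "(F has_real_derivative F' t) (at t)" if "a < t" "t < b" for t
 proof -
  have "at t within {a..b} = at t" using that by (intro at_within_interior) auto
  then show ?thesis using der[of t] that by simp
 qed
 obtain l z where z: "a < z" "z < b" "(F has_real_derivative l) (at z)" "F b - F a = (b - a) * l"
  using MVT[OF ab c] d by (metis real_differentiable_def)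
 have "l = F' z" using z d by (blast intro: DERIV_unique)
 then have "(b - a) * l \<le> 0" using le[of z] z ab by (simp add: mult_nonneg_nonpos)
 then show ?thesis using z(4) by simp
qed simp

lemma derivative_nonpos_decreasing:
 fixes F :: "real \<Rightarrow> real"
 assumes "a \<le> b" and "\<And>t. t \<in> {a..b} \<Longrightarrow> (F has_real_derivative F' t) (at t within {a..b})"
  and "\<And>t. t \<in> {a..b} \<Longrightarrow> F' t \<le> 0"
 shows "F b \<le> F a"
 using assms by (intro derivative_nonpos_decreasing_open[of a b F F']) auto

lemma loewner_path_Im_decreasing:
 assumes G: "loewner_path lam S G" and "{a..b} \<subseteq> S" "a \<le> b"
 shows "Im (G b) \<le> Im (G a)"
proof (rule derivative_nonpos_decreasing[OF assms(3)])
 note G' = loewner_path_subset[OF G assms(2)]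
 show "((\<lambda>t. Im (G t)) has_real_derivative - 2 * Im (G t) / (cmod (G t - of_real (lam t)))^2) (at t within {a..b})"
  if "t \<in> {a..b}" for t by (rule loewner_path_Im_derivative[OF G' that])
 show "- 2 * Im (G t) / (cmod (G t - of_real (lam t)))^2 \<le> 0" if "t \<in> {a..b}" for t
  using loewner_pathD(1)[OF G' that] by (simp add: divide_nonpos_nonneg)
qed

text \<open>Two trajectories \<open>G\<close>, \<open>H\<close> satisfy \<open>(G - H)' = - 2 (G - H) / (w\<^sub>G w\<^sub>H)\<close>, and AM-GM bounds the
 growth of the difference by the decay of the two imaginary parts.\<close>

lemma loewner_path_contraction:
 assumes G: "loewner_path lam {a..b} G" and H: "loewner_path lam {a..b} H" and "a \<le> b"
 shows "(cmod (G b - H b))^2 * (Im (G b) * Im (H b)) \<le> (cmod (G a - H a))^2 * (Im (G a) * Im (H a))"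
proof -
 define D where "D t = G t - H t" for t
 define u where "u t = G t - of_real (lam t)" for t
 define v where "v t = H t - of_real (lam t)" for t
 have sq: "(cmod (D t))^2 = Re (D t) * Re (D t) + Im (D t) * Im (D t)" for t unfolding cmod_power2 by (simp add: power2_eq_square)
 define F where "F t = (Re (D t) * Re (D t) + Im (D t) * Im (D t)) * (Im (G t) * Im (H t))" for t
 define q where "q t = 2 / u t - 2 / v t" for t
 define F' where "F' t = ((Re (D t) * Re (q t) + Re (q t) * Re (D t)) + (Im (D t) * Im (q t) + Im (q t) * Im (D t))) * (Im (G t) * Im (H t))
   + (Im (G t) * (- 2 * Im (H t) / (cmod (v t))^2) + (- 2 * Im (G t) / (cmod (u t))^2) * Im (H t)) * (Re (D t) * Re (D t) + Im (D t) * Im (D t))" for t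
 have "F b \<le> F a"
 proof (rule derivative_nonpos_decreasing[OF assms(3)])
  fix t assume t: "t \<in> {a..b}"
  have "(D has_vector_derivative q t) (at t within {a..b})"
   unfolding D_def q_def u_def v_def by (intro has_vector_derivative_diff loewner_pathD(3)[OF G t] loewner_pathD(3)[OF H t])
  then have rd: "((\<lambda>t. Re (D t)) has_real_derivative Re (q t)) (at t within {a..b})"
   and id: "((\<lambda>t. Im (D t)) has_real_derivative Im (q t)) (at t within {a..b})"
   by (simp_all add: has_real_derivative_iff_has_vector_derivative has_vector_derivative_complex_iff)
  show "(F has_real_derivative F' t) (at t within {a..b})"
   unfolding F_def F'_def u_def v_def
   by (intro DERIV_mult' DERIV_add rd id loewner_path_Im_derivative[OF G t] loewner_path_Im_derivative[OF H t]
     DERIV_cong[OF DERIV_mult'[OF DERIV_add[OF DERIV_mult'[OF rd rd] DERIV_mult'[OF id id]]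
      DERIV_mult'[OF loewner_path_Im_derivative[OF G t] loewner_path_Im_derivative[OF H t]]]]) (simp add: algebra_simps)
  have uv: "u t \<noteq> 0" "v t \<noteq> 0" using loewner_pathD(2)[OF G t] loewner_pathD(2)[OF H t] by (auto simp: u_def v_def)
  define N where "N = (cmod (D t))^2"
  define Y where "Y = Im (G t) * Im (H t)"
  have Y: "Y \<ge> 0" using loewner_pathD(1)[OF G t] loewner_pathD(1)[OF H t] by (simp add: Y_def)
  have "q t = - 2 * D t / (u t * v t)" using uv by (simp add: q_def D_def u_def v_def field_simps)
  then have "Re (cnj (D t) * q t) \<le> 2 * N / (cmod (u t) * cmod (v t))"
  proof -
   assume e: "q t = - 2 * D t / (u t * v t)"
   have "Re (cnj (D t) * q t) \<le> cmod (cnj (D t) * q t)" by (rule complex_Re_le_cmod)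
   also have "\<dots> = 2 * N / (cmod (u t) * cmod (v t))" unfolding e N_def by (simp add: norm_mult norm_divide power2_eq_square)
   finally show ?thesis .
  qed
  also have "\<dots> = N * (2 * (1 / cmod (u t)) * (1 / cmod (v t)))" by simp
  also have "\<dots> \<le> N * ((1 / cmod (u t))^2 + (1 / cmod (v t))^2)"
   by (intro mult_left_mono sum_squares_bound) (simp add: N_def)
  finally have R: "Re (cnj (D t) * q t) \<le> N * (1 / (cmod (u t))^2 + 1 / (cmod (v t))^2)" by (simp add: power_divide)
  have "F' t = 2 * Y * (Re (cnj (D t) * q t) - N * (1 / (cmod (u t))^2 + 1 / (cmod (v t))^2))"
   unfolding F'_def N_def Y_def sq by (simp add: algebra_simps add_divide_distrib)
  also have "\<dots> \<le> 0" using R Y by (intro mult_nonneg_nonpos) auto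
  finally show "F' t \<le> 0" .
 qed
 then show ?thesis unfolding F_def sq[symmetric] unfolding D_def .
qed

text \<open>The contraction estimate with initial difference 0; the weights \<open>Im (G t)\<close>
  and \<open>Im (H t)\<close> are positive, so the difference itself vanishes.\<close>

lemma loewner_path_unique:
 assumes G: "loewner_path lam {a..b} G" and H: "loewner_path lam {a..b} H" and "G a = H a" and t: "t \<in> {a..b}"
 shows "G t = H t"
proof -
 have sub: "{a..t} \<subseteq> {a..b}" "a \<le> t" using t by auto
 have "(cmod (G t - H t))^2 * (Im (G t) * Im (H t)) \<le> 0"
  using loewner_path_contraction[OF loewner_path_subset[OF G sub(1)] loewner_path_subset[OF H sub(1)] sub(2)] assms(3) by simp
 moreover have "Im (G t) * Im (H t) > 0" using loewner_pathD(1)[OF G t] loewner_pathD(1)[OF H t] by simp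
 ultimately have "(cmod (G t - H t))^2 \<le> 0"
  using mult_pos_pos[of "(cmod (G t - H t))^2" "Im (G t) * Im (H t)"] by linarith
 then show ?thesis by simp
qed

text \<open>A trajectory whose imaginary part dies must hit the driver: otherwise \<open>ln (Im G)\<close>, with
 derivative \<open>- 2 / |w|\<^sup>2\<close>, would stay bounded.\<close>

lemma dying_path_tendsto_0:
 assumes G: "loewner_path lam {0..<\<tau>} G" and fe: "finite_energy \<tau> lam f" and \<tau>: "\<tau> > 0"
  and die: "((\<lambda>t. Im (G t)) \<longlongrightarrow> 0) (at_left \<tau>)"
 shows "((\<lambda>t. G t - of_real (lam t)) \<longlongrightarrow> 0) (at_left \<tau>)"
proof -
 define w where "w t = G t - of_real (lam t)" for t
 have dp: "driven_path 1 \<tau> lam G" by (rule loewner_path_driven[OF G])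
 have wc: "continuous_on {0..<\<tau>} w" unfolding w_def
  by (intro continuous_intros loewner_path_continuous[OF G] continuous_on_subset[OF finite_energy_continuous[OF fe]]) auto
 \<comment> \<open>At first smallness of \<open>w\<close> is obtained only at some times arbitrarily
   close to \<tau>.\<close>
 have close: "\<exists>t\<in>{t0<..<\<tau>}. cmod (w t) < \<rho>" if "\<rho> > 0" and t0: "t0 \<in> {0..<\<tau>}" for \<rho> t0
 proof (rule ccontr)
  assume "\<not> ?thesis"
  then have far: "cmod (w t) \<ge> \<rho>" if "t \<in> {t0<..<\<tau>}" for t using that by force
  define t1 where "t1 = (t0 + \<tau>) / 2"
  have t1: "t0 < t1" "t1 < \<tau>" using t0 by (auto simp: t1_def)
  have lower: "Im (G t1) * exp (- 2 / \<rho>^2 * (t - t1)) \<le> Im (G t)" if t: "t \<in> {t1..<\<tau>}" for t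
  proof -
   have sub: "{t1..t} \<subseteq> {0..<\<tau>}" using t t1 t0 by auto
   note G' = loewner_path_subset[OF G sub]
   have "- (Im (G t) * exp (2 / \<rho>^2 * (t - t1))) \<le> - (Im (G t1) * exp (2 / \<rho>^2 * (t1 - t1)))"
   proof (rule derivative_nonpos_decreasing[of t1 t "\<lambda>s. - (Im (G s) * exp (2 / \<rho>^2 * (s - t1)))"
      "\<lambda>s. - (Im (G s) * (exp (2 / \<rho>^2 * (s - t1)) * (2 / \<rho>^2)) + (- 2 * Im (G s) / (cmod (w s))^2) * exp (2 / \<rho>^2 * (s - t1)))"])
    show "t1 \<le> t" using t by simp
    fix s assume s: "s \<in> {t1..t}"
    have "((\<lambda>s. exp (2 / \<rho>^2 * (s - t1))) has_real_derivative exp (2 / \<rho>^2 * (s - t1)) * (2 / \<rho>^2)) (at s within {t1..t})"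
     using \<open>\<rho> > 0\<close> by (auto intro!: derivative_eq_intros simp: field_simps power2_eq_square)
    then show "((\<lambda>s. - (Im (G s) * exp (2 / \<rho>^2 * (s - t1)))) has_real_derivative
      - (Im (G s) * (exp (2 / \<rho>^2 * (s - t1)) * (2 / \<rho>^2)) + (- 2 * Im (G s) / (cmod (w s))^2) * exp (2 / \<rho>^2 * (s - t1)))) (at s within {t1..t})"
     unfolding w_def by (intro DERIV_minus DERIV_mult' loewner_path_Im_derivative[OF G' s])
    have "\<rho>^2 \<le> (cmod (w s))^2" using far[of s] s t t1 \<open>\<rho> > 0\<close> by (intro power_mono) auto
    then have "2 / (cmod (w s))^2 \<le> 2 / \<rho>^2" using \<open>\<rho> > 0\<close> far[of s] s t t1 by (intro divide_left_mono mult_pos_pos) auto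
    moreover have "Im (G s) * exp (2 / \<rho>^2 * (s - t1)) \<ge> 0" using loewner_pathD(1)[OF G' s] by simp
    ultimately have "(Im (G s) * exp (2 / \<rho>^2 * (s - t1))) * (2 / \<rho>^2 - 2 / (cmod (w s))^2) \<ge> 0" by simp
    then show "- (Im (G s) * (exp (2 / \<rho>^2 * (s - t1)) * (2 / \<rho>^2)) + (- 2 * Im (G s) / (cmod (w s))^2) * exp (2 / \<rho>^2 * (s - t1))) \<le> 0"
     by (simp add: algebra_simps)
   qed
   then have "Im (G t1) \<le> Im (G t) * exp (2 / \<rho>^2 * (t - t1))" by simp
   then have "Im (G t1) * exp (- (2 / \<rho>^2 * (t - t1))) \<le> Im (G t) * exp (2 / \<rho>^2 * (t - t1)) * exp (- (2 / \<rho>^2 * (t - t1)))"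
    by (intro mult_right_mono) auto
   also have "\<dots> = Im (G t)" by (simp add: mult.assoc flip: exp_add)
   finally show ?thesis by simp
  qed
  define c where "c = Im (G t1) * exp (- 2 / \<rho>^2 * (\<tau> - t1))"
  have "c > 0" using loewner_pathD(1)[OF G, of t1] t1 t0 by (simp add: c_def)
  have "0 \<ge> c"
  proof (rule tendsto_lowerbound[OF die _ trivial_limit_at_left_real])
   have "\<forall>\<^sub>F t in at_left \<tau>. t \<in> {t1<..<\<tau>}" using t1 by (intro eventually_at_left_real)
   then show "\<forall>\<^sub>F t in at_left \<tau>. c \<le> Im (G t)"
   proof eventually_elim
    case (elim t)
    have "c \<le> Im (G t1) * exp (- 2 / \<rho>^2 * (t - t1))" unfolding c_def
     using elim loewner_pathD(1)[OF G, of t1] t1 t0 by (intro mult_left_mono) (auto simp: divide_right_mono mult_left_mono)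
    also have "\<dots> \<le> Im (G t)" using lower[of t] elim by auto
    finally show ?case .
   qed
  qed
  then show False using \<open>c > 0\<close> by simp
 qed
 \<comment> \<open>From a time where \<open>w\<close> is small it cannot leave again:
   \<open>w^2\<close> moves by at most \<open>4 * (\<tau> - s)\<close> plus a term controlled by the
   remaining energy. This upgrades smallness at some times to convergence.\<close>
 have grow: "cmod (w t) \<le> cmod (w s) + 2 * sqrt (\<tau> - s) + 2 * (sqrt (\<tau> - s) * sqrt (remaining_energy \<tau> f s))"
  if st: "0 \<le> s" "s \<le> t" "t < \<tau>" for s t
 proof -
  have "continuous_on {s..t} (\<lambda>r. cmod (w r))" by (intro continuous_intros continuous_on_subset[OF wc]) (use st in auto)
  then obtain m where m: "m \<in> {s..t}" "\<And>r. r \<in> {s..t} \<Longrightarrow> cmod (w r) \<le> cmod (w m)"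
   using continuous_attains_sup[of "{s..t}" "\<lambda>r. cmod (w r)"] st by auto
  define M where "M = cmod (w m)"
  define a where "a = cmod (w s)"
  define b where "b = 2 * sqrt (\<tau> - s)"
  define c where "c = 2 * (sqrt (\<tau> - s) * sqrt (remaining_energy \<tau> f s))"
  have abc: "a \<ge> 0" "b \<ge> 0" "c \<ge> 0" "M \<ge> 0" using st by (auto simp: a_def b_def c_def M_def remaining_energy_nonneg)
  have "cmod ((w s)^2 - (w m)^2 + 4 * of_real (m - s)) \<le> 2 * M * integral {s..m} (\<lambda>r. \<bar>f r\<bar>)"
   using driven_path_square_bound[OF dp fe _ st(1), of m M] m st unfolding w_def M_def by auto
  also have "\<dots> \<le> 2 * M * (sqrt (\<tau> - s) * sqrt (remaining_energy \<tau> f s))"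
   using m st abc by (intro mult_left_mono integral_abs_le_remaining[OF fe]) auto
  finally have 1: "cmod ((w s)^2 - (w m)^2 + 4 * of_real (m - s)) \<le> c * M" by (simp add: c_def mult_ac)
  have "(w m)^2 = (w s)^2 + 4 * of_real (m - s) - ((w s)^2 - (w m)^2 + 4 * of_real (m - s))" by simp
  then have "cmod ((w m)^2) \<le> cmod ((w s)^2 + 4 * of_real (m - s)) + cmod ((w s)^2 - (w m)^2 + 4 * of_real (m - s))"
   by (metis norm_triangle_ineq4)
  also have "cmod ((w s)^2 + 4 * of_real (m - s)) \<le> cmod ((w s)^2) + cmod (4 * of_real (m - s))" by (rule norm_triangle_ineq)
  also have "cmod (4 * of_real (m - s)) = 4 * (m - s)" using m by (simp add: norm_mult del: of_real_diff)
  also have "4 * (m - s) \<le> b^2" using m st by (simp add: b_def power_mult_distrib)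
  finally have "(cmod (w m))^2 \<le> (cmod (w s))^2 + b^2 + cmod ((w s)^2 - (w m)^2 + 4 * of_real (m - s))"
   by (simp only: norm_power)
  then have M2: "M * M \<le> a * a + b * b + c * M" using 1 unfolding M_def a_def power2_eq_square by linarith
  \<comment> \<open>If \<open>M\<close> exceeded \<open>a + b + c\<close>, then
    \<open>M * M \<ge> M * (a + b + c) \<ge> a * a + b * b + c * M\<close>, so equality would hold
    throughout and \<open>M\<close> would equal the sum after all.\<close>
  have "M \<le> a + b + c"
  proof (rule ccontr)
   assume "\<not> ?thesis"
   then have gt: "M > a + b + c" by simp
   have "M * (a + b + c) \<le> M * M" using gt abc by (intro mult_left_mono) auto
   moreover have "a * a \<le> M * a" "b * b \<le> M * b" using gt abc by (intro mult_right_mono; simp)+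
   ultimately have "M * M = M * (a + b + c)" using M2 by (simp add: algebra_simps)
   moreover have "M > 0" using gt abc by linarith
   ultimately show False using gt by simp
  qed
  then show ?thesis using m(2)[of t] st unfolding M_def a_def b_def c_def by auto
 qed
 have "((\<lambda>s. 2 * sqrt (\<tau> - s) + 2 * (sqrt (\<tau> - s) * sqrt (remaining_energy \<tau> f s))) \<longlongrightarrow> 2 * sqrt (\<tau> - \<tau>) + 2 * (sqrt (\<tau> - \<tau>) * sqrt 0)) (at_left \<tau>)"
  by (intro tendsto_intros remaining_energy_tendsto_0[OF fe \<tau>])
 then have sm: "((\<lambda>s. 2 * sqrt (\<tau> - s) + 2 * (sqrt (\<tau> - s) * sqrt (remaining_energy \<tau> f s))) \<longlongrightarrow> 0) (at_left \<tau>)" by simp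
 have "(w \<longlongrightarrow> 0) (at_left \<tau>)"
 proof (rule tendstoI)
  fix e :: real assume "e > 0"
  have "\<forall>\<^sub>F s in at_left \<tau>. 2 * sqrt (\<tau> - s) + 2 * (sqrt (\<tau> - s) * sqrt (remaining_energy \<tau> f s)) < e/2"
   by (rule order_tendstoD(2)[OF sm]) (use \<open>e > 0\<close> in simp)
  then obtain b where b: "b < \<tau>" "\<And>s. b < s \<Longrightarrow> s < \<tau> \<Longrightarrow> 2 * sqrt (\<tau> - s) + 2 * (sqrt (\<tau> - s) * sqrt (remaining_energy \<tau> f s)) < e/2"
   unfolding eventually_at_left_field by blast
  obtain s where s: "s \<in> {max 0 b<..<\<tau>}" "cmod (w s) < e/2" using close[of "e/2" "max 0 b"] \<open>e > 0\<close> b(1) \<tau> by auto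
  have "\<forall>\<^sub>F t in at_left \<tau>. t \<in> {s<..<\<tau>}" using s by (intro eventually_at_left_real) auto
  then show "\<forall>\<^sub>F t in at_left \<tau>. dist (w t) 0 < e"
  proof eventually_elim
   case (elim t)
   have "cmod (w t) \<le> cmod (w s) + (2 * sqrt (\<tau> - s) + 2 * (sqrt (\<tau> - s) * sqrt (remaining_energy \<tau> f s)))"
    using grow[of s t] s elim by auto
   also have "\<dots> < e/2 + e/2" using s b(2)[of s] by (intro add_strict_mono) auto
   finally show ?case by simp
  qed
 qed
 then show ?thesis by (simp add: w_def[abs_def])
qed

lemma driven_by_alive_path:
 assumes d: "driven_by {0..r} \<gamma> lam" and r: "r \<ge> 0" and z: "z \<in> upper_half_plane - \<gamma> ` {0<..r}"
 obtains G where "loewner_path lam {0..r} G" "G 0 = z"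
proof -
 obtain g where g: "capacity_curve {0..r} \<gamma>"
  "\<And>t. t \<in> {0..r} \<Longrightarrow> mapping_out (\<gamma> ` {0<..t}) (2 * t) (g t)"
  "\<And>t. t \<in> {0..r} \<Longrightarrow> (g t \<longlongrightarrow> of_real (lam t)) (at (\<gamma> t) within upper_half_plane - \<gamma> ` {0<..t})"
  "\<And>t z. t \<in> {0..r} \<Longrightarrow> z \<in> upper_half_plane - \<gamma> ` {0<..t} \<Longrightarrow>
      ((\<lambda>s. g s z) has_vector_derivative 2 / (g t z - of_real (lam t))) (at t within {0..r})"
  by (rule driven_byE[OF d]) (rule that)
 have zt: "z \<in> upper_half_plane - \<gamma> ` {0<..t}" if "t \<in> {0..r}" for t using z that by auto
 have "loewner_path lam {0..r} (\<lambda>t. g t z)"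
  unfolding loewner_path_def
 proof (intro ballI conjI)
  fix t assume t: "t \<in> {0..r}"
  have "g t z \<in> upper_half_plane"
   using g(2)[OF t] zt[OF t] unfolding mapping_out_def bij_betw_def by blast
  then show "Im (g t z) > 0" by (simp add: upper_half_plane_def)
  show "((\<lambda>t. g t z) has_vector_derivative 2 / (g t z - of_real (lam t))) (at t within {0..r})" by (rule g(4)[OF t zt[OF t]])
 qed
 moreover have "g 0 z = z"
  using mapping_out_trivial[of "g 0" z] g(2)[of 0] r z by simp
 ultimately show thesis by (rule that)
qed

lemma decreasing_tendsto_0_at_left:
 fixes f :: "real \<Rightarrow> real"
 assumes r: "r > 0" and dec: "\<And>s t. 0 \<le> s \<Longrightarrow> s \<le> t \<Longrightarrow> t < r \<Longrightarrow> f t \<le> f s" and pos: "\<And>t. 0 \<le> t \<Longrightarrow> t < r \<Longrightarrow> f t \<ge> 0"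
  and small: "\<And>e. e > 0 \<Longrightarrow> \<exists>s\<in>{0..<r}. f s < e"
 shows "(f \<longlongrightarrow> 0) (at_left r)"
proof (rule tendstoI)
 fix e :: real assume "e > 0"
 from small[OF this] obtain s where s: "s \<in> {0..<r}" "f s < e" by (elim bexE)
 have "\<forall>\<^sub>F t in at_left r. t \<in> {s<..<r}" using s by (intro eventually_at_left_real) auto
 then show "\<forall>\<^sub>F t in at_left r. dist (f t) 0 < e"
 proof eventually_elim
  case (elim t)
  then show ?case using dec[of s t] pos[of t] s by (auto simp: dist_real_def)
 qed
qed

text \<open>By injectivity the tip survives up to \<tau>. Were its height to stay above
  \<open>c\<close>, take a nearby point \<open>z'\<close> off the hull: \<open>g \<tau> z'\<close>
  is close to the real number \<open>lam \<tau>\<close>, so the trajectory of \<open>z'\<close>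
  descends to height \<open>c/2\<close> while that of the tip stays above \<open>c\<close>. The
  contraction estimate forbids such a separation from close starting points.\<close>

lemma driven_by_dying_path:
 assumes d: "driven_by {0..\<tau>} \<gamma> lam" and \<tau>: "\<tau> > 0"
 obtains G where "loewner_path lam {0..<\<tau>} G" "G 0 = \<gamma> \<tau>" "((\<lambda>t. Im (G t)) \<longlongrightarrow> 0) (at_left \<tau>)"
proof -
 obtain g where g: "capacity_curve {0..\<tau>} \<gamma>"
  "\<And>t. t \<in> {0..\<tau>} \<Longrightarrow> mapping_out (\<gamma> ` {0<..t}) (2 * t) (g t)"
  "\<And>t. t \<in> {0..\<tau>} \<Longrightarrow> (g t \<longlongrightarrow> of_real (lam t)) (at (\<gamma> t) within upper_half_plane - \<gamma> ` {0<..t})"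
  "\<And>t z. t \<in> {0..\<tau>} \<Longrightarrow> z \<in> upper_half_plane - \<gamma> ` {0<..t} \<Longrightarrow>
      ((\<lambda>s. g s z) has_vector_derivative 2 / (g t z - of_real (lam t))) (at t within {0..\<tau>})"
  by (rule driven_byE[OF d]) (rule that)
 define z where "z = \<gamma> \<tau>"
 have zH: "z \<in> upper_half_plane" using g(1) \<tau> by (simp add: capacity_curve_def z_def)
 have inj: "inj_on \<gamma> {0..\<tau>}" using g(1) by (simp add: capacity_curve_def)
 have zt: "z \<in> upper_half_plane - \<gamma> ` {0<..t}" if "t \<in> {0..<\<tau>}" for t
 proof -
  have "z \<notin> \<gamma> ` {0<..t}"
  proof
   assume "z \<in> \<gamma> ` {0<..t}"
   then obtain s where s: "s \<in> {0<..t}" "\<gamma> \<tau> = \<gamma> s" unfolding z_def by blast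
   have "\<tau> = s" by (rule inj_onD[OF inj s(2)]) (use s(1) that \<tau> in auto)
   then show False using s(1) that by simp
  qed
  then show ?thesis using zH by simp
 qed
 define G where "G t = g t z" for t
 have lp: "loewner_path lam {0..<\<tau>} G"
  unfolding loewner_path_def
 proof (intro ballI conjI)
  fix t assume t: "t \<in> {0..<\<tau>}"
  then have t': "t \<in> {0..\<tau>}" by auto
  have "g t z \<in> upper_half_plane"
   using g(2)[OF t'] zt[OF t] unfolding mapping_out_def bij_betw_def by blast
  then show "Im (G t) > 0" by (simp add: upper_half_plane_def G_def)
  show "(G has_vector_derivative 2 / (G t - of_real (lam t))) (at t within {0..<\<tau>})"
   unfolding G_def by (rule has_vector_derivative_within_subset[OF g(4)[OF t' zt[OF t]]]) auto
 qed
 have G0: "G 0 = z" unfolding G_def using mapping_out_trivial[of "g 0" z] g(2)[of 0] \<tau> zH by simp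
 have small: "\<exists>t\<in>{0..<\<tau>}. Im (G t) < c" if "c > 0" for c
 proof (rule ccontr)
  assume "\<not> ?thesis"
  then have big: "Im (G t) \<ge> c" if "t \<in> {0..<\<tau>}" for t using that by force
  define y where "y = Im z"
  have yc: "y \<ge> c" using big[of 0] G0 \<tau> by (simp add: y_def)
  define D where "D = upper_half_plane - \<gamma> ` {0<..\<tau>}"
  \<comment> \<open>Chosen so that the initial side of the contraction estimate is at most
    \<open>c ^ 4 / 32\<close>, while the separation at height \<open>c / 2\<close> would require at
    least \<open>c ^ 4 / 8\<close>.\<close>
  define \<rho> where "\<rho> = min (c/4) (c^2 / (8 * y))"
  have \<rho>: "\<rho> > 0" "\<rho> \<le> c/4" "\<rho> * (8 * y) \<le> c^2"
   using \<open>c > 0\<close> yc by (auto simp: \<rho>_def min_def field_simps)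
  have tend: "(g \<tau> \<longlongrightarrow> of_real (lam \<tau>)) (at z within D)" using g(3)[of \<tau>] \<tau> by (simp add: z_def D_def)
  have "\<forall>\<^sub>F x in at z within D. dist (g \<tau> x) (of_real (lam \<tau>)) < c/2" by (rule tendstoD[OF tend]) (use \<open>c > 0\<close> in simp)
  then obtain d0 where d0: "d0 > 0" "\<And>x. x \<in> D \<Longrightarrow> x \<noteq> z \<Longrightarrow> dist x z < d0 \<Longrightarrow> dist (g \<tau> x) (of_real (lam \<tau>)) < c/2"
   unfolding eventually_at by blast
  \<comment> \<open>Points off the hull exist arbitrarily close to the tip because an arc has no
    interior.\<close>
  have "\<not> (upper_half_plane \<inter> ball z (min \<rho> d0)) \<subseteq> \<gamma> ` {0<..\<tau>}"
   using zH \<rho> d0 \<tau> by (intro capacity_curve_hull(3)[OF g(1)]) (auto intro: upper_half_plane_open)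
  then obtain z' where "z' \<in> upper_half_plane" "z' \<in> ball z (min \<rho> d0)" "z' \<notin> \<gamma> ` {0<..\<tau>}" by blast
  then have z': "z' \<in> D" "dist z z' < \<rho>" "dist z z' < d0" by (auto simp: D_def)
  have "z \<in> \<gamma> ` {0<..\<tau>}" using \<tau> by (auto simp: z_def)
  then have "z' \<noteq> z" using z'(1) by (auto simp: D_def)
  obtain H where H: "loewner_path lam {0..\<tau>} H" "H 0 = z'" "H \<tau> = g \<tau> z'"
  proof
   show "loewner_path lam {0..\<tau>} (\<lambda>t. g t z')"
    unfolding loewner_path_def
   proof (intro ballI conjI)
    fix t assume t: "t \<in> {0..\<tau>}"
    have zt': "z' \<in> upper_half_plane - \<gamma> ` {0<..t}" using z'(1) t by (auto simp: D_def)
    have "g t z' \<in> upper_half_plane" using g(2)[OF t] zt' unfolding mapping_out_def bij_betw_def by blast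
    then show "Im (g t z') > 0" by (simp add: upper_half_plane_def)
    show "((\<lambda>t. g t z') has_vector_derivative 2 / (g t z' - of_real (lam t))) (at t within {0..\<tau>})" by (rule g(4)[OF t zt'])
   qed
   show "g 0 z' = z'" using mapping_out_trivial[of "g 0" z'] g(2)[of 0] \<tau> z'(1) by (simp add: D_def)
  qed simp
  have "\<bar>Im (H \<tau>)\<bar> \<le> dist (g \<tau> z') (of_real (lam \<tau>))"
   using abs_Im_le_cmod[of "g \<tau> z' - of_real (lam \<tau>)"] H(3) by (simp add: dist_norm)
  also have "\<dots> < c/2" using d0(2)[OF z'(1) \<open>z' \<noteq> z\<close>] z'(3) by (simp add: dist_commute)
  finally have H\<tau>: "Im (H \<tau>) < c/2" by simp
  have Imz': "\<bar>Im z' - y\<bar> < \<rho>"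
   using abs_Im_le_cmod[of "z' - z"] z'(2) by (simp add: dist_norm y_def norm_minus_commute)
  have "continuous_on {0..\<tau>} (\<lambda>t. Im (H t))" by (intro continuous_intros loewner_path_continuous[OF H(1)])
  moreover have "c/2 \<le> Im (H 0)" using Imz' yc \<rho>(2) \<open>c > 0\<close> unfolding H(2) by linarith
  \<comment> \<open>Stopping at height exactly \<open>c / 2\<close> keeps the weight of the second
    trajectory in the contraction estimate bounded below.\<close>
  ultimately have "\<exists>s\<ge>0. s \<le> \<tau> \<and> Im (H s) = c/2"
   using H\<tau> \<tau> by (intro IVT2') auto
  then obtain s where s: "0 \<le> s" "s \<le> \<tau>" "Im (H s) = c/2" by (elim exE conjE)
  have s\<tau>: "s < \<tau>" using s H\<tau> by (cases "s = \<tau>") auto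
  have sub: "{0..s} \<subseteq> {0..<\<tau>}" "{0..s} \<subseteq> {0..\<tau>}" using s s\<tau> by auto
  have con: "(cmod (G s - H s))^2 * (Im (G s) * Im (H s)) \<le> (cmod (z - z'))^2 * (y * Im z')"
   using loewner_path_contraction[OF loewner_path_subset[OF lp sub(1)] loewner_path_subset[OF H(1) sub(2)] s(1)] G0 H(2)
   by (simp add: y_def)
  have Gs: "Im (G s) \<ge> c" using big[of s] s s\<tau> by simp
  have "c/2 \<le> cmod (G s - H s)"
   using abs_Im_le_cmod[of "G s - H s"] Gs s(3) by simp
  then have "(c/2)^2 \<le> (cmod (G s - H s))^2" using \<open>c > 0\<close> by (intro power_mono) auto
  then have "(c/2)^2 * (c * (c/2)) \<le> (cmod (G s - H s))^2 * (Im (G s) * Im (H s))"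
   using Gs s(3) \<open>c > 0\<close> by (intro mult_mono) auto
  also have "\<dots> \<le> (cmod (z - z'))^2 * (y * Im z')" by (rule con)
  also have "\<dots> \<le> \<rho>^2 * (y * (2 * y))"
  proof (intro mult_mono power_mono)
   show "cmod (z - z') \<le> \<rho>" using z'(2) by (simp add: dist_norm)
   show "Im z' \<le> 2 * y" using Imz' \<rho> yc \<open>c > 0\<close> by linarith
   show "0 \<le> y * Im z'" using z'(1) yc \<open>c > 0\<close> by (simp add: D_def upper_half_plane_def)
  qed (use yc \<open>c > 0\<close> z'(1) in \<open>auto simp: D_def upper_half_plane_def\<close>)
  also have "\<dots> = (\<rho> * (8 * y))^2 / 32" by (simp add: power2_eq_square)
  also have "\<dots> \<le> (c^2)^2 / 32" using \<rho> yc \<open>c > 0\<close> by (intro divide_right_mono power_mono) auto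
  finally have "c ^ 4 / 8 \<le> c ^ 4 / 32" by (simp add: power2_eq_square power_numeral_reduce)
  then show False using \<open>c > 0\<close> by (simp add: field_simps)
 qed
 have "((\<lambda>t. Im (G t)) \<longlongrightarrow> 0) (at_left \<tau>)"
 proof (rule decreasing_tendsto_0_at_left[OF \<tau>])
  show "Im (G t) \<le> Im (G s)" if "0 \<le> s" "s \<le> t" "t < \<tau>" for s t
   by (rule loewner_path_Im_decreasing[OF lp]) (use that in auto)
  show "0 \<le> Im (G t)" if "0 \<le> t" "t < \<tau>" for t using loewner_pathD(1)[OF lp, of t] that by simp
 qed (rule small)
 then show thesis using that[OF lp] G0 by (simp add: z_def)
qed

text \<open>The two trajectories agree before \<open>r\<close> by uniqueness, and the surviving one
  has a positive height at \<open>r\<close> that bounds all earlier heights from below.\<close>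

lemma dying_path_not_alive:
 assumes G: "loewner_path lam {0..<r} G" and die: "((\<lambda>t. Im (G t)) \<longlongrightarrow> 0) (at_left r)"
  and H: "loewner_path lam {0..r} H" and eq: "G 0 = H 0" and r: "r > 0"
 shows False
proof -
 have *: "G t = H t" if t: "t \<in> {0..<r}" for t
 proof -
  have sub: "{0..t} \<subseteq> {0..<r}" "{0..t} \<subseteq> {0..r}" using t by auto
  show ?thesis using loewner_path_unique[OF loewner_path_subset[OF G sub(1)] loewner_path_subset[OF H sub(2)] eq, of t] t by simp
 qed
 have ev: "\<forall>\<^sub>F t in at_left r. Im (H r) \<le> Im (G t)"
  using eventually_at_left_real[OF r]
 proof (rule eventually_mono)
  fix t assume t: "t \<in> {0<..<r}"
  have "Im (H r) \<le> Im (H t)" by (rule loewner_path_Im_decreasing[OF H]) (use t in auto)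
  then show "Im (H r) \<le> Im (G t)" using * t by simp
 qed
 have "0 \<ge> Im (H r)" by (rule tendsto_lowerbound[OF die ev trivial_limit_at_left_real])
 then show False using loewner_pathD(1)[OF H, of r] r by simp
qed

lemma driven_by_curve:
 assumes "driven_by J \<gamma> lam"
 shows "capacity_curve J \<gamma>" "\<gamma> 0 = 0" "t \<in> J \<Longrightarrow> t > 0 \<Longrightarrow> \<gamma> t \<in> upper_half_plane"
proof -
 show c: "capacity_curve J \<gamma>" using assms unfolding driven_by_def by (rule conjunct1)
 show "\<gamma> 0 = 0" "t \<in> J \<Longrightarrow> t > 0 \<Longrightarrow> \<gamma> t \<in> upper_half_plane" using c by (simp_all add: capacity_curve_def)
qed

text \<open>The driver alone tells when a trajectory dies. The point \<open>\<gamma>1 t\<close> dies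
  at \<open>t\<close>, so it cannot survive the second flow and lies on \<open>\<gamma>2\<close> up
  to time \<open>t\<close>; being \<open>\<gamma>2 s\<close> with \<open>s < t\<close> would mean
  dying too early.\<close>

lemma driven_by_curve_unique:
 assumes d1: "driven_by {0..\<tau>} \<gamma>1 lam" and d2: "driven_by {0..\<tau>} \<gamma>2 lam" and t: "t \<in> {0..\<tau>}"
 shows "\<gamma>1 t = \<gamma>2 t"
proof (cases "t = 0")
 case True
 then show ?thesis using driven_by_curve(2)[OF d1] driven_by_curve(2)[OF d2] by simp
next
 case False
 then have t0: "t > 0" using t by simp
 have sub: "{0..t} \<subseteq> {0..\<tau>}" using t by auto
 obtain G where G: "loewner_path lam {0..<t} G" "G 0 = \<gamma>1 t" "((\<lambda>t. Im (G t)) \<longlongrightarrow> 0) (at_left t)"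
  by (rule driven_by_dying_path[OF driven_by_subset[OF d1 sub] t0]) (rule that)
 have "\<gamma>1 t \<in> upper_half_plane" by (rule driven_by_curve(3)[OF d1 t t0])
 have "\<gamma>1 t \<in> \<gamma>2 ` {0<..t}"
 proof (rule ccontr)
  assume "\<not> ?thesis"
  then have z: "\<gamma>1 t \<in> upper_half_plane - \<gamma>2 ` {0<..t}" using \<open>\<gamma>1 t \<in> upper_half_plane\<close> by simp
  obtain H where H: "loewner_path lam {0..t} H" "H 0 = \<gamma>1 t"
   by (rule driven_by_alive_path[OF driven_by_subset[OF d2 sub] less_imp_le[OF t0] z]) (rule that)
  have "G 0 = H 0" unfolding G(2) H(2) ..
  from dying_path_not_alive[OF G(1,3) H(1) this t0] show False .
 qed
 then obtain s where s: "s \<in> {0<..t}" "\<gamma>1 t = \<gamma>2 s" by blast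
 show ?thesis
 proof (cases "s = t")
  case True then show ?thesis using s(2) by (simp only:)
 next
  case False
  then have st: "0 < s" "s < t" using s(1) by auto
  have sub2: "{0..s} \<subseteq> {0..\<tau>}" using st t by auto
  obtain H where H: "loewner_path lam {0..<s} H" "H 0 = \<gamma>2 s" "((\<lambda>t. Im (H t)) \<longlongrightarrow> 0) (at_left s)"
   by (rule driven_by_dying_path[OF driven_by_subset[OF d2 sub2] st(1)]) (rule that)
  have "loewner_path lam {0..s} G" by (rule loewner_path_subset[OF G(1)]) (use st in auto)
  moreover have "H 0 = G 0" unfolding G(2) H(2) s(2) ..
  ultimately have False by (rule dying_path_not_alive[OF H(1,3) _ _ st(1)])
  then show ?thesis by (rule FalseE)
 qed
qed

subsection \<open>Existence of trajectories\<close>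

text \<open>Picard iteration measured against the weight \<open>exp (2 * K * (t - a))\<close>, in
  which one step halves the error; the iteration converges on the whole interval without
  subdivision.\<close>

lemma picard_lindelof:
 fixes F :: "real \<Rightarrow> complex \<Rightarrow> complex"
 assumes ab: "a \<le> b" and K: "K > 0"
  and cont: "\<And>x. continuous_on {a..b} x \<Longrightarrow> continuous_on {a..b} (\<lambda>s. F s (x s))"
  and lip: "\<And>s x y. s \<in> {a..b} \<Longrightarrow> cmod (F s x - F s y) \<le> K * cmod (x - y)"
 obtains x where "x a = x0" "\<And>t. t \<in> {a..b} \<Longrightarrow> (x has_vector_derivative F t (x t)) (at t within {a..b})"
proof -
 define X where "X n = ((\<lambda>x t. x0 + integral {a..t} (\<lambda>s. F s (x s))) ^^ n) (\<lambda>_. x0)" for n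
 have X_Suc: "X (Suc n) t = x0 + integral {a..t} (\<lambda>s. F s (X n s))" for n t by (simp add: X_def)
 have Xc: "continuous_on {a..b} (X n)" for n
 proof (induction n)
  case 0
  show ?case by (simp add: X_def)
 next
  case (Suc n)
  have "continuous_on {a..b} (\<lambda>t. x0 + integral {a..t} (\<lambda>s. F s (X n s)))"
   by (intro continuous_intros indefinite_integral_continuous_1 integrable_continuous_real cont Suc)
  then show ?case by (rule continuous_on_eq) (simp only: X_Suc)
 qed
 have "bounded ((\<lambda>t. X 1 t - X 0 t) ` {a..b})"
  by (intro compact_imp_bounded compact_continuous_image continuous_intros Xc) simp
 then obtain C where C: "\<And>t. t \<in> {a..b} \<Longrightarrow> cmod (X 1 t - X 0 t) \<le> C" unfolding bounded_iff by blast
 have C0: "C \<ge> 0" using order_trans[OF norm_ge_zero C[of a]] ab by simp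
 \<comment> \<open>Integrating \<open>K * exp (2 * K * (s - a))\<close> returns half of the weight,
   which is where the factor \<open>1 / 2 ^ n\<close> comes from.\<close>
 have step: "cmod (X (Suc n) t - X n t) \<le> C / 2 ^ n * exp (2 * K * (t - a))" if "t \<in> {a..b}" for n t using that
 proof (induction n arbitrary: t)
  case 0
  have "C * 1 \<le> C * exp (2 * K * (t - a))" using 0 K C0 by (intro mult_left_mono) auto
  then show ?case using C[OF 0] by simp
 next
  case (Suc n)
  have sub: "{a..t} \<subseteq> {a..b}" using Suc.prems by auto
  have int: "(\<lambda>s. F s (X m s)) integrable_on {a..t}" for m
   by (rule integrable_continuous_real[OF continuous_on_subset[OF cont[OF Xc] sub]])
  have e: "X (Suc (Suc n)) t - X (Suc n) t = integral {a..t} (\<lambda>s. F s (X (Suc n) s) - F s (X n s))"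
   by (simp only: X_Suc[of "Suc n" t] X_Suc[of n t] integral_diff[OF int int] add_diff_cancel_left)
  have hi: "((\<lambda>s. K * (C / 2 ^ n * exp (2 * K * (s - a)))) has_integral
    (C / 2 ^ n * exp (2 * K * (t - a)) / 2 - C / 2 ^ n * exp (2 * K * (a - a)) / 2)) {a..t}"
   using Suc.prems by (intro fundamental_theorem_of_calculus)
    (auto intro!: derivative_eq_intros simp flip: has_real_derivative_iff_has_vector_derivative)
  have "cmod (integral {a..t} (\<lambda>s. F s (X (Suc n) s) - F s (X n s))) \<le> integral {a..t} (\<lambda>s. K * (C / 2 ^ n * exp (2 * K * (s - a))))"
  proof (rule integral_norm_bound_integral)
   show "(\<lambda>s. F s (X (Suc n) s) - F s (X n s)) integrable_on {a..t}" by (intro integrable_diff int)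
   show "(\<lambda>s. K * (C / 2 ^ n * exp (2 * K * (s - a)))) integrable_on {a..t}" using hi by blast
   fix s assume "s \<in> {a..t}"
   then have s: "s \<in> {a..b}" using sub by blast
   have "cmod (F s (X (Suc n) s) - F s (X n s)) \<le> K * cmod (X (Suc n) s - X n s)" by (rule lip[OF s])
   also have "\<dots> \<le> K * (C / 2 ^ n * exp (2 * K * (s - a)))" using K by (intro mult_left_mono Suc.IH s) auto
   finally show "cmod (F s (X (Suc n) s) - F s (X n s)) \<le> K * (C / 2 ^ n * exp (2 * K * (s - a)))" .
  qed
  also have "\<dots> = C / 2 ^ n * exp (2 * K * (t - a)) / 2 - C / 2 ^ n / 2" using integral_unique[OF hi] by simp
  also have "\<dots> \<le> C / 2 ^ Suc n * exp (2 * K * (t - a))" unfolding power_Suc2 using C0 by simp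
  finally show ?case unfolding e .
 qed
 have "uniform_limit {a..b} (\<lambda>n t. \<Sum>i<n. (X (Suc i) t - X i t)) (\<lambda>t. \<Sum>i. (X (Suc i) t - X i t)) sequentially"
 proof (rule Weierstrass_m_test)
  show "summable (\<lambda>n. C * exp (2 * K * (b - a)) * (1/2) ^ n)" by (intro summable_mult summable_geometric) simp
  fix n t assume t: "t \<in> {a..b}"
  have "C / 2 ^ n * exp (2 * K * (t - a)) \<le> C / 2 ^ n * exp (2 * K * (b - a))"
   using t K C0 by (intro mult_left_mono) auto
  then show "cmod (X (Suc n) t - X n t) \<le> C * exp (2 * K * (b - a)) * (1/2) ^ n"
   using step[OF t, of n] by (simp add: power_divide)
 qed
 moreover define Y where "Y t = x0 + (\<Sum>i. (X (Suc i) t - X i t))" for t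
 ultimately have uX: "uniform_limit {a..b} X Y sequentially"
 proof -
  assume u: "uniform_limit {a..b} (\<lambda>n t. \<Sum>i<n. (X (Suc i) t - X i t)) (\<lambda>t. \<Sum>i. (X (Suc i) t - X i t)) sequentially"
  have "dist (X n t) (Y t) = dist (\<Sum>i<n. (X (Suc i) t - X i t)) (\<Sum>i. (X (Suc i) t - X i t))" for n t
  proof -
   have x: "X 0 t = x0" by (simp add: X_def)
   have "(\<Sum>i<n. X (Suc i) t - X i t) = X n t - X 0 t" by (rule sum_lessThan_telescope)
   then show ?thesis unfolding Y_def dist_norm x by (simp add: diff_diff_add)
  qed
  then show ?thesis using u unfolding uniform_limit_iff by simp
 qed
 have Yc: "continuous_on {a..b} Y" by (rule uniform_limit_theorem[OF _ uX]) (auto simp: Xc)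
 have fp: "x0 + integral {a..t} (\<lambda>s. F s (Y s)) = Y t" if t: "t \<in> {a..b}" for t
 proof -
  have sub: "{a..t} \<subseteq> {a..b}" using t by auto
  have uF: "uniform_limit {a..t} (\<lambda>n s. F s (X n s)) (\<lambda>s. F s (Y s)) sequentially"
  proof (rule uniform_limitI)
   fix e :: real assume "e > 0"
   then have "\<forall>\<^sub>F n in sequentially. \<forall>s\<in>{a..b}. dist (X n s) (Y s) < e / K" using K by (intro uniform_limitD[OF uX]) simp
   then show "\<forall>\<^sub>F n in sequentially. \<forall>s\<in>{a..t}. dist (F s (X n s)) (F s (Y s)) < e"
   proof eventually_elim
    case (elim n)
    show ?case
    proof
     fix s assume "s \<in> {a..t}"
     then have s: "s \<in> {a..b}" using sub by blast
     have "K * dist (X n s) (Y s) < K * (e / K)" using elim s K by (intro mult_strict_left_mono) auto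
     then show "dist (F s (X n s)) (F s (Y s)) < e" using lip[OF s, of "X n s" "Y s"] K by (simp add: dist_norm)
    qed
   qed
  qed
  obtain I J where IJ: "\<And>n. ((\<lambda>s. F s (X n s)) has_integral I n) {a..t}" "((\<lambda>s. F s (Y s)) has_integral J) {a..t}" "I \<longlonglongrightarrow> J"
   by (rule uniform_limit_integral[OF uF continuous_on_subset[OF cont[OF Xc] sub] sequentially_bot]) (rule that)
  have "(\<lambda>n. x0 + I n) \<longlonglongrightarrow> x0 + J" by (intro tendsto_intros IJ)
  moreover have "(\<lambda>n. x0 + I n) = (\<lambda>n. X (Suc n) t)" using integral_unique[OF IJ(1)] by (simp only: X_Suc)
  moreover have "(\<lambda>n. X (Suc n) t) \<longlonglongrightarrow> Y t" by (rule LIMSEQ_Suc[OF tendsto_uniform_limitI[OF uX t]])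
  ultimately have "x0 + J = Y t" using LIMSEQ_unique by metis
  then show ?thesis using integral_unique[OF IJ(2)] by simp
 qed
 show thesis
 proof (rule that[of Y])
  show "Y a = x0" using fp[of a] ab by simp
  fix t assume t: "t \<in> {a..b}"
  have "((\<lambda>t. x0 + integral {a..t} (\<lambda>s. F s (Y s))) has_vector_derivative 0 + F t (Y t)) (at t within {a..b})"
   by (intro has_vector_derivative_add has_vector_derivative_const integral_has_vector_derivative cont Yc t)
  then have "((\<lambda>t. x0 + integral {a..t} (\<lambda>s. F s (Y s))) has_vector_derivative F t (Y t)) (at t within {a..b})" by simp
  then show "(Y has_vector_derivative F t (Y t)) (at t within {a..b})"
   by (rule has_vector_derivative_transform[OF t, rotated]) (rule fp[symmetric])
 qed
qed

text \<open>The vector field \<open>2 / (z - lam)\<close> is Lipschitz only away from the real line, so the imaginary part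
 is cut off from below.\<close>

lemma truncated_flow_exists:
 fixes c p :: complex
 assumes ab: "a \<le> b" and l: "continuous_on {a..b} l" and y0: "y0 > 0" and c: "cmod c = 1"
 obtains Q where "Q a = p" "\<And>t. t \<in> {a..b} \<Longrightarrow>
  (Q has_vector_derivative c * (2 / (of_real (Re (Q t)) + \<i> * of_real (max (Im (Q t)) y0) - of_real (l t)))) (at t within {a..b})"
proof -
 \<comment> \<open>The nearest-point retraction onto the half-plane of height at least
   \<open>y0\<close>: it does not increase distances, so the truncated field is Lipschitz on all of
   the plane.\<close>
 define L where "L z = of_real (Re z) + \<i> * of_real (max (Im z) y0)" for z
 have im: "cmod (L z - of_real r) \<ge> y0" for z r
  using abs_Im_le_cmod[of "L z - of_real r"] y0 by (simp add: L_def)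
 have nz: "L z - of_real r \<noteq> 0" for z r using im[of z r] y0 by auto
 have Llip: "cmod (L x - L y) \<le> cmod (x - y)" for x y
 proof (rule power2_le_imp_le)
  have "\<bar>max (Im x) y0 - max (Im y) y0\<bar> \<le> \<bar>Im x - Im y\<bar>" by (simp add: max_def)
  then have "(max (Im x) y0 - max (Im y) y0)^2 \<le> (Im x - Im y)^2" by (simp only: abs_le_square_iff)
  then show "(cmod (L x - L y))^2 \<le> (cmod (x - y))^2" unfolding cmod_power2 L_def by simp
 qed simp
 obtain Q where Q: "Q a = p" "\<And>t. t \<in> {a..b} \<Longrightarrow> (Q has_vector_derivative c * (2 / (L (Q t) - of_real (l t)))) (at t within {a..b})"
 proof (rule picard_lindelof[OF ab, of "2 / y0^2" "\<lambda>s z. c * (2 / (L z - of_real (l s)))" p])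
  show "2 / y0^2 > 0" using y0 by simp
  show "continuous_on {a..b} (\<lambda>s. c * (2 / (L (x s) - of_real (l s))))" if "continuous_on {a..b} x" for x
   using nz by (intro continuous_intros) (auto simp: L_def intro!: continuous_intros that l)
  show "cmod (c * (2 / (L x - of_real (l s))) - c * (2 / (L y - of_real (l s)))) \<le> 2 / y0^2 * cmod (x - y)" for s x y
  proof -
   have "c * (2 / (L x - of_real (l s))) - c * (2 / (L y - of_real (l s)))
     = c * (2 * (L y - L x) / ((L x - of_real (l s)) * (L y - of_real (l s))))"
    using nz[of x "l s"] nz[of y "l s"] by (simp add: field_simps)
   then have "cmod (c * (2 / (L x - of_real (l s))) - c * (2 / (L y - of_real (l s))))
     = 2 * cmod (L x - L y) / (cmod (L x - of_real (l s)) * cmod (L y - of_real (l s)))"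
    using c by (simp only: norm_mult norm_divide norm_minus_commute[of "L y" "L x"]) simp
   also have "\<dots> \<le> 2 * cmod (x - y) / (y0 * y0)"
    using im[of x "l s"] im[of y "l s"] y0 Llip[of x y] by (intro frac_le mult_mono) auto
   finally show ?thesis by (simp add: power2_eq_square)
  qed
 qed (rule that)
 show thesis
 proof (rule that[where Q = Q])
  show "Q a = p" by (rule Q(1))
  show "(Q has_vector_derivative c * (2 / (of_real (Re (Q t)) + \<i> * of_real (max (Im (Q t)) y0) - of_real (l t)))) (at t within {a..b})"
   if "t \<in> {a..b}" for t using Q(2)[OF that] unfolding L_def .
 qed
qed

text \<open>Truncation at height \<open>c / 2\<close> bounds the speed by \<open>4 / c\<close>, so
  in time \<open>c^2 / 8\<close> the height drops by at most \<open>c / 2\<close> and the truncation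
  is never felt.\<close>

lemma loewner_forward_exists:
 assumes ab: "a \<le> b" and l: "continuous_on {a..b} lam" and c: "c > 0" "Im p \<ge> c" and small: "b - a \<le> c^2 / 8"
 obtains P where "loewner_path lam {a..b} P" "P a = p"
proof -
 obtain Q where Q: "Q a = p" "\<And>t. t \<in> {a..b} \<Longrightarrow>
  (Q has_vector_derivative 1 * (2 / (of_real (Re (Q t)) + \<i> * of_real (max (Im (Q t)) (c/2)) - of_real (lam t)))) (at t within {a..b})"
  using c by (rule_tac truncated_flow_exists[OF ab l, of "c/2" 1 p]) auto
 have im: "Im (Q t) \<ge> c/2" if t: "t \<in> {a..b}" for t
 proof -
  have "cmod (Q t - Q a) \<le> 4 / c * \<bar>t - a\<bar>"
  proof (rule vector_derivative_bound[OF convex_real_interval(5) Q(2)])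
   fix s assume "s \<in> {a..b}"
   have "c/2 \<le> cmod (of_real (Re (Q s)) + \<i> * of_real (max (Im (Q s)) (c/2)) - of_real (lam s))"
    using abs_Im_le_cmod[of "of_real (Re (Q s)) + \<i> * of_real (max (Im (Q s)) (c/2)) - of_real (lam s)"] c by simp
   then have "2 / cmod (of_real (Re (Q s)) + \<i> * of_real (max (Im (Q s)) (c/2)) - of_real (lam s)) \<le> 2 / (c/2)"
    using c by (intro divide_left_mono mult_pos_pos) auto
   then show "cmod (1 * (2 / (of_real (Re (Q s)) + \<i> * of_real (max (Im (Q s)) (c/2)) - of_real (lam s)))) \<le> 4 / c"
    by (simp add: norm_divide)
  qed (use t in auto)
  also have "\<dots> \<le> 4 / c * (c^2 / 8)" using t small c by (intro mult_left_mono) auto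
  also have "\<dots> = c/2" using c by (simp add: power2_eq_square)
  finally show ?thesis using abs_Im_le_cmod[of "Q t - Q a"] Q(1) c by simp
 qed
 have "loewner_path lam {a..b} Q" unfolding loewner_path_def
 proof (intro ballI conjI)
  fix t assume t: "t \<in> {a..b}"
  show "Im (Q t) > 0" using im[OF t] c by simp
  have "of_real (Re (Q t)) + \<i> * of_real (max (Im (Q t)) (c/2)) = Q t" using im[OF t] by (simp add: complex_eq_iff)
  with Q(2)[OF t] show "(Q has_vector_derivative 2 / (Q t - of_real (lam t))) (at t within {a..b})" by simp
 qed
 then show thesis using that Q(1) by blast
qed

text \<open>Run backwards the height only increases, so truncation at the final height
  \<open>Im p\<close> is never felt and the solution exists over any length of time.\<close>

lemma loewner_backward_exists:
 assumes ab: "a \<le> b" and l: "continuous_on {a..b} lam" and p: "Im p > 0"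
 obtains P where "loewner_path lam {a..b} P" "P b = p"
proof -
 \<comment> \<open>Time is reflected by \<open>s\<close> to \<open>a + b - s\<close>, and the sign
   of the field is reversed accordingly.\<close>
 have l': "continuous_on {a..b} (\<lambda>s. lam (a + b - s))"
  by (rule continuous_on_compose2[OF l]) (auto intro!: continuous_intros)
 obtain Q where Q: "Q a = p" "\<And>t. t \<in> {a..b} \<Longrightarrow>
  (Q has_vector_derivative (- 1) * (2 / (of_real (Re (Q t)) + \<i> * of_real (max (Im (Q t)) (Im p)) - of_real (lam (a + b - t))))) (at t within {a..b})"
  using p by (rule_tac truncated_flow_exists[OF ab l', of "Im p" "-1" p]) auto
 have im: "Im (Q t) \<ge> Im p" if t: "t \<in> {a..b}" for t
 proof -
  define A where "A s = of_real (Re (Q s)) + \<i> * of_real (max (Im (Q s)) (Im p)) - of_real (lam (a + b - s))" for s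
  have "- Im (Q t) \<le> - Im (Q a)"
  proof (rule derivative_nonpos_decreasing[of a t "\<lambda>s. - Im (Q s)" "\<lambda>s. - Im ((- 1) * (2 / A s))"])
   fix s assume s: "s \<in> {a..t}"
   have "(Q has_vector_derivative (- 1) * (2 / A s)) (at s within {a..t})"
    unfolding A_def by (rule has_vector_derivative_within_subset[OF Q(2)]) (use s t in auto)
   then have "((\<lambda>s. Im (Q s)) has_real_derivative Im ((- 1) * (2 / A s))) (at s within {a..t})"
    by (simp add: has_real_derivative_iff_has_vector_derivative has_vector_derivative_complex_iff)
   then show "((\<lambda>s. - Im (Q s)) has_real_derivative - Im ((- 1) * (2 / A s))) (at s within {a..t})" by (rule DERIV_minus)
   have "Im (A s) > 0" using p by (simp add: A_def)
   then show "- Im ((- 1) * (2 / A s)) \<le> 0" by (simp add: Im_divide divide_nonpos_nonneg)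
  qed (use t in auto)
  then show ?thesis using Q(1) by simp
 qed
 have "loewner_path lam {a..b} (\<lambda>s. Q (a + b - s))" unfolding loewner_path_def
 proof (intro ballI conjI)
  fix t assume t: "t \<in> {a..b}"
  then have t': "a + b - t \<in> {a..b}" by auto
  show "Im (Q (a + b - t)) > 0" using im[OF t'] p by simp
  have im_eq: "(\<lambda>s. a + b - s) ` {a..b} = {a..b}" by (auto simp: image_iff intro!: bexI[of _ "a + b - _"])
  have "of_real (Re (Q (a + b - t))) + \<i> * of_real (max (Im (Q (a + b - t))) (Im p)) = Q (a + b - t)"
   using im[OF t'] by (simp add: complex_eq_iff)
  with Q(2)[OF t'] have "(Q has_vector_derivative - (2 / (Q (a + b - t) - of_real (lam t)))) (at (a + b - t) within {a..b})" by simp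
  moreover have "((\<lambda>s. a + b - s) has_vector_derivative (- 1)) (at t within {a..b})"
   by (auto intro!: derivative_eq_intros simp flip: has_real_derivative_iff_has_vector_derivative)
  ultimately have "((Q \<circ> (\<lambda>s. a + b - s)) has_vector_derivative (- 1) *\<^sub>R (- (2 / (Q (a + b - t) - of_real (lam t))))) (at t within {a..b})"
   by (intro vector_diff_chain_within) (simp_all add: im_eq)
  then show "((\<lambda>s. Q (a + b - s)) has_vector_derivative 2 / (Q (a + b - t) - of_real (lam t))) (at t within {a..b})"
   by (simp add: o_def)
 qed
 then show thesis using that[of "\<lambda>s. Q (a + b - s)"] Q(1) by simp
qed

text \<open>The difference solves a linear equation, so an exponential integrating factor gives it
  exactly. Injectivity, backward uniqueness, the derivative of the inverse maps and the contraction
  in the cone all come from this formula.\<close>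

lemma loewner_path_difference:
 assumes G: "loewner_path lam {a..b} G" and H: "loewner_path lam {a..b} H" and ab: "a \<le> b" and l: "continuous_on {a..b} lam"
 shows "G a - H a = (G b - H b) * exp (integral {a..b} (\<lambda>t. 2 / ((G t - of_real (lam t)) * (H t - of_real (lam t)))))"
proof -
 define k where "k t = 2 / ((G t - of_real (lam t)) * (H t - of_real (lam t)))" for t
 define \<phi> where "\<phi> t = (G t - H t) * exp (integral {a..t} k)" for t
 have kc: "continuous_on {a..b} k" unfolding k_def
  using loewner_pathD(2)[OF G] loewner_pathD(2)[OF H]
  by (intro continuous_intros loewner_path_continuous[OF G] loewner_path_continuous[OF H] l) auto
 have "cmod (\<phi> b - \<phi> a) \<le> 0 * \<bar>b - a\<bar>"
 proof (rule vector_derivative_bound[OF convex_real_interval(5)])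
  fix t assume t: "t \<in> {a..b}"
  have "((\<lambda>t. integral {a..t} k) has_vector_derivative k t) (at t within {a..b})"
   by (rule integral_has_vector_derivative[OF kc t])
  then have "((exp \<circ> (\<lambda>t. integral {a..t} k)) has_vector_derivative k t * exp (integral {a..t} k)) (at t within {a..b})"
   by (rule field_vector_diff_chain_within) (auto intro!: derivative_eq_intros)
  then have e: "((\<lambda>t. exp (integral {a..t} k)) has_vector_derivative k t * exp (integral {a..t} k)) (at t within {a..b})"
   by (simp add: o_def)
  have "(\<phi> has_vector_derivative (G t - H t) * (k t * exp (integral {a..t} k))
    + (2 / (G t - of_real (lam t)) - 2 / (H t - of_real (lam t))) * exp (integral {a..t} k)) (at t within {a..b})"
   unfolding \<phi>_def by (intro has_vector_derivative_mult has_vector_derivative_diff e loewner_pathD(3)[OF G t] loewner_pathD(3)[OF H t])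
  moreover have "(u - v) * (2 / (u * v)) + (2 / u - 2 / v) = 0" if "u \<noteq> 0" "v \<noteq> 0" for u v :: complex
   using that by (simp add: field_simps)
  from this[OF loewner_pathD(2)[OF G t] loewner_pathD(2)[OF H t]]
  have "(G t - H t) * k t + (2 / (G t - of_real (lam t)) - 2 / (H t - of_real (lam t))) = 0"
   by (simp add: k_def)
  then have "(G t - H t) * (k t * exp (integral {a..t} k))
    + (2 / (G t - of_real (lam t)) - 2 / (H t - of_real (lam t))) * exp (integral {a..t} k) = 0"
   by (simp add: mult.assoc[symmetric] distrib_right[symmetric])
  ultimately show "(\<phi> has_vector_derivative 0) (at t within {a..b})" by simp
 qed (use ab in auto)
 then show ?thesis by (simp add: \<phi>_def k_def[abs_def])
qed

lemma loewner_path_cong: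
 assumes "loewner_path lam S G" "\<And>t. t \<in> S \<Longrightarrow> H t = G t"
 shows "loewner_path lam S H"
 unfolding loewner_path_def
proof (intro ballI conjI)
 fix t assume t: "t \<in> S"
 show "Im (H t) > 0" using loewner_pathD(1)[OF assms(1) t] assms(2)[OF t] by simp
 have "(H has_vector_derivative 2 / (G t - of_real (lam t))) (at t within S)"
  by (rule has_vector_derivative_transform[OF t _ loewner_pathD(3)[OF assms(1) t]]) (rule assms(2))
 then show "(H has_vector_derivative 2 / (H t - of_real (lam t))) (at t within S)" using assms(2)[OF t] by simp
qed

lemma loewner_path_backward_unique:
 assumes G: "loewner_path lam {a..b} G" and H: "loewner_path lam {a..b} H" and l: "continuous_on {a..b} lam"
  and eq: "G b = H b" and t: "t \<in> {a..b}"
 shows "G t = H t"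
proof -
 have sub: "{t..b} \<subseteq> {a..b}" "t \<le> b" using t by auto
 have "G t - H t = 0"
  using loewner_path_difference[OF loewner_path_subset[OF G sub(1)] loewner_path_subset[OF H sub(1)] sub(2) continuous_on_subset[OF l sub(1)]] eq
  by simp
 then show ?thesis by simp
qed

subsection \<open>The curve generated by a smooth driver\<close>

definition loewner_domain :: "(real \<Rightarrow> real) \<Rightarrow> real \<Rightarrow> complex set" where
 "loewner_domain lam t = {z. \<exists>P. loewner_path lam {0..t} P \<and> P 0 = z}"

text \<open>The choice is harmless, since trajectories from a given starting point are
  unique.\<close>

definition loewner_map :: "(real \<Rightarrow> real) \<Rightarrow> real \<Rightarrow> complex \<Rightarrow> complex" where
 "loewner_map lam t z = (SOME P. loewner_path lam {0..t} P \<and> P 0 = z) t"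

lemma loewner_map_eq:
 assumes P: "loewner_path lam {0..t} P" and s: "s \<in> {0..t}"
 shows "P 0 \<in> loewner_domain lam s" "loewner_map lam s (P 0) = P s"
proof -
 have sub: "{0..s} \<subseteq> {0..t}" using s by auto
 note P' = loewner_path_subset[OF P sub]
 show "P 0 \<in> loewner_domain lam s" unfolding loewner_domain_def by (intro CollectI exI[of _ P] conjI P' refl)
 have *: "loewner_path lam {0..s} (SOME Q. loewner_path lam {0..s} Q \<and> Q 0 = P 0) \<and> (SOME Q. loewner_path lam {0..s} Q \<and> Q 0 = P 0) 0 = P 0"
  by (rule someI[of "\<lambda>Q. loewner_path lam {0..s} Q \<and> Q 0 = P 0" P]) (intro conjI P' refl)
 show "loewner_map lam s (P 0) = P s"
  unfolding loewner_map_def by (rule loewner_path_unique[OF conjunct1[OF *] P' conjunct2[OF *]]) (use s in simp)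
qed

lemma loewner_map_path:
 assumes "z \<in> loewner_domain lam t" "0 \<le> t"
 shows "loewner_path lam {0..t} (\<lambda>s. loewner_map lam s z)" "loewner_map lam 0 z = z"
proof -
 obtain P where P: "loewner_path lam {0..t} P" "P 0 = z" using assms(1) unfolding loewner_domain_def by (elim CollectE exE conjE)
 show "loewner_path lam {0..t} (\<lambda>s. loewner_map lam s z)"
  by (rule loewner_path_cong[OF P(1)]) (use loewner_map_eq(2)[OF P(1)] P(2) in auto)
 show "loewner_map lam 0 z = z" using loewner_map_eq(2)[OF P(1), of 0] P(2) assms by simp
qed

lemma loewner_domain_antimono:
 assumes "z \<in> loewner_domain lam t" "s \<in> {0..t}"
 shows "z \<in> loewner_domain lam s"
proof -
 obtain P where P: "loewner_path lam {0..t} P" "P 0 = z" using assms(1) unfolding loewner_domain_def by (elim CollectE exE conjE)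
 show ?thesis using loewner_map_eq(1)[OF P(1) assms(2)] P(2) by simp
qed

text \<open>Continuous induction from the right: the largest point with
  \<open>\<phi> \<le> 0\<close> would have only positive values to its right, contradicting the
  step.\<close>

lemma backward_bootstrap:
 fixes \<phi> :: "real \<Rightarrow> real"
 assumes cont: "continuous_on {a..b} \<phi>"
  and step: "\<And>s. s \<in> {a..b} \<Longrightarrow> (\<And>u. u \<in> {s<..b} \<Longrightarrow> \<phi> u > 0) \<Longrightarrow> \<phi> s > 0"
  and s: "s \<in> {a..b}"
 shows "\<phi> s > 0"
proof (rule ccontr)
 assume neg: "\<not> \<phi> s > 0"
 define S where "S = {a..b} \<inter> \<phi> -` {..0}"
 have "closed S" unfolding S_def by (rule continuous_closed_preimage[OF cont]) auto
 moreover have "bounded S" by (rule bounded_subset[OF bounded_closed_interval[of a b]]) (auto simp: S_def)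
 ultimately have "compact S" by (simp add: compact_eq_bounded_closed)
 moreover have "S \<noteq> {}" using neg s by (auto simp: S_def)
 ultimately obtain m where m: "m \<in> S" "\<And>t. t \<in> S \<Longrightarrow> t \<le> m" using compact_attains_sup by metis
 have mab: "m \<in> {a..b}" using m(1) by (simp add: S_def)
 have "\<phi> m > 0"
 proof (rule step[OF mab])
  fix u assume u: "u \<in> {m<..b}"
  then have "u \<notin> S" using m(2)[of u] by auto
  then show "\<phi> u > 0" using u mab by (auto simp: S_def)
 qed
 then show False using m(1) by (simp add: S_def)
qed

text \<open>The condition \<open>short\<close> is invariant under scaling space by \<open>r\<close>
  and time by \<open>r^2\<close>. It is what confines backward trajectories near the vertical, and
  thereby makes the driver generate a simple curve.\<close>

locale loewner_driver =
 fixes lam lam' :: "real \<Rightarrow> real" and \<tau> M :: real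
 assumes duration: "\<tau> > 0"
  and derivative: "\<And>t. t \<in> {0..\<tau>} \<Longrightarrow> (lam has_real_derivative lam' t) (at t within {0..\<tau>})"
  and derivative_continuous: "continuous_on {0..\<tau>} lam'"
  and slope: "\<And>t. t \<in> {0..\<tau>} \<Longrightarrow> \<bar>lam' t\<bar> \<le> M"
  and short: "M^2 * \<tau> \<le> 1 / 2"
  and start: "lam 0 = 0"
begin

abbreviation "D \<equiv> loewner_domain lam"
abbreviation "g \<equiv> loewner_map lam"

lemma slope_nonneg: "M \<ge> 0"
 using slope[of 0] duration by (simp add: order_trans[OF abs_ge_zero])

lemma driver_continuous: "{a..b} \<subseteq> {0..\<tau>} \<Longrightarrow> continuous_on {a..b} lam"
proof (rule continuous_on_subset)
 show "continuous_on {0..\<tau>} lam" unfolding continuous_on_eq_continuous_within using derivative DERIV_continuous by blast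
qed

lemma domain_upper: "z \<in> D t \<Longrightarrow> 0 \<le> t \<Longrightarrow> Im (g t z) > 0" "z \<in> D t \<Longrightarrow> 0 \<le> t \<Longrightarrow> Im z > 0"
proof -
 assume z: "z \<in> D t" "0 \<le> t"
 show "Im (g t z) > 0" using loewner_pathD(1)[OF loewner_map_path(1)[OF z], of t] z(2) by simp
 show "Im z > 0" using loewner_pathD(1)[OF loewner_map_path(1)[OF z], of 0] z(2) loewner_map_path(2)[OF z] by simp
qed

text \<open>Flowing backwards from \<open>p\<close> is always possible, so every point of the
  half-plane is reached at time \<open>t\<close>.\<close>

lemma preimage_exists:
 assumes t: "t \<in> {0..\<tau>}" and p: "Im p > 0"
 shows "\<exists>z\<in>D t. g t z = p"
proof -
 have sub: "{0..t} \<subseteq> {0..\<tau>}" and t0: "0 \<le> t" using t by auto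
 obtain P where P: "loewner_path lam {0..t} P" "P t = p"
  by (rule loewner_backward_exists[OF t0 driver_continuous[OF sub] p]) (rule that)
 show ?thesis using loewner_map_eq[OF P(1), of t] P(2) t0 by (intro bexI[of _ "P 0"]) auto
qed

lemma map_difference:
 assumes z: "z \<in> D t" "z' \<in> D t" and st: "0 \<le> s" "s \<le> t" "t \<le> \<tau>"
 shows "g s z - g s z' = (g t z - g t z') * exp (integral {s..t} (\<lambda>u. 2 / ((g u z - of_real (lam u)) * (g u z' - of_real (lam u)))))"
proof -
 have t: "0 \<le> t" and sub: "{s..t} \<subseteq> {0..t}" "{s..t} \<subseteq> {0..\<tau>}" using st by auto
 show ?thesis
  by (rule loewner_path_difference[OF loewner_path_subset[OF loewner_map_path(1)[OF z(1) t] sub(1)]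
     loewner_path_subset[OF loewner_map_path(1)[OF z(2) t] sub(1)] st(2) driver_continuous[OF sub(2)]])
qed

lemma map_inj: "t \<in> {0..\<tau>} \<Longrightarrow> inj_on (g t) (D t)"
proof (rule inj_onI)
 fix z z' assume t: "t \<in> {0..\<tau>}" and z: "z \<in> D t" "z' \<in> D t" and eq: "g t z = g t z'"
 have t': "0 \<le> t" "t \<le> \<tau>" using t by auto
 have "g 0 z - g 0 z' = 0" unfolding map_difference[OF z order_refl t'] eq by (simp only: diff_self mult_zero_left)
 then show "z = z'" unfolding loewner_map_path(2)[OF z(1) t'(1)] loewner_map_path(2)[OF z(2) t'(1)] by (simp only: right_minus_eq)
qed

lemma map_bij: 
 assumes t: "t \<in> {0..\<tau>}"
 shows "bij_betw (g t) (D t) upper_half_plane"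
proof (rule bij_betw_imageI[OF map_inj[OF t]])
 show "g t ` D t = upper_half_plane"
 proof (intro equalityI subsetI)
  fix p assume "p \<in> g t ` D t"
  then obtain z where "z \<in> D t" "p = g t z" by (elim imageE)
  then show "p \<in> upper_half_plane" using domain_upper(1)[of z t] t by (simp add: upper_half_plane_def)
 next
  fix p assume "p \<in> upper_half_plane"
  then have "Im p > 0" by (simp add: upper_half_plane_def)
  from preimage_exists[OF t this] obtain z where "z \<in> D t" "g t z = p" by (elim bexE)
  then show "p \<in> g t ` D t" by (intro image_eqI[of p "g t" z]) simp_all
 qed
qed

lemma domain_0: "D 0 = upper_half_plane"
proof -
 have "z \<in> D 0" if "Im z > 0" for z
 proof -
  have "0 \<in> {0..\<tau>}" using duration by simp
  from preimage_exists[OF this that] obtain x where "x \<in> D 0" "g 0 x = z" by (elim bexE)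
  then show ?thesis using loewner_map_path(2)[of x lam 0] by simp
 qed
 moreover have "Im z > 0" if "z \<in> D 0" for z by (rule domain_upper(2)[OF that order_refl])
 ultimately show ?thesis unfolding upper_half_plane_def by blast
qed

text \<open>Instead of gluing two solutions at \<open>t\<close>, the short continuation is followed
  to its end, a starting point with the same end is taken from surjectivity at \<open>t'\<close>,
  and backward uniqueness with injectivity at \<open>t\<close> identifies it with
  \<open>z\<close>.\<close>

lemma domain_extend:
 assumes z: "z \<in> D t" and c: "Im (g t z) \<ge> c" "c > 0" and t: "0 \<le> t" "t \<le> t'" "t' \<le> \<tau>" "t' - t \<le> c^2 / 8"
 shows "z \<in> D t'"
proof -
 have sub: "{t..t'} \<subseteq> {0..\<tau>}" "{t..t'} \<subseteq> {0..t'}" using t by auto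
 obtain P where P: "loewner_path lam {t..t'} P" "P t = g t z"
  by (rule loewner_forward_exists[OF t(2) driver_continuous[OF sub(1)] c(2,1) t(4)]) (rule that)
 have "Im (P t') > 0" using loewner_pathD(1)[OF P(1), of t'] t by simp
 then obtain x where x: "x \<in> D t'" "g t' x = P t'" using preimage_exists[of t' "P t'"] t by auto
 have t'0: "0 \<le> t'" using t by simp
 have "g t x = P t"
  by (rule loewner_path_backward_unique[OF loewner_path_subset[OF loewner_map_path(1)[OF x(1) t'0] sub(2)] P(1) driver_continuous[OF sub(1)] x(2)])
   (use t in simp)
 moreover have "x \<in> D t" by (rule loewner_domain_antimono[OF x(1)]) (use t in simp)
 ultimately have "x = z" using inj_onD[OF map_inj, of t x z] z P(2) t by simp
 then show ?thesis using x(1) by simp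
qed

text \<open>By the difference formula the difference quotient of the inverse is
  \<open>exp (J q)\<close>, so differentiability reduces to continuity of \<open>J\<close> at
  \<open>p\<close>. The inverse is treated before the map because its domain, the half-plane, is
  known to be open.\<close>

lemma inverse_derivative:
 assumes t: "t \<in> {0..\<tau>}" and p: "Im p > 0"
  and f: "\<And>q. Im q > 0 \<Longrightarrow> f q \<in> D t \<and> g t (f q) = q"
 shows "\<exists>d. (f has_field_derivative d) (at p)"
proof -
 define J where "J q = integral {0..t} (\<lambda>u. 2 / ((g u (f q) - of_real (lam u)) * (g u (f p) - of_real (lam u))))" for q
 define y where "y = Im p"
 \<comment> \<open>The exponent comes from the integrand \<open>2 / (A * B)\<close>, bounded by
   \<open>4 / y^2\<close> once one trajectory ends above \<open>y / 2\<close> and the other at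
   \<open>y\<close>, as heights only decrease forwards.\<close>
 define L where "L = exp (4 * t / y^2)"
 have t0: "0 \<le> t" and t\<tau>: "t \<le> \<tau>" using t by auto
 have y: "y > 0" using p by (simp add: y_def)
 have w: "cmod (g u (f q) - of_real (lam u)) \<ge> Im q" if "Im q > 0" "u \<in> {0..t}" for q u
 proof -
  have "Im (g t (f q)) \<le> Im (g u (f q))"
   by (rule loewner_path_Im_decreasing[OF loewner_map_path(1)[OF conjunct1[OF f[OF that(1)]] t0]]) (use that(2) in auto)
  then show ?thesis using f[OF that(1)] abs_Im_le_cmod[of "g u (f q) - of_real (lam u)"] by simp
 qed
 have nz: "g u (f q) - of_real (lam u) \<noteq> 0" if "Im q > 0" "u \<in> {0..t}" for q u
 proof
  assume "g u (f q) - of_real (lam u) = 0"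
  then show False using w[OF that] that(1) by simp
 qed
 have wc: "continuous_on {s..t} (\<lambda>u. 2 / ((g u (f q) - of_real (lam u)) * (g u (f q') - of_real (lam u))))"
  if q: "Im q > 0" and q': "Im q' > 0" and s: "0 \<le> s" for q q' s
 proof -
  have sub: "{s..t} \<subseteq> {0..t}" "{s..t} \<subseteq> {0..\<tau>}" using s t by auto
  have c: "continuous_on {s..t} (\<lambda>u. g u (f q))" if "Im q > 0" for q
   by (rule continuous_on_subset[OF loewner_path_continuous[OF loewner_map_path(1)[OF conjunct1[OF f[OF that]] t0]] sub(1)])
  have "(g u (f q) - of_real (lam u)) * (g u (f q') - of_real (lam u)) \<noteq> 0" if u: "u \<in> {s..t}" for u
   by (intro no_zero_divisors nz q q' subsetD[OF sub(1) u])
  then show ?thesis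
   by (intro continuous_on_divide continuous_on_mult continuous_on_diff continuous_on_of_real continuous_on_const
     driver_continuous[OF sub(2)] c q q' ballI)
 qed
 have ft: "g t (f q) = q" and f00: "g 0 (f q) = f q" if "Im q > 0" for q
  using conjunct2[OF f[OF that]] loewner_map_path(2)[OF conjunct1[OF f[OF that]] t0] by simp_all
 have f0: "f q - f p = (q - p) * exp (J q)" if "Im q > 0" for q
  using map_difference[OF conjunct1[OF f[OF that]] conjunct1[OF f[OF p]] order_refl t0 t\<tau>]
  unfolding ft[OF that] ft[OF p] f00[OF that] f00[OF p] J_def .
 have close: "cmod (g u (f q) - g u (f p)) \<le> L * cmod (q - p)" if q: "Im q > y / 2" and u: "u \<in> {0..t}" for q u
 proof -
  have q0: "Im q > 0" using q y by simp
  have "cmod (integral {u..t} (\<lambda>u. 2 / ((g u (f q) - of_real (lam u)) * (g u (f p) - of_real (lam u))))) \<le> 4 / y^2 * (t - u)"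
  proof (rule integral_bound)
   fix s assume s: "s \<in> {u..t}"
   then have s': "s \<in> {0..t}" using u by auto
   define A where "A = g s (f q) - of_real (lam s)"
   define B where "B = g s (f p) - of_real (lam s)"
   have AB: "y / 2 \<le> cmod A" "y \<le> cmod B" using w[OF q0 s'] w[OF p s'] q unfolding A_def B_def y_def by linarith+
   have "2 / (cmod A * cmod B) \<le> 2 / (y / 2 * y)"
    by (intro frac_le mult_mono mult_pos_pos AB) (use y in auto)
   then have "cmod (2 / (A * B)) \<le> 4 / y^2"
    by (simp add: norm_divide norm_mult power2_eq_square)
   then show "cmod (2 / ((g s (f q) - of_real (lam s)) * (g s (f p) - of_real (lam s)))) \<le> 4 / y^2"
    unfolding A_def B_def .
  next
   show "u \<le> t" using u by simp
   show "continuous_on {u..t} (\<lambda>u. 2 / ((g u (f q) - of_real (lam u)) * (g u (f p) - of_real (lam u))))"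
    by (rule wc[OF q0 p]) (use u in simp)
  qed
  also have "\<dots> \<le> 4 / y^2 * t" using u y by (intro mult_left_mono) auto
  finally have e: "cmod (integral {u..t} (\<lambda>u. 2 / ((g u (f q) - of_real (lam u)) * (g u (f p) - of_real (lam u))))) \<le> 4 * t / y^2" by simp
  have "g u (f q) - g u (f p) = (q - p) * exp (integral {u..t} (\<lambda>u. 2 / ((g u (f q) - of_real (lam u)) * (g u (f p) - of_real (lam u)))))"
   using map_difference[OF conjunct1[OF f[OF q0]] conjunct1[OF f[OF p]] _ _ t\<tau>, of u] u unfolding ft[OF q0] ft[OF p] by simp
  then have "cmod (g u (f q) - g u (f p)) = cmod (q - p) * exp (Re (integral {u..t} (\<lambda>u. 2 / ((g u (f q) - of_real (lam u)) * (g u (f p) - of_real (lam u))))))"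
   by (simp only: norm_mult norm_exp_eq_Re)
  also have "\<dots> \<le> cmod (q - p) * L" unfolding L_def
   by (intro mult_left_mono exp_mono order_trans[OF complex_Re_le_cmod e] norm_ge_zero)
  finally show ?thesis by (simp add: mult.commute)
 qed
 have J: "cmod (J q - J p) \<le> 4 * L / y ^ 3 * t * cmod (q - p)" if q: "Im q > y / 2" for q
 proof -
  have q0: "Im q > 0" using q y by simp
  have "J q - J p = integral {0..t} (\<lambda>u. 2 / ((g u (f q) - of_real (lam u)) * (g u (f p) - of_real (lam u)))
    - 2 / ((g u (f p) - of_real (lam u)) * (g u (f p) - of_real (lam u))))"
   unfolding J_def by (rule integral_diff[symmetric]; rule integrable_continuous_real; rule wc) (use q0 p in auto)
  also have "cmod \<dots> \<le> 4 * L / y ^ 3 * cmod (q - p) * (t - 0)"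
  proof (rule integral_bound[OF t0])
   show "continuous_on {0..t} (\<lambda>u. 2 / ((g u (f q) - of_real (lam u)) * (g u (f p) - of_real (lam u)))
    - 2 / ((g u (f p) - of_real (lam u)) * (g u (f p) - of_real (lam u))))"
    by (intro continuous_on_diff wc) (use q0 p in auto)
   fix u assume u: "u \<in> {0..t}"
   define a where "a = g u (f q) - of_real (lam u)"
   define b where "b = g u (f p) - of_real (lam u)"
   have ab: "cmod a \<ge> y / 2" "cmod b \<ge> y" using w[OF q0 u] w[OF p u] q by (auto simp: a_def b_def y_def)
   have nz: "a \<noteq> 0" "b \<noteq> 0" using ab y by auto
   have "2 / (a * b) - 2 / (b * b) = - (2 * (a - b)) / (a * (b * b))" using nz by (simp add: field_simps)
   then have "cmod (2 / (a * b) - 2 / (b * b)) = 2 * cmod (a - b) / (cmod a * (cmod b * cmod b))"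
    by (simp only: norm_divide norm_minus_cancel norm_mult) simp
   also have "\<dots> \<le> 2 * (L * cmod (q - p)) / (y / 2 * (y * y))"
    using ab y close[OF q u] by (intro frac_le mult_mono mult_pos_pos) (auto simp: a_def b_def L_def)
   also have "\<dots> = 4 * L / y ^ 3 * cmod (q - p)" by (simp add: power3_eq_cube)
   finally show "cmod (2 / ((g u (f q) - of_real (lam u)) * (g u (f p) - of_real (lam u)))
    - 2 / ((g u (f p) - of_real (lam u)) * (g u (f p) - of_real (lam u)))) \<le> 4 * L / y ^ 3 * cmod (q - p)"
    unfolding a_def b_def .
  qed
  finally show ?thesis by (simp add: mult_ac)
 qed
 have "open {q. Im q > y / 2}" by (rule open_halfspace_Im_gt)
 then have near: "\<forall>\<^sub>F q in at p. Im q > y / 2"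
  using eventually_at_topological p y by (auto simp: eventually_at_topological y_def intro!: exI[of _ "{q. Im q > y / 2}"])
 have "((\<lambda>q. J q - J p) \<longlongrightarrow> 0) (at p)"
 proof (rule Lim_null_comparison)
  show "\<forall>\<^sub>F q in at p. cmod (J q - J p) \<le> 4 * L / y ^ 3 * t * cmod (q - p)" using near by eventually_elim (rule J)
  have "((\<lambda>q. 4 * L / y ^ 3 * t * cmod (q - p)) \<longlongrightarrow> 4 * L / y ^ 3 * t * cmod (p - p)) (at p)"
   by (intro tendsto_intros)
  then show "((\<lambda>q. 4 * L / y ^ 3 * t * cmod (q - p)) \<longlongrightarrow> 0) (at p)" by simp
 qed
 then have "(J \<longlongrightarrow> J p) (at p)" by (simp add: LIM_zero_iff)
 then have "((\<lambda>q. exp (J q)) \<longlongrightarrow> exp (J p)) (at p)" by (rule tendsto_exp)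
 moreover have "\<forall>\<^sub>F q in at p. exp (J q) = (f q - f p) / (q - p)"
  using near eventually_neq_at_within[of p p UNIV]
 proof eventually_elim
  case (elim q)
  then show ?case using f0[of q] y by simp
 qed
 ultimately have "((\<lambda>q. (f q - f p) / (q - p)) \<longlongrightarrow> exp (J p)) (at p)" by (rule Lim_transform_eventually)
 then show ?thesis unfolding has_field_derivative_iff by blast
qed

text \<open>An injective holomorphic inverse on the half-plane has open image, which is
  \<open>D t\<close>, and its own holomorphic inverse is \<open>g t\<close>.\<close>

lemma map_holomorphic:
 assumes t: "t \<in> {0..\<tau>}"
 shows "open (D t)" "g t holomorphic_on D t" "inv_into (D t) (g t) holomorphic_on upper_half_plane"
proof -
 define f where "f = inv_into (D t) (g t)"
 have gD: "g t ` D t = upper_half_plane" using map_bij[OF t] by (simp add: bij_betw_def)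
 have f: "f q \<in> D t \<and> g t (f q) = q" if "Im q > 0" for q
 proof -
  have q: "q \<in> g t ` D t" using that gD by (simp add: upper_half_plane_def)
  show ?thesis unfolding f_def using inv_into_into[OF q] f_inv_into_f[OF q] by simp
 qed
 have fg: "f (g t z) = z" if "z \<in> D t" for z unfolding f_def by (rule inv_into_f_f[OF map_inj[OF t] that])
 have fh: "f holomorphic_on upper_half_plane"
  unfolding holomorphic_on_open[OF upper_half_plane_open]
  using inverse_derivative[OF t _ f] by (simp add: upper_half_plane_def)
 then show "inv_into (D t) (g t) holomorphic_on upper_half_plane" by (simp add: f_def)
 have inj: "inj_on f upper_half_plane" by (rule inj_on_inverseI[of _ "g t"]) (use f in \<open>auto simp: upper_half_plane_def\<close>)
 have fD: "f ` upper_half_plane = D t"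
  using f fg domain_upper(1)[of _ t] t by (force simp: upper_half_plane_def image_iff)
 show "open (D t)" unfolding fD[symmetric] by (rule open_mapping_thm3[OF fh upper_half_plane_open inj])
 obtain h where h: "h holomorphic_on f ` upper_half_plane" "\<And>q. q \<in> upper_half_plane \<Longrightarrow> h (f q) = q"
  using holomorphic_inverse_ex[OF fh upper_half_plane_open inj] by blast
 show "g t holomorphic_on D t"
 proof (rule holomorphic_transform[OF h(1)[unfolded fD]])
  fix z assume z: "z \<in> D t"
  then have "g t z \<in> upper_half_plane" using gD by blast
  from h(2)[OF this] show "h z = g t z" using fg[OF z] by simp
 qed
qed

section \<open>Cone and modulus estimates along trajectories\<close>

lemma position_derivative:
 assumes G: "loewner_path lam {a..b} G" and sub: "{a..b} \<subseteq> {0..\<tau>}" and t: "t \<in> {a..b}"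
 shows "((\<lambda>t. Re (G t) - lam t) has_real_derivative
  2 * (Re (G t) - lam t) / (cmod (G t - of_real (lam t)))^2 - lam' t) (at t within {a..b})"
proof -
 have "((\<lambda>t. Re (G t)) has_real_derivative Re (2 / (G t - of_real (lam t)))) (at t within {a..b})"
  using loewner_pathD(3)[OF G t] by (simp add: has_real_derivative_iff_has_vector_derivative has_vector_derivative_complex_iff)
 moreover have "Re (2 / (G t - of_real (lam t))) = 2 * (Re (G t) - lam t) / (cmod (G t - of_real (lam t)))^2"
  by (simp add: Re_divide cmod_power2)
 moreover have "(lam has_real_derivative lam' t) (at t within {a..b})"
  by (rule DERIV_subset[OF derivative sub]) (use t sub in auto)
 ultimately show ?thesis by (metis DERIV_diff)
qed

lemma height_square_derivative:
 assumes G: "loewner_path lam {a..b} G" and t: "t \<in> {a..b}"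
 shows "((\<lambda>t. Im (G t) * Im (G t)) has_real_derivative
  - 4 * (Im (G t) * Im (G t)) / (cmod (G t - of_real (lam t)))^2) (at t within {a..b})"
 by (rule DERIV_cong[OF DERIV_mult'[OF loewner_path_Im_derivative[OF G t] loewner_path_Im_derivative[OF G t]]]) simp

text \<open>Run backwards, a trajectory in the cone \<open>\<bar>Re w\<bar> \<le> Im w / 2\<close> stays in \<open>\<bar>Re w\<bar> \<le> Im w\<close>: there
 \<open>(Im w)\<^sup>2\<close> grows at least at rate 2, while \<open>\<bar>Re w\<bar>\<close> grows at most at rate \<open>M\<close>.\<close>

lemma cone:
 assumes G: "loewner_path lam {a..r} G" and sub: "{a..r} \<subseteq> {0..\<tau>}" and end_cone: "\<bar>Re (G r) - lam r\<bar> \<le> Im (G r) / 2"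
  and s: "s \<in> {a..r}"
 shows "\<bar>Re (G s) - lam s\<bar> \<le> \<bar>Re (G r) - lam r\<bar> + M * (r - s)"
  and "(Im (G r))^2 + 2 * (r - s) \<le> (Im (G s))^2" and "(Im (G s))^2 \<le> (Im (G r))^2 + 4 * (r - s)"
  and "\<bar>Re (G s) - lam s\<bar> \<le> Im (G s)"
proof -
 define X where "X t = Re (G t) - lam t" for t
 define Y where "Y t = Im (G t)" for t
 define n where "n t = (cmod (G t - of_real (lam t)))^2" for t
 have n: "n t = (X t)^2 + (Y t)^2" for t by (simp add: n_def cmod_power2 X_def Y_def)
 have Ypos: "Y t > 0" if "t \<in> {a..r}" for t using loewner_pathD(1)[OF G that] by (simp add: Y_def)
 have npos: "n t > 0" if "t \<in> {a..r}" for t using Ypos[OF that] by (simp add: n sum_power2_gt_zero_iff)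
 have Xd: "(X has_real_derivative 2 * X t / n t - lam' t) (at t within {u..r})" if "t \<in> {u..r}" "u \<ge> a" for t u
  unfolding X_def n_def by (rule position_derivative[OF loewner_path_subset[OF G]]) (use that sub in auto)
 have Zd: "((\<lambda>t. Y t * Y t) has_real_derivative - 4 * (Y t * Y t) / n t) (at t within {u..r})" if "t \<in> {u..r}" "u \<ge> a" for t u
  unfolding Y_def n_def by (rule height_square_derivative[OF loewner_path_subset[OF G]]) (use that in auto)
 have Xb: "\<bar>X s\<bar> \<le> \<bar>X r\<bar> + M * (r - s)" if s: "s \<in> {a..r}" for s
 proof (rule field_le_epsilon)
  fix e :: real assume e: "e > 0"
  \<comment> \<open>\<open>sqrt (X^2 + e^2)\<close> is a smooth substitute for
    \<open>\<bar>X\<bar>\<close>, whose derivative does not exist at zeros of \<open>X\<close>;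
    \<open>e\<close> tends to 0 at the end.\<close>
  have pos: "0 < X t * X t + e^2" for t using e by (simp add: add_nonneg_pos)
  have "- sqrt (X r * X r + e^2) - M * r \<le> - sqrt (X s * X s + e^2) - M * s"
  proof (rule derivative_nonpos_decreasing[of s r "\<lambda>t. - sqrt (X t * X t + e^2) - M * t"
     "\<lambda>t. - (inverse (sqrt (X t * X t + e^2)) / 2 * (X t * (2 * X t / n t - lam' t) + (2 * X t / n t - lam' t) * X t + 0)) - M * 1"])
   fix t assume t: "t \<in> {s..r}"
   have xd: "(X has_real_derivative 2 * X t / n t - lam' t) (at t within {s..r})" by (rule Xd) (use t s in auto)
   show "((\<lambda>t. - sqrt (X t * X t + e^2) - M * t) has_real_derivative
     - (inverse (sqrt (X t * X t + e^2)) / 2 * (X t * (2 * X t / n t - lam' t) + (2 * X t / n t - lam' t) * X t + 0)) - M * 1) (at t within {s..r})"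
    by (intro DERIV_diff DERIV_minus DERIV_cmult DERIV_ident DERIV_chain2[where f = sqrt and g = "\<lambda>t. X t * X t + e^2" and x = t, OF DERIV_real_sqrt[OF pos[of t]]] DERIV_add DERIV_mult' xd DERIV_const)
   have tin: "t \<in> {a..r}" "t \<in> {0..\<tau>}" using t s sub by auto
   have "- (X t * lam' t) \<ge> - (sqrt (X t * X t + e^2) * M)"
   proof -
    have "X t * lam' t \<le> \<bar>X t\<bar> * \<bar>lam' t\<bar>" by (metis abs_ge_self abs_mult)
    also have "\<dots> \<le> sqrt (X t * X t + e^2) * M"
     using real_sqrt_ge_abs1[of "X t" e] slope[OF tin(2)] slope_nonneg pos[of t] by (intro mult_mono) (auto simp: power2_eq_square)
    finally show ?thesis by simp
   qed
   moreover have "X t * (2 * X t / n t) \<ge> 0" using npos[OF tin(1)] by simp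
   ultimately have "X t * (2 * X t / n t - lam' t) \<ge> - (sqrt (X t * X t + e^2) * M)" by (simp add: right_diff_distrib)
   moreover have "- (inverse S / 2 * (x * q + q * x + 0)) - M * 1 \<le> 0" if "x * q \<ge> - (S * M)" "S > 0" for S x q :: real
   proof -
    have "inverse S * (x * q) \<ge> inverse S * (- (S * M))" using that by (intro mult_left_mono) auto
    moreover have "inverse S * (- (S * M)) = - M" using that(2) by simp
    moreover have "inverse S / 2 * (x * q + q * x + 0) = inverse S * (x * q)" by simp
    ultimately show ?thesis by linarith
   qed
   moreover have "sqrt (X t * X t + e^2) > 0" using pos[of t] by (rule real_sqrt_gt_zero)
   ultimately show "- (inverse (sqrt (X t * X t + e^2)) / 2 * (X t * (2 * X t / n t - lam' t) + (2 * X t / n t - lam' t) * X t + 0)) - M * 1 \<le> 0"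
    by blast
  qed (use s in auto)
  moreover have "\<bar>X s\<bar> \<le> sqrt (X s * X s + e^2)" using real_sqrt_ge_abs1[of "X s" e] by (simp add: power2_eq_square)
  moreover have "sqrt (X r * X r + e^2) \<le> \<bar>X r\<bar> + \<bar>e\<bar>" using sqrt_sum_squares_le_sum_abs[of "X r" e] by (simp add: power2_eq_square)
  ultimately show "\<bar>X s\<bar> \<le> \<bar>X r\<bar> + M * (r - s) + e" using e by (simp add: algebra_simps)
 qed
 have Zup: "Y s * Y s \<le> Y r * Y r + 4 * (r - s)" if s: "s \<in> {a..r}" for s
 proof -
  have "- (Y r * Y r) - 4 * r \<le> - (Y s * Y s) - 4 * s"
  proof (rule derivative_nonpos_decreasing[of s r "\<lambda>t. - (Y t * Y t) - 4 * t" "\<lambda>t. - (- 4 * (Y t * Y t) / n t) - 4 * 1"])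
   fix t assume t: "t \<in> {s..r}"
   show "((\<lambda>t. - (Y t * Y t) - 4 * t) has_real_derivative - (- 4 * (Y t * Y t) / n t) - 4 * 1) (at t within {s..r})"
    by (intro DERIV_diff DERIV_minus DERIV_cmult DERIV_ident Zd) (use t s in auto)
   have "n t > 0" using npos t s by auto
   then show "- (- 4 * (Y t * Y t) / n t) - 4 * 1 \<le> 0" by (simp add: divide_le_eq n power2_eq_square)
  qed (use s in auto)
  then show ?thesis by simp
 qed
 \<comment> \<open>The cone condition is assumed only at later times, the form in which the
   bootstrap supplies it; the left endpoint itself is covered by the open-interval monotonicity
   criterion.\<close>
 have Zlow: "Y r * Y r + 2 * (r - s) \<le> Y s * Y s"
  if s: "s \<in> {a..r}" and cn: "\<And>u. u \<in> {s<..r} \<Longrightarrow> Y u * Y u - X u * X u > 0" for s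
 proof -
  have "Y r * Y r + 2 * r \<le> Y s * Y s + 2 * s"
  proof (rule derivative_nonpos_decreasing_open[of s r "\<lambda>t. Y t * Y t + 2 * t" "\<lambda>t. - 4 * (Y t * Y t) / n t + 2 * 1"])
   fix t assume t: "t \<in> {s..r}"
   show "((\<lambda>t. Y t * Y t + 2 * t) has_real_derivative - 4 * (Y t * Y t) / n t + 2 * 1) (at t within {s..r})"
    by (intro DERIV_add DERIV_cmult DERIV_ident Zd) (use t s in auto)
  next
   fix t assume t: "t \<in> {s<..<r}"
   have "n t > 0" using npos t s by auto
   moreover have "n t \<le> 2 * (Y t * Y t)" using cn[of t] t by (simp add: n power2_eq_square)
   ultimately have "2 \<le> 4 * (Y t * Y t) / n t" by (simp add: pos_le_divide_eq)
   then show "- 4 * (Y t * Y t) / n t + 2 * 1 \<le> 0" by simp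
  qed (use s in auto)
  then show ?thesis by simp
 qed
 have cn: "Y s * Y s - X s * X s > 0" if s: "s \<in> {a..r}" for s
 proof (rule backward_bootstrap[of a r "\<lambda>s. Y s * Y s - X s * X s", OF _ _ s])
  show "continuous_on {a..r} (\<lambda>s. Y s * Y s - X s * X s)" unfolding X_def Y_def
   by (intro continuous_intros loewner_path_continuous[OF G] driver_continuous[OF sub])
  fix s assume s: "s \<in> {a..r}" and pos: "\<And>u. u \<in> {s<..r} \<Longrightarrow> Y u * Y u - X u * X u > 0"
  have r: "r \<in> {a..r}" using s by auto
  \<comment> \<open>This is where \<open>short\<close> enters: it gives
    \<open>2 * (M * (r - s))^2 \<le> r - s\<close>, so
    \<open>X^2 \<le> Y r ^ 2 / 2 + (r - s)\<close>, strictly below the lower bound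
    \<open>Y r ^ 2 + 2 * (r - s)\<close> for \<open>Y s ^ 2\<close>.\<close>
  have "\<bar>X s\<bar> \<le> Y r / 2 + M * (r - s)" using Xb[OF s] end_cone by (simp add: X_def Y_def)
  then have "X s * X s \<le> (Y r / 2 + M * (r - s))^2"
   by (metis abs_ge_zero power2_abs power2_eq_square power_mono)
  also have "\<dots> \<le> (Y r)^2 / 2 + 2 * (M * (r - s))^2"
   using sum_squares_bound[of "Y r / 2" "M * (r - s)"] by (simp add: power2_sum power_divide power2_eq_square algebra_simps)
  also have "2 * (M * (r - s))^2 \<le> r - s"
  proof -
   have "M^2 * (r - s) \<le> M^2 * \<tau>" using s sub by (intro mult_left_mono) auto
   then have "2 * (M^2 * (r - s)) \<le> 1" using short by simp
   then have "2 * (M^2 * (r - s)) * (r - s) \<le> 1 * (r - s)" using s by (intro mult_right_mono) auto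
   then show ?thesis by (simp add: power2_eq_square mult_ac)
  qed
  finally have "X s * X s \<le> (Y r)^2 / 2 + (r - s)" by simp
  moreover have "(Y r)^2 > 0" using Ypos[OF r] by simp
  moreover have "Y r * Y r + 2 * (r - s) \<le> Y s * Y s" by (rule Zlow[OF s pos])
  moreover have "r - s \<ge> 0" using s by simp
  ultimately show "Y s * Y s - X s * X s > 0" by (simp add: power2_eq_square)
 qed
 show "\<bar>Re (G s) - lam s\<bar> \<le> \<bar>Re (G r) - lam r\<bar> + M * (r - s)" using Xb[OF s] by (simp add: X_def)
 show "(Im (G r))^2 + 2 * (r - s) \<le> (Im (G s))^2"
  using Zlow[OF s cn] s by (simp add: Y_def power2_eq_square)
 show "(Im (G s))^2 \<le> (Im (G r))^2 + 4 * (r - s)" using Zup[OF s] by (simp add: Y_def power2_eq_square)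
 have "(X s)^2 \<le> (Y s)^2" using cn[OF s] by (simp add: power2_eq_square)
 then show "\<bar>Re (G s) - lam s\<bar> \<le> Im (G s)" using Ypos[OF s] by (simp add: abs_le_square_iff[symmetric] X_def Y_def)
qed

text \<open>A Gronwall estimate for \<open>\<bar>w\<bar>^2\<close>, whose derivative is bounded by
  \<open>5 + M^2 * \<bar>w\<bar>^2\<close> in every direction of \<open>w\<close>. The first bound
  serves at the tip, where nearby points must stay near the driver; the second serves at infinity,
  where trajectories must stay large.\<close>

lemma modulus_growth:
 assumes G: "loewner_path lam {s..t} G" and sub: "{s..t} \<subseteq> {0..\<tau>}" and st: "s \<le> t"
 shows "(cmod (G t - of_real (lam t)))^2 \<le> 2 * ((cmod (G s - of_real (lam s)))^2 + 5 * (t - s))"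
  and "(cmod (G s - of_real (lam s)))^2 - 10 * (t - s) \<le> 2 * (cmod (G t - of_real (lam t)))^2"
proof -
 define X where "X t = Re (G t) - lam t" for t
 define Y where "Y t = Im (G t)" for t
 define n where "n t = (cmod (G t - of_real (lam t)))^2" for t
 define N where "N t = X t * X t + Y t * Y t" for t
 have n: "n t = N t" for t by (simp add: n_def N_def cmod_power2 X_def Y_def flip: power2_eq_square)
 define N' where "N' t = (X t * (2 * X t / n t - lam' t) + (2 * X t / n t - lam' t) * X t) + - 4 * (Y t * Y t) / n t" for t
 have Nd: "(N has_real_derivative N' u) (at u within {s..t})" if u: "u \<in> {s..t}" for u
  unfolding N_def N'_def X_def Y_def n_def
  by (intro DERIV_add DERIV_mult' position_derivative[OF G sub u] height_square_derivative[OF G u])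
 have N'b: "\<bar>N' u\<bar> \<le> 5 + M^2 * N u" if u: "u \<in> {s..t}" for u
 proof -
  have pos: "n u > 0" using loewner_pathD(2)[OF G u] by (simp add: n_def)
  have a: "4 * (X u * X u) / n u \<le> 4" "4 * (Y u * Y u) / n u \<le> 4" "4 * (X u * X u) / n u \<ge> 0" "4 * (Y u * Y u) / n u \<ge> 0"
   using pos by (simp_all add: divide_le_eq n N_def)
  have "\<bar>X u\<bar> * \<bar>lam' u\<bar> \<le> \<bar>X u\<bar> * M" by (rule mult_left_mono[OF slope]) (use u sub in auto)
  then have "\<bar>2 * (X u * lam' u)\<bar> \<le> 2 * 1 * (M * \<bar>X u\<bar>)" by (simp add: abs_mult mult.commute)
  also have "\<dots> \<le> 1^2 + (M * \<bar>X u\<bar>)^2" by (rule sum_squares_bound)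
  also have "\<dots> = 1 + M^2 * (X u * X u)" unfolding power_mult_distrib power2_abs by (simp add: power2_eq_square)
  also have "\<dots> \<le> 1 + M^2 * N u" by (intro add_left_mono mult_left_mono) (auto simp: N_def)
  finally have "\<bar>2 * (X u * lam' u)\<bar> \<le> 1 + M^2 * N u" .
  moreover have "N' u = 4 * (X u * X u) / n u - 4 * (Y u * Y u) / n u - 2 * (X u * lam' u)"
   unfolding N'_def by (simp add: algebra_simps)
  ultimately show ?thesis using a by linarith
 qed
 \<comment> \<open>From \<open>exp (- x) \<ge> 1 - x\<close> with \<open>x \<le> 1 / 2\<close>,
   again by \<open>short\<close>; the exponential weights thus cost only a factor 2.\<close>
 have e2: "exp (M^2 * (u - s)) \<le> 2" "exp (- (M^2 * (u - s))) \<ge> 1 / 2" if u: "u \<in> {s..t}" for u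
 proof -
  have "M^2 * (u - s) \<le> M^2 * \<tau>" using u sub st by (intro mult_left_mono) auto
  then show "exp (- (M^2 * (u - s))) \<ge> 1 / 2" using exp_ge_add_one_self[of "- (M^2 * (u - s))"] short by linarith
  then have "exp (M^2 * (u - s)) * (1 / 2) \<le> exp (M^2 * (u - s)) * exp (- (M^2 * (u - s)))" by (intro mult_left_mono) auto
  then show "exp (M^2 * (u - s)) \<le> 2" by (simp flip: exp_add)
 qed
 have ed: "((\<lambda>u. exp (c * (u - s))) has_real_derivative c * exp (c * (u - s))) (at u within {s..t})" for c u
  by (auto intro!: derivative_eq_intros)
 have tin: "t \<in> {s..t}" using st by simp
 have "N t * exp (- (M^2) * (t - s)) - 5 * t \<le> N s * exp (- (M^2) * (s - s)) - 5 * s"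
 proof (rule derivative_nonpos_decreasing[OF st, of "\<lambda>u. N u * exp (- (M^2) * (u - s)) - 5 * u"
    "\<lambda>u. N u * (- (M^2) * exp (- (M^2) * (u - s))) + N' u * exp (- (M^2) * (u - s)) - 5 * 1"])
  fix u assume u: "u \<in> {s..t}"
  show "((\<lambda>u. N u * exp (- (M^2) * (u - s)) - 5 * u) has_real_derivative
   N u * (- (M^2) * exp (- (M^2) * (u - s))) + N' u * exp (- (M^2) * (u - s)) - 5 * 1) (at u within {s..t})"
   by (intro DERIV_diff DERIV_mult' ed Nd[OF u] DERIV_cmult DERIV_ident)
  have "(N' u - M^2 * N u) * exp (- (M^2) * (u - s)) \<le> 5 * 1"
   using N'b[OF u] u by (intro mult_mono) auto
  then show "N u * (- (M^2) * exp (- (M^2) * (u - s))) + N' u * exp (- (M^2) * (u - s)) - 5 * 1 \<le> 0" by (simp add: algebra_simps)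
 qed
 moreover have "N t * (1 / 2) \<le> N t * exp (- (M^2 * (t - s)))" using e2(2)[OF tin] by (intro mult_left_mono) (auto simp: N_def)
 ultimately show "(cmod (G t - of_real (lam t)))^2 \<le> 2 * ((cmod (G s - of_real (lam s)))^2 + 5 * (t - s))"
  by (simp add: n[unfolded n_def])
 have "- (N t * exp (M^2 * (t - s))) - 10 * t \<le> - (N s * exp (M^2 * (s - s))) - 10 * s"
 proof (rule derivative_nonpos_decreasing[OF st, of "\<lambda>u. - (N u * exp (M^2 * (u - s))) - 10 * u"
    "\<lambda>u. - (N u * (M^2 * exp (M^2 * (u - s))) + N' u * exp (M^2 * (u - s))) - 10 * 1"])
  fix u assume u: "u \<in> {s..t}"
  show "((\<lambda>u. - (N u * exp (M^2 * (u - s))) - 10 * u) has_real_derivative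
   - (N u * (M^2 * exp (M^2 * (u - s))) + N' u * exp (M^2 * (u - s))) - 10 * 1) (at u within {s..t})"
   by (intro DERIV_diff DERIV_minus DERIV_mult' ed Nd[OF u] DERIV_cmult DERIV_ident)
  have "- (N' u + M^2 * N u) * exp (M^2 * (u - s)) \<le> 5 * 2"
   using N'b[OF u] e2(1)[OF u] by (intro mult_mono) auto
  then show "- (N u * (M^2 * exp (M^2 * (u - s))) + N' u * exp (M^2 * (u - s))) - 10 * 1 \<le> 0" by (simp add: algebra_simps)
 qed
 moreover have "N t * exp (M^2 * (t - s)) \<le> N t * 2" using e2(1)[OF tin] by (intro mult_left_mono) (auto simp: N_def)
 ultimately show "(cmod (G s - of_real (lam s)))^2 - 10 * (t - s) \<le> 2 * (cmod (G t - of_real (lam t)))^2"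
  by (simp add: n[unfolded n_def])
qed

end

section \<open>The tip as a limit of backward trajectories\<close>

context loewner_driver
begin

lemma driver_finite_energy:
 assumes r: "r \<in> {0<..\<tau>}"
 shows "finite_energy r lam lam'"
proof -
 have sub: "{0..r} \<subseteq> {0..\<tau>}" and r0: "0 < r" using r by auto
 have der: "(lam has_real_derivative lam' t) (at t)" if t: "t \<in> {0<..<r}" for t
 proof -
  have "at t within {0..\<tau>} = at t" using t r by (intro at_within_interior) auto
  then show ?thesis using derivative[of t] t r by simp
 qed
 have "abs_continuous_on {0..r} lam"
  using slope sub by (intro abs_continuous_on_deriv_bounded[of 0 r lam lam' M] der driver_continuous) auto
 then show ?thesis
  using r0 der continuous_on_subset[OF derivative_continuous sub]
  by (intro finite_energyI[of r lam "{}" lam'] integrable_continuous_real continuous_intros) auto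
qed

text \<open>In the cone each \<open>w\<close> is within 45 degrees of the vertical, so a product of
  two has nonpositive real part. The exponent in the difference formula then has nonpositive real
  part, and distances shrink backwards.\<close>

lemma backflow_contracts:
 assumes G: "loewner_path lam {a..r} G" and H: "loewner_path lam {a..r} H" and sub: "{a..r} \<subseteq> {0..\<tau>}" and ar: "a \<le> r"
  and cG: "\<bar>Re (G r) - lam r\<bar> \<le> Im (G r) / 2" and cH: "\<bar>Re (H r) - lam r\<bar> \<le> Im (H r) / 2"
 shows "cmod (G a - H a) \<le> cmod (G r - H r)"
proof -
 define k where "k t = 2 / ((G t - of_real (lam t)) * (H t - of_real (lam t)))" for t
 have kc: "continuous_on {a..r} k"
 proof -
  have "(G t - of_real (lam t)) * (H t - of_real (lam t)) \<noteq> 0" if "t \<in> {a..r}" for t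
   by (intro no_zero_divisors loewner_pathD(2)[OF G that] loewner_pathD(2)[OF H that])
  then show ?thesis unfolding k_def
   by (intro continuous_on_divide continuous_on_mult continuous_on_diff continuous_on_of_real continuous_on_const
     loewner_path_continuous[OF G] loewner_path_continuous[OF H] driver_continuous[OF sub] ballI)
 qed
 have neg: "0 \<le> - Re (k t)" if t: "t \<in> {a..r}" for t
 proof -
  define u where "u = G t - of_real (lam t)"
  define v where "v = H t - of_real (lam t)"
  have "\<bar>Re u\<bar> \<le> Im u" "\<bar>Re v\<bar> \<le> Im v"
   using cone(4)[OF G sub cG t] cone(4)[OF H sub cH t] by (simp_all add: u_def v_def)
  then have "\<bar>Re u\<bar> * \<bar>Re v\<bar> \<le> Im u * Im v" by (intro mult_mono) auto
  then have "Re (u * v) \<le> 0" using abs_ge_self[of "Re u * Re v"] by (simp add: abs_mult)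
  then have "Re (2 / (u * v)) \<le> 0" by (simp add: Re_divide divide_nonpos_nonneg del: times_complex.sel)
  then show ?thesis unfolding k_def u_def v_def by simp
 qed
 have "((\<lambda>t. - Re (k t)) has_integral - Re (integral {a..r} k)) {a..r}"
  using has_integral_linear[OF integrable_integral[OF integrable_continuous_real[OF kc]] bounded_linear_minus[OF bounded_linear_Re]]
  by (simp add: o_def)
 then have "- Re (integral {a..r} k) \<ge> 0" by (rule has_integral_nonneg) (rule neg)
 moreover have "cmod (G a - H a) = cmod (G r - H r) * exp (Re (integral {a..r} k))"
  unfolding loewner_path_difference[OF G H ar driver_continuous[OF sub]] k_def[abs_def] by (simp only: norm_mult norm_exp_eq_Re)
 ultimately show ?thesis by (simp add: mult_left_le)
qed

lemma map_contracts:
 assumes z: "z \<in> D r" "z' \<in> D r" and sr: "0 \<le> s" "s \<le> r" "r \<le> \<tau>"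
  and c: "\<bar>Re (g r z) - lam r\<bar> \<le> Im (g r z) / 2" "\<bar>Re (g r z') - lam r\<bar> \<le> Im (g r z') / 2"
 shows "cmod (g s z - g s z') \<le> cmod (g r z - g r z')"
proof -
 have r: "0 \<le> r" and sub: "{s..r} \<subseteq> {0..r}" "{s..r} \<subseteq> {0..\<tau>}" using sr by auto
 show ?thesis
  by (rule backflow_contracts[OF loewner_path_subset[OF loewner_map_path(1)[OF z(1) r] sub(1)]
     loewner_path_subset[OF loewner_map_path(1)[OF z(2) r] sub(1)] sub(2) sr(2) c])
qed

text \<open>Preimages of points descending vertically onto the driver; with real part exactly
  \<open>lam r\<close> they meet the end condition of the cone estimate.\<close>

definition approximation :: "real \<Rightarrow> nat \<Rightarrow> complex" where
 "approximation r n = inv_into (D r) (g r) (Complex (lam r) (1 / real (Suc n)))"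

definition tip :: "real \<Rightarrow> complex" where
 "tip r = lim (approximation r)"

lemma approximation:
 assumes r: "r \<in> {0..\<tau>}"
 shows "approximation r n \<in> D r" "g r (approximation r n) = Complex (lam r) (1 / real (Suc n))"
proof -
 have "Complex (lam r) (1 / real (Suc n)) \<in> g r ` D r"
  using map_bij[OF r] by (simp add: bij_betw_def upper_half_plane_def)
 then show "approximation r n \<in> D r" "g r (approximation r n) = Complex (lam r) (1 / real (Suc n))"
  unfolding approximation_def by (rule inv_into_into, rule f_inv_into_f)
qed

lemma approximation_cone:
 assumes r: "r \<in> {0..\<tau>}"
 shows "\<bar>Re (g r (approximation r n)) - lam r\<bar> \<le> Im (g r (approximation r n)) / 2"
 unfolding approximation(2)[OF r] by simp

text \<open>Backward contraction bounds the distances at every earlier time \<open>s\<close> by the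
  differences of the heights \<open>1 / (n + 1)\<close> at time \<open>r\<close>.\<close>

lemma approximation_Cauchy:
 assumes r: "r \<in> {0..\<tau>}" and s: "0 \<le> s" "s \<le> r"
 shows "convergent (\<lambda>n. g s (approximation r n))"
proof -
 have "Cauchy (\<lambda>n. 1 / real (Suc n))"
  by (rule LIMSEQ_imp_Cauchy[OF LIMSEQ_inverse_real_of_nat[unfolded inverse_eq_divide]])
 moreover have "dist (g s (approximation r m)) (g s (approximation r n)) \<le> dist (1 / real (Suc m)) (1 / real (Suc n))" for m n
 proof -
  have "cmod (g s (approximation r m) - g s (approximation r n)) \<le> cmod (g r (approximation r m) - g r (approximation r n))"
   using r by (intro map_contracts approximation(1) s approximation_cone) auto
  also have "\<dots> = \<bar>1 / real (Suc m) - 1 / real (Suc n)\<bar>"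
   unfolding approximation(2)[OF r] by (simp add: cmod_def)
  finally show ?thesis by (simp add: dist_norm)
 qed
 ultimately have "Cauchy (\<lambda>n. g s (approximation r n))" unfolding Cauchy_def by (meson order.strict_trans1)
 then show ?thesis by (simp add: Cauchy_convergent_iff)
qed

lemma approximation_limit:
 assumes r: "r \<in> {0..\<tau>}"
 shows "approximation r \<longlonglongrightarrow> tip r"
proof -
 have "g 0 (approximation r n) = approximation r n" for n
  using loewner_map_path(2)[OF approximation(1)[OF r]] r by simp
 then have "convergent (approximation r)" using approximation_Cauchy[OF r, of 0] r by simp
 then show ?thesis unfolding tip_def by (simp add: convergent_LIMSEQ_iff)
qed

lemma tip_0: "tip 0 = 0"
proof -
 have 0: "0 \<in> {0..\<tau>}" using duration by simp
 have "approximation 0 = (\<lambda>n. Complex 0 (1 / real (Suc n)))"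
  using approximation(2)[OF 0] loewner_map_path(2)[OF approximation(1)[OF 0]] start by (simp add: fun_eq_iff)
 moreover have "(\<lambda>n. Complex 0 (1 / real (Suc n))) \<longlonglongrightarrow> Complex 0 0"
  by (intro tendsto_Complex tendsto_const LIMSEQ_inverse_real_of_nat[unfolded inverse_eq_divide])
 moreover have "Complex 0 0 = 0" by (simp add: complex_eq_iff)
 ultimately have "approximation 0 \<longlonglongrightarrow> 0" by (simp only:)
 then show ?thesis using approximation_limit[OF 0] LIMSEQ_unique by blast
qed

text \<open>The cone estimates pass to the limit. Before time \<open>r\<close> the limit height is
  at least \<open>sqrt (2 * (r - s))\<close>, hence positive, and continuity of the inverse map at
  that interior point identifies the limit as the image of the tip.\<close>

lemma tip_path:
 assumes r: "r \<in> {0<..\<tau>}" and s: "0 \<le> s" "s < r"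
 shows "tip r \<in> D s" "\<bar>Re (g s (tip r)) - lam s\<bar> \<le> M * (r - s)"
  "2 * (r - s) \<le> (Im (g s (tip r)))^2" "(Im (g s (tip r)))^2 \<le> 4 * (r - s)"
proof -
 have r': "r \<in> {0..\<tau>}" "0 \<le> r" and s': "s \<in> {0..\<tau>}" "s \<in> {0..r}" "s \<le> r" using r s by auto
 have sub: "{0..r} \<subseteq> {0..\<tau>}" using r by auto
 obtain p where p: "(\<lambda>n. g s (approximation r n)) \<longlonglongrightarrow> p"
  using approximation_Cauchy[OF r'(1) s(1) s'(3)] unfolding convergent_def by blast
 note path = loewner_map_path(1)[OF approximation(1)[OF r'(1)] r'(2)]
 note cn = cone[OF path sub approximation_cone[OF r'(1)] s'(2), unfolded approximation(2)[OF r'(1)] complex.sel]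
 have l0: "(\<lambda>n. 1 / real (Suc n)) \<longlonglongrightarrow> 0" by (rule LIMSEQ_inverse_real_of_nat[unfolded inverse_eq_divide])
 have "(\<lambda>n. \<bar>Re (g s (approximation r n)) - lam s\<bar>) \<longlonglongrightarrow> \<bar>Re p - lam s\<bar>" by (intro tendsto_intros p)
 moreover have "\<bar>Re (g s (approximation r n)) - lam s\<bar> \<le> M * (r - s)" for n using cn(1)[of n] by simp
 ultimately have 1: "\<bar>Re p - lam s\<bar> \<le> M * (r - s)" by (intro LIMSEQ_le_const2) auto
 have Z: "(\<lambda>n. (Im (g s (approximation r n)))^2) \<longlonglongrightarrow> (Im p)^2" by (intro tendsto_intros p)
 have a: "(\<lambda>n. (1 / real (Suc n))^2 + c * (r - s)) \<longlonglongrightarrow> 0^2 + c * (r - s)" for c by (intro tendsto_intros l0)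
 have "0^2 + 2 * (r - s) \<le> (Im p)^2" by (rule LIMSEQ_le[OF a Z]) (intro exI allI impI cn(2))
 then have 2: "2 * (r - s) \<le> (Im p)^2" by simp
 have "(Im p)^2 \<le> 0^2 + 4 * (r - s)" by (rule LIMSEQ_le[OF Z a]) (intro exI allI impI cn(3))
 then have 3: "(Im p)^2 \<le> 4 * (r - s)" by simp
 have "Im (g s (approximation r n)) \<ge> 0" for n using loewner_pathD(1)[OF path s'(2), of n] by simp
 moreover have "(\<lambda>n. Im (g s (approximation r n))) \<longlonglongrightarrow> Im p" by (intro tendsto_intros p)
 ultimately have "Im p \<ge> 0" by (intro LIMSEQ_le_const) auto
 moreover have "(Im p)^2 > 0" by (rule less_le_trans[OF _ 2]) (use s in simp)
 ultimately have pH: "Im p > 0" by (cases "Im p = 0") auto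
 have "continuous_on upper_half_plane (inv_into (D s) (g s))"
  by (rule holomorphic_on_imp_continuous_on[OF map_holomorphic(3)[OF s'(1)]])
 then have "isCont (inv_into (D s) (g s)) p"
  using pH upper_half_plane_open by (simp add: continuous_on_eq_continuous_at upper_half_plane_def)
 then have "(\<lambda>n. inv_into (D s) (g s) (g s (approximation r n))) \<longlonglongrightarrow> inv_into (D s) (g s) p"
  using p by (rule isCont_tendsto_compose)
 moreover have "inv_into (D s) (g s) (g s (approximation r n)) = approximation r n" for n
  by (rule inv_into_f_f[OF map_inj[OF s'(1)] loewner_domain_antimono[OF approximation(1)[OF r'(1)] s'(2)]])
 ultimately have "approximation r \<longlonglongrightarrow> inv_into (D s) (g s) p" by simp
 then have e: "tip r = inv_into (D s) (g s) p" using approximation_limit[OF r'(1)] LIMSEQ_unique by blast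
 have "p \<in> g s ` D s" using map_bij[OF s'(1)] pH by (simp add: bij_betw_def upper_half_plane_def)
 then have "tip r \<in> D s" "g s (tip r) = p" unfolding e by (rule inv_into_into, rule f_inv_into_f)
 then show "tip r \<in> D s" "\<bar>Re (g s (tip r)) - lam s\<bar> \<le> M * (r - s)"
  "2 * (r - s) \<le> (Im (g s (tip r)))^2" "(Im (g s (tip r)))^2 \<le> 4 * (r - s)" using 1 2 3 by simp_all
qed

lemma tip_upper: "r \<in> {0<..\<tau>} \<Longrightarrow> Im (tip r) > 0"
 using domain_upper(2)[OF tip_path(1), of r 0] by simp

lemma slope_short:
 assumes "0 \<le> h" "h \<le> \<tau>"
 shows "(M * h)^2 \<le> h / 2"
proof -
 have "M^2 * h \<le> M^2 * \<tau>" using assms by (intro mult_left_mono) auto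
 then have "M^2 * h * h \<le> 1 / 2 * h" using short assms by (intro mult_right_mono) auto
 then show ?thesis by (simp add: power2_eq_square mult_ac)
qed

lemma tip_cone:
 assumes r: "r \<in> {0<..\<tau>}" and s: "0 \<le> s" "s < r"
 shows "\<bar>Re (g s (tip r)) - lam s\<bar> \<le> Im (g s (tip r)) / 2" "cmod (g s (tip r) - of_real (lam s)) \<le> 3 * sqrt (r - s)"
proof -
 note tp = tip_path[OF r s]
 have "(Re (g s (tip r)) - lam s)^2 \<le> (M * (r - s))^2" using tp(2) by (metis abs_ge_zero power2_abs power_mono)
 also have "\<dots> \<le> (r - s) / 2" using r s by (intro slope_short) auto
 finally have X: "(Re (g s (tip r)) - lam s)^2 \<le> (r - s) / 2" .
 have "Im (g s (tip r)) > 0" by (rule domain_upper(1)[OF tp(1) s(1)])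
 moreover have "(Re (g s (tip r)) - lam s)^2 \<le> (Im (g s (tip r)) / 2)^2" using X tp(3) by (simp add: power_divide)
 ultimately show "\<bar>Re (g s (tip r)) - lam s\<bar> \<le> Im (g s (tip r)) / 2" by (simp add: abs_le_square_iff[symmetric])
 have "(cmod (g s (tip r) - of_real (lam s)))^2 \<le> (3 * sqrt (r - s))^2"
  unfolding cmod_power2 using X tp(4) s by (simp add: power_mult_distrib)
 then show "cmod (g s (tip r) - of_real (lam s)) \<le> 3 * sqrt (r - s)" by (rule power2_le_imp_le) (use s in simp)
qed

lemma domain_path_open:
 assumes "\<And>s. s \<in> {0..<r} \<Longrightarrow> z \<in> D s"
 shows "loewner_path lam {0..<r} (\<lambda>s. g s z)"
 unfolding loewner_path_def
proof (intro ballI conjI)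
 fix t assume t: "t \<in> {0..<r}"
 define s where "s = (t + r) / 2"
 have s: "t < s" "s \<in> {0..<r}" "0 \<le> s" using t by (auto simp: s_def)
 have ts: "t \<in> {0..s}" using s t by auto
 note path = loewner_map_path(1)[OF assms[OF s(2)] s(3)]
 show "Im (g t z) > 0" by (rule loewner_pathD(1)[OF path ts])
 have "at t within {0..<r} = at t within {0..s}"
  by (rule at_within_nhd[of t "{..<s}"]) (use s in auto)
 then show "((\<lambda>s. g s z) has_vector_derivative 2 / (g t z - of_real (lam t))) (at t within {0..<r})"
  using loewner_pathD(3)[OF path ts] by simp
qed

lemma tip_dies:
 assumes r: "r \<in> {0<..\<tau>}"
 shows "((\<lambda>s. g s (tip r) - of_real (lam s)) \<longlongrightarrow> 0) (at_left r)"
proof (rule Lim_null_comparison)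
 have r0: "0 < r" using r by simp
 show "\<forall>\<^sub>F s in at_left r. cmod (g s (tip r) - of_real (lam s)) \<le> 3 * sqrt (r - s)"
  using eventually_at_left_real[OF r0] by eventually_elim (intro tip_cone(2)[OF r], auto)
 have "((\<lambda>s. 3 * sqrt (r - s)) \<longlongrightarrow> 3 * sqrt (r - r)) (at_left r)" by (intro tendsto_intros)
 then show "((\<lambda>s. 3 * sqrt (r - s)) \<longlongrightarrow> 0) (at_left r)" by simp
qed

text \<open>Shortly before death \<open>w^2\<close> is close to \<open>- 4 * (r - t)\<close>, which
  places any dying trajectory in the cone. It then contracts backwards together with the trajectory
  of the tip; both approach the driver at \<open>r\<close>, so the starting points coincide.\<close>

lemma dying_is_tip:
 assumes r: "r \<in> {0<..\<tau>}" and z: "\<And>s. s \<in> {0..<r} \<Longrightarrow> z \<in> D s"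
  and die: "((\<lambda>s. Im (g s z)) \<longlongrightarrow> 0) (at_left r)"
 shows "z = tip r"
proof -
 have r0: "0 < r" and r\<tau>: "r \<le> \<tau>" using r by auto
 note path = domain_path_open[OF z]
 note fe = driver_finite_energy[OF r]
 have w: "((\<lambda>s. g s z - of_real (lam s)) \<longlongrightarrow> 0) (at_left r)" by (rule dying_path_tendsto_0[OF path fe r0 die])
 have "((\<lambda>t. (g t z - 1 * of_real (lam t))^2 / of_real (r - t)) \<longlongrightarrow> -4) (at_left r)"
  by (rule driven_path_square_asymp[OF loewner_path_driven[OF path] fe _ r0]) (use w in simp_all)
 then have "\<forall>\<^sub>F t in at_left r. dist ((g t z - of_real (lam t))^2 / of_real (r - t)) (-4) < 1"
  by (intro tendstoD) simp_all
 then have "\<forall>\<^sub>F t in at_left r. cmod (z - tip r) \<le> cmod (g t z - of_real (lam t)) + cmod (g t (tip r) - of_real (lam t))"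
  using eventually_at_left_real[OF r0]
 proof eventually_elim
  case (elim t)
  have t: "0 \<le> t" "t < r" and t': "t \<in> {0..<r}" using elim(2) by auto
  define a where "a = Re (g t z) - lam t"
  define b where "b = Im (g t z)"
  have b: "b > 0" unfolding b_def by (rule domain_upper(1)[OF z[OF t'] t(1)])
  define h where "h = r - t"
  have h: "h > 0" using t by (simp add: h_def)
  define W where "W = (g t z - of_real (lam t))^2 / of_real h"
  have W: "cmod (W + 4) < 1" using elim(1) by (simp add: dist_norm W_def h_def)
  have WW: "(g t z - of_real (lam t))^2 = W * of_real h" using h by (simp add: W_def)
  have re: "a * a - b * b = Re W * h" using arg_cong[OF WW, of Re] by (simp add: power2_eq_square a_def b_def)
  have im: "2 * (a * b) = Im W * h"
   using arg_cong[OF WW, of Im] by (simp add: power2_eq_square a_def b_def mult.commute)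
  \<comment> \<open>With real part below -3 and imaginary part within 1, the square gives
    \<open>b * b \<ge> 3 * h\<close> and \<open>2 * (\<bar>a\<bar> * b) \<le> h\<close>, well inside
    the cone \<open>\<bar>a\<bar> \<le> b / 2\<close>.\<close>
  have Wb: "\<bar>Re W + 4\<bar> < 1" "\<bar>Im W\<bar> < 1" using W abs_Re_le_cmod[of "W + 4"] abs_Im_le_cmod[of "W + 4"] by simp_all
  have "Re W * h \<le> - 3 * h" using Wb(1) h by (intro mult_right_mono) auto
  then have i1: "b * b \<ge> 3 * h" using re zero_le_square[of a] by linarith
  have "\<bar>2 * (a * b)\<bar> = \<bar>Im W\<bar> * h" unfolding im abs_mult using h by simp
  moreover have "\<bar>Im W\<bar> * h \<le> 1 * h" using Wb(2) h by (intro mult_right_mono) auto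
  ultimately have i2: "2 * (\<bar>a\<bar> * b) \<le> h" using b by (simp add: abs_mult)
  note i = i1 i2
  have "\<bar>a\<bar> * b \<le> b / 2 * b" using i h by simp
  then have "\<bar>a\<bar> \<le> b / 2" using b by simp
  then have c: "\<bar>Re (g t z) - lam t\<bar> \<le> Im (g t z) / 2" by (simp add: a_def b_def)
  have "cmod (g 0 z - g 0 (tip r)) \<le> cmod (g t z - g t (tip r))"
   using r\<tau> t by (intro map_contracts z[OF t'] tip_path(1)[OF r t] c tip_cone(1)[OF r t]) auto
  also have "\<dots> \<le> cmod (g t z - of_real (lam t)) + cmod (g t (tip r) - of_real (lam t))"
   using norm_triangle_ineq4[of "g t z - of_real (lam t)" "g t (tip r) - of_real (lam t)"] by simp
  finally show ?case using loewner_map_path(2)[OF z[OF t'] t(1)] loewner_map_path(2)[OF tip_path(1)[OF r t] t(1)] by simp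
 qed
 moreover have "((\<lambda>t. cmod (g t z - of_real (lam t)) + cmod (g t (tip r) - of_real (lam t))) \<longlongrightarrow> cmod 0 + cmod 0) (at_left r)"
  by (intro tendsto_add tendsto_norm w tip_dies[OF r])
 ultimately have "cmod 0 + cmod 0 \<ge> cmod (z - tip r)" by (intro tendsto_lowerbound[OF _ _ trivial_limit_at_left_real])
 then show ?thesis by simp
qed

lemma tip_not_alive: "r \<in> {0<..\<tau>} \<Longrightarrow> r \<le> t \<Longrightarrow> tip r \<notin> D t"
proof
 assume r: "r \<in> {0<..\<tau>}" and rt: "r \<le> t" and a: "tip r \<in> D t"
 have r0: "0 < r" "0 \<le> r" using r by auto
 have a': "tip r \<in> D r" by (rule loewner_domain_antimono[OF a]) (use r rt in auto)
 have p: "loewner_path lam {0..<r} (\<lambda>s. g s (tip r))" by (rule domain_path_open) (use tip_path(1)[OF r] in auto)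
 have "((\<lambda>s. Im (g s (tip r) - of_real (lam s))) \<longlongrightarrow> Im 0) (at_left r)" by (rule tendsto_Im[OF tip_dies[OF r]])
 then have "((\<lambda>s. Im (g s (tip r))) \<longlongrightarrow> 0) (at_left r)" by simp
 from dying_path_not_alive[OF p this loewner_map_path(1)[OF a' r0(2)] refl r0(1)] show False .
qed

text \<open>A point outside \<open>D t\<close> has a finite lifetime \<open>R\<close>. It is already
  dead at \<open>R\<close>, and its height tends to 0 there, since a positive lower bound would let
  the trajectory be continued; hence it is the tip at time \<open>R\<close>.\<close>

lemma domain_eq:
 assumes t: "t \<in> {0..\<tau>}"
 shows "D t = upper_half_plane - tip ` {0<..t}"
proof (intro equalityI subsetI)
 fix z assume z: "z \<in> D t"
 then have "z \<in> upper_half_plane" using domain_upper(2)[OF z] t by (simp add: upper_half_plane_def)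
 moreover have "z \<notin> tip ` {0<..t}"
 proof
  assume "z \<in> tip ` {0<..t}"
  then obtain r where "r \<in> {0<..t}" "z = tip r" by (elim imageE)
  then show False using tip_not_alive[of r t] z t by simp
 qed
 ultimately show "z \<in> upper_half_plane - tip ` {0<..t}" by simp
next
 fix z assume z: "z \<in> upper_half_plane - tip ` {0<..t}"
 show "z \<in> D t"
 proof (rule ccontr)
  assume dead: "z \<notin> D t"
  define A where "A = {s \<in> {0..t}. z \<in> D s}"
  define R where "R = Sup A"
  have A0: "0 \<in> A" using z domain_0 t by (simp add: A_def)
  have bdd: "bdd_above A" by (rule bdd_aboveI[of _ t]) (simp add: A_def)
  have inA: "u \<in> {0..t}" "z \<in> D u" if "u \<in> A" for u
  proof -
   have u: "u \<in> {0..t} \<and> z \<in> D u" using that unfolding A_def by (rule CollectD)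
   show "u \<in> {0..t}" by (rule conjunct1[OF u])
   show "z \<in> D u" by (rule conjunct2[OF u])
  qed
  have R: "0 \<le> R" "R \<le> t"
  proof -
   show "0 \<le> R" unfolding R_def by (rule cSup_upper[OF A0 bdd])
   show "R \<le> t" unfolding R_def
   proof (rule cSup_least)
    show "A \<noteq> {}" using A0 by blast
    show "u \<le> t" if "u \<in> A" for u using inA(1)[OF that] by simp
   qed
  qed
  have alive: "z \<in> D s" if s: "s \<in> {0..<R}" for s
  proof -
   have "s < Sup A" using s by (simp add: R_def)
   moreover have "A \<noteq> {}" using A0 by blast
   ultimately obtain u where u: "u \<in> A" "s < u" by (rule less_cSupE)
   have "s \<in> {0..u}" using u(2) s by simp
   then show ?thesis by (rule loewner_domain_antimono[OF inA(2)[OF u(1)]])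
  qed
  have R\<tau>: "R \<le> \<tau>" using R t by simp
  \<comment> \<open>The supremum is not attained: a point alive at \<open>R\<close> would survive a
    little longer.\<close>
  have dR: "z \<notin> D R"
  proof
   assume a: "z \<in> D R"
   then have Rt: "R < t" using dead R by (cases "R = t") auto
   define c where "c = Im (g R z)"
   have c: "c > 0" unfolding c_def by (rule domain_upper(1)[OF a R(1)])
   define u where "u = min t (R + c^2 / 8)"
   have u: "R < u" "u \<le> t" "u - R \<le> c^2 / 8" using Rt c by (auto simp: u_def min_def)
   have "z \<in> D u" by (rule domain_extend[OF a _ c R(1)]) (use u t c_def in auto)
   moreover have "u \<in> {0..t}" using u R by simp
   ultimately have "u \<in> A" unfolding A_def by (intro CollectI conjI)
   then show False using cSup_upper[OF _ bdd, of u] u by (simp add: R_def)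
  qed
  have "R \<noteq> 0" using dR inA(2)[OF A0] by metis
  then have R0: "R > 0" using R(1) by simp
  have path: "loewner_path lam {0..<R} (\<lambda>s. g s z)" by (rule domain_path_open) (rule alive)
  have "((\<lambda>s. Im (g s z)) \<longlongrightarrow> 0) (at_left R)"
  proof (rule decreasing_tendsto_0_at_left[OF R0])
   show "Im (g u z) \<le> Im (g s z)" if "0 \<le> s" "s \<le> u" "u < R" for s u
    by (rule loewner_path_Im_decreasing[OF path]) (use that in auto)
   show "Im (g s z) \<ge> 0" if "0 \<le> s" "s < R" for s using loewner_pathD(1)[OF path, of s] that by simp
   show "\<exists>s\<in>{0..<R}. Im (g s z) < e" if e: "e > 0" for e
   proof (rule ccontr)
    assume n: "\<not> (\<exists>s\<in>{0..<R}. Im (g s z) < e)"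
    \<comment> \<open>Close enough to \<open>R\<close> for a continuation from height
      \<open>e\<close>, valid for time \<open>e^2 / 8\<close>, to reach \<open>R\<close>.\<close>
    define s where "s = max 0 (R - e^2 / 8)"
    have s: "s \<in> {0..<R}" "R - s \<le> e^2 / 8" using R0 e by (auto simp: s_def max_def)
    have "Im (g s z) \<ge> e" using n s(1) by (meson not_less)
    then have "z \<in> D R" by (rule domain_extend[OF alive[OF s(1)] _ e]) (use s R\<tau> in auto)
    then show False using dR by simp
   qed
  qed
  then have "z = tip R" using R0 R\<tau> alive by (intro dying_is_tip) auto
  then show False using z R R0 by auto
 qed
qed

text \<open>At time \<open>s\<close> the image of \<open>tip t\<close> is within
  \<open>3 * sqrt (t - s)\<close> of \<open>lam s\<close>, the limit of the images of the
  approximations of \<open>tip s\<close>; contraction carries this distance back to time 0.\<close>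

lemma tip_holder:
 assumes st: "0 \<le> s" "s < t" "t \<le> \<tau>"
 shows "cmod (tip t - tip s) \<le> 3 * sqrt (t - s)"
proof -
 have s: "s \<in> {0..\<tau>}" and t: "t \<in> {0<..\<tau>}" and s\<tau>: "s \<le> \<tau>" using st by auto
 note tp = tip_path(1)[OF t st(1,2)]
 have "(\<lambda>n. cmod (tip t - approximation s n)) \<longlonglongrightarrow> cmod (tip t - tip s)"
  by (intro tendsto_intros approximation_limit s)
 moreover have "(\<lambda>n. cmod (g s (tip t) - Complex (lam s) (1 / real (Suc n)))) \<longlonglongrightarrow> cmod (g s (tip t) - Complex (lam s) 0)"
  by (intro tendsto_norm tendsto_diff tendsto_Complex tendsto_const LIMSEQ_inverse_real_of_nat[unfolded inverse_eq_divide])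
 moreover have "cmod (tip t - approximation s n) \<le> cmod (g s (tip t) - Complex (lam s) (1 / real (Suc n)))" for n
  using map_contracts[OF tp approximation(1)[OF s, of n] order_refl st(1) s\<tau> tip_cone(1)[OF t st(1,2)] approximation_cone[OF s]]
  unfolding approximation(2)[OF s] loewner_map_path(2)[OF tp st(1)] loewner_map_path(2)[OF approximation(1)[OF s] st(1)] .
 ultimately have "cmod (tip t - tip s) \<le> cmod (g s (tip t) - Complex (lam s) 0)" by (intro LIMSEQ_le) auto
 also have "Complex (lam s) 0 = of_real (lam s)" by (simp add: complex_eq_iff)
 finally show ?thesis using tip_cone(2)[OF t st(1,2)] by simp
qed

lemma tip_continuous: "continuous_on {0..\<tau>} tip"
 unfolding continuous_on_iff
proof (intro ballI allI impI)
 fix s and e :: real assume s: "s \<in> {0..\<tau>}" and e: "0 < e"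
 have b: "cmod (tip t - tip s) \<le> 3 * sqrt \<bar>t - s\<bar>" if "t \<in> {0..\<tau>}" for t
  using tip_holder[of s t] tip_holder[of t s] that s
  by (cases s t rule: linorder_cases) (auto simp: norm_minus_commute)
 show "\<exists>d>0. \<forall>t\<in>{0..\<tau>}. dist t s < d \<longrightarrow> dist (tip t) (tip s) < e"
 proof (intro exI[of _ "(e/3)^2"] conjI ballI impI)
  show "0 < (e/3)^2" using e by simp
  fix t assume t: "t \<in> {0..\<tau>}" "dist t s < (e/3)^2"
  then have "sqrt \<bar>t - s\<bar> < sqrt ((e/3)^2)" by (simp only: real_sqrt_less_iff dist_real_def)
  then have "sqrt \<bar>t - s\<bar> < e / 3" using e by simp
  then show "dist (tip t) (tip s) < e" using b[OF t(1)] by (simp add: dist_norm)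
 qed
qed

text \<open>Of two tips the later one is still alive when the earlier one has died; the tip at time
  0 is the only real one.\<close>

lemma tip_inj: "inj_on tip {0..\<tau>}"
proof -
 have "tip s \<noteq> tip t" if st: "s \<in> {0..\<tau>}" "t \<in> {0..\<tau>}" "s < t" for s t
 proof (cases "s = 0")
  case True
  then show ?thesis using tip_upper[of t] tip_0 st by auto
 next
  case False
  then have "tip s \<notin> D s" using tip_not_alive[of s s] st by simp
  moreover have "tip t \<in> D s" using st by (intro tip_path(1)) auto
  ultimately show ?thesis by metis
 qed
 then show ?thesis by (intro linorder_inj_onI) (auto simp: neq_commute)
qed

text \<open>Along the trajectory of a remote point \<open>w\<close> differs from \<open>z\<close> by
  a bounded amount, so \<open>2 / w\<close> differs from \<open>2 / z\<close> by order
  \<open>1 / \<bar>z\<bar>^2\<close>. Integration over time gives \<open>2 * t / z\<close> with that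
  error.\<close>

lemma map_asymptotics:
 assumes t: "t \<in> {0..\<tau>}"
 shows "(\<lambda>z. g t z - z - of_real (2 * t) / z) \<in> O[inf at_infinity (principal (D t))](\<lambda>z. 1 / z^2)"
proof (rule bigoI)
 define L where "L = M * \<tau>"
 have t0: "0 \<le> t" and t\<tau>: "t \<le> \<tau>" using t by auto
 have L: "\<bar>lam s\<bar> \<le> L" if s: "s \<in> {0..\<tau>}" for s
 proof -
  have "\<bar>lam s - lam 0\<bar> \<le> M * \<bar>s - 0\<bar>"
   using field_differentiable_bound[of "{0..\<tau>}" lam lam' M s 0] derivative slope s by auto
  also have "\<dots> \<le> L" unfolding L_def using s slope_nonneg by (intro mult_left_mono) auto
  finally show ?thesis using start by simp
 qed
 \<comment> \<open>The threshold yields \<open>20 * \<tau> \<le> \<bar>z\<bar>^2\<close>, so the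
   loss \<open>10 * s\<close> in the modulus estimate is at most half of
   \<open>\<bar>z\<bar>^2\<close>; the summand 1 keeps \<open>z\<close> away from 0.\<close>
 have bound: "cmod (g t z - z - of_real (2 * t) / z) \<le> 4 * (4 * \<tau> + L) * \<tau> / (cmod z)^2"
  if z: "z \<in> D t" and big: "cmod z \<ge> 1 + 20 * \<tau>" for z
 proof -
  have z1: "cmod z \<ge> 1" "z \<noteq> 0" using big duration by auto
  have "20 * \<tau> * 1 \<le> cmod z * cmod z" using big duration z1 by (intro mult_mono) auto
  then have zz: "20 * \<tau> \<le> (cmod z)^2" by (simp add: power2_eq_square)
  note path = loewner_map_path[OF z t0]
  have w: "cmod (g s z - of_real (lam s)) \<ge> cmod z / 2" if s: "s \<in> {0..t}" for s
  proof -
   have sub: "{0..s} \<subseteq> {0..t}" "{0..s} \<subseteq> {0..\<tau>}" "0 \<le> s" using s t by auto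
   have "(cmod (g 0 z - of_real (lam 0)))^2 - 10 * (s - 0) \<le> 2 * (cmod (g s z - of_real (lam s)))^2"
    by (rule modulus_growth(2)[OF loewner_path_subset[OF path(1) sub(1)] sub(2,3)])
   then have "(cmod z)^2 \<le> 2 * (cmod (g s z - of_real (lam s)))^2 + 10 * s" using path(2) start by simp
   moreover have "10 * s \<le> (cmod z)^2 / 2" using zz s t by simp
   ultimately have "(cmod z / 2)^2 \<le> (cmod (g s z - of_real (lam s)))^2" by (simp add: power_divide)
   then show ?thesis by (rule power2_le_imp_le) simp
  qed
  have near: "cmod (g s z - z) \<le> 4 * \<tau> / cmod z" if s: "s \<in> {0..t}" for s
  proof -
   have "cmod (g s z - g 0 z) \<le> 4 / cmod z * \<bar>s - 0\<bar>"
   proof (rule vector_derivative_bound[OF convex_real_interval(5) loewner_pathD(3)[OF path(1)]])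
    fix u assume u: "u \<in> {0..t}"
    have "2 / cmod (g u z - of_real (lam u)) \<le> 2 / (cmod z / 2)"
     by (rule frac_le[OF _ order_refl _ w[OF u]]) (use z1 in auto)
    then show "cmod (2 / (g u z - of_real (lam u))) \<le> 4 / cmod z" by (simp add: norm_divide)
   qed (use s t0 in auto)
   also have "\<dots> \<le> 4 / cmod z * \<tau>" using s t by (intro mult_left_mono) auto
   finally show ?thesis using path(2) by simp
  qed
  have "cmod ((g t z - 2 / z * of_real t) - (g 0 z - 2 / z * of_real 0)) \<le> 4 * (4 * \<tau> + L) / (cmod z)^2 * \<bar>t - 0\<bar>"
  proof (rule vector_derivative_bound[of "{0..t}" "\<lambda>s. g s z - 2 / z * of_real s" "\<lambda>s. 2 / (g s z - of_real (lam s)) - 2 / z * 1"])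
   fix s assume s: "s \<in> {0..t}"
   have "((\<lambda>s. of_real s) has_vector_derivative (1::complex)) (at s within {0..t})"
    by (auto intro!: derivative_eq_intros has_vector_derivative_of_real)
   then show "((\<lambda>s. g s z - 2 / z * of_real s) has_vector_derivative 2 / (g s z - of_real (lam s)) - 2 / z * 1) (at s within {0..t})"
    by (intro has_vector_derivative_diff has_vector_derivative_mult_right loewner_pathD(3)[OF path(1) s])
   define v where "v = g s z - of_real (lam s)"
   have v: "cmod v \<ge> cmod z / 2" "v \<noteq> 0" using w[OF s] z1 by (auto simp: v_def)
   have vz: "cmod (z - v) \<le> 4 * \<tau> + L"
   proof -
    have "z - v = - (g s z - z) + of_real (lam s)" by (simp add: v_def)
    then have "cmod (z - v) \<le> cmod (- (g s z - z)) + cmod (of_real (lam s) :: complex)"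
     using norm_triangle_ineq by metis
    then have "cmod (z - v) \<le> cmod (g s z - z) + \<bar>lam s\<bar>" by (simp only: norm_minus_cancel norm_of_real)
    moreover have "4 * \<tau> / cmod z \<le> 4 * \<tau> / 1" using z1 duration by (intro divide_left_mono) auto
    ultimately show ?thesis using near[OF s] L[of s] s t by simp
   qed
   have "2 / v - 2 / z * 1 = 2 * (z - v) / (v * z)" using v z1 by (simp add: field_simps)
   then have "cmod (2 / v - 2 / z * 1) = 2 * cmod (z - v) / (cmod v * cmod z)" by (simp only: norm_divide norm_mult) simp
   also have "\<dots> \<le> 2 * (4 * \<tau> + L) / (cmod z / 2 * cmod z)"
    using v z1 vz order_trans[OF norm_ge_zero vz] by (intro frac_le mult_mono mult_pos_pos) auto
   also have "\<dots> = 4 * (4 * \<tau> + L) / (cmod z)^2" by (simp add: power2_eq_square)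
   finally show "cmod (2 / (g s z - of_real (lam s)) - 2 / z * 1) \<le> 4 * (4 * \<tau> + L) / (cmod z)^2" by (simp add: v_def)
  qed (use t0 in auto)
  also have "\<dots> \<le> 4 * (4 * \<tau> + L) / (cmod z)^2 * \<tau>"
   using t duration L[of 0] by (intro mult_left_mono) auto
  also have "\<dots> = 4 * (4 * \<tau> + L) * \<tau> / (cmod z)^2" by simp
  also have "(g t z - 2 / z * of_real t) - (g 0 z - 2 / z * of_real 0) = g t z - z - of_real (2 * t) / z"
   using path(2) by simp
  finally show ?thesis .
 qed
 have "\<forall>\<^sub>F z in at_infinity. z \<in> D t \<longrightarrow> cmod (g t z - z - of_real (2 * t) / z) \<le> 4 * (4 * \<tau> + L) * \<tau> * cmod (1 / z^2)"
  unfolding eventually_at_infinity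
  using bound by (intro exI[of _ "1 + 20 * \<tau>"]) (auto simp: norm_divide norm_power)
 then show "\<forall>\<^sub>F z in inf at_infinity (principal (D t)). cmod (g t z - z - of_real (2 * t) / z) \<le> 4 * (4 * \<tau> + L) * \<tau> * cmod (1 / z^2)"
  by (simp add: eventually_inf_principal)
qed

lemma map_mapping_out:
 assumes t: "t \<in> {0..\<tau>}"
 shows "mapping_out (tip ` {0<..t}) (2 * t) (g t)"
 unfolding mapping_out_def domain_eq[OF t, symmetric]
 by (intro conjI map_holomorphic(2)[OF t] map_bij[OF t] map_asymptotics[OF t])

text \<open>A point alive at \<open>t\<close> stays alive slightly longer, which turns the
  derivative along its own lifetime into the derivative within the full time interval.\<close>

lemma map_derivative:
 assumes t: "t \<in> {0..\<tau>}" and z: "z \<in> D t"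
 shows "((\<lambda>s. g s z) has_vector_derivative 2 / (g t z - of_real (lam t))) (at t within {0..\<tau>})"
proof -
 have t0: "0 \<le> t" and t\<tau>: "t \<le> \<tau>" using t by auto
 define c where "c = Im (g t z)"
 have c: "c > 0" unfolding c_def by (rule domain_upper(1)[OF z t0])
 define u where "u = min \<tau> (t + c^2 / 8)"
 have u: "t \<le> u" "u \<le> \<tau>" "u - t \<le> c^2 / 8" "t < \<tau> \<Longrightarrow> t < u" using t c by (auto simp: u_def min_def)
 have u0: "0 \<le> u" using t0 u by simp
 have zu: "z \<in> D u" by (rule domain_extend[OF z _ c t0 u(1,2,3)]) (simp add: c_def)
 have "at t within {0..\<tau>} = at t within {0..u}"
 proof (cases "t < \<tau>")
  case True
  then show ?thesis by (intro at_within_nhd[of t "{..<u}"]) (use u in auto)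
 next
  case False
  then have "u = \<tau>" using t u by simp
  then show ?thesis by simp
 qed
 then show ?thesis using loewner_pathD(3)[OF loewner_map_path(1)[OF zu u0], of t] t0 u(1) by simp
qed

text \<open>At time \<open>t\<close> the tip is a boundary point, but a little earlier it is
  interior: \<open>g s\<close> is continuous there and its value is within \<open>3 * sqrt h\<close>
  of the driver. The modulus estimate carries nearby points from \<open>s\<close> to
  \<open>t\<close>.\<close>

lemma map_tip_limit:
 assumes t: "t \<in> {0..\<tau>}"
 shows "(g t \<longlongrightarrow> of_real (lam t)) (at (tip t) within D t)"
proof (cases "t = 0")
 case True
 have "(g 0 \<longlongrightarrow> 0) (at 0 within D 0)"
 proof (rule Lim_transform_eventually[OF tendsto_ident_at])
  show "\<forall>\<^sub>F z in at 0 within D 0. z = g 0 z"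
   unfolding eventually_at_filter by (rule always_eventually) (use loewner_map_path(2) in auto)
 qed
 then show ?thesis using True tip_0 start by simp
next
 case False
 then have t': "t \<in> {0<..\<tau>}" and t0: "0 < t" and t\<tau>: "t \<le> \<tau>" using t by auto
 show ?thesis
 proof (rule tendstoI)
  fix e :: real assume e: "e > 0"
  \<comment> \<open>The estimate ends in
    \<open>\<bar>w\<bar>^2 \<le> 2 * (16 * h + 5 * h) = 42 * h\<close>, which
    \<open>h \<le> e^2 / 100\<close> keeps below \<open>e^2\<close>.\<close>
  define h where "h = min t (e^2 / 100)"
  have h: "h > 0" "h \<le> t" "h \<le> e^2 / 100" using t0 e by (auto simp: h_def)
  define s where "s = t - h"
  have s: "0 \<le> s" "s < t" "t - s = h" "s \<in> {0..\<tau>}" "s \<in> {0..t}" using h t\<tau> by (auto simp: s_def)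
  have "continuous_on (D s) (g s)" by (rule holomorphic_on_imp_continuous_on[OF map_holomorphic(2)[OF s(4)]])
  then have "isCont (g s) (tip t)"
   using tip_path(1)[OF t' s(1,2)] map_holomorphic(1)[OF s(4)] by (simp add: continuous_on_eq_continuous_at)
  then have "(g s \<longlongrightarrow> g s (tip t)) (at (tip t))" by (simp add: isCont_def)
  then have "\<forall>\<^sub>F z in at (tip t). dist (g s z) (g s (tip t)) < sqrt h" by (rule tendstoD) (use h in simp)
  then have "\<forall>\<^sub>F z in at (tip t) within D t. dist (g s z) (g s (tip t)) < sqrt h"
   using at_le[OF subset_UNIV] filter_leD by blast
  moreover have "\<forall>\<^sub>F z in at (tip t) within D t. z \<in> D t" by (simp add: eventually_at_filter)
  ultimately show "\<forall>\<^sub>F z in at (tip t) within D t. dist (g t z) (of_real (lam t)) < e"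
  proof eventually_elim
   case (elim z)
   have sub: "{s..t} \<subseteq> {0..t}" "{s..t} \<subseteq> {0..\<tau>}" "s \<le> t" "0 \<le> t" using s t\<tau> by auto
   have "cmod (g s z - of_real (lam s)) \<le> cmod (g s z - g s (tip t)) + cmod (g s (tip t) - of_real (lam s))"
    using norm_triangle_ineq[of "g s z - g s (tip t)" "g s (tip t) - of_real (lam s)"] by simp
   also have "\<dots> \<le> sqrt h + 3 * sqrt h"
    using elim(1) tip_cone(2)[OF t' s(1,2)] unfolding s(3) by (simp add: dist_norm)
   finally have "(cmod (g s z - of_real (lam s)))^2 \<le> (4 * sqrt h)^2" by (intro power_mono) auto
   then have "(cmod (g s z - of_real (lam s)))^2 \<le> 16 * h" using h by (simp add: power_mult_distrib)
   then have "2 * ((cmod (g s z - of_real (lam s)))^2 + 5 * (t - s)) \<le> 42 * h" unfolding s(3) by simp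
   moreover have "(cmod (g t z - of_real (lam t)))^2 \<le> 2 * ((cmod (g s z - of_real (lam s)))^2 + 5 * (t - s))"
    by (rule modulus_growth(1)[OF loewner_path_subset[OF loewner_map_path(1)[OF elim(2) sub(4)] sub(1)] sub(2,3)])
   moreover have "42 * h < e^2"
   proof -
    have "e^2 > 0" using e by simp
    then show ?thesis using h(1,3) by simp
   qed
   ultimately have "(cmod (g t z - of_real (lam t)))^2 < e^2" by simp
   then have "cmod (g t z - of_real (lam t)) < e" by (rule power2_less_imp_less) (use e in simp)
   then show ?case by (simp add: dist_norm)
  qed
 qed
qed

theorem driven_by_tip: "driven_by {0..\<tau>} tip lam"
 unfolding driven_by_def
proof (intro conjI exI[of _ g] ballI)
 show "capacity_curve {0..\<tau>} tip"
  unfolding capacity_curve_def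
 proof (intro conjI ballI impI)
  show "continuous_on {0..\<tau>} tip" by (rule tip_continuous)
  show "inj_on tip {0..\<tau>}" by (rule tip_inj)
  show "tip 0 = 0" by (rule tip_0)
  show "tip t \<in> upper_half_plane" if "t \<in> {0..\<tau>}" "t > 0" for t
   using tip_upper[of t] that by (simp add: upper_half_plane_def)
  show "\<exists>g. mapping_out (tip ` {0<..t}) (2 * t) g" if "t \<in> {0..\<tau>}" for t
   by (rule exI) (rule map_mapping_out[OF that])
 qed
 fix t assume t: "t \<in> {0..\<tau>}"
 show "mapping_out (tip ` {0<..t}) (2 * t) (g t)" by (rule map_mapping_out[OF t])
 show "(g t \<longlongrightarrow> of_real (lam t)) (at (tip t) within upper_half_plane - tip ` {0<..t})"
  unfolding domain_eq[OF t, symmetric] by (rule map_tip_limit[OF t])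
 fix z assume "z \<in> upper_half_plane - tip ` {0<..t}"
 then have "z \<in> D t" unfolding domain_eq[OF t] .
 then show "((\<lambda>s. g s z) has_vector_derivative 2 / (g t z - of_real (lam t))) (at t within {0..\<tau>})"
  by (rule map_derivative[OF t])
qed

lemma dying_path_is_tip:
 assumes P: "loewner_path lam {0..<r} P" and r: "r \<in> {0<..\<tau>}" and die: "((\<lambda>t. Im (P t)) \<longlongrightarrow> 0) (at_left r)"
 shows "P 0 = tip r"
proof (rule dying_is_tip[OF r])
 have e: "P 0 \<in> D s \<and> g s (P 0) = P s" if s: "s \<in> {0..<r}" for s
 proof -
  have "{0..s} \<subseteq> {0..<r}" using s by auto
  from loewner_map_eq[OF loewner_path_subset[OF P this], of s] s show ?thesis by simp
 qed
 then show "P 0 \<in> D s" if "s \<in> {0..<r}" for s using that by blast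
 have "\<forall>\<^sub>F t in at_left r. t \<in> {0<..<r}" by (rule eventually_at_left_real) (use r in simp)
 then have "\<forall>\<^sub>F t in at_left r. Im (P t) = Im (g t (P 0))" by (rule eventually_mono) (use e in simp)
 then show "((\<lambda>s. Im (g s (P 0))) \<longlongrightarrow> 0) (at_left r)" by (rule Lim_transform_eventually[OF die])
qed

end

subsection \<open>The optimal curve to a point\<close>

text \<open>Equivalently -8 times the logarithm of the sine of the argument of \<open>z\<close>; it
  depends only on the direction of \<open>z\<close> and vanishes on the imaginary axis.\<close>

definition emp_energy :: "complex \<Rightarrow> real" where
 "emp_energy z = 4 * ln (1 + (Re z / Im z)^2)"

lemma emp_energy_nonneg: "emp_energy z \<ge> 0"
 unfolding emp_energy_def by simp

lemma emp_energy_eq: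
 assumes "Im z > 0"
 shows "emp_energy z = 4 * ln (Re z * Re z + Im z * Im z) - 8 * ln (Im z)"
proof -
 have "1 + (Re z / Im z)^2 = (Re z * Re z + Im z * Im z) / (Im z * Im z)"
  using assms by (simp add: field_simps power2_eq_square)
 moreover have "Re z * Re z + Im z * Im z > 0" using assms by (simp add: add_nonneg_pos)
 ultimately show ?thesis using assms unfolding emp_energy_def by (simp add: ln_div ln_mult)
qed

text \<open>The half-angle formula. It transfers asymptotics of \<open>w^2\<close> to the tilt
  without choosing a square root.\<close>

lemma tilt_from_square:
 assumes "Im z > 0"
 shows "Re z / Im z = Im (z^2) / (cmod (z^2) - Re (z^2))"
proof -
 have "cmod (z^2) - Re (z^2) = 2 * Im z * Im z"
  unfolding norm_power cmod_power2 by (simp add: power2_eq_square)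
 moreover have "Im (z^2) = 2 * Im z * Re z" by (simp add: power2_eq_square)
 ultimately show ?thesis using assms by simp
qed

text \<open>The feedback law of the optimal curve to a point: \<open>k = 8 Re w / \<bar>w\<bar>\<^sup>2\<close>.\<close>

lemma
 assumes fe: "finite_energy \<tau> lam f" and \<tau>: "\<tau> > 0" and G: "loewner_path lam {0..<\<tau>} G"
  and die: "((\<lambda>t. G t - of_real (lam t)) \<longlongrightarrow> 0) (at_left \<tau>)"
 defines "w \<equiv> \<lambda>t. G t - of_real (lam t)"
 defines "k \<equiv> \<lambda>t. 8 * Re (w t) / (cmod (w t))^2"
 shows emp_lower: "emp_energy (w 0) \<le> remaining_energy \<tau> f 0 / 2"
  and emp_eqD: "emp_energy (w 0) = remaining_energy \<tau> f 0 / 2 \<Longrightarrow> t \<in> {0..<\<tau>} \<Longrightarrow> lam t - lam 0 = integral {0..t} k"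
  and emp_eqI: "(\<And>t. t \<in> {0<..<\<tau>} \<Longrightarrow> f t = k t) \<Longrightarrow> emp_energy (w 0) = remaining_energy \<tau> f 0 / 2"
  and emp_law_continuous: "continuous_on {0..<\<tau>} k"
proof -
 note dp = loewner_path_driven[OF G]
 define X where "X t = Re (w t)" for t
 define Y where "Y t = Im (w t)" for t
 have pos: "Y t > 0" if "t \<in> {0..<\<tau>}" for t using loewner_pathD(1)[OF G that] by (simp add: Y_def w_def)
 have Xac: "abs_continuous_on {0..t} X" and Yac: "abs_continuous_on {0..t} Y" if t: "t \<in> {0..<\<tau>}" for t
  using driven_path_ac[OF dp fe t] by (simp_all add: X_def[abs_def] Y_def[abs_def] w_def)
 have npos: "X t * X t + Y t * Y t > 0" if "t \<in> {0..<\<tau>}" for t using pos[OF that] by (simp add: add_nonneg_pos)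
 have n: "(cmod (w t))^2 = X t * X t + Y t * Y t" for t unfolding cmod_power2 X_def Y_def by (simp add: power2_eq_square)
 obtain N where N: "negligible N" "\<And>x. x \<in> {0<..<\<tau>} - N \<Longrightarrow> (lam has_real_derivative f x) (at x)"
  using finite_energy_derivative[OF fe] by blast
 define \<phi> where "\<phi> t = 4 * ln (X t * X t + Y t * Y t) - 8 * ln (Y t)" for t
 have \<phi>: "\<phi> t = emp_energy (w t)" if "t \<in> {0..<\<tau>}" for t
  using emp_energy_eq[of "w t"] pos[OF that] by (simp add: \<phi>_def X_def Y_def)
 have ac: "abs_continuous_on {0..t} \<phi>" if t: "t \<in> {0..<\<tau>}" for t
 proof -
  have p: "Y s > 0" "X s * X s + Y s * Y s > 0" if "s \<in> {0..t}" for s using pos[of s] npos[of s] that t by auto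
  show ?thesis unfolding \<phi>_def
   by (intro abs_continuous_on_diff abs_continuous_on_cmult abs_continuous_on_ln abs_continuous_on_add abs_continuous_on_mult Xac Yac t p)
 qed
 have der: "(\<phi> has_real_derivative (f t - k t)^2 / 2 - (f t)^2 / 2) (at t)" if t: "t \<in> {0<..<\<tau>} - N" for t
 proof -
  have t': "t \<in> {0..<\<tau>}" using t by auto
  have at: "at t within {0..<\<tau>} = at t" using t by (intro at_within_interior) auto
  \<comment> \<open>With the reciprocal as a variable, the identity for the derivative is polynomial
    modulo \<open>(X^2 + Y^2) * i = 1\<close>.\<close>
  define i where "i = 1 / (cmod (w t))^2"
  have i1: "(X t * X t + Y t * Y t) * i = 1"
  proof -
   have "a * (1 / a) = 1" if "a > 0" for a :: real using that by simp
   from this[OF npos[OF t']] show ?thesis unfolding i_def n .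
  qed
  have "((\<lambda>t. Re (G t)) has_real_derivative Re (2 / (G t - of_real (lam t)))) (at t)"
   using loewner_pathD(3)[OF G t', unfolded at] by (simp add: has_real_derivative_iff_has_vector_derivative has_vector_derivative_complex_iff)
  moreover have "Re (2 / (G t - of_real (lam t))) = 2 * X t * i"
   by (simp add: Re_divide cmod_power2 X_def w_def i_def)
  ultimately have "((\<lambda>t. Re (G t) - lam t) has_real_derivative 2 * X t * i - f t) (at t)"
   using DERIV_diff[OF _ N(2)[OF t]] by metis
  then have Xd: "(X has_real_derivative 2 * X t * i - f t) (at t)" by (simp add: X_def[abs_def] w_def)
  have "((\<lambda>t. Im (G t)) has_real_derivative - 2 * Y t * i) (at t)"
   using loewner_path_Im_derivative[OF G t', unfolded at] by (simp add: Y_def w_def i_def)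
  then have Yd: "(Y has_real_derivative - 2 * Y t * i) (at t)" by (simp add: Y_def[abs_def] w_def)
  have l: "((\<lambda>x. ln (h x)) has_real_derivative d / h t) (at t)" if "(h has_real_derivative d) (at t)" "h t > 0" for h d
   by (rule DERIV_cong[OF DERIV_chain2[OF DERIV_ln[OF that(2)] that(1)]]) (simp add: divide_inverse mult.commute)
  have "(\<phi> has_real_derivative 4 * ((X t * (2 * X t * i - f t) + (2 * X t * i - f t) * X t + (Y t * (- 2 * Y t * i) + (- 2 * Y t * i) * Y t)) / (X t * X t + Y t * Y t))
    - 8 * ((- 2 * Y t * i) / Y t)) (at t)"
   unfolding \<phi>_def
   by (intro DERIV_diff DERIV_cmult l[OF DERIV_add[OF DERIV_mult'[OF Xd Xd] DERIV_mult'[OF Yd Yd]]] l[OF Yd] pos[OF t'] npos[OF t'])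
  moreover have "4 * ((X t * (2 * X t * i - f t) + (2 * X t * i - f t) * X t + (Y t * (- 2 * Y t * i) + (- 2 * Y t * i) * Y t)) / (X t * X t + Y t * Y t))
    - 8 * ((- 2 * Y t * i) / Y t) = (f t - k t)^2 / 2 - (f t)^2 / 2"
  proof -
   have e1: "c / (X t * X t + Y t * Y t) = c * i" for c by (simp add: i_def n)
   have e2: "(- 2 * Y t * i) / Y t = - 2 * i" using pos[OF t'] by simp
   have e3: "k t = 8 * X t * i" by (simp add: k_def i_def X_def)
   have e4: "Y t * Y t * i = 1 - X t * X t * i" using i1 by (simp add: algebra_simps)
   have "4 * ((X t * (2 * X t * i - f t) + (2 * X t * i - f t) * X t + (Y t * (- 2 * Y t * i) + (- 2 * Y t * i) * Y t)) * i) - 8 * (- 2 * i)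
    = 16 * (X t * X t * i) * i - 8 * (X t * f t * i) - 16 * (Y t * Y t * i) * i + 16 * i"
    by (simp add: algebra_simps)
   also have "\<dots> = (f t - 8 * X t * i)^2 / 2 - (f t)^2 / 2"
    unfolding e4 by (simp add: power2_eq_square algebra_simps)
   finally show ?thesis unfolding e1 e2 e3 .
  qed
  ultimately show ?thesis by (simp only:)
 qed
 have lim: "(\<phi> \<longlongrightarrow> 0) (at_left \<tau>)"
 proof -
  have ev: "\<forall>\<^sub>F t in at_left \<tau>. t \<in> {0<..<\<tau>}" by (rule eventually_at_left_real[OF \<tau>])
  define Q where "Q t = (w t)^2 / of_real (\<tau> - t)" for t
  have "((\<lambda>t. (G t - 1 * of_real (lam t))^2 / of_real (\<tau> - t)) \<longlongrightarrow> - 4) (at_left \<tau>)"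
   by (rule driven_path_square_asymp[OF dp fe _ \<tau>]) (use die in simp_all)
  then have Q: "(Q \<longlongrightarrow> - 4) (at_left \<tau>)" by (simp add: Q_def[abs_def] w_def)
  \<comment> \<open>At the limit -4 the half-angle quotient is 0 divided by 8, so the tilt and hence
    \<phi> tend to 0.\<close>
  have "((\<lambda>t. 4 * ln (1 + (Im (Q t) / (cmod (Q t) - Re (Q t)))^2)) \<longlongrightarrow> 4 * ln (1 + (Im (-4) / (cmod (-4) - Re (-4)))^2)) (at_left \<tau>)"
   by (intro tendsto_intros Q) auto
  then have "((\<lambda>t. 4 * ln (1 + (Im (Q t) / (cmod (Q t) - Re (Q t)))^2)) \<longlongrightarrow> 0) (at_left \<tau>)" by simp
  moreover have "\<forall>\<^sub>F t in at_left \<tau>. 4 * ln (1 + (Im (Q t) / (cmod (Q t) - Re (Q t)))^2) = \<phi> t"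
   using ev
  proof eventually_elim
   case (elim t)
   then have t: "t \<in> {0..<\<tau>}" and h: "\<tau> - t > 0" by auto
   have "Im (Q t) = Im ((w t)^2) / (\<tau> - t)" "Re (Q t) = Re ((w t)^2) / (\<tau> - t)" "cmod (Q t) = cmod ((w t)^2) / (\<tau> - t)"
    unfolding Q_def using h by (simp_all only: Im_divide_of_real Re_divide_of_real norm_divide norm_of_real abs_of_pos)
   then have "Im (Q t) / (cmod (Q t) - Re (Q t)) = Im ((w t)^2) / (cmod ((w t)^2) - Re ((w t)^2))"
    using h by (simp add: diff_divide_distrib[symmetric])
   also have "\<dots> = Re (w t) / Im (w t)" by (rule tilt_from_square[symmetric]) (use pos[OF t] in \<open>simp add: Y_def\<close>)
   finally show ?case unfolding \<phi>[OF t] emp_energy_def by (simp only:)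
  qed
  ultimately show ?thesis by (rule Lim_transform_eventually)
 qed
 have wc: "continuous_on {0..<\<tau>} w" unfolding w_def
  by (intro continuous_intros loewner_path_continuous[OF G] continuous_on_subset[OF finite_energy_continuous[OF fe]]) auto
 have wnz: "(cmod (w t))^2 \<noteq> 0" if "t \<in> {0..<\<tau>}" for t using npos[OF that] unfolding n by (rule less_imp_neq[THEN not_sym])
 show kc: "continuous_on {0..<\<tau>} k" unfolding k_def by (intro continuous_intros wc) (use wnz in simp)
 note cs = completing_square_le[OF fe \<tau> ac N(1) der lim kc] completing_square_eqD[OF fe \<tau> ac N(1) der lim kc]
  completing_square_eqI[OF fe \<tau> ac N(1) der lim kc]
 have \<phi>0: "\<phi> 0 = emp_energy (w 0)" using \<tau> by (intro \<phi>) simp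
 show "emp_energy (w 0) \<le> remaining_energy \<tau> f 0 / 2" using cs(1) unfolding \<phi>0 .
 show "lam t - lam 0 = integral {0..t} k" if "emp_energy (w 0) = remaining_energy \<tau> f 0 / 2" "t \<in> {0..<\<tau>}"
  by (rule cs(2)) (use that \<phi>0 in simp_all)
 show "emp_energy (w 0) = remaining_energy \<tau> f 0 / 2" if "\<And>t. t \<in> {0<..<\<tau>} \<Longrightarrow> f t = k t"
  unfolding \<phi>0[symmetric]
 proof (rule cs(3))
  fix t assume "t \<in> {0<..<\<tau>} - N"
  then have "t \<in> {0<..<\<tau>}" by simp
  then show "f t = k t" by (rule that)
 qed
qed

text \<open>Under the feedback law \<open>X' = - 6 * X / \<bar>w\<bar>^2\<close> and
  \<open>Y' = - 2 * Y / \<bar>w\<bar>^2\<close>, so \<open>X / Y^3\<close> is constant. Then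
  \<open>\<bar>w\<bar>^2\<close> is a polynomial in \<open>Y\<close>, the profile of
  \<open>Y\<close> falls at rate 2, and \<open>lam + 4/3 * X\<close> is conserved, which recovers
  the driver.\<close>

lemma emp_rigidity:
 assumes fe: "finite_energy \<tau> lam f" and \<tau>: "\<tau> > 0" and G: "loewner_path lam {0..<\<tau>} G"
  and die: "((\<lambda>t. G t - of_real (lam t)) \<longlongrightarrow> 0) (at_left \<tau>)"
  and z: "G 0 = z" and lam0: "lam 0 = 0" and eq: "emp_energy z = remaining_energy \<tau> f 0 / 2"
 defines "c \<equiv> Re z / Im z ^ 3"
 shows "\<tau> = profile_poly (c^2) (Im z) / 2"
  and "t \<in> {0..<\<tau>} \<Longrightarrow> \<exists>y. 0 \<le> y \<and> y \<le> Im z \<and> profile_poly (c^2) y = 2 * (\<tau> - t) \<and> lam t = 4/3 * c * (Im z ^ 3 - y ^ 3)"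
proof -
 define w where "w t = G t - of_real (lam t)" for t
 define n where "n t = (cmod (w t))^2" for t
 define X where "X t = Re (w t)" for t
 define Y where "Y t = Im (w t)" for t
 define k where "k t = 8 * X t / n t" for t
 have w0: "w 0 = z" using z lam0 by (simp add: w_def)
 have z0: "0 \<in> {0..<\<tau>}" using \<tau> by simp
 have Ypos: "Y t > 0" if "t \<in> {0..<\<tau>}" for t using loewner_pathD(1)[OF G that] by (simp add: Y_def w_def)
 have nXY: "n t = X t * X t + Y t * Y t" for t unfolding n_def cmod_power2 X_def Y_def by (simp add: power2_eq_square)
 have npos: "n t > 0" if "t \<in> {0..<\<tau>}" for t using Ypos[OF that] unfolding nXY by (simp add: add_nonneg_pos)
 have kc: "continuous_on {0..<\<tau>} k" using emp_law_continuous[OF fe \<tau> G die] unfolding k_def X_def n_def w_def .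
 have lk: "lam t = lam 0 + integral {0..t} k" if "t \<in> {0..<\<tau>}" for t
 proof -
  have "lam t - lam 0 = integral {0..t} (\<lambda>t. 8 * Re (G t - of_real (lam t)) / (cmod (G t - of_real (lam t)))^2)"
   by (rule emp_eqD[OF fe \<tau> G die _ that]) (use eq z lam0 in simp)
  then show ?thesis unfolding k_def X_def n_def w_def by simp
 qed
 have ld: "(lam has_real_derivative k t) (at t within {0..<\<tau>})" if t: "t \<in> {0..<\<tau>}" for t
  by (rule integral_function_derivative[OF kc _ t, of lam 0]) (use lk lam0 in simp)
 have Xd: "(X has_real_derivative - 6 * X t / n t) (at t within {0..<\<tau>})" if t: "t \<in> {0..<\<tau>}" for t
 proof -
  have "((\<lambda>t. Re (G t)) has_real_derivative Re (2 / (G t - of_real (lam t)))) (at t within {0..<\<tau>})"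
   using loewner_pathD(3)[OF G t] by (simp add: has_real_derivative_iff_has_vector_derivative has_vector_derivative_complex_iff)
  moreover have "Re (2 / (G t - of_real (lam t))) = 2 * X t / n t" by (simp add: Re_divide cmod_power2 X_def w_def n_def)
  ultimately have "((\<lambda>t. Re (G t) - lam t) has_real_derivative 2 * X t / n t - k t) (at t within {0..<\<tau>})"
   using DERIV_diff[OF _ ld[OF t]] by metis
  moreover have "2 * X t / n t - k t = - 6 * X t / n t" by (simp add: k_def diff_divide_distrib[symmetric])
  ultimately show ?thesis by (simp add: X_def[abs_def] w_def)
 qed
 have Yd: "(Y has_real_derivative - 2 * Y t / n t) (at t within {0..<\<tau>})" if t: "t \<in> {0..<\<tau>}" for t
  using loewner_path_Im_derivative[OF G t] by (simp add: Y_def[abs_def] w_def n_def)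
 note const = zero_derivative_constant
 have X0: "X 0 = Re z" and Y0: "Y 0 = Im z" using w0 by (simp_all add: X_def Y_def)
 have XY: "X t = c * Y t ^ 3" if t: "t \<in> {0..<\<tau>}" for t
 proof -
  have "((\<lambda>t. X t / Y t ^ 3) has_real_derivative 0) (at t within {0..<\<tau>})" if t: "t \<in> {0..<\<tau>}" for t
  proof -
   have "((\<lambda>t. X t / Y t ^ 3) has_real_derivative
    ((- 6 * X t / n t) * Y t ^ 3 - X t * (real 3 * ((- 2 * Y t / n t) * Y t ^ (3 - Suc 0)))) / (Y t ^ 3 * Y t ^ 3)) (at t within {0..<\<tau>})"
    using Ypos[OF t] by (intro DERIV_divide DERIV_power Xd[OF t] Yd[OF t]) auto
   moreover have e: "(- 6 * X t / n t) * Y t ^ 3 - X t * (real 3 * ((- 2 * Y t / n t) * Y t ^ (3 - Suc 0))) = 0"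
    by (simp add: power_numeral_reduce)
   ultimately show ?thesis by (simp only: e div_0)
  qed
  from const[OF this t] have "X t / Y t ^ 3 = c" unfolding X0 Y0 c_def .
  then show ?thesis using Ypos[OF t] by (simp add: field_simps)
 qed
 let ?N = "profile_poly (c^2)"
 have N: "?N (Y t) = ?N (Im z) - 2 * t" if t: "t \<in> {0..<\<tau>}" for t
 proof -
  have "((\<lambda>t. ?N (Y t) + 2 * t) has_real_derivative 0) (at t within {0..<\<tau>})" if t: "t \<in> {0..<\<tau>}" for t
  proof -
   have "((\<lambda>t. ?N (Y t) + 2 * t) has_real_derivative (Y t * (1 + c^2 * Y t ^ 4)) * (- 2 * Y t / n t) + 2 * 1) (at t within {0..<\<tau>})"
    by (intro DERIV_add DERIV_cmult DERIV_ident DERIV_chain2[OF profile_poly_derivative] Yd[OF t])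
   moreover have "(Y t * (1 + c^2 * Y t ^ 4)) * (- 2 * Y t / n t) + 2 * 1 = 0"
   proof -
    define Q where "Q = 1 + c^2 * Y t ^ 4"
    \<comment> \<open>On the cubic the squared modulus is exactly the factor produced by the
      derivative of the profile, so the quotient collapses to a constant.\<close>
    have nQ: "n t = Y t * Q * Y t"
     unfolding nXY XY[OF t] Q_def by (simp add: power2_eq_square power_numeral_reduce algebra_simps)
    have "(Y t * Q) * (- 2 * Y t / a) = - 2 * (Y t * Q * Y t) / a" for a by simp
    then have "(Y t * Q) * (- 2 * Y t / n t) = - 2 * n t / n t" by (simp only: nQ[symmetric])
    then show ?thesis using npos[OF t] by (simp add: Q_def)
   qed
   ultimately show ?thesis by simp
  qed
  from const[OF this t] show ?thesis using Y0 by simp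
 qed
 have "((\<lambda>t. Im (G t - of_real (lam t))) \<longlongrightarrow> Im 0) (at_left \<tau>)" by (rule tendsto_Im[OF die])
 then have Ylim: "(Y \<longlongrightarrow> 0) (at_left \<tau>)" by (simp add: Y_def[abs_def] w_def)
 have "((\<lambda>t. ?N (Y t)) \<longlongrightarrow> 0^2 / 2 + c^2 * 0 ^ 6 / 6) (at_left \<tau>)"
  unfolding profile_poly_def by (intro tendsto_intros Ylim) auto
 then have l1: "((\<lambda>t. ?N (Y t)) \<longlongrightarrow> 0) (at_left \<tau>)" by simp
 have l2: "((\<lambda>t. ?N (Im z) - 2 * t) \<longlongrightarrow> ?N (Im z) - 2 * \<tau>) (at_left \<tau>)" by (intro tendsto_intros)
 have ev: "\<forall>\<^sub>F t in at_left \<tau>. ?N (Y t) = ?N (Im z) - 2 * t"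
  using eventually_at_left_real[OF \<tau>] by eventually_elim (use N in auto)
 have "0 = ?N (Im z) - 2 * \<tau>"
  by (rule tendsto_unique[OF trivial_limit_at_left_real Lim_transform_eventually[OF l1 ev] l2])
 then show \<tau>eq: "\<tau> = ?N (Im z) / 2" by simp
 show "\<exists>y. 0 \<le> y \<and> y \<le> Im z \<and> ?N y = 2 * (\<tau> - t) \<and> lam t = 4/3 * c * (Im z ^ 3 - y ^ 3)" if t: "t \<in> {0..<\<tau>}"
 proof (intro exI[of _ "Y t"] conjI)
  show "0 \<le> Y t" using Ypos[OF t] by simp
  have "Im (G t) \<le> Im (G 0)" by (rule loewner_path_Im_decreasing[OF G]) (use t in auto)
  then show "Y t \<le> Im z" using z by (simp add: Y_def w_def)
  show "?N (Y t) = 2 * (\<tau> - t)" using N[OF t] \<tau>eq by simp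
  have "((\<lambda>t. lam t + 4/3 * X t) has_real_derivative 0) (at t within {0..<\<tau>})" if t: "t \<in> {0..<\<tau>}" for t
  proof -
   have "((\<lambda>t. lam t + 4/3 * X t) has_real_derivative k t + 4/3 * (- 6 * X t / n t)) (at t within {0..<\<tau>})"
    by (intro DERIV_add DERIV_cmult ld Xd t)
   moreover have "k t + 4/3 * (- 6 * X t / n t) = 0" by (simp add: k_def)
   ultimately show ?thesis by simp
  qed
  from const[OF this t] have "lam t + 4/3 * X t = 4/3 * X 0" using lam0 by simp
  then show "lam t = 4/3 * c * (Im z ^ 3 - Y t ^ 3)"
   using XY[OF t] XY[OF z0] Y0 by (simp add: algebra_simps)
 qed
qed

lemma driven_by_cong:
 assumes d: "driven_by {0..r} \<gamma> lam" and \<gamma>: "\<And>t. t \<in> {0..r} \<Longrightarrow> \<gamma>' t = \<gamma> t" and l: "\<And>t. t \<in> {0..r} \<Longrightarrow> lam' t = lam t"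
  and r: "0 \<le> r"
 shows "driven_by {0..r} \<gamma>' lam'"
proof -
 obtain g where g: "capacity_curve {0..r} \<gamma>"
  "\<And>t. t \<in> {0..r} \<Longrightarrow> mapping_out (\<gamma> ` {0<..t}) (2 * t) (g t)"
  "\<And>t. t \<in> {0..r} \<Longrightarrow> (g t \<longlongrightarrow> of_real (lam t)) (at (\<gamma> t) within upper_half_plane - \<gamma> ` {0<..t})"
  "\<And>t z. t \<in> {0..r} \<Longrightarrow> z \<in> upper_half_plane - \<gamma> ` {0<..t} \<Longrightarrow>
      ((\<lambda>s. g s z) has_vector_derivative 2 / (g t z - of_real (lam t))) (at t within {0..r})"
  by (rule driven_byE[OF d]) (rule that)
 have im: "\<gamma>' ` {0<..t} = \<gamma> ` {0<..t}" if "t \<in> {0..r}" for t by (rule image_cong[OF refl], rule \<gamma>) (use that in auto)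
 note cc = g(1)[unfolded capacity_curve_def]
 note c = conjunct1[OF cc] conjunct1[OF conjunct2[OF cc]]
 show ?thesis
  unfolding driven_by_def
 proof (intro conjI exI[of _ g] ballI)
  show "capacity_curve {0..r} \<gamma>'"
   unfolding capacity_curve_def
  proof (intro conjI ballI impI)
   show "continuous_on {0..r} \<gamma>'" by (rule continuous_on_eq[OF c(1)]) (rule \<gamma>[symmetric])
   show "inj_on \<gamma>' {0..r}" by (rule inj_on_cong[THEN iffD2, OF _ c(2)]) (rule \<gamma>)
   show "\<gamma>' 0 = 0" using \<gamma>[of 0] r driven_by_curve(2)[OF d] by simp
   show "\<gamma>' t \<in> upper_half_plane" if "t \<in> {0..r}" "0 < t" for t
    unfolding \<gamma>[OF that(1)] by (rule driven_by_curve(3)[OF d that])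
   show "\<exists>g. mapping_out (\<gamma>' ` {0<..t}) (2 * t) g" if "t \<in> {0..r}" for t
    unfolding im[OF that] by (rule exI) (rule g(2)[OF that])
  qed
  fix t assume t: "t \<in> {0..r}"
  show "mapping_out (\<gamma>' ` {0<..t}) (2 * t) (g t)" unfolding im[OF t] by (rule g(2)[OF t])
  show "(g t \<longlongrightarrow> of_real (lam' t)) (at (\<gamma>' t) within upper_half_plane - \<gamma>' ` {0<..t})"
   unfolding im[OF t] \<gamma>[OF t] l[OF t] by (rule g(3)[OF t])
  show "((\<lambda>s. g s z) has_vector_derivative 2 / (g t z - of_real (lam' t))) (at t within {0..r})"
   if "z \<in> upper_half_plane - \<gamma>' ` {0<..t}" for z
   unfolding l[OF t] by (rule g(4)[OF t]) (use that in \<open>simp only: im[OF t]\<close>)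
 qed
qed

text \<open>The rigidity computation in reverse supplies the driver; its curve comes from the locale
  for short drivers. Reaching \<open>z\<close> is checked through an explicit trajectory from
  \<open>z\<close> that dies at \<tau>, since only the tip dies at that time.\<close>

lemma emp_extremal:
 assumes z: "Im z > 0" "\<bar>Re z\<bar> \<le> Im z / 8"
 defines "c \<equiv> Re z / Im z ^ 3"
 defines "\<tau> \<equiv> profile_poly (c^2) (Im z) / 2"
 obtains lam \<gamma> where "\<tau> > 0" "simple_curve_to z (\<tau>, \<gamma>)" "driven_by {0..\<tau>} \<gamma> lam" "continuous_on {0..\<tau>} lam"
  "driver_energy \<tau> lam = ennreal (emp_energy z)"
  "\<And>t. t \<in> {0..<\<tau>} \<Longrightarrow> \<exists>y. 0 \<le> y \<and> y \<le> Im z \<and> profile_poly (c^2) y = 2 * (\<tau> - t) \<and> lam t = 4/3 * c * (Im z ^ 3 - y ^ 3)"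
proof -
 define \<kappa> where "\<kappa> = c^2"
 define b where "b = Im z"
 have b: "b > 0" using z by (simp add: b_def)
 have \<kappa>: "\<kappa> \<ge> 0" by (simp add: \<kappa>_def)
 have fac: "1 + \<kappa> * s ^ 4 \<ge> 1" for s using \<kappa> by (simp add: zero_le_even_power')
 have \<tau>\<kappa>: "\<tau> = profile_poly \<kappa> b / 2" by (simp add: \<tau>_def \<kappa>_def b_def)
 have p: "1 + \<kappa> * b ^ 4 > 0" "(2::real) > 0" using fac[of b] by simp_all
 obtain S where S: "S 0 = b" "S \<tau> = 0" "continuous_on {0..\<tau>} S"
  "\<And>t. t \<in> {0..<\<tau>} \<Longrightarrow> 0 < S t \<and> S t \<le> b"
  "\<And>t. t \<in> {0..<\<tau>} \<Longrightarrow> (S has_real_derivative - 2 / (S t * (1 + \<kappa> * S t ^ 4))) (at t)"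
  "\<And>t. t \<in> {0..\<tau>} \<Longrightarrow> profile_poly \<kappa> (S t) = 2 * (\<tau> - t)"
  by (rule profile_exists[OF b p, folded \<tau>\<kappa>]) (rule that)
 have \<tau>: "\<tau> > 0" unfolding \<tau>\<kappa> profile_poly_def using b \<kappa> by (simp add: add_pos_nonneg)
 have S0: "0 \<le> S t \<and> S t \<le> b" if "t \<in> {0..\<tau>}" for t
  using S(2) S(4)[of t] that b by (cases "t = \<tau>") auto
 define lam where "lam t = 4/3 * c * (b ^ 3 - S t ^ 3)" for t
 define F where "F t = 8 * c * S t / (1 + \<kappa> * S t ^ 4)" for t
 define M where "M = 8 * \<bar>c\<bar> * b"
 have lamd: "(lam has_real_derivative F t) (at t)" if t: "t \<in> {0..<\<tau>}" for t
 proof -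
  define A where "A = 1 + \<kappa> * S t ^ 4"
  have A: "A > 0" "S t > 0" using fac[of "S t"] S(4)[OF t] by (auto simp: A_def)
  have "(lam has_real_derivative 4/3 * c * (0 - real 3 * ((- 2 / (S t * (1 + \<kappa> * S t ^ 4))) * S t ^ (3 - Suc 0)))) (at t)"
   unfolding lam_def by (intro DERIV_cmult DERIV_diff DERIV_const DERIV_power S(5) t)
  moreover have "4/3 * c * (0 - real 3 * ((- 2 / (S t * A)) * S t ^ (3 - Suc 0))) = 8 * c * S t / A"
   using A by (simp add: field_simps power2_eq_square)
  ultimately show ?thesis unfolding F_def A_def by (simp only:)
 qed
 \<comment> \<open>\<open>S\<close> is not differentiable at \<tau>, being of order
   \<open>sqrt (\<tau> - t)\<close>, but its cube is, with derivative 0; thus \<open>lam\<close> is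
   C1 on the closed interval.\<close>
 have lam\<tau>: "(lam has_real_derivative F \<tau>) (at \<tau> within {0..\<tau>})"
 proof -
  have "((\<lambda>t. (lam t - lam \<tau>) / (t - \<tau>)) \<longlongrightarrow> 0) (at \<tau> within {0..\<tau>})"
  proof (rule Lim_null_comparison)
   have "\<bar>(lam t - lam \<tau>) / (t - \<tau>)\<bar> \<le> 16/3 * \<bar>c\<bar> * S t" if t: "t \<in> {0..<\<tau>}" for t
   proof -
    have h: "\<tau> - t > 0" and t': "t \<in> {0..\<tau>}" using t by auto
    have "(S t)^2 / 2 \<le> profile_poly \<kappa> (S t)" unfolding profile_poly_def using \<kappa> S0[OF t'] by simp
    then have s2: "(S t)^2 \<le> 4 * (\<tau> - t)" using S(6)[OF t'] by simp
    have "lam t - lam \<tau> = - (4/3 * c * S t * (S t)^2)" by (simp add: lam_def S(2) power_numeral_reduce power2_eq_square algebra_simps)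
    then have "\<bar>lam t - lam \<tau>\<bar> = 4/3 * \<bar>c\<bar> * S t * (S t)^2" using S0[OF t'] by (simp add: abs_mult)
    also have "\<dots> \<le> 4/3 * \<bar>c\<bar> * S t * (4 * (\<tau> - t))" using S0[OF t'] by (intro mult_left_mono[OF s2]) auto
    finally have "\<bar>lam t - lam \<tau>\<bar> \<le> 16/3 * \<bar>c\<bar> * S t * (\<tau> - t)" by (simp add: algebra_simps)
    moreover have "\<bar>t - \<tau>\<bar> = \<tau> - t" using h by simp
    ultimately show ?thesis using h unfolding abs_divide by (simp add: pos_divide_le_eq)
   qed
   then show "\<forall>\<^sub>F t in at \<tau> within {0..\<tau>}. norm ((lam t - lam \<tau>) / (t - \<tau>)) \<le> 16/3 * \<bar>c\<bar> * S t"
    unfolding eventually_at_filter by (intro always_eventually) auto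
   have "(S \<longlongrightarrow> S \<tau>) (at \<tau> within {0..\<tau>})" using S(3) \<tau> unfolding continuous_on_def by auto
   then have "((\<lambda>t. 16/3 * \<bar>c\<bar> * S t) \<longlongrightarrow> 16/3 * \<bar>c\<bar> * 0) (at \<tau> within {0..\<tau>})" unfolding S(2) by (intro tendsto_intros)
   then show "((\<lambda>t. 16/3 * \<bar>c\<bar> * S t) \<longlongrightarrow> 0) (at \<tau> within {0..\<tau>})" by simp
  qed
  moreover have "F \<tau> = 0" by (simp add: F_def S(2))
  ultimately show ?thesis by (simp add: has_field_derivative_iff)
 qed
 have lam0: "lam 0 = 0" by (simp add: lam_def S(1))
 interpret loewner_driver lam F \<tau> M
 proof
  show "\<tau> > 0" by (rule \<tau>)
  show "(lam has_real_derivative F t) (at t within {0..\<tau>})" if "t \<in> {0..\<tau>}" for t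
   using lam\<tau> has_field_derivative_at_within[OF lamd[of t], of "{0..\<tau>}"] that by (cases "t = \<tau>") auto
  have "1 + \<kappa> * S t ^ 4 \<noteq> 0" for t using fac[of "S t"] by linarith
  then show "continuous_on {0..\<tau>} F" unfolding F_def by (intro continuous_intros S(3)) auto
  show "\<bar>F t\<bar> \<le> M" if t: "t \<in> {0..\<tau>}" for t
  proof -
   have "\<bar>F t\<bar> = 8 * \<bar>c\<bar> * S t / (1 + \<kappa> * S t ^ 4)" using S0[OF t] fac[of "S t"] by (simp add: F_def abs_mult abs_divide)
   also have "\<dots> \<le> 8 * \<bar>c\<bar> * b / 1" using S0[OF t] fac[of "S t"] b by (intro frac_le mult_left_mono) auto
   finally show ?thesis by (simp add: M_def)
  qed
  show "lam 0 = 0" by (rule lam0)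
  \<comment> \<open>In terms of the squared tilt \<open>q\<close> the left side is
    \<open>16 * q + 16/3 * q^2\<close>; the bound \<open>\<bar>Re z\<bar> \<le> Im z / 8\<close>
    gives \<open>q \<le> 1/64\<close>.\<close>
  show "M^2 * \<tau> \<le> 1 / 2"
  proof -
   define q where "q = (c * b^2)^2"
   have cb: "c * b^2 = Re z / Im z" using b by (simp add: c_def b_def power_numeral_reduce power2_eq_square)
   have "\<bar>Re z / Im z\<bar> \<le> 1 / 8" using z by (simp add: abs_divide divide_le_eq)
   then have "(Re z / Im z)^2 \<le> (1/8)^2" by (simp only: abs_le_square_iff[symmetric])
   moreover have "q = (Re z / Im z)^2" by (simp only: q_def cb)
   ultimately have q: "0 \<le> q" "q \<le> 1/64" by (simp_all add: power_one_over)
   have "M^2 * \<tau> = 16 * q + 16/3 * (q * q)"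
    unfolding M_def \<tau>\<kappa> profile_poly_def \<kappa>_def q_def power_mult_distrib power2_abs
    by (simp add: power2_eq_square power_numeral_reduce field_simps)
   also have "\<dots> \<le> 16 * (1/64) + 16/3 * (1/64 * (1/64))" using q by (intro add_mono mult_left_mono mult_mono) auto
   finally show ?thesis by simp
  qed
 qed
 \<comment> \<open>The candidate trajectory lies on the cubic \<open>Re w = c * (Im w)^3\<close>
   with height \<open>S\<close>; it starts at \<open>z\<close>.\<close>
 define V where "V t = Complex (lam t + c * S t ^ 3) (S t)" for t
 have Vw: "V t - of_real (lam t) = Complex (c * S t ^ 3) (S t)" for t by (simp add: V_def complex_eq_iff)
 have nV: "(cmod (Complex (c * S t ^ 3) (S t)))^2 = S t * S t * (1 + \<kappa> * S t ^ 4)" for t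
  unfolding cmod_power2 by (simp add: \<kappa>_def power2_eq_square power_numeral_reduce algebra_simps)
 have path: "loewner_path lam {0..<\<tau>} V"
  unfolding loewner_path_def
 proof (intro ballI conjI)
  fix t assume t: "t \<in> {0..<\<tau>}"
  show "Im (V t) > 0" using S(4)[OF t] by (simp add: V_def)
  define A where "A = 1 + \<kappa> * S t ^ 4"
  have A: "A > 0" "S t > 0" using fac[of "S t"] S(4)[OF t] by (auto simp: A_def)
  have nA: "(c * S t ^ 3)^2 + (S t)^2 = S t * S t * A" using nV[of t] unfolding cmod_power2 A_def complex.sel .
  have Sd: "(S has_real_derivative - 2 / (S t * A)) (at t within {0..<\<tau>})"
   unfolding A_def by (rule has_field_derivative_at_within[OF S(5)[OF t]])
  have "((\<lambda>t. lam t + c * S t ^ 3) has_real_derivative F t + c * (real 3 * ((- 2 / (S t * A)) * S t ^ (3 - Suc 0)))) (at t within {0..<\<tau>})"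
   by (intro DERIV_add DERIV_cmult DERIV_power Sd has_field_derivative_at_within[OF lamd[OF t]])
  moreover have "F t + c * (real 3 * ((- 2 / (S t * A)) * S t ^ (3 - Suc 0))) = Re (2 / (V t - of_real (lam t)))"
  proof -
   have "Re (2 / (V t - of_real (lam t))) = 2 * (c * S t ^ 3) / (S t * S t * A)"
    unfolding Vw Re_divide complex.sel nA by simp
   also have "\<dots> = 8 * c * S t / A + c * (real 3 * ((- 2 / (S t * A)) * S t ^ (3 - Suc 0)))"
    using A by (simp add: field_simps power_numeral_reduce power2_eq_square)
   finally show ?thesis unfolding F_def A_def by simp
  qed
  moreover have "- 2 / (S t * A) = Im (2 / (V t - of_real (lam t)))"
  proof -
   have "Im (2 / (V t - of_real (lam t))) = - 2 * S t / (S t * S t * A)"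
    unfolding Vw Im_divide complex.sel nA by simp
   then show ?thesis using A by simp
  qed
  ultimately show "(V has_vector_derivative 2 / (V t - of_real (lam t))) (at t within {0..<\<tau>})"
   using Sd unfolding has_vector_derivative_complex_iff by (simp add: V_def has_real_derivative_iff_has_vector_derivative)
 qed
 have Slim: "(S \<longlongrightarrow> 0) (at_left \<tau>)" using continuous_on_left_end[OF S(3) \<tau>] S(2) by simp
 have cb3: "c * b ^ 3 = Re z" using b by (simp add: c_def b_def)
 have V0: "V 0 = z" using lam0 cb3 S(1) by (simp add: V_def complex_eq_iff b_def)
 have die: "((\<lambda>t. Im (V t)) \<longlongrightarrow> 0) (at_left \<tau>)" using Slim by (simp add: V_def)
 have \<tau>in: "\<tau> \<in> {0<..\<tau>}" using \<tau> by simp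
 have tip\<tau>: "tip \<tau> = z" using dying_path_is_tip[OF path \<tau>in die] V0 by simp
 note fe = driver_finite_energy[OF \<tau>in]
 define \<gamma> where "\<gamma> = restrict tip {0..\<tau>}"
 have drv: "driven_by {0..\<tau>} \<gamma> lam"
  by (rule driven_by_cong[OF driven_by_tip]) (use \<tau> in \<open>simp_all add: \<gamma>_def\<close>)
 have "emp_energy (V 0 - of_real (lam 0)) = remaining_energy \<tau> F 0 / 2"
 proof (rule emp_eqI[OF fe \<tau> path dying_path_tendsto_0[OF path fe \<tau> die]])
  fix t assume "t \<in> {0<..<\<tau>}"
  then have t: "t \<in> {0..<\<tau>}" by auto
  define A where "A = 1 + \<kappa> * S t ^ 4"
  have A: "A > 0" "S t > 0" using fac[of "S t"] S(4)[OF t] by (auto simp: A_def)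
  have "8 * (c * S t ^ 3) / (S t * S t * A) = 8 * c * S t / A" using A by (simp add: field_simps power_numeral_reduce)
  then show "F t = 8 * Re (V t - of_real (lam t)) / (cmod (V t - of_real (lam t)))^2"
   unfolding Vw nV F_def A_def by simp
 qed
 then have e: "emp_energy z = remaining_energy \<tau> F 0 / 2" using V0 lam0 by simp
 show thesis
 proof (rule that[OF \<tau> _ drv])
  show "simple_curve_to z (\<tau>, \<gamma>)"
   unfolding simple_curve_to_def using \<tau> driven_by_curve(1)[OF drv] tip\<tau> by (simp add: \<gamma>_def)
  show "continuous_on {0..\<tau>} lam" by (rule driver_continuous) simp
  show "driver_energy \<tau> lam = ennreal (emp_energy z)"
   unfolding e driver_energy_eq[OF fe] remaining_energy_def ..
  show "\<exists>y. 0 \<le> y \<and> y \<le> Im z \<and> profile_poly (c^2) y = 2 * (\<tau> - t) \<and> lam t = 4/3 * c * (Im z ^ 3 - y ^ 3)"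
   if t: "t \<in> {0..<\<tau>}" for t
   using S(4)[OF t] S(6)[of t] t by (intro exI[of _ "S t"]) (auto simp: \<kappa>_def lam_def b_def)
 qed
qed

text \<open>Any competing curve of finite energy has a driver, and the dying trajectory of its tip
  gives the lower bound. Equality fixes the duration and the driver by rigidity, and a driver
  determines its curve.\<close>

lemma EMP_curve_energy:
 assumes z: "Im z > 0" "\<bar>Re z\<bar> \<le> Im z / 8"
 shows "(case EMP_curve z of (\<tau>, \<gamma>) \<Rightarrow> curve_energy \<tau> \<gamma>) = ennreal (emp_energy z)"
proof -
 define c where "c = Re z / Im z ^ 3"
 define \<tau> where "\<tau> = profile_poly (c^2) (Im z) / 2"
 obtain lam \<gamma> where ex: "\<tau> > 0" "simple_curve_to z (\<tau>, \<gamma>)" "driven_by {0..\<tau>} \<gamma> lam" "continuous_on {0..\<tau>} lam"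
  "driver_energy \<tau> lam = ennreal (emp_energy z)"
  "\<And>t. t \<in> {0..<\<tau>} \<Longrightarrow> \<exists>y. 0 \<le> y \<and> y \<le> Im z \<and> profile_poly (c^2) y = 2 * (\<tau> - t) \<and> lam t = 4/3 * c * (Im z ^ 3 - y ^ 3)"
  by (rule emp_extremal[OF z, folded c_def, folded \<tau>_def]) (rule that)
 have energy: "curve_energy \<tau> \<gamma> = ennreal (emp_energy z)" using curve_energy_eq[OF ex(3)] ex(5) by simp
 \<comment> \<open>Without a driver the infimum is over the empty set and infinite, so such curves
   never compete.\<close>
 have finite_case: "\<exists>l. driven_by {0..\<tau>'} \<gamma>' l \<and> curve_energy \<tau>' \<gamma>' = driver_energy \<tau>' l"
  if "curve_energy \<tau>' \<gamma>' < \<infinity>" for \<tau>' \<gamma>'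
 proof -
  have "{l. driven_by {0..\<tau>'} \<gamma>' l} \<noteq> {}"
  proof
   assume "{l. driven_by {0..\<tau>'} \<gamma>' l} = {}"
   then have "curve_energy \<tau>' \<gamma>' = top" unfolding curve_energy_def by (simp only: image_empty Inf_empty)
   then show False using that by simp
  qed
  then obtain l where "l \<in> {l. driven_by {0..\<tau>'} \<gamma>' l}" by (elim ex_in_conv[THEN iffD2, THEN exE])
  then have "driven_by {0..\<tau>'} \<gamma>' l" by (rule CollectD)
  then show ?thesis using curve_energy_eq by (intro exI[of _ l] conjI)
 qed
 have main: "ennreal (emp_energy z) \<le> curve_energy \<tau>' \<gamma>' \<and> (curve_energy \<tau>' \<gamma>' = ennreal (emp_energy z) \<longrightarrow> (\<tau>', \<gamma>') = (\<tau>, \<gamma>))"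
  if sc: "simple_curve_to z (\<tau>', \<gamma>')" for \<tau>' \<gamma>'
 proof (cases "curve_energy \<tau>' \<gamma>' < \<infinity>")
  case False
  then have "curve_energy \<tau>' \<gamma>' = top" by (simp add: less_top[symmetric])
  then show ?thesis by simp
 next
  case fin: True
  have s: "\<tau>' > 0" "\<gamma>' \<in> extensional {0..\<tau>'}" "\<gamma>' \<tau>' = z" using sc unfolding simple_curve_to_def by auto
  from finite_case[OF fin] obtain l where l: "driven_by {0..\<tau>'} \<gamma>' l" "curve_energy \<tau>' \<gamma>' = driver_energy \<tau>' l" by (elim exE conjE)
  have fin': "driver_energy \<tau>' l < \<infinity>" using fin l(2) by simp
  note fe = driver_energy_finite[OF s(1) fin']
  have en: "driver_energy \<tau>' l = ennreal (remaining_energy \<tau>' (deriv l) 0 / 2)"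
   using driver_energy_eq[OF fe] by (simp add: remaining_energy_def)
  have l0: "l 0 = 0" by (rule driven_by_start[OF l(1)]) (use s in simp)
  obtain G where G: "loewner_path l {0..<\<tau>'} G" "G 0 = \<gamma>' \<tau>'" "((\<lambda>t. Im (G t)) \<longlongrightarrow> 0) (at_left \<tau>')"
   by (rule driven_by_dying_path[OF l(1) s(1)]) (rule that)
  have Gz: "G 0 = z" using G(2) s(3) by simp
  note die = dying_path_tendsto_0[OF G(1) fe s(1) G(3)]
  have low: "emp_energy z \<le> remaining_energy \<tau>' (deriv l) 0 / 2" using emp_lower[OF fe s(1) G(1) die] Gz l0 by simp
  have "(\<tau>', \<gamma>') = (\<tau>, \<gamma>)" if eq: "curve_energy \<tau>' \<gamma>' = ennreal (emp_energy z)"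
  proof -
   have "emp_energy z = remaining_energy \<tau>' (deriv l) 0 / 2"
    using eq unfolding l(2) en using emp_energy_nonneg[of z] remaining_energy_nonneg[of \<tau>' "deriv l" 0] by (simp add: ennreal_inj)
   note r = emp_rigidity[OF fe s(1) G(1) die Gz l0 this, folded c_def]
   have \<tau>': "\<tau>' = \<tau>" using r(1) by (simp add: \<tau>_def)
   have agree: "l t = lam t" if t: "t \<in> {0..<\<tau>}" for t
   proof -
    obtain y where y: "0 \<le> y" "y \<le> Im z" "profile_poly (c^2) y = 2 * (\<tau> - t)" "l t = 4/3 * c * (Im z ^ 3 - y ^ 3)"
     using r(2)[of t] t \<tau>' by auto
    obtain x where x: "0 \<le> x" "x \<le> Im z" "profile_poly (c^2) x = 2 * (\<tau> - t)" "lam t = 4/3 * c * (Im z ^ 3 - x ^ 3)"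
     using ex(6)[OF t] by auto
    have "1 + c^2 * Im z ^ 4 > 0" by (simp add: add_pos_nonneg zero_le_even_power')
    then have "x = y"
     using profile_poly_strict_mono[of "c^2" "Im z" x y] profile_poly_strict_mono[of "c^2" "Im z" y x] x y
     by (cases x y rule: linorder_cases) auto
    then show ?thesis using x(4) y(4) by simp
   qed
   note lim = continuous_on_left_end[OF _ ex(1)]
   have "\<forall>\<^sub>F t in at_left \<tau>. l t = lam t"
    using eventually_at_left_real[OF ex(1)] by eventually_elim (use agree in auto)
   from Lim_transform_eventually[OF lim[OF finite_energy_continuous[OF fe, unfolded \<tau>']] this] lim[OF ex(4)]
   have "l \<tau> = lam \<tau>" by (rule tendsto_unique[OF trivial_limit_at_left_real])
   then have all: "lam t = l t" if "t \<in> {0..\<tau>}" for t using agree[of t] that by (cases "t = \<tau>") auto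
   \<comment> \<open>The competitor is now driven by the extremal driver, so the uniqueness of
     curves applies.\<close>
   have "driven_by {0..\<tau>} \<gamma>' lam"
    by (rule driven_by_cong[OF l(1)[unfolded \<tau>'] refl all less_imp_le[OF ex(1)]])
   from driven_by_curve_unique[OF this ex(3)] have "\<gamma>' t = \<gamma> t" if "t \<in> {0..\<tau>}" for t using that .
   moreover have "\<gamma> \<in> extensional {0..\<tau>}" using ex(2) unfolding simple_curve_to_def by auto
   ultimately have "\<gamma>' = \<gamma>" using s(2) \<tau>' by (intro extensionalityI[of _ "{0..\<tau>}"]) auto
   then show ?thesis using \<tau>' by simp
  qed
  moreover have "ennreal (emp_energy z) \<le> curve_energy \<tau>' \<gamma>'" unfolding l(2) en by (rule ennreal_leI[OF low])
  ultimately show ?thesis by (intro conjI impI)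
 qed
 have "EMP_curve z = (\<tau>, \<gamma>)"
  unfolding EMP_curve_def
 proof (rule the_equality)
  show "is_arg_min (\<lambda>(\<tau>, \<gamma>). curve_energy \<tau> \<gamma>) (simple_curve_to z) (\<tau>, \<gamma>)"
   unfolding is_arg_min_def
  proof (intro conjI ex(2) notI)
   assume "\<exists>y. simple_curve_to z y \<and> (case y of (\<tau>, \<gamma>) \<Rightarrow> curve_energy \<tau> \<gamma>) < (case (\<tau>, \<gamma>) of (\<tau>, \<gamma>) \<Rightarrow> curve_energy \<tau> \<gamma>)"
   then obtain y where y: "simple_curve_to z y" "(case y of (\<tau>, \<gamma>) \<Rightarrow> curve_energy \<tau> \<gamma>) < (case (\<tau>, \<gamma>) of (\<tau>, \<gamma>) \<Rightarrow> curve_energy \<tau> \<gamma>)"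
    by (elim exE conjE)
   obtain \<tau>' \<gamma>' where ye: "y = (\<tau>', \<gamma>')" by (cases y)
   show False using conjunct1[OF main[OF y(1)[unfolded ye]]] y(2) unfolding ye by (simp add: energy)
  qed
  fix p assume p: "is_arg_min (\<lambda>(\<tau>, \<gamma>). curve_energy \<tau> \<gamma>) (simple_curve_to z) p"
  obtain \<tau>' \<gamma>' where pe: "p = (\<tau>', \<gamma>')" by (cases p)
  have sc: "simple_curve_to z (\<tau>', \<gamma>')" using p unfolding is_arg_min_def pe by (rule conjunct1)
  have "\<not> curve_energy \<tau> \<gamma> < curve_energy \<tau>' \<gamma>'"
  proof
   assume "curve_energy \<tau> \<gamma> < curve_energy \<tau>' \<gamma>'"
   then have "\<exists>y. simple_curve_to z y \<and> (case y of (\<tau>, \<gamma>) \<Rightarrow> curve_energy \<tau> \<gamma>) < (case p of (\<tau>, \<gamma>) \<Rightarrow> curve_energy \<tau> \<gamma>)"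
    by (intro exI[of _ "(\<tau>, \<gamma>)"] conjI ex(2)) (simp add: pe)
   moreover have "\<not> (\<exists>y. simple_curve_to z y \<and> (case y of (\<tau>, \<gamma>) \<Rightarrow> curve_energy \<tau> \<gamma>) < (case p of (\<tau>, \<gamma>) \<Rightarrow> curve_energy \<tau> \<gamma>))"
    using p unfolding is_arg_min_def by (rule conjunct2)
   ultimately show False by (rule notE[rotated])
  qed
  then have "curve_energy \<tau>' \<gamma>' = ennreal (emp_energy z)" using conjunct1[OF main[OF sc]] energy by simp
  with conjunct2[OF main[OF sc]] show "p = (\<tau>, \<gamma>)" unfolding pe by (rule mp)
 qed
 then show ?thesis by (simp add: energy)
qed

section \<open>The limit along a given curve\<close>

lemma curve_energy_ratio:
 assumes T: "T > 0" and C1: "C1_holder \<beta> {0..<T} lam lam'" and lam0: "lam 0 = 0" and m: "lam' 0 \<noteq> 0"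
  and d: "driven_by {0..<T} \<gamma> lam"
 shows "((\<lambda>\<delta>. curve_energy \<delta> \<gamma> / (case EMP_curve (\<gamma> \<delta>) of (\<tau>, \<gamma>\<^sub>0) \<Rightarrow> curve_energy \<tau> \<gamma>\<^sub>0)) \<longlongrightarrow> 9/8) (at_right 0)"
proof -
 have der: "(lam has_real_derivative lam' t) (at t within {0..<T})" if "t \<in> {0..<T}" for t
  using C1 that unfolding C1_holder_def by blast
 have cont: "continuous_on {0..<T} lam'" using C1 unfolding C1_holder_def by blast
 have ev: "\<forall>\<^sub>F \<delta> in at_right 0. \<delta> \<in> {0<..<T}" using T by (rule eventually_at_right_real)
 have d\<delta>: "driven_by {0..\<delta>} \<gamma> lam" if "\<delta> \<in> {0<..<T}" for \<delta> by (rule driven_by_subset[OF d]) (use that in auto)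
 have fe: "finite_energy \<delta> lam lam'" if "\<delta> \<in> {0<..<T}" for \<delta> by (rule finite_energy_C1[OF der cont that])
 have "\<exists>G. loewner_path lam {0..<\<delta>} G \<and> G 0 = \<gamma> \<delta> \<and> ((\<lambda>t. G t - of_real (lam t)) \<longlongrightarrow> 0) (at_left \<delta>)" if \<delta>: "\<delta> \<in> {0<..<T}" for \<delta>
 proof -
  have \<delta>0: "\<delta> > 0" using \<delta> by simp
  obtain G where G: "loewner_path lam {0..<\<delta>} G" "G 0 = \<gamma> \<delta>" "((\<lambda>t. Im (G t)) \<longlongrightarrow> 0) (at_left \<delta>)"
   by (rule driven_by_dying_path[OF d\<delta>[OF \<delta>] \<delta>0]) (rule that)
  show ?thesis by (intro exI[of _ G] conjI G(1,2) dying_path_tendsto_0[OF G(1) fe[OF \<delta>] \<delta>0 G(3)])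
 qed
 then have "\<forall>\<delta>\<in>{0<..<T}. \<exists>G. loewner_path lam {0..<\<delta>} G \<and> G 0 = \<gamma> \<delta> \<and> ((\<lambda>t. G t - of_real (lam t)) \<longlongrightarrow> 0) (at_left \<delta>)" ..
 from bchoice[OF this] obtain G where G': "\<forall>\<delta>\<in>{0<..<T}. loewner_path lam {0..<\<delta>} (G \<delta>) \<and> G \<delta> 0 = \<gamma> \<delta> \<and> ((\<lambda>t. G \<delta> t - of_real (lam t)) \<longlongrightarrow> 0) (at_left \<delta>)" ..
 have G: "loewner_path lam {0..<\<delta>} (G \<delta>)" "G \<delta> 0 = \<gamma> \<delta>" "((\<lambda>t. G \<delta> t - of_real (lam t)) \<longlongrightarrow> 0) (at_left \<delta>)" if "\<delta> \<in> {0<..<T}" for \<delta>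
  using bspec[OF G' that] by (rule conjunct1, rule conjunct1[OF conjunct2], rule conjunct2[OF conjunct2])
 have upper: "Im (\<gamma> \<delta>) > 0" if "\<delta> \<in> {0<..<T}" for \<delta>
  using driven_by_curve(3)[OF d, of \<delta>] that by (simp add: upper_half_plane_def)
 define P where "P \<delta> = (\<gamma> \<delta>)^2" for \<delta>
 \<comment> \<open>\<open>A\<close> is the correction to the square at its natural scale, and
   \<open>B\<close> below is the square divided by \<delta>. The half-angle formula makes the tilt
   divided by \<open>sqrt \<delta>\<close> equal to \<open>Im A / (\<bar>B\<bar> - Re B)\<close>,
   which tends to \<open>(8/3 * lam' 0) / 8\<close>.\<close>
 define A where "A \<delta> = (P \<delta> + 4 * of_real \<delta>) / of_real (\<delta> * sqrt \<delta>)" for \<delta>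
 have "((\<lambda>\<delta>. ((G \<delta> 0 - 1 * of_real (lam 0))^2 + 4 * of_real \<delta>) / of_real (\<delta> * sqrt \<delta>))
   \<longlongrightarrow> (8 * \<i> / 3) * 1 * of_real (lam' 0)) (at_right 0)"
 proof (rule driven_path_tip_asymp[OF T der cont])
  fix \<delta> assume \<delta>: "\<delta> \<in> {0<..<T}"
  show "driven_path 1 \<delta> lam (G \<delta>)" by (rule loewner_path_driven[OF G(1)[OF \<delta>]])
  show "Im (G \<delta> t - 1 * of_real (lam t)) > 0" if "t \<in> {0..<\<delta>}" for t using loewner_pathD(1)[OF G(1)[OF \<delta>] that] by simp
  show "((\<lambda>t. G \<delta> t - 1 * of_real (lam t)) \<longlongrightarrow> 0) (at_left \<delta>)" using G(3)[OF \<delta>] by simp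
 qed simp_all
 moreover have "\<forall>\<^sub>F \<delta> in at_right 0. ((G \<delta> 0 - 1 * of_real (lam 0))^2 + 4 * of_real \<delta>) / of_real (\<delta> * sqrt \<delta>) = A \<delta>"
  using ev by eventually_elim (simp only: A_def P_def G(2) lam0 of_real_0 mult_1 diff_zero)
 ultimately have Al: "(A \<longlongrightarrow> (8 * \<i> / 3) * 1 * of_real (lam' 0)) (at_right 0)" by (rule Lim_transform_eventually)
 have "((\<lambda>\<delta>::real. sqrt \<delta>) \<longlongrightarrow> sqrt 0) (at_right 0)" by (intro tendsto_real_sqrt tendsto_ident_at)
 then have s0: "((\<lambda>\<delta>::real. sqrt \<delta>) \<longlongrightarrow> 0) (at_right 0)" by simp
 define B where "B \<delta> = A \<delta> * of_real (sqrt \<delta>) - 4" for \<delta>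
 have "(B \<longlongrightarrow> (8 * \<i> / 3) * 1 * of_real (lam' 0) * of_real 0 - 4) (at_right 0)"
  unfolding B_def by (intro tendsto_intros Al s0)
 then have Bl: "(B \<longlongrightarrow> -4) (at_right 0)" by simp
 define q where "q \<delta> = (Re (\<gamma> \<delta>) / Im (\<gamma> \<delta>))^2" for \<delta>
 have "((\<lambda>\<delta>. (Im (A \<delta>) / (cmod (B \<delta>) - Re (B \<delta>)))^2) \<longlongrightarrow> (Im ((8 * \<i> / 3) * 1 * of_real (lam' 0)) / (cmod (-4) - Re (-4)))^2) (at_right 0)"
  by (intro tendsto_intros Al Bl) auto
 moreover have "(Im ((8 * \<i> / 3) * 1 * of_real (lam' 0)) / (cmod (-4) - Re (-4)))^2 = (lam' 0)^2 / 9"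
  by (simp add: power2_eq_square)
 ultimately have "((\<lambda>\<delta>. (Im (A \<delta>) / (cmod (B \<delta>) - Re (B \<delta>)))^2) \<longlongrightarrow> (lam' 0)^2 / 9) (at_right 0)" by (simp only:)
 moreover have "\<forall>\<^sub>F \<delta> in at_right 0. (Im (A \<delta>) / (cmod (B \<delta>) - Re (B \<delta>)))^2 = q \<delta> / \<delta>"
  using ev
 proof eventually_elim
  case (elim \<delta>)
  define r where "r = sqrt \<delta>"
  have r: "r > 0" "\<delta> = r * r" and \<delta>: "\<delta> > 0" using elim by (simp_all add: r_def)
  have ImA: "Im (A \<delta>) = Im (P \<delta>) / (\<delta> * r)"
   unfolding A_def r_def[symmetric] Im_divide_of_real by simp
  have "B \<delta> = P \<delta> / of_real \<delta>"
   unfolding B_def A_def r_def[symmetric] using r(1) \<delta> by (simp add: field_simps)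
  then have BB: "cmod (B \<delta>) - Re (B \<delta>) = (cmod (P \<delta>) - Re (P \<delta>)) / \<delta>"
   using \<delta> by (simp only: norm_divide norm_of_real Re_divide_of_real diff_divide_distrib abs_of_pos)
  have "Im (A \<delta>) / (cmod (B \<delta>) - Re (B \<delta>)) = (Im (P \<delta>) / (cmod (P \<delta>) - Re (P \<delta>))) / r"
   unfolding ImA BB using r(1) \<delta> by simp
  also have "\<dots> = Re (\<gamma> \<delta>) / Im (\<gamma> \<delta>) / r" unfolding P_def tilt_from_square[OF upper[OF elim]] ..
  finally have e: "Im (A \<delta>) / (cmod (B \<delta>) - Re (B \<delta>)) = Re (\<gamma> \<delta>) / Im (\<gamma> \<delta>) / r" .
  have "(x / r)^2 = x^2 / \<delta>" for x using \<delta> by (simp add: power_divide r_def)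
  then show ?case unfolding e q_def .
 qed
 ultimately have ql: "((\<lambda>\<delta>. q \<delta> / \<delta>) \<longlongrightarrow> (lam' 0)^2 / 9) (at_right 0)" by (rule Lim_transform_eventually)
 have qnn: "q \<delta> \<ge> 0" for \<delta> by (simp add: q_def)
 have "((\<lambda>\<delta>. q \<delta> / \<delta> * \<delta>) \<longlongrightarrow> (lam' 0)^2 / 9 * 0) (at_right 0)" by (intro tendsto_intros ql tendsto_ident_at)
 then have "((\<lambda>\<delta>. q \<delta> / \<delta> * \<delta>) \<longlongrightarrow> 0) (at_right 0)" by simp
 then have "\<forall>\<^sub>F \<delta> in at_right 0. dist (q \<delta> / \<delta> * \<delta>) 0 < 1/64" by (rule tendstoD) simp
 \<comment> \<open>The squared tilt is of order \<delta>, so the endpoint eventually lies in the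
   sector for which the optimal curve was constructed.\<close>
 then have flat: "\<forall>\<^sub>F \<delta> in at_right 0. \<bar>Re (\<gamma> \<delta>)\<bar> \<le> Im (\<gamma> \<delta>) / 8"
  using ev
 proof eventually_elim
  case (elim \<delta>)
  have "q \<delta> < 1/64" using elim by (simp add: dist_real_def qnn)
  then have "(Re (\<gamma> \<delta>) / Im (\<gamma> \<delta>))^2 \<le> (1/8)^2" by (simp add: q_def power_one_over)
  then have "\<bar>Re (\<gamma> \<delta>) / Im (\<gamma> \<delta>)\<bar> \<le> \<bar>1/8\<bar>" by (simp only: abs_le_square_iff)
  then show ?case using upper[OF elim(2)] by (simp add: abs_divide pos_divide_le_eq)
 qed
 show ?thesis
 proof (rule energy_ratio_limit[where R = "\<lambda>\<delta>. remaining_energy \<delta> lam' 0" and \<Psi> = "\<lambda>\<delta>. emp_energy (\<gamma> \<delta>)" and m = "lam' 0"])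
  show "\<forall>\<^sub>F \<delta> in at_right 0. curve_energy \<delta> \<gamma> = ennreal (remaining_energy \<delta> lam' 0 / 2)"
   using ev
  proof eventually_elim
   case (elim \<delta>)
   show ?case unfolding curve_energy_eq[OF d\<delta>[OF elim]] driver_energy_eq[OF fe[OF elim]] remaining_energy_def ..
  qed
  show "\<forall>\<^sub>F \<delta> in at_right 0. (case EMP_curve (\<gamma> \<delta>) of (\<tau>, \<gamma>\<^sub>0) \<Rightarrow> curve_energy \<tau> \<gamma>\<^sub>0) = ennreal (emp_energy (\<gamma> \<delta>))"
   using ev flat by eventually_elim (intro EMP_curve_energy upper)
  show "((\<lambda>\<delta>. remaining_energy \<delta> lam' 0 / \<delta>) \<longlongrightarrow> (lam' 0)^2) (at_right 0)" by (rule energy_rate[OF T cont])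
  have "((\<lambda>\<delta>. 4 * (ln (1 + q \<delta>) / \<delta>)) \<longlongrightarrow> 4 * ((lam' 0)^2 / 9)) (at_right 0)"
   using qnn by (intro tendsto_intros ln_one_plus_rate ql) simp
  then show "((\<lambda>\<delta>. emp_energy (\<gamma> \<delta>) / \<delta>) \<longlongrightarrow> 4 / 9 * (lam' 0)^2) (at_right 0)" by (simp add: emp_energy_def q_def)
  show "remaining_energy \<delta> lam' 0 \<ge> 0" for \<delta> by (rule remaining_energy_nonneg)
  show "lam' 0 \<noteq> 0" by (rule m)
 qed
qed

theorem theorem5p1:
  fixes \<epsilon> T :: real
  assumes "\<epsilon> > 0" and "T > 0"
  shows
    "(\<forall>\<gamma> lam lam'.
        C1_holder (1/2 + \<epsilon>) {0..<T} lam lam' \<and> lam 0 = 0 \<and> lam' 0 \<noteq> 0 \<and> driven_by {0..<T} \<gamma> lam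
        \<longrightarrow> ((\<lambda>\<delta>. curve_energy \<delta> \<gamma> / (case EMP_curve (\<gamma> \<delta>) of (\<tau>, \<gamma>\<^sub>0) \<Rightarrow> curve_energy \<tau> \<gamma>\<^sub>0))
              \<longlongrightarrow> 9/8) (at_right 0)) \<and>
     (\<forall>\<eta> \<eta>' u v.
        C1_holder (1/2 + \<epsilon>) {0..<T} \<eta> \<eta>' \<and> \<eta> 0 = 0 \<and> \<eta>' 0 \<noteq> 0 \<and>
        (\<forall>\<delta>\<in>{0<..<T}. welded_at \<eta> \<delta> (u \<delta>) (v \<delta>))
        \<longrightarrow> ((\<lambda>\<delta>. driver_energy \<delta> \<eta> / (case EMW_minimizer (u \<delta>) (v \<delta>) of (\<tau>, \<xi>) \<Rightarrow> driver_energy \<tau> \<xi>))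
              \<longlongrightarrow> 9/8) (at_right 0))"
proof (intro conjI allI impI)
  fix \<gamma> lam lam'
  assume "C1_holder (1/2 + \<epsilon>) {0..<T} lam lam' \<and> lam 0 = 0 \<and> lam' 0 \<noteq> 0 \<and> driven_by {0..<T} \<gamma> lam"
  then show "((\<lambda>\<delta>. curve_energy \<delta> \<gamma> / (case EMP_curve (\<gamma> \<delta>) of (\<tau>, \<gamma>\<^sub>0) \<Rightarrow> curve_energy \<tau> \<gamma>\<^sub>0)) \<longlongrightarrow> 9/8) (at_right 0)"
    by (elim conjE) (rule curve_energy_ratio[OF \<open>T > 0\<close>])
next
  fix \<eta> \<eta>' u v
  assume "C1_holder (1/2 + \<epsilon>) {0..<T} \<eta> \<eta>' \<and> \<eta> 0 = 0 \<and> \<eta>' 0 \<noteq> 0 \<and>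
    (\<forall>\<delta>\<in>{0<..<T}. welded_at \<eta> \<delta> (u \<delta>) (v \<delta>))"
  then show "((\<lambda>\<delta>. driver_energy \<delta> \<eta> / (case EMW_minimizer (u \<delta>) (v \<delta>) of (\<tau>, \<xi>) \<Rightarrow> driver_energy \<tau> \<xi>)) \<longlongrightarrow> 9/8) (at_right 0)"
    by (elim conjE) (rule welding_energy_ratio[OF \<open>T > 0\<close>], auto)
qed

end
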